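(* Let $N\ge1$, $s\in(0,1)$, $\beta>-1$ and $1<p<1+\frac{2s(1+\beta)}{1+2s}$. Let $\phi\in L^1_{loc}(\mathbb{R}^N)$ be a nonnegative function satisfying $$\lim_{|x|\to\infty}\frac{\phi(x)}{|x|^{\frac{2s(\beta+1)}{\beta+2-p}}}=+\infty .$$ For $n\ge1$ set $\phi_n=\inf\{\phi(z):|z|\ge n\}$ and $\nu_n=\inf\{\phi,\phi_n\}$, and let $u_n$ be the solution of $$\partial_tu+(-\Delta)^su+t^\beta u^p=0\ \text{ in }Q_\infty=(0,\infty)\times\mathbb{R}^N,\qquad u(0,\cdot)=\nu_n .$$ Then the sequence $\{u_n\}$ is increasing (nondecreasing in $n$) and converges in $Q_\infty$ to $$U(t)=\left(\frac{1+\beta}{p-1}\right)^{\frac1{p-1}}t^{-\frac{1+\beta}{p-1}}.$$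
   Context: The fractional Laplacian is $(-\Delta)^s\phi=\lim_{\varepsilon\to0^+}(-\Delta)^s_\varepsilon\phi$, where $(-\Delta)^s_\varepsilon\phi(x)=a_{N,s}\int_{|z-x|>\varepsilon}\frac{\phi(x)-\phi(z)}{|z-x|^{N+2s}}dz$ and $a_{N,s}=\frac{\Gamma(\frac N2+s)}{\pi^{N/2}\Gamma(2-s)}s(1-s)$. $Q_T=(0,T)\times\mathbb{R}^N$. Note that $\beta+2-p>0$. Infima of $\phi$ are understood as essential infima; $\phi_n$ is a nonnegative constant and $\nu_n(x)=\min\{\phi(x),\phi_n\}$ is a bounded function. For nonnegative $\mu\in L^1(\mathbb{R}^N)$, $u_\mu$ denotes the unique nonnegative weak solution with initial data $\mu$: for all $T>0$, $u_\mu\in L^1(Q_T)$, $t^\beta u_\mu^p\in L^1(Q_T)$ and $\int_0^T\int_{\mathbb{R}^N}[(-\partial_t\xi+(-\Delta)^s\xi)u_\mu+t^\beta u_\mu^p\xi]dxdt=\int_{\mathbb{R}^N}\xi(0,x)\mu(x)dx$ for all $\xi\in\mathbb Y_{s,T}$, where $\mathbb Y_{s,T}$ is the space of functions $\xi$ with $\|\xi\|_{L^1(Q_T)}+\|\xi\|_{L^\infty(Q_T)}+\|\partial_t\xi\|_{L^\infty(Q_T)}+\|(-\Delta)^s\xi\|_{L^\infty(Q_T)}<\infty$, $\xi(T,\cdot)=0$, and such that for $0<t<T$ there exist $M>0$, $\varepsilon_0>0$ with $\|(-\Delta)^s_\varepsilon\xi(t,\cdot)\|_{L^\infty}\le M$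 for $0<\varepsilon\le\varepsilon_0$. For the bounded, not necessarily integrable, initial datum $\nu_n$, the solution $u_n$ is the increasing limit as $k\to\infty$ of $u_{\nu_n\chi_{B_k}}$, where $B_k$ is the ball of center $0$ and radius $k$. *)

theory Defs
  imports "HOL-Analysis.Analysis" "HOL-Probability.Essential_Supremum"
begin

(* Throughout, \<real>^N is a type 'a::euclidean_space with N = DIM('a), and elements of
   Lebesgue spaces are represented by functions considered up to Lebesgue null sets. *)

definition Q_upto :: "real \<Rightarrow> (real \<times> 'a::euclidean_space) set" where
  "Q_upto T = {0<..<T} \<times> UNIV"

definition Q_inf :: "(real \<times> 'a::euclidean_space) set" where
  "Q_inf = {0<..} \<times> UNIV"

(* esssup is \<infinity> for non-measurable arguments, so finiteness of the norm includes measurability. *)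
definition Linf_norm :: "'b::euclidean_space set \<Rightarrow> ('b \<Rightarrow> real) \<Rightarrow> ereal" where
  "Linf_norm A f = esssup (lebesgue_on A) (\<lambda>z. ereal \<bar>f z\<bar>)"

definition essinf_on :: "'b::euclidean_space set \<Rightarrow> ('b \<Rightarrow> real) \<Rightarrow> ereal" where
  "essinf_on A f = - esssup (lebesgue_on A) (\<lambda>z. - ereal (f z))"

definition locally_integrable :: "('a::euclidean_space \<Rightarrow> real) \<Rightarrow> bool" where
  "locally_integrable f \<longleftrightarrow> (\<forall>K. compact K \<longrightarrow> set_integrable lebesgue K f)"

definition frac_const :: "nat \<Rightarrow> real \<Rightarrow> real" where
  "frac_const N s =
     Gamma (real N / 2 + s) / (pi powr (real N / 2) * Gamma (2 - s)) * (s * (1 - s))"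

definition frac_lap_eps :: "real \<Rightarrow> real \<Rightarrow> ('a::euclidean_space \<Rightarrow> real) \<Rightarrow> 'a \<Rightarrow> real" where
  "frac_lap_eps s \<epsilon> f x = frac_const DIM('a) s *
     set_lebesgue_integral lebesgue {z. norm (z - x) > \<epsilon>}
       (\<lambda>z. (f x - f z) / norm (z - x) powr (real DIM('a) + 2 * s))"

definition frac_lap :: "real \<Rightarrow> ('a::euclidean_space \<Rightarrow> real) \<Rightarrow> 'a \<Rightarrow> real" where
  "frac_lap s f x = Lim (at_right 0) (\<lambda>\<epsilon>. frac_lap_eps s \<epsilon> f x)"

(* The space Y_{s,T}.  As \<partial>\<^sub>t \<xi> is a bounded weak derivative, \<xi> is taken to be the representative
   that is Lipschitz in time (which gives \<xi>(0,.) and \<xi>(T,.) a meaning); then \<partial>\<^sub>t \<xi> is the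
   classical derivative, which exists almost everywhere.  Differentiability almost everywhere
   without the Lipschitz condition would admit Cantor-type functions of t.
   Lim is arbitrary where no limit exists, so existence of the limit defining the fractional
   Laplacian is required explicitly. *)
definition Y_space :: "real \<Rightarrow> real \<Rightarrow> (real \<Rightarrow> 'a::euclidean_space \<Rightarrow> real) set" where
  "Y_space s T = {\<xi>.
     set_integrable lebesgue (Q_upto T) (\<lambda>(t, x). \<xi> t x) \<and>
     Linf_norm (Q_upto T) (\<lambda>(t, x). \<xi> t x) < \<infinity> \<and>
     (AE x in lebesgue. \<exists>L. L-lipschitz_on {0..T} (\<lambda>t. \<xi> t x)) \<and>
     Linf_norm (Q_upto T) (\<lambda>(t, x). deriv (\<lambda>r. \<xi> r x) t) < \<infinity> \<and>
     (AE (t, x) in lebesgue_on (Q_upto T).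
        \<exists>l. ((\<lambda>\<epsilon>. frac_lap_eps s \<epsilon> (\<xi> t) x) \<longlongrightarrow> l) (at_right 0)) \<and>
     Linf_norm (Q_upto T) (\<lambda>(t, x). frac_lap s (\<xi> t) x) < \<infinity> \<and>
     (AE x in lebesgue. \<xi> T x = 0) \<and>
     (\<forall>t. 0 < t \<and> t < T \<longrightarrow>
        (\<exists>M>0. \<exists>\<epsilon>\<^sub>0>0. \<forall>\<epsilon>. 0 < \<epsilon> \<and> \<epsilon> \<le> \<epsilon>\<^sub>0 \<longrightarrow>
           Linf_norm UNIV (frac_lap_eps s \<epsilon> (\<xi> t)) \<le> ereal M))}"

definition weak_solution ::
  "real \<Rightarrow> real \<Rightarrow> real \<Rightarrow> ('a::euclidean_space \<Rightarrow> real) \<Rightarrow> (real \<Rightarrow> 'a \<Rightarrow> real) \<Rightarrow> bool" where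
  "weak_solution s \<beta> p \<mu> u \<longleftrightarrow>
     (AE (t, x) in lebesgue_on Q_inf. 0 \<le> u t x) \<and>
     (\<forall>T>0.
        set_integrable lebesgue (Q_upto T) (\<lambda>(t, x). u t x) \<and>
        set_integrable lebesgue (Q_upto T) (\<lambda>(t, x). t powr \<beta> * u t x powr p) \<and>
        (\<forall>\<xi>\<in>Y_space s T.
           set_lebesgue_integral lebesgue (Q_upto T)
             (\<lambda>(t, x). (- deriv (\<lambda>r. \<xi> r x) t + frac_lap s (\<xi> t) x) * u t x
                        + t powr \<beta> * u t x powr p * \<xi> t x)
           = (LINT x|lebesgue. \<xi> 0 x * \<mu> x)))"

(* Solutions for bounded initial data that need not be integrable: limits of the weak solutions
   for the data truncated to balls.  Monotonicity in k is a consequence of comparison and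
   is not imposed. *)
definition limit_solution ::
  "real \<Rightarrow> real \<Rightarrow> real \<Rightarrow> ('a::euclidean_space \<Rightarrow> real) \<Rightarrow> (real \<Rightarrow> 'a \<Rightarrow> real) \<Rightarrow> bool" where
  "limit_solution s \<beta> p \<nu> u \<longleftrightarrow>
     (\<exists>v. (\<forall>k::nat. weak_solution s \<beta> p (\<lambda>x. \<nu> x * indicator (ball 0 (real k)) x) (v k)) \<and>
          (AE (t, x) in lebesgue_on Q_inf. (\<lambda>k. v k t x) \<longlonglongrightarrow> u t x))"

definition phi_lower :: "('a::euclidean_space \<Rightarrow> real) \<Rightarrow> nat \<Rightarrow> real" where
  "phi_lower \<phi> n = real_of_ereal (essinf_on {z. norm z \<ge> real n} \<phi>)"

definition nu_trunc :: "('a::euclidean_space \<Rightarrow> real) \<Rightarrow> nat \<Rightarrow> 'a \<Rightarrow> real" where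
  "nu_trunc \<phi> n x = min (\<phi> x) (phi_lower \<phi> n)"

definition flat_solution :: "real \<Rightarrow> real \<Rightarrow> real \<Rightarrow> real" where
  "flat_solution \<beta> p t =
     ((1 + \<beta>) / (p - 1)) powr (1 / (p - 1)) * t powr (- ((1 + \<beta>) / (p - 1)))"

(* f(x) \<rightarrow> +\<infinity> as |x| \<rightarrow> \<infinity>, disregarding null sets: for all K there is R such that
   f(x) \<ge> K for almost every x with |x| \<ge> R. *)
definition ess_tends_to_infinity :: "('a::euclidean_space \<Rightarrow> real) \<Rightarrow> bool" where
  "ess_tends_to_infinity f \<longleftrightarrow> filterlim f at_top (inf at_infinity (ae_filter lebesgue))"

end

theory Submission imports Defs
begin

text \<open>Everything rests on a comparison principle between weak solutions and explicit barriers.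
  Testing the weak formulation with translates of a bump function mollifies the solution in space
  and turns it into an absolutely continuous function of time at every point; the convexity
  inequality \<open>j a - j b \<le> j' a * (a - b)\<close> then gives a Kato inequality for the mollified positive
  part, and letting the mollifier shrink removes the error.

  The spatially constant solutions \<open>U\<^sub>c\<close> with initial value \<open>c\<close> increase to \<open>U\<close> as \<open>c\<close> grows, and
  comparison with them gives \<open>u\<^sub>n \<le> U\<close>. Conversely, \<open>\<nu>\<^sub>n\<close> equals \<open>c = \<phi>\<^sub>n\<close> outside the ball of radius
  \<open>n\<close>, so the solution stays close to \<open>U\<^sub>c\<close> there, and the inflow into the ball has the size
  \<open>n powr (-2s)\<close> times \<open>U\<^sub>c\<close>. During the time \<open>\<tau> = c powr (-(p-1)/(1+\<beta>))\<close>, in which \<open>U\<^sub>c\<close> remains of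
  order \<open>c\<close>, the inflow raises the level in the ball by about \<open>n powr (-2s) * c * \<tau>\<close>, and the growth condition
  on \<open>\<phi>\<close> says exactly that this is unbounded. Hence
  every level \<open>M\<close> is reached in a time tending to zero, so that \<open>U\<^sub>M\<close> is an asymptotic lower
  bound for each \<open>M\<close>.\<close>

section \<open>The Levy kernel\<close>

text \<open>Two features of the setting shape the argument. A weak solution has no regularity: its
  initial value is seen only through test functions and \<open>(-\<Delta>)^s\<close> cannot be
  applied to it, so the operator is always moved onto a bump function or a barrier, where it is an
  absolutely convergent integral. Flat solutions are not integrable in space, whereas the comparison
  integrates over the whole space. Each barrier is therefore cut off with \<open>outer R\<close>; by
  scaling this costs a source of order \<open>R powr (- (2 * s))\<close>, which disappears as
  \<open>R\<close> tends to infinity. The lower barrier interpolates, by a cut-off \<open>f\<close>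
  vanishing in the ball, between a level \<open>b\<close> inside and a level \<open>a\<close>
  outside. Since \<open>r powr p\<close> is convex, the absorption may be checked for
  \<open>a\<close> and \<open>b\<close> separately, and all interaction sits in
  \<open>(a - b) * (-\<Delta>)^s f\<close>. This works because \<open>(-\<Delta>)^s f\<close> lies
  below a negative constant up to a multiple of \<open>f\<close>, also near the edge of the support
  of \<open>f\<close>; an exponential damping of \<open>a\<close> absorbs that multiple.\<close>

lemma lborel_affine_integral:
  fixes f :: "'a::euclidean_space \<Rightarrow> real"
  assumes [measurable]: "f \<in> borel_measurable borel" and c: "c \<noteq> 0"
  shows "(\<integral>x. f (t + c *\<^sub>R x) \<partial>lborel) = (\<integral>x. f x \<partial>lborel) / \<bar>c\<bar> ^ DIM('a)"
proof -
  have "(\<integral>x. f x \<partial>lborel) = (\<integral>x. f x \<partial>density (distr lborel borel (\<lambda>x. t + c *\<^sub>R x)) (\<lambda>_. \<bar>c\<bar> ^ DIM('a)))"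
    using lborel_affine[OF c, of t] by simp
  also have "\<dots> = (\<integral>x. \<bar>c\<bar> ^ DIM('a) * f (t + c *\<^sub>R x) \<partial>lborel)"
    by (subst integral_density) (auto simp: integral_distr)
  finally show ?thesis using c by (simp add: field_simps)
qed

lemma lborel_affine_integrable:
  fixes f :: "'a::euclidean_space \<Rightarrow> real"
  assumes f: "integrable lborel f" and c: "c \<noteq> 0"
  shows "integrable lborel (\<lambda>x. f (t + c *\<^sub>R x))"
proof -
  have [measurable]: "f \<in> borel_measurable borel" using borel_measurable_integrable[OF f] by simp
  have "integrable (density (distr lborel borel (\<lambda>x. t + c *\<^sub>R x)) (\<lambda>_. \<bar>c\<bar> ^ DIM('a))) f"
    using lborel_affine[OF c, of t] f by simp
  then have "integrable lborel (\<lambda>x. \<bar>c\<bar> ^ DIM('a) * f (t + c *\<^sub>R x))"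
    by (subst (asm) integrable_density) (auto simp: integrable_distr_eq)
  then show ?thesis using c by simp
qed

lemma lborel_shift:
  fixes f :: "'a::euclidean_space \<Rightarrow> real"
  assumes [measurable]: "f \<in> borel_measurable borel"
  shows "(\<integral>x. f (x + t) \<partial>lborel) = (\<integral>x. f x \<partial>lborel)"
    "(\<integral>x. f (x - t) \<partial>lborel) = (\<integral>x. f x \<partial>lborel)"
    "(\<integral>x. f (- x) \<partial>lborel) = (\<integral>x. f x \<partial>lborel)"
  using lborel_affine_integral[of f 1 t] lborel_affine_integral[of f 1 "-t"]
    lborel_affine_integral[of f "-1" 0] assms
  by (simp_all add: add.commute)

lemma lborel_shift_integrable:
  fixes f :: "'a::euclidean_space \<Rightarrow> real"
  assumes "integrable lborel f"
  shows "integrable lborel (\<lambda>x. f (x + t))" "integrable lborel (\<lambda>x. f (x - t))"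
    "integrable lborel (\<lambda>x. f (- x))"
  using lborel_affine_integrable[OF assms, of 1 t] lborel_affine_integrable[OF assms, of 1 "-t"]
    lborel_affine_integrable[OF assms, of "-1" 0]
  by (simp_all add: add.commute)

lemma emeasure_cball_finite [simp]: "emeasure lborel (cball (c::'a::euclidean_space) r) < \<infinity>"
  using emeasure_bounded_finite[of "cball c r"] by simp

text \<open>The jump kernel without its normalising constant. Division by zero makes its value at
  the origin 0.\<close>

definition levy :: "real \<Rightarrow> 'a::euclidean_space \<Rightarrow> real" where
  "levy s z = 1 / norm z powr (real DIM('a) + 2 * s)"

lemma levy_measurable [measurable]: "levy s \<in> borel_measurable borel"
  unfolding levy_def[abs_def] by measurable

lemma levy_nonneg [simp]: "0 \<le> levy s z" by (simp add: levy_def)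
lemma levy_uminus [simp]: "levy s (- z) = levy s z" by (simp add: levy_def)

text \<open>Dyadic decomposition: the shells near the origin contribute a geometric series of ratio
  \<open>2 powr (2 * s - 2)\<close>, those near infinity one of ratio
  \<open>2 powr (- 2 * s)\<close>. Both ratios are below 1 because \<open>0 < s < 1\<close>.\<close>

lemma levy_mass_integrable:
  assumes s: "0 < s" "s < 1"
  shows "integrable lborel (\<lambda>z::'a::euclidean_space. min 1 ((norm z)\<^sup>2) * levy s z)"
proof -
  define N where "N = DIM('a)"
  define V where "V = unit_ball_vol (real N)"
  have V0: "V \<ge> 0" by (simp add: V_def)
  define a where "a = real N + 2 * s"
  define f where "f z = min 1 ((norm z)\<^sup>2) * levy s z" for z :: 'a
  have levy: "levy s z = norm z powr (- a)" for z :: 'a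
    by (simp add: levy_def a_def N_def powr_minus_divide del: minus_add_distrib)
  have a0: "a > 0" using s by (auto simp: a_def N_def)
  \<comment> \<open>On the shell between radii \<open>2^-(i+1)\<close> and \<open>2^-i\<close> the
    integrand is at most \<open>2^(-2i) * 2^(a(i+1))\<close>; the factor 4 is slack. Likewise
    \<open>d i\<close> bounds it between radii \<open>2^i\<close> and
    \<open>2^(i+1)\<close>.\<close>
  define c where "c i = 4 * 2 powr a * (2 powr (a - 2)) ^ i" for i :: nat
  define d where "d i = (2 powr (- a)) ^ i" for i :: nat
  \<comment> \<open>Full balls replace the shells, since only an upper bound is wanted and the
    volume of a ball is explicit.\<close>
  define g where "g i z = ennreal (c i) * indicator (cball (0::'a) ((1/2)^i)) z
       + ennreal (d i) * indicator (cball (0::'a) (2^(Suc i))) z" for i z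
  have ve: "emeasure lborel (cball (0::'a) r) = ennreal (V * r ^ N)" if "r \<ge> 0" for r
    using that by (simp add: emeasure_cball V_def N_def)
  have [simp]: "c i \<ge> 0" "d i \<ge> 0" for i by (auto simp: c_def d_def)
  have le: "ennreal (f z) \<le> (\<Sum>i. g i z)" for z
  proof (cases "z = 0")
    case True then show ?thesis by (simp add: f_def)
  next
    case False
    have "\<exists>i. ennreal (f z) \<le> g i z"
    proof (cases "norm z \<le> 1")
      case True
      define r where "r = norm z"
      have r: "0 < r" "r \<le> 1" using True False by (auto simp: r_def)
      define i where "i = nat \<lfloor>- log 2 r\<rfloor>"
      have "0 \<le> - log 2 r" using r by simp
      then have i: "real i \<le> - log 2 r" "- log 2 r < real i + 1"
        unfolding i_def by linarith+
      have r1: "r \<le> (1/2)^i"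
      proof -
        have "log 2 r \<le> - real i" using i by simp
        then have "r \<le> 2 powr (- real i)" using r by (simp add: log_le_iff)
        then show ?thesis by (simp add: powr_minus powr_realpow power_one_over divide_simps)
      qed
      have r2: "2 powr (- (real i + 1)) \<le> r"
      proof -
        have "- (real i + 1) \<le> log 2 r" using i by simp
        then show ?thesis using r by (simp add: le_log_iff)
      qed
      have "r powr (- a) \<le> (2 powr (- (real i + 1))) powr (- a)"
        by (rule powr_mono2') (use a0 r2 in auto)
      also have "\<dots> = 2 powr a * (2 powr a) ^ i"
        by (simp add: powr_powr flip: powr_realpow powr_add) (simp add: algebra_simps)
      finally have A: "r powr (- a) \<le> 2 powr a * (2 powr a) ^ i" .
      have B: "r\<^sup>2 \<le> (2 powr (- 2)) ^ i"
      proof -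
        have "r^2 \<le> ((1/2)^i)^2" using r1 r by (intro power_mono) auto
        also have "\<dots> = (2 powr (- 2)) ^ i"
        proof -
          have "(((1/2)^i)^2 :: real) = ((1/2)^2)^i" by (simp only: power_mult[symmetric] mult.commute)
          then show ?thesis by (simp add: powr_minus power2_eq_square)
        qed
        finally show ?thesis .
      qed
      have "f z = r\<^sup>2 * r powr (- a)"
      proof -
        have "min 1 (r\<^sup>2) = r\<^sup>2" using r by (intro min_absorb2) (simp add: power_le_one)
        then show ?thesis by (simp add: f_def levy r_def[symmetric] a_def N_def)
      qed
      also have "\<dots> \<le> (2 powr (- 2)) ^ i * (2 powr a * (2 powr a) ^ i)"
        by (intro mult_mono A B) auto
      also have "\<dots> = 2 powr a * (2 powr (a - 2)) ^ i"
        by (simp flip: power_mult_distrib powr_add)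
      also have "\<dots> \<le> c i" by (simp add: c_def)
      finally have "f z \<le> c i" .
      then have "ennreal (f z) \<le> ennreal (c i) * indicator (cball (0::'a) ((1/2)^i)) z"
        using r1 by (simp add: r_def indicator_def ennreal_leI)
      also have "\<dots> \<le> g i z" by (simp add: g_def)
      finally show ?thesis by blast
    next
      case False
      define r where "r = norm z"
      have r: "r > 1" using False by (simp add: r_def)
      define i where "i = nat \<lfloor>log 2 r\<rfloor>"
      have "0 \<le> log 2 r" using r by simp
      then have i: "real i \<le> log 2 r" "log 2 r < real i + 1"
        unfolding i_def by linarith+
      have r1: "2^i \<le> r" using i r by (simp add: le_log_iff powr_realpow)
      have r2: "r \<le> 2^(Suc i)"
      proof -
        have "r < 2 powr (real i + 1)" using i r by (simp add: log_less_iff)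
        then show ?thesis by (simp add: powr_add powr_realpow)
      qed
      have "f z = r powr (- a)"
      proof -
        have "min 1 (r\<^sup>2) = 1" using r by (intro min_absorb1) (simp add: one_le_power)
        then show ?thesis by (simp add: f_def levy r_def[symmetric] a_def N_def)
      qed
      also have "\<dots> \<le> (2^i) powr (- a)" by (rule powr_mono2') (use a0 r1 in auto)
      also have "\<dots> = d i" by (simp add: d_def powr_powr mult.commute flip: powr_realpow)
      finally have "ennreal (f z) \<le> ennreal (d i) * indicator (cball (0::'a) (2^(Suc i))) z"
        using r2 by (simp add: r_def indicator_def ennreal_leI)
      also have "\<dots> \<le> g i z" by (simp add: g_def)
      finally show ?thesis by blast
    qed
    then obtain i where "ennreal (f z) \<le> g i z" by blast
    also have "\<dots> \<le> (\<Sum>i. g i z)"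
      using sum_le_suminf[of "\<lambda>i. g i z" "{i}"] by (simp add: summableI)
    finally show ?thesis .
  qed
  have [measurable]: "cball (0::'a) r \<in> sets borel" for r by (intro borel_closed) simp
  have gm [measurable]: "g i \<in> borel_measurable borel" for i unfolding g_def[abs_def] by measurable
  have fm [measurable]: "f \<in> borel_measurable borel" unfolding f_def[abs_def] by measurable
  have gi: "(\<integral>\<^sup>+z. g i z \<partial>lborel) = ennreal (4 * 2 powr a * V * (2 powr (2 * s - 2)) ^ i + 2 ^ N * V * (2 powr (- 2 * s)) ^ i)" for i
  proof -
    have "(\<integral>\<^sup>+z. g i z \<partial>lborel) = ennreal (c i) * ennreal (V * ((1/2)^i) ^ N) + ennreal (d i) * ennreal (V * (2^(Suc i)) ^ N)"
      unfolding g_def by (simp add: nn_integral_add nn_integral_cmult ve)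
    also have "\<dots> = ennreal (c i * (V * ((1/2)^i) ^ N) + d i * (V * (2^(Suc i)) ^ N))"
      using V0 by (simp add: ennreal_mult' ennreal_plus)
    also have "c i * (V * ((1/2)^i) ^ N) = 4 * 2 powr a * V * (2 powr (2 * s - 2)) ^ i"
    proof -
      have "(2 powr (a - 2)) ^ i * ((1/2)^i) ^ N = (2 powr (2 * s-2)) ^ i"
      proof -
        have "((1/2::real)^i) ^ N = (2 powr (- real N)) ^ i"
          by (simp add: powr_minus powr_realpow power_one_over power_inverse flip: power_mult; simp add: mult.commute inverse_eq_divide)
        then have "(2 powr (a - 2)) ^ i * ((1/2::real)^i) ^ N = (2 powr (a - 2) * 2 powr (- real N)) ^ i"
          by (simp add: power_mult_distrib)
        also have "2 powr (a - 2) * 2 powr (- real N) = 2 powr (2 * s-2)"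
          by (simp add: a_def flip: powr_add)
        finally show ?thesis .
      qed
      then show ?thesis by (simp add: c_def)
    qed
    also have "d i * (V * (2^(Suc i)) ^ N) = 2 ^ N * V * (2 powr (- 2 * s)) ^ i"
    proof -
      have "(2 powr (- a)) ^ i * (2^i) ^ N = (2 powr (- 2 * s)) ^ i"
      proof -
        have "((2::real)^i) ^ N = (2 powr (real N)) ^ i"
          by (simp add: powr_realpow flip: power_mult; simp add: mult.commute)
        then have "(2 powr (- a)) ^ i * ((2::real)^i) ^ N = (2 powr (- a) * 2 powr (real N)) ^ i"
          by (simp add: power_mult_distrib)
        also have "2 powr (- a) * 2 powr (real N) = 2 powr (- 2 * s)"
          by (simp add: a_def flip: powr_add)
        finally show ?thesis .
      qed
      then show ?thesis by (simp add: d_def power_mult_distrib)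
    qed
    finally show ?thesis .
  qed
  have p1: "2 powr (2 * s - 2) < (1::real)" "2 powr (- 2 * s) < (1::real)"
    using s powr_less_mono[of "2 * s-2" 0 "2::real"] powr_less_mono[of "-2 * s" 0 "2::real"] by auto
  have "summable (\<lambda>i. 4 * 2 powr a * V * (2 powr (2 * s - 2)) ^ i + 2 ^ N * V * (2 powr (- 2 * s)) ^ i)"
    using p1 by (intro summable_add summable_mult summable_geometric) auto
  then have fin: "(\<Sum>i. ennreal (4 * 2 powr a * V * (2 powr (2 * s - 2)) ^ i + 2 ^ N * V * (2 powr (- 2 * s)) ^ i)) < \<infinity>"
    using V0 by (subst suminf_ennreal2) auto
  have "(\<integral>\<^sup>+z. ennreal (f z) \<partial>lborel) \<le> (\<integral>\<^sup>+z. (\<Sum>i. g i z) \<partial>lborel)"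
    by (intro nn_integral_mono le)
  also have "\<dots> = (\<Sum>i. \<integral>\<^sup>+z. g i z \<partial>lborel)" by (intro nn_integral_suminf) simp
  also have "\<dots> < \<infinity>" using fin by (simp add: gi)
  finally have "(\<integral>\<^sup>+z. ennreal (f z) \<partial>lborel) < \<infinity>" .
  then have "integrable lborel f"
    by (intro integrableI_nonneg) (auto simp: f_def)
  then show ?thesis by (simp add: f_def[abs_def])
qed

section \<open>The fractional Laplacian of functions with bounded second differences\<close>

text \<open>The sign is opposite to that of the usual second difference, so that, like
  \<open>(-\<Delta>)^s\<close>, it is nonnegative at a maximum.\<close>

definition second_diff :: "('a::real_vector \<Rightarrow> real) \<Rightarrow> 'a \<Rightarrow> 'a \<Rightarrow> real" where
  "second_diff f x z = 2 * f x - f (x + z) - f (x - z)"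

text \<open>A derivative-free form of bounded \<open>C^{1,1}\<close> regularity. The weight
  \<open>min 1 ((norm z)^2)\<close> is the one against which the kernel is integrable, so a single
  constant controls the function and its fractional Laplacian.\<close>

definition C11 :: "real \<Rightarrow> ('a::euclidean_space \<Rightarrow> real) \<Rightarrow> bool" where
  "C11 C f \<longleftrightarrow> continuous_on UNIV f \<and> (\<forall>x. \<bar>f x\<bar> \<le> C) \<and>
     (\<forall>x z. \<bar>second_diff f x z\<bar> \<le> C * min 1 ((norm z)\<^sup>2))"

text \<open>The second difference makes the integral absolutely convergent, so no principal value is needed.\<close>

definition fl :: "real \<Rightarrow> ('a::euclidean_space \<Rightarrow> real) \<Rightarrow> 'a \<Rightarrow> real" where
  "fl s f x = frac_const DIM('a) s / 2 * (\<integral>z. second_diff f x z * levy s z \<partial>lborel)"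

text \<open>The factor by which \<open>fl s\<close> turns a \<open>C11\<close> constant into a sup
  bound.\<close>

definition levy_mass :: "'a::euclidean_space itself \<Rightarrow> real \<Rightarrow> real" where
  "levy_mass _ s = frac_const DIM('a) s / 2 * (\<integral>z. min 1 ((norm z)\<^sup>2) * levy s z \<partial>(lborel :: 'a measure))"

lemma second_diff_measurable' [measurable (raw)]:
  assumes [measurable]: "f \<in> borel_measurable borel" "g \<in> borel_measurable M" "h \<in> borel_measurable M"
  shows "(\<lambda>w. second_diff f (g w) (h w :: 'a::euclidean_space)) \<in> borel_measurable M"
  unfolding second_diff_def by measurable

lemma frac_const_pos:
  assumes "0 < s" "s < 1"
  shows "frac_const N s > 0"
  using assms by (simp add: frac_const_def Gamma_real_pos zero_less_mult_iff zero_less_divide_iff)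

lemma C11_measurable: "C11 C f \<Longrightarrow> f \<in> borel_measurable borel"
  by (auto simp: C11_def intro: borel_measurable_continuous_onI)

lemma C11_nonneg: "C11 C f \<Longrightarrow> 0 \<le> C"
  unfolding C11_def by (meson abs_ge_zero order_trans)

lemma C11_mono: "C11 C f \<Longrightarrow> C \<le> D \<Longrightarrow> C11 D f"
  unfolding C11_def by (meson mult_right_mono min.boundedI order_trans zero_le_one zero_le_power2)

lemma C11_const: "C11 \<bar>c\<bar> (\<lambda>_. c)"
  by (auto simp: C11_def second_diff_def)

lemma C11_add: "C11 C f \<Longrightarrow> C11 D g \<Longrightarrow> C11 (C + D) (\<lambda>x. f x + g x)"
proof -
  assume *: "C11 C f" "C11 D g"
  have "\<bar>f x + g x\<bar> \<le> C + D" for x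
    using * unfolding C11_def by (metis abs_triangle_ineq add_mono order_trans)
  moreover have "\<bar>second_diff (\<lambda>x. f x + g x) x z\<bar> \<le> (C + D) * min 1 ((norm z)\<^sup>2)" for x z
  proof -
    have "second_diff (\<lambda>x. f x + g x) x z = second_diff f x z + second_diff g x z"
      by (simp add: second_diff_def)
    moreover have "\<bar>second_diff f x z\<bar> \<le> C * min 1 ((norm z)\<^sup>2)" "\<bar>second_diff g x z\<bar> \<le> D * min 1 ((norm z)\<^sup>2)"
      using * by (auto simp: C11_def)
    ultimately show ?thesis by (simp add: distrib_right)
  qed
  ultimately show ?thesis using * by (auto simp: C11_def intro!: continuous_intros)
qed

lemma C11_cmult: "C11 C f \<Longrightarrow> C11 (\<bar>c\<bar> * C) (\<lambda>x. c * f x)"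
proof -
  assume *: "C11 C f"
  have "\<bar>c * f x\<bar> \<le> \<bar>c\<bar> * C" for x
    using * by (auto simp: C11_def abs_mult intro: mult_left_mono)
  moreover have "\<bar>second_diff (\<lambda>x. c * f x) x z\<bar> \<le> \<bar>c\<bar> * C * min 1 ((norm z)\<^sup>2)" for x z
  proof -
    have "second_diff (\<lambda>x. c * f x) x z = c * second_diff f x z"
      by (simp add: second_diff_def algebra_simps)
    moreover have "\<bar>second_diff f x z\<bar> \<le> C * min 1 ((norm z)\<^sup>2)" using * unfolding C11_def by blast
    ultimately show ?thesis by (simp only: abs_mult mult.assoc mult_left_mono abs_ge_zero)
  qed
  moreover have "continuous_on UNIV (\<lambda>x. c * f x)"
    using * by (auto simp: C11_def intro: continuous_on_mult_left)
  ultimately show ?thesis unfolding C11_def by blast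
qed

lemma C11_shift: "C11 C f \<Longrightarrow> C11 C (\<lambda>x. f (x - y))"
proof -
  assume *: "C11 C f"
  have "second_diff (\<lambda>x. f (x - y)) x z = second_diff f (x - y) z" for x z
    by (simp add: second_diff_def algebra_simps)
  moreover have "continuous_on UNIV (\<lambda>x. f (x - y))"
  proof (rule continuous_on_compose2[of UNIV f])
    show "continuous_on UNIV f" using * by (simp add: C11_def)
    show "continuous_on UNIV (\<lambda>x::'a. x - y)" by (intro continuous_intros)
  qed simp
  ultimately show ?thesis using * by (auto simp: C11_def)
qed

lemma fl_integrable:
  assumes s: "0 < s" "s < 1" and f: "C11 C f"
  shows "integrable lborel (\<lambda>z. second_diff f x z * levy s z)"
proof (rule Bochner_Integration.integrable_bound)
  show "integrable lborel (\<lambda>z::'a. C * (min 1 ((norm z)\<^sup>2) * levy s z))"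
    by (intro integrable_mult_right levy_mass_integrable s)
  have [measurable]: "f \<in> borel_measurable borel" by (rule C11_measurable[OF f])
  show "(\<lambda>z. second_diff f x z * levy s z) \<in> borel_measurable lborel" by measurable
  show "AE z in lborel. norm (second_diff f x z * levy s z) \<le> norm (C * (min 1 ((norm z)\<^sup>2) * levy s z))"
    using f C11_nonneg[OF f] by (intro AE_I2) (auto simp: C11_def abs_mult mult.assoc[symmetric] intro!: mult_right_mono)
qed

lemma fl_measurable [measurable]:
  assumes [measurable]: "f \<in> borel_measurable borel"
  shows "fl s f \<in> borel_measurable borel"
  unfolding fl_def[abs_def] by measurable

lemma fl_bound:
  assumes s: "0 < s" "s < 1" and f: "C11 C f"
  shows "\<bar>fl s f (x::'a::euclidean_space)\<bar> \<le> C * levy_mass TYPE('a) s"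
proof -
  have "\<bar>\<integral>z. second_diff f x z * levy s z \<partial>lborel\<bar> \<le> (\<integral>z. \<bar>second_diff f x z * levy s z\<bar> \<partial>lborel)"
    using fl_integrable[OF s f, of x] by (intro integral_abs_bound)
  also have "\<dots> \<le> (\<integral>z. C * (min 1 ((norm z)\<^sup>2) * levy s z) \<partial>(lborel :: 'a measure))"
  proof (rule integral_mono)
    show "integrable lborel (\<lambda>z::'a. C * (min 1 ((norm z)\<^sup>2) * levy s z))"
      by (intro integrable_mult_right levy_mass_integrable s)
    show "integrable lborel (\<lambda>z. \<bar>second_diff f x z * levy s z\<bar>)"
      using fl_integrable[OF s f, of x] by simp
    show "\<bar>second_diff f x z * levy s z\<bar> \<le> C * (min 1 ((norm z)\<^sup>2) * levy s z)" for z
      using f by (auto simp: C11_def abs_mult mult.assoc[symmetric] intro!: mult_right_mono)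
  qed
  finally have "\<bar>\<integral>z. second_diff f x z * levy s z \<partial>lborel\<bar> \<le> C * (\<integral>z. (min 1 ((norm z)\<^sup>2) * levy s z) \<partial>(lborel :: 'a measure))"
    by simp
  then have "frac_const DIM('a) s / 2 * \<bar>\<integral>z. second_diff f x z * levy s z \<partial>lborel\<bar> \<le> frac_const DIM('a) s / 2 * (C * (\<integral>z. (min 1 ((norm z)\<^sup>2) * levy s z) \<partial>(lborel :: 'a measure)))"
    using frac_const_pos[OF s, of "DIM('a)"] by (intro mult_left_mono) auto
  then show ?thesis
    using frac_const_pos[OF s, of "DIM('a)"] by (simp add: fl_def levy_mass_def abs_mult mult_ac)
qed

lemma levy_mass_nonneg: "0 < s \<Longrightarrow> s < 1 \<Longrightarrow> 0 \<le> levy_mass TYPE('a::euclidean_space) s"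
  using frac_const_pos[of s "DIM('a)"] by (auto simp: levy_mass_def intro!: mult_nonneg_nonneg integral_nonneg)

lemma levy_away_integrable:
  assumes s: "0 < s" "s < 1" and e: "\<epsilon> > 0"
  shows "integrable lborel (\<lambda>z::'a::euclidean_space. indicator {z. norm z > \<epsilon>} z * levy s z)"
proof (rule Bochner_Integration.integrable_bound)
  show "integrable lborel (\<lambda>z::'a. (1 / min 1 (\<epsilon>\<^sup>2)) * (min 1 ((norm z)\<^sup>2) * levy s z))"
    by (intro integrable_mult_right levy_mass_integrable s)
  show "(\<lambda>z::'a. indicator {z. norm z > \<epsilon>} z * levy s z) \<in> borel_measurable lborel" by measurable
  have "indicator {z. norm z > \<epsilon>} z \<le> (1 / min 1 (\<epsilon>\<^sup>2)) * min 1 ((norm z)\<^sup>2)" for z :: 'a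
  proof (cases "norm z > \<epsilon>")
    case True
    then have "\<epsilon>\<^sup>2 \<le> (norm z)\<^sup>2" using e by (intro power_mono) auto
    then have "min 1 (\<epsilon>\<^sup>2) \<le> min 1 ((norm z)\<^sup>2)" by (rule min.mono[OF order_refl])
    then show ?thesis using e True by simp
  next
    case False then show ?thesis using e by simp
  qed
  then have "indicator {z. norm z > \<epsilon>} z * levy s z \<le> (1 / min 1 (\<epsilon>\<^sup>2)) * min 1 ((norm z)\<^sup>2) * levy s z" for z :: 'a
    by (intro mult_right_mono) auto
  then show "AE z::'a in lborel. norm (indicator {z. norm z > \<epsilon>} z * levy s z) \<le> norm ((1 / min 1 (\<epsilon>\<^sup>2)) * (min 1 ((norm z)\<^sup>2) * levy s z))"
    using e by (intro AE_I2) (simp add: abs_mult mult.assoc)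
qed

text \<open>Away from the origin the integral converges absolutely, so it may be averaged with its
  image under \<open>z \<mapsto> -z\<close>; this produces the second difference and the factor
  1/2.\<close>

lemma frac_lap_eps_eq:
  assumes s: "0 < s" "s < 1" and f: "C11 C f" and e: "\<epsilon> > 0"
  shows "frac_lap_eps s \<epsilon> f (x::'a::euclidean_space) =
     frac_const DIM('a) s / 2 * (\<integral>z. indicator {z. norm z > \<epsilon>} z * (second_diff f x z * levy s z) \<partial>lborel)"
proof -
  have [measurable]: "f \<in> borel_measurable borel" by (rule C11_measurable[OF f])
  define g where "g z = indicator {z. norm z > \<epsilon>} z * ((f x - f (x + z)) * levy s z)" for z
  have [measurable]: "g \<in> borel_measurable borel" unfolding g_def[abs_def] by measurable
  have gi: "integrable lborel g"
  proof (rule Bochner_Integration.integrable_bound)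
    show "integrable lborel (\<lambda>z::'a. 2 * C * (indicator {z. norm z > \<epsilon>} z * levy s z))"
      by (intro integrable_mult_right levy_away_integrable s e)
    show "g \<in> borel_measurable lborel" by simp
    have "\<bar>f x - f (x + z)\<bar> \<le> 2 * C" for z
    proof -
      have "\<bar>f x\<bar> \<le> C" "\<bar>f (x + z)\<bar> \<le> C" using f by (auto simp: C11_def)
      then show ?thesis by linarith
    qed
    then show "AE z in lborel. norm (g z) \<le> norm (2 * C * (indicator {z. norm z > \<epsilon>} z * levy s z))"
      using C11_nonneg[OF f] by (intro AE_I2) (auto simp: g_def abs_mult indicator_def intro!: mult_right_mono)
  qed
  have "set_lebesgue_integral lebesgue {z. norm (z - x) > \<epsilon>}
       (\<lambda>z. (f x - f z) / norm (z - x) powr (real DIM('a) + 2 * s)) = (\<integral>z. g (z - x) \<partial>lebesgue)"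
    unfolding set_lebesgue_integral_def by (intro Bochner_Integration.integral_cong) (auto simp: g_def levy_def indicator_def)
  also have "\<dots> = (\<integral>z. g (z - x) \<partial>lborel)" by (rule integral_completion) simp
  also have "\<dots> = (\<integral>z. g z \<partial>lborel)" by (rule lborel_shift) simp
  also have "\<dots> = ((\<integral>z. g z \<partial>lborel) + (\<integral>z. g (- z) \<partial>lborel)) / 2"
    using lborel_shift(3)[of g] by simp
  also have "\<dots> = (\<integral>z. g z + g (- z) \<partial>lborel) / 2"
    using gi lborel_shift_integrable(3)[OF gi] by simp
  also have "(\<lambda>z. g z + g (- z)) = (\<lambda>z. indicator {z. norm z > \<epsilon>} z * (second_diff f x z * levy s z))"
    by (auto simp: g_def second_diff_def indicator_def algebra_simps fun_eq_iff)
  finally show ?thesis by (simp add: frac_lap_eps_def)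
qed

lemma frac_lap_eps_bound:
  assumes s: "0 < s" "s < 1" and f: "C11 C f" and e: "\<epsilon> > 0"
  shows "\<bar>frac_lap_eps s \<epsilon> f (x::'a::euclidean_space)\<bar> \<le> C * levy_mass TYPE('a) s"
proof -
  have [measurable]: "f \<in> borel_measurable borel" by (rule C11_measurable[OF f])
  have i1: "integrable lborel (\<lambda>z. indicator {z. norm z > \<epsilon>} z * (second_diff f x z * levy s z))"
    by (rule Bochner_Integration.integrable_bound[OF fl_integrable[OF s f, of x]])
      (auto simp: indicator_def)
  have "\<bar>\<integral>z. indicator {z. norm z > \<epsilon>} z * (second_diff f x z * levy s z) \<partial>lborel\<bar>
     \<le> (\<integral>z. \<bar>indicator {z. norm z > \<epsilon>} z * (second_diff f x z * levy s z)\<bar> \<partial>lborel)"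
    using i1 by (intro integral_abs_bound)
  also have "\<dots> \<le> (\<integral>z. C * (min 1 ((norm z)\<^sup>2) * levy s z) \<partial>(lborel :: 'a measure))"
  proof (rule integral_mono)
    show "integrable lborel (\<lambda>z::'a. C * (min 1 ((norm z)\<^sup>2) * levy s z))"
      by (intro integrable_mult_right levy_mass_integrable s)
    show "integrable lborel (\<lambda>z. \<bar>indicator {z. norm z > \<epsilon>} z * (second_diff f x z * levy s z)\<bar>)"
      using i1 by simp
    show "\<bar>indicator {z. norm z > \<epsilon>} z * (second_diff f x z * levy s z)\<bar> \<le> C * (min 1 ((norm z)\<^sup>2) * levy s z)" for z
      using f C11_nonneg[OF f] by (auto simp: C11_def abs_mult mult.assoc[symmetric] indicator_def intro!: mult_right_mono)
  qed
  finally have *: "\<bar>\<integral>z. indicator {z. norm z > \<epsilon>} z * (second_diff f x z * levy s z) \<partial>lborel\<bar> \<le> C * (\<integral>z. (min 1 ((norm z)\<^sup>2) * levy s z) \<partial>(lborel :: 'a measure))"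
    by simp
  have "c / 2 * I \<le> C * (c / 2 * m)" if "I \<le> C * m" "c > 0" for c I m :: real
    using mult_left_mono[OF that(1), of "c / 2"] that(2) by (simp add: mult_ac)
  from this[OF * frac_const_pos[OF s, of "DIM('a)"]] show ?thesis
    using frac_const_pos[OF s, of "DIM('a)"] by (simp only: frac_lap_eps_eq[OF s f e] levy_mass_def abs_mult abs_divide abs_numeral abs_of_pos)
qed

lemma frac_lap_eps_tendsto:
  assumes s: "0 < s" "s < 1" and f: "C11 C f"
  shows "((\<lambda>\<epsilon>. frac_lap_eps s \<epsilon> f (x::'a::euclidean_space)) \<longlongrightarrow> fl s f x) (at_right 0)"
proof -
  have [measurable]: "f \<in> borel_measurable borel" by (rule C11_measurable[OF f])
  \<comment> \<open>The truncation radius is written as \<open>inverse t\<close>, which turns the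
    limit at \<open>0\<close> from the right into one along \<open>at_top\<close>. The full
    integrand dominates its truncations.\<close>
  have "((\<lambda>t. \<integral>z. indicator {z. norm z > inverse t} z * (second_diff f x z * levy s z) \<partial>lborel) \<longlongrightarrow>
     (\<integral>z. second_diff f x z * levy s z \<partial>lborel)) at_top"
  proof (rule integral_dominated_convergence_at_top)
    show "integrable lborel (\<lambda>z. \<bar>second_diff f x z * levy s z\<bar>)"
      using fl_integrable[OF s f, of x] by simp
    show "\<forall>\<^sub>F t in at_top. AE z in lborel. norm (indicator {z. norm z > inverse t} z * (second_diff f x z * levy s z)) \<le> \<bar>second_diff f x z * levy s z\<bar>"
      by (intro always_eventually allI AE_I2) (auto simp: indicator_def)
    show "AE z in lborel. ((\<lambda>t. indicator {z. norm z > inverse t} z * (second_diff f x z * levy s z)) \<longlongrightarrow> second_diff f x z * levy s z) at_top"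
    proof (intro AE_I2 tendsto_eventually)
      fix z :: 'a
      show "\<forall>\<^sub>F t::real in at_top. indicator {z. norm z > inverse t} z * (second_diff f x z * levy s z) = second_diff f x z * levy s z"
      proof (cases "z = 0")
        case True then show ?thesis by (simp add: second_diff_def)
      next
        case False
        have "\<forall>\<^sub>F t::real in at_top. t > 1 / norm z" by (rule eventually_gt_at_top)
        then show ?thesis
        proof eventually_elim
          case (elim t)
          have "0 < 1 / norm z" using False by simp
          then have "t > 0" using elim by linarith
          then have "inverse t < norm z" using elim False by (simp add: field_simps)
          then show ?case by simp
        qed
      qed
    qed
  qed measurable
  then have "((\<lambda>\<epsilon>. \<integral>z. indicator {z. norm z > \<epsilon>} z * (second_diff f x z * levy s z) \<partial>lborel) \<longlongrightarrow>
     (\<integral>z. second_diff f x z * levy s z \<partial>lborel)) (at_right 0)"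
    by (simp add: filterlim_at_right_to_top)
  then have "((\<lambda>\<epsilon>. frac_const DIM('a) s / 2 * (\<integral>z. indicator {z. norm z > \<epsilon>} z * (second_diff f x z * levy s z) \<partial>lborel)) \<longlongrightarrow> fl s f x) (at_right 0)"
    unfolding fl_def by (intro tendsto_intros)
  then show ?thesis
  proof (rule Lim_transform_eventually)
    have "\<forall>\<^sub>F \<epsilon>::real in at_right 0. 0 < \<epsilon>" by (rule eventually_at_right_less)
    then show "\<forall>\<^sub>F \<epsilon> in at_right 0. frac_const DIM('a) s / 2 * (\<integral>z. indicator {z. norm z > \<epsilon>} z * (second_diff f x z * levy s z) \<partial>lborel) = frac_lap_eps s \<epsilon> f x"
      by eventually_elim (simp add: frac_lap_eps_eq[OF s f])
  qed
qed

lemma frac_lap_eq_fl: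
  assumes "0 < s" "s < 1" "C11 C f"
  shows "frac_lap s f x = fl s f x"
  unfolding frac_lap_def by (rule tendsto_Lim[OF _ frac_lap_eps_tendsto[OF assms]]) simp

lemma fl_shift: "fl s (\<lambda>x. f (x - y)) x = fl s f (x - y)"
  by (simp add: fl_def second_diff_def algebra_simps)

lemma fl_cmult: "fl s (\<lambda>x. c * f x) x = c * fl s f x"
proof -
  have "(\<integral>z. second_diff (\<lambda>x. c * f x) x z * levy s z \<partial>lborel) = (\<integral>z. c * (second_diff f x z * levy s z) \<partial>lborel)"
    by (intro Bochner_Integration.integral_cong refl) (simp add: second_diff_def algebra_simps)
  then show ?thesis by (simp add: fl_def)
qed

lemma fl_const: "fl s (\<lambda>_. c) x = 0"
  by (simp add: fl_def second_diff_def)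

lemma fl_add:
  assumes s: "0 < s" "s < 1" and "C11 C f" "C11 D g"
  shows "fl s (\<lambda>x. f x + g x) x = fl s f x + fl s g x"
proof -
  have "(\<integral>z. second_diff (\<lambda>x. f x + g x) x z * levy s z \<partial>lborel) = (\<integral>z. second_diff f x z * levy s z + second_diff g x z * levy s z \<partial>lborel)"
    by (intro Bochner_Integration.integral_cong refl) (simp add: second_diff_def algebra_simps)
  then show ?thesis
    using fl_integrable[OF s assms(3), of x] fl_integrable[OF s assms(4), of x] by (simp add: fl_def distrib_left)
qed

text \<open>The kernel is homogeneous of degree \<open>-(N + 2s)\<close> and the substitution
  returns a volume factor \<open>c powr N\<close>. Every power of \<open>R\<close> or
  \<open>n\<close> with exponent \<open>- (2 * s)\<close> in the barriers comes from here.\<close>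

lemma fl_scale:
  assumes c: "c > 0" and [measurable]: "f \<in> borel_measurable borel"
  shows "fl s (\<lambda>x. f (x /\<^sub>R c)) (x::'a::euclidean_space) = c powr (- (2 * s)) * fl s f (x /\<^sub>R c)"
proof -
  let ?N = "real DIM('a)"
  have "(\<integral>z. second_diff (\<lambda>x. f (x /\<^sub>R c)) x z * levy s z \<partial>lborel) =
    (\<integral>z. c powr (- (?N + 2 * s)) * (second_diff f (x /\<^sub>R c) (0 + inverse c *\<^sub>R z) * levy s (0 + inverse c *\<^sub>R z)) \<partial>lborel)"
  proof (intro Bochner_Integration.integral_cong refl)
    fix z :: 'a
    have "levy s z = c powr (- (?N + 2 * s)) * levy s (inverse c *\<^sub>R z)"
      using c by (simp add: levy_def powr_mult powr_divide powr_minus divide_simps del: minus_add_distrib)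
    then show "second_diff (\<lambda>x. f (x /\<^sub>R c)) x z * levy s z = c powr (- (?N + 2 * s)) * (second_diff f (x /\<^sub>R c) (0 + inverse c *\<^sub>R z) * levy s (0 + inverse c *\<^sub>R z))"
      by (simp add: second_diff_def scaleR_right_distrib scaleR_right_diff_distrib)
  qed
  also have "\<dots> = c powr (- (?N + 2 * s)) * (\<integral>z. second_diff f (x /\<^sub>R c) (0 + inverse c *\<^sub>R z) * levy s (0 + inverse c *\<^sub>R z) \<partial>lborel)"
    by simp
  also have "(\<integral>z. second_diff f (x /\<^sub>R c) (0 + inverse c *\<^sub>R z) * levy s (0 + inverse c *\<^sub>R z) \<partial>lborel)
     = (\<integral>z. second_diff f (x /\<^sub>R c) z * levy s z \<partial>lborel) / \<bar>inverse c\<bar> ^ DIM('a)"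
    using c by (intro lborel_affine_integral[of "\<lambda>z. second_diff f (x /\<^sub>R c) z * levy s z"]) auto
  also have "\<dots> = c powr ?N * (\<integral>z. second_diff f (x /\<^sub>R c) z * levy s z \<partial>lborel)"
    using c by (simp add: powr_realpow power_inverse divide_simps)
  finally have "(\<integral>z. second_diff (\<lambda>x. f (x /\<^sub>R c)) x z * levy s z \<partial>lborel) =
     (c powr (- (?N + 2 * s)) * c powr ?N) * (\<integral>z. second_diff f (x /\<^sub>R c) z * levy s z \<partial>lborel)" by simp
  also have "c powr (- (?N + 2 * s)) * c powr ?N = c powr (- (2 * s))"
    by (simp flip: powr_add)
  finally show ?thesis by (simp add: fl_def)
qed

lemma C11_scale:
  assumes c: "c > 0" and f: "C11 C f"
  shows "C11 (C * max 1 (1 / c\<^sup>2)) (\<lambda>x. f (x /\<^sub>R c))"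
proof -
  have C: "C \<ge> 0" by (rule C11_nonneg[OF f])
  have "continuous_on UNIV (\<lambda>x. f (x /\<^sub>R c))"
  proof (rule continuous_on_compose2[of UNIV f])
    show "continuous_on UNIV f" using f by (simp add: C11_def)
    show "continuous_on UNIV (\<lambda>x::'a. x /\<^sub>R c)" by (intro continuous_intros)
  qed simp
  moreover have "\<bar>f (x /\<^sub>R c)\<bar> \<le> C * max 1 (1 / c\<^sup>2)" for x
  proof -
    have "\<bar>f (x /\<^sub>R c)\<bar> \<le> C * 1" using f by (auto simp: C11_def)
    also have "\<dots> \<le> C * max 1 (1 / c\<^sup>2)" using C by (intro mult_left_mono) auto
    finally show ?thesis .
  qed
  moreover have "\<bar>second_diff (\<lambda>x. f (x /\<^sub>R c)) x z\<bar> \<le> C * max 1 (1 / c\<^sup>2) * min 1 ((norm z)\<^sup>2)" for x z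
  proof -
    have "second_diff (\<lambda>x. f (x /\<^sub>R c)) x z = second_diff f (x /\<^sub>R c) (z /\<^sub>R c)"
      by (simp add: second_diff_def scaleR_right_distrib scaleR_right_diff_distrib)
    also have "\<bar>\<dots>\<bar> \<le> C * min 1 ((norm (z /\<^sub>R c))\<^sup>2)" using f unfolding C11_def by blast
    also have "\<dots> \<le> C * (max 1 (1 / c\<^sup>2) * min 1 ((norm z)\<^sup>2))"
    proof (intro mult_left_mono C)
      have e: "(norm (z /\<^sub>R c))\<^sup>2 = (1/c\<^sup>2) * (norm z)\<^sup>2"
      proof -
        have "norm (z /\<^sub>R c) = norm z / c" using c by (simp add: divide_inverse mult.commute)
        then show ?thesis by (simp add: power_divide)
      qed
      show "min 1 ((norm (z /\<^sub>R c))\<^sup>2) \<le> max 1 (1 / c\<^sup>2) * min 1 ((norm z)\<^sup>2)"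
      proof (cases "(norm z)\<^sup>2 \<le> 1")
        case True
        then have "min 1 ((norm z)\<^sup>2) = (norm z)\<^sup>2" by simp
        moreover have "(1/c\<^sup>2) * (norm z)\<^sup>2 \<le> max 1 (1 / c\<^sup>2) * (norm z)\<^sup>2" by (intro mult_right_mono) auto
        ultimately show ?thesis using e by linarith
      next
        case False
        then have "min 1 ((norm z)\<^sup>2) = 1" by simp
        then show ?thesis by (metis max.cobounded1 min.cobounded1 mult.right_neutral order_trans)
      qed
    qed
    finally show ?thesis by (simp add: mult.assoc)
  qed
  ultimately show ?thesis unfolding C11_def by blast
qed

section \<open>Mollification\<close>

lemma nn_integral_reflect:
  fixes f :: "'a::euclidean_space \<Rightarrow> ennreal"
  assumes [measurable]: "f \<in> borel_measurable borel"
  shows "(\<integral>\<^sup>+y. f (x - y) \<partial>lborel) = (\<integral>\<^sup>+y. f y \<partial>lborel)"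
proof -
  have "(\<integral>\<^sup>+y. f y \<partial>lborel) = (\<integral>\<^sup>+y. f y \<partial>density (distr lborel borel (\<lambda>y. x + (-1) *\<^sub>R y)) (\<lambda>_. 1))"
    using arg_cong[OF lborel_affine[of "-1" x], of "\<lambda>M. integral\<^sup>N M f"] by simp
  also have "\<dots> = (\<integral>\<^sup>+y. f (x - y) \<partial>lborel)"
    by (subst nn_integral_density) (auto simp: nn_integral_distr)
  finally show ?thesis by simp
qed

text \<open>Outer regularity gives \<open>U\<close>, inner regularity gives \<open>K\<close>. The
  pair serves the indicator case of the continuity of translations.\<close>

lemma compact_open_approx:
  fixes A :: "'a::euclidean_space set"
  assumes A: "A \<in> sets borel" and fin: "emeasure lborel A < \<infinity>" and e: "e > 0"
  obtains K U where "compact K" "K \<subseteq> A" "open U" "A \<subseteq> U"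
    "emeasure lborel (U - K) < \<infinity>" "measure lborel (U - K) < e"
proof -
  obtain U where U: "open U" "A \<subseteq> U" "emeasure lborel (U - A) < ennreal (e / 2)"
    using outer_regular_lborel[of A "e / 2"] A e by auto
  \<comment> \<open>Inner regularity is applied to a finite measure, hence the restriction of
    Lebesgue measure to \<open>A\<close>.\<close>
  define M where "M = density lborel (indicator A)"
  have Mem: "emeasure M B = emeasure lborel (A \<inter> B)" if "B \<in> sets borel" for B
    unfolding M_def using that A by (simp add: emeasure_density flip: indicator_inter_arith)
  have "emeasure M A = (SUP K \<in> {K. K \<subseteq> A \<and> compact K}. emeasure M K)"
    by (rule inner_regular) (use A fin Mem[of UNIV] in \<open>auto simp: M_def\<close>)
  then have S: "emeasure lborel A = (SUP K \<in> {K. K \<subseteq> A \<and> compact K}. emeasure M K)"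
    using Mem[OF A] by simp
  have "\<exists>K. K \<subseteq> A \<and> compact K \<and> emeasure lborel A < emeasure lborel K + ennreal (e / 2)"
  proof (cases "emeasure lborel A = 0")
    case True then show ?thesis using e by (intro exI[of _ "{}"]) auto
  next
    case False
    then have "emeasure lborel A - ennreal (e / 2) < emeasure lborel A"
      using fin e by (intro ennreal_between) (auto simp: zero_less_iff_neq_zero)
    then obtain K where K: "K \<subseteq> A" "compact K" "emeasure lborel A - ennreal (e / 2) < emeasure M K"
      unfolding S less_SUP_iff by (auto simp: S[symmetric])
    have "emeasure M K = emeasure lborel K"
      using K by (subst Mem) (auto simp: Int_absorb1 intro: borel_compact)
    then have "emeasure lborel A - ennreal (e / 2) < emeasure lborel K" using K by simp
    then have "emeasure lborel A < emeasure lborel K + ennreal (e / 2)"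
      by (metis ennreal_le_minus_iff not_le)
    then show ?thesis using K by blast
  qed
  then obtain K where K: "K \<subseteq> A" "compact K" "emeasure lborel A < emeasure lborel K + ennreal (e / 2)" by blast
  have Kb: "K \<in> sets borel" "U \<in> sets borel" using K U by (auto intro: borel_compact)
  have Kf: "emeasure lborel K < \<infinity>"
    using le_less_trans[OF emeasure_mono[of K A lborel] fin] K A by simp
  have AK: "emeasure lborel (A - K) < ennreal (e / 2)"
  proof -
    have "emeasure lborel K + emeasure lborel (A - K) = emeasure lborel A"
      using K Kb A by (subst plus_emeasure) (auto intro: arg_cong[where f="emeasure lborel"])
    then have "emeasure lborel K + emeasure lborel (A - K) < emeasure lborel K + ennreal (e / 2)"
      using K by simp
    then show ?thesis using Kf by (meson add_left_mono not_le)
  qed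
  have "emeasure lborel (U - K) \<le> emeasure lborel ((U - A) \<union> (A - K))"
    by (rule emeasure_mono) (use A Kb in auto)
  also have "\<dots> \<le> emeasure lborel (U - A) + emeasure lborel (A - K)"
    by (rule emeasure_subadditive) (use A Kb in auto)
  also have "\<dots> < ennreal (e / 2) + ennreal (e / 2)" by (intro add_strict_mono U AK)
  also have "\<dots> = ennreal e" using e by (simp flip: ennreal_plus)
  finally have L: "emeasure lborel (U - K) < ennreal e" .
  then have F: "emeasure lborel (U - K) < \<infinity>" using less_top_ennreal by (metis infinity_ennreal_def less_trans ennreal_less_top)
  then have "measure lborel (U - K) < e" using L e
    by (simp add: emeasure_eq_ennreal_measure ennreal_less_iff)
  with that[of K U] K U F show ?thesis by blast
qed

text \<open>Induction over integrable functions: indicators of sets of finite measure, sums, and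
  dominated pointwise limits, where a three-term estimate passes the modulus of continuity to the
  limit.\<close>

lemma translation_continuous_L1:
  fixes f :: "'a::euclidean_space \<Rightarrow> real"
  assumes "integrable lborel f" "e > 0"
  shows "\<exists>d>0. \<forall>h. norm h < d \<longrightarrow> (\<integral>x. \<bar>f (x + h) - f x\<bar> \<partial>lborel) < e"
  using assms
proof (induction arbitrary: e rule: integrable_induct)
  case (base A c)
  \<comment> \<open>The set \<open>U - K\<close> is met twice, at \<open>x\<close> and at
    \<open>x + h\<close>, which explains the 2; the added 1 covers \<open>c = 0\<close>.\<close>
  define e' where "e' = e / (2 * \<bar>c\<bar> + 1)"
  have e': "e' > 0" using base by (simp add: e'_def)
  obtain K U where KU: "compact K" "K \<subseteq> A" "open U" "A \<subseteq> U"
    "emeasure lborel (U - K) < \<infinity>" "measure lborel (U - K) < e'"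
    using compact_open_approx[of A e'] base e' by auto
  have Sb: "U - K \<in> sets borel" using KU by (auto intro: borel_compact)
  \<comment> \<open>A shift shorter than \<open>d\<close> cannot lead from \<open>K\<close> out of
    \<open>U\<close> or back. Hence the indicator of \<open>A\<close> can change only if
    \<open>x\<close> or \<open>x + h\<close> lies in \<open>U - K\<close>.\<close>
  obtain d where d: "d > 0" "\<And>x y. x \<in> K \<Longrightarrow> y \<in> - U \<Longrightarrow> d \<le> dist x y"
  proof -
    have "K \<inter> - U = {}" "closed (- U)" using KU by auto
    then show ?thesis using separate_compact_closed[OF KU(1), of "- U"] that by blast
  qed
  define g where "g = (indicator (U - K) :: 'a \<Rightarrow> real)"
  have gi: "integrable lborel g" unfolding g_def using Sb KU by (intro integrable_real_indicator) auto
  have [measurable]: "A \<in> sets borel" using base by simp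
  have "(\<integral>x. \<bar>indicator A (x + h) *\<^sub>R c - indicator A x *\<^sub>R c\<bar> \<partial>lborel) < e" if h: "norm h < d" for h
  proof -
    have gn: "0 \<le> g x" for x by (simp add: g_def)
    have g2: "integrable lborel (\<lambda>x. g (x + h))" by (rule lborel_shift_integrable(1)[OF gi])
    have pw: "\<bar>indicator A (x + h) *\<^sub>R c - indicator A x *\<^sub>R c\<bar> \<le> \<bar>c\<bar> * (g x + g (x + h))" for x
    proof -
      have "x + h \<in> U" if "x \<in> K" using d(2)[OF that, of "x + h"] h by (auto simp: dist_norm)
      moreover have "x \<in> U" if "x + h \<in> K" using d(2)[OF that, of x] h by (auto simp: dist_norm)
      ultimately show ?thesis using KU by (auto simp: g_def indicator_def)
    qed
    have "(\<integral>x. \<bar>indicator A (x + h) *\<^sub>R c - indicator A x *\<^sub>R c\<bar> \<partial>lborel) \<le> (\<integral>x. \<bar>c\<bar> * (g x + g (x + h)) \<partial>lborel)"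
    proof (rule integral_mono')
      show "integrable lborel (\<lambda>x. \<bar>c\<bar> * (g x + g (x + h)))"
        using gi g2 by (intro integrable_mult_right Bochner_Integration.integrable_add)
    qed (use pw gn in auto)
    also have "\<dots> = \<bar>c\<bar> * ((\<integral>x. g x \<partial>lborel) + (\<integral>x. g (x + h) \<partial>lborel))"
      using gi lborel_shift_integrable(1)[OF gi] by simp
    also have "\<dots> = \<bar>c\<bar> * (2 * measure lborel (U - K))"
      using lborel_shift(1)[of g h] gi Sb by (simp add: g_def)
    also have "\<dots> \<le> \<bar>c\<bar> * (2 * e')" using KU by (intro mult_left_mono) auto
    also have "\<dots> < e" using base by (simp add: e'_def field_simps)
    finally show ?thesis .
  qed
  then show ?case using d by blast
next
  case (add f g)
  obtain d1 where d1: "d1 > 0" "\<And>h. norm h < d1 \<Longrightarrow> (\<integral>x. \<bar>f (x + h) - f x\<bar> \<partial>lborel) < e / 2"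
    using add.IH(1)[of "e / 2"] add.prems by auto
  obtain d2 where d2: "d2 > 0" "\<And>h. norm h < d2 \<Longrightarrow> (\<integral>x. \<bar>g (x + h) - g x\<bar> \<partial>lborel) < e / 2"
    using add.IH(2)[of "e / 2"] add.prems by auto
  have "(\<integral>x. \<bar>f (x + h) + g (x + h) - (f x + g x)\<bar> \<partial>lborel) < e" if h: "norm h < min d1 d2" for h
  proof -
    have i: "integrable lborel (\<lambda>x. \<bar>f (x + h) - f x\<bar>)" "integrable lborel (\<lambda>x. \<bar>g (x + h) - g x\<bar>)"
      using add.hyps lborel_shift_integrable(1)[OF add.hyps(1)] lborel_shift_integrable(1)[OF add.hyps(2)] by auto
    have "(\<integral>x. \<bar>f (x + h) + g (x + h) - (f x + g x)\<bar> \<partial>lborel) \<le> (\<integral>x. \<bar>f (x + h) - f x\<bar> + \<bar>g (x + h) - g x\<bar> \<partial>lborel)"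
      by (rule integral_mono') (use i in auto)
    also have "\<dots> = (\<integral>x. \<bar>f (x + h) - f x\<bar> \<partial>lborel) + (\<integral>x. \<bar>g (x + h) - g x\<bar> \<partial>lborel)"
      using i by simp
    also have "\<dots> < e / 2 + e / 2" using d1 d2 h by (intro add_strict_mono) auto
    finally show ?thesis by simp
  qed
  then show ?case using d1 d2 by (intro exI[of _ "min d1 d2"]) auto
next
  case (lim f s)
  have "(\<lambda>i. \<integral>x. \<bar>s i x - f x\<bar> \<partial>lborel) \<longlonglongrightarrow> (\<integral>x. 0 \<partial>(lborel :: 'a measure))"
  proof (rule integral_dominated_convergence)
    show "integrable lborel (\<lambda>x. 3 * \<bar>f x\<bar>)" using lim.hyps(4) by simp
    show "AE x in lborel. (\<lambda>i. \<bar>s i x - f x\<bar>) \<longlonglongrightarrow> 0"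
      using lim.hyps(2) by (intro AE_I2 tendsto_rabs_zero) (simp add: LIM_zero_iff)
    show "AE x in lborel. norm \<bar>s i x - f x\<bar> \<le> 3 * \<bar>f x\<bar>" for i
    proof (intro AE_I2)
      fix x
      have "\<bar>s i x\<bar> \<le> 2 * \<bar>f x\<bar>" using lim.hyps(3)[of x i] by simp
      then show "norm \<bar>s i x - f x\<bar> \<le> 3 * \<bar>f x\<bar>" by (simp add: abs_if split: if_splits)
    qed
  qed (use lim.hyps(1,4) in auto)
  then have "\<forall>\<^sub>F i in sequentially. (\<integral>x. \<bar>s i x - f x\<bar> \<partial>lborel) < e / 3"
    using lim.prems by (intro order_tendstoD) auto
  then obtain i where i: "(\<integral>x. \<bar>s i x - f x\<bar> \<partial>lborel) < e / 3" by (auto simp: eventually_sequentially)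
  obtain d where d: "d > 0" "\<And>h. norm h < d \<Longrightarrow> (\<integral>x. \<bar>s i (x + h) - s i x\<bar> \<partial>lborel) < e / 3"
    using lim.IH[where i=i and e="e / 3"] lim.prems by auto
  have "(\<integral>x. \<bar>f (x + h) - f x\<bar> \<partial>lborel) < e" if h: "norm h < d" for h
  proof -
    define q where "q x = \<bar>s i x - f x\<bar>" for x
    have qi: "integrable lborel q" unfolding q_def using lim.hyps(1,4) by auto
    have si: "integrable lborel (\<lambda>x. \<bar>s i (x + h) - s i x\<bar>)"
      using lim.hyps(1)[of i] lborel_shift_integrable(1)[OF lim.hyps(1)[of i]] by auto
    have "(\<integral>x. \<bar>f (x + h) - f x\<bar> \<partial>lborel) \<le> (\<integral>x. q (x + h) + \<bar>s i (x + h) - s i x\<bar> + q x \<partial>lborel)"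
    proof (rule integral_mono')
      show "integrable lborel (\<lambda>x. q (x + h) + \<bar>s i (x + h) - s i x\<bar> + q x)"
        using qi si lborel_shift_integrable(1)[OF qi] by auto
    qed (auto simp: q_def)
    also have "\<dots> = (\<integral>x. q x \<partial>lborel) + (\<integral>x. \<bar>s i (x + h) - s i x\<bar> \<partial>lborel) + (\<integral>x. q x \<partial>lborel)"
      using qi si lborel_shift_integrable(1)[OF qi] lborel_shift(1)[of q h] by simp
    also have "\<dots> < e / 3 + e / 3 + e / 3" using i d(2)[OF h] unfolding q_def by linarith
    finally show ?thesis by simp
  qed
  then show ?case using d by blast
qed

text \<open>Correlation rather than convolution: this is \<open>f\<close> tested against the translate of \<open>g\<close> to \<open>y\<close>,
  which is what the weak formulation produces.\<close>

definition corr :: "('a::euclidean_space \<Rightarrow> real) \<Rightarrow> ('a \<Rightarrow> real) \<Rightarrow> 'a \<Rightarrow> real" where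
  "corr g f y = (\<integral>x. g (x - y) * f x \<partial>lborel)"

lemma corr_eq:
  assumes [measurable]: "g \<in> borel_measurable borel" "f \<in> borel_measurable borel"
  shows "corr g f y = (\<integral>x. g x * f (y + x) \<partial>lborel)"
proof -
  have "(\<integral>x. g (x - y) * f x \<partial>lborel) = (\<integral>x. g ((x + y) - y) * f (x + y) \<partial>lborel)"
    by (rule lborel_shift(1)[symmetric, of "\<lambda>x. g (x - y) * f x"]) measurable
  then show ?thesis by (simp add: corr_def add.commute)
qed

lemma corr_integrand_integrable:
  fixes g f :: "'a::euclidean_space \<Rightarrow> real"
  assumes f: "integrable lborel f" and [measurable]: "g \<in> borel_measurable borel" and g: "\<And>x. \<bar>g x\<bar> \<le> C"
  shows "integrable lborel (\<lambda>x. g (x - y) * f x)"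
proof (rule Bochner_Integration.integrable_bound)
  show "integrable lborel (\<lambda>x. C * f x)" using f by simp
  show "(\<lambda>x. g (x - y) * f x) \<in> borel_measurable lborel" using borel_measurable_integrable[OF f] by simp
  have "\<bar>g x\<bar> \<le> \<bar>C\<bar>" for x using g[of x] by linarith
  then show "AE x in lborel. norm (g (x - y) * f x) \<le> norm (C * f x)"
    by (intro AE_I2) (simp add: abs_mult mult_right_mono)
qed

lemma corr_integrand_integrable':
  fixes g f :: "'a::euclidean_space \<Rightarrow> real"
  assumes g: "integrable lborel g" and [measurable]: "f \<in> borel_measurable borel" and f: "\<And>x. \<bar>f x\<bar> \<le> C"
  shows "integrable lborel (\<lambda>x. g (x - y) * f x)"
proof (rule Bochner_Integration.integrable_bound)
  show "integrable lborel (\<lambda>x. C * g (x - y))" using lborel_shift_integrable(2)[OF g] by simp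
  show "(\<lambda>x. g (x - y) * f x) \<in> borel_measurable lborel" using borel_measurable_integrable[OF g] by simp
  have "\<bar>f x\<bar> \<le> \<bar>C\<bar>" for x using f[of x] by linarith
  then show "AE x in lborel. norm (g (x - y) * f x) \<le> norm (C * g (x - y))"
    by (intro AE_I2) (simp add: abs_mult mult_right_mono mult.commute)
qed

lemma corr_measurable_pair:
  assumes [measurable]: "g \<in> borel_measurable borel" "v \<in> borel_measurable (M \<Otimes>\<^sub>M borel)"
  shows "(\<lambda>w. corr g (\<lambda>x. v (fst w, x)) (snd w)) \<in> borel_measurable (M \<Otimes>\<^sub>M borel)"
  unfolding corr_def by measurable

lemma corr_measurable [measurable]:
  assumes [measurable]: "g \<in> borel_measurable borel" "f \<in> borel_measurable borel"
  shows "corr g f \<in> borel_measurable borel"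
  unfolding corr_def[abs_def] by measurable

lemma integral_norm_le_nn_integral:
  "ennreal (norm (\<integral>x. f x \<partial>M)) \<le> (\<integral>\<^sup>+x. ennreal (norm (f x)) \<partial>M)"
  by (cases "integrable M f") (auto simp: integral_norm_bound_ennreal not_integrable_integral_eq)

text \<open>Young's inequality for two \<open>L^1\<close> functions, by Tonelli and the reflection
  invariance of Lebesgue measure.\<close>

lemma nn_integral_corr_le:
  assumes [measurable]: "g \<in> borel_measurable borel" "f \<in> borel_measurable borel"
  shows "(\<integral>\<^sup>+y. ennreal \<bar>corr g f y\<bar> \<partial>lborel) \<le> (\<integral>\<^sup>+x. ennreal \<bar>g x\<bar> \<partial>lborel) * (\<integral>\<^sup>+x. ennreal \<bar>f x\<bar> \<partial>lborel)"
proof -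
  have "ennreal \<bar>corr g f y\<bar> \<le> (\<integral>\<^sup>+x. ennreal \<bar>g (x - y)\<bar> * ennreal \<bar>f x\<bar> \<partial>lborel)" for y
  proof -
    have "ennreal (norm (corr g f y)) \<le> (\<integral>\<^sup>+x. ennreal (norm (g (x - y) * f x)) \<partial>lborel)"
      unfolding corr_def by (rule integral_norm_le_nn_integral)
    then show ?thesis by (simp add: abs_mult ennreal_mult)
  qed
  then have "(\<integral>\<^sup>+y. ennreal \<bar>corr g f y\<bar> \<partial>lborel) \<le> (\<integral>\<^sup>+y. (\<integral>\<^sup>+x. ennreal \<bar>g (x - y)\<bar> * ennreal \<bar>f x\<bar> \<partial>lborel) \<partial>lborel)"
    by (intro nn_integral_mono)
  also have "\<dots> = (\<integral>\<^sup>+x. (\<integral>\<^sup>+y. ennreal \<bar>g (x - y)\<bar> * ennreal \<bar>f x\<bar> \<partial>lborel) \<partial>lborel)"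
    by (rule lborel_pair.Fubini') measurable
  also have "\<dots> = (\<integral>\<^sup>+x. (\<integral>\<^sup>+y. ennreal \<bar>g y\<bar> \<partial>lborel) * ennreal \<bar>f x\<bar> \<partial>lborel)"
    using nn_integral_reflect[of "\<lambda>z. ennreal \<bar>g z\<bar>"] by (simp add: nn_integral_multc)
  also have "\<dots> = (\<integral>\<^sup>+x. ennreal \<bar>g x\<bar> \<partial>lborel) * (\<integral>\<^sup>+x. ennreal \<bar>f x\<bar> \<partial>lborel)"
    by (simp add: nn_integral_cmult)
  finally show ?thesis .
qed

lemma corr_integrable:
  assumes g: "integrable lborel g" and f: "integrable lborel f"
  shows "integrable lborel (corr g f)"
proof (rule integrableI_bounded)
  have [measurable]: "g \<in> borel_measurable borel" "f \<in> borel_measurable borel"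
    using g f by (auto dest: borel_measurable_integrable)
  show "corr g f \<in> borel_measurable lborel" by simp
  have "(\<integral>\<^sup>+x. ennreal \<bar>g x\<bar> \<partial>lborel) < \<infinity>" "(\<integral>\<^sup>+x. ennreal \<bar>f x\<bar> \<partial>lborel) < \<infinity>"
    using g f by (auto simp: integrable_iff_bounded)
  then show "(\<integral>\<^sup>+ x. ennreal (norm (corr g f x)) \<partial>lborel) < \<infinity>"
    using le_less_trans[OF nn_integral_corr_le[of g f]] by (simp add: ennreal_mult_less_top)
qed

lemma corr_integrable_pair:
  assumes M: "sigma_finite_measure M" and g: "integrable lborel g"
    and v: "integrable (M \<Otimes>\<^sub>M lborel) v"
  shows "integrable (M \<Otimes>\<^sub>M lborel) (\<lambda>w. corr g (\<lambda>x. v (fst w, x)) (snd w))"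
proof (rule integrableI_bounded)
  interpret M: sigma_finite_measure M by fact
  interpret pair_sigma_finite M lborel ..
  have [measurable]: "g \<in> borel_measurable borel" using g by (auto dest: borel_measurable_integrable)
  have [measurable]: "v \<in> borel_measurable (M \<Otimes>\<^sub>M borel)"
    using borel_measurable_integrable[OF v] by (simp cong: measurable_cong_sets)
  note [measurable] = corr_measurable_pair
  show m: "(\<lambda>w. corr g (\<lambda>x. v (fst w, x)) (snd w)) \<in> borel_measurable (M \<Otimes>\<^sub>M lborel)"
    by measurable
  have "(\<integral>\<^sup>+ w. ennreal (norm (corr g (\<lambda>x. v (fst w, x)) (snd w))) \<partial>(M \<Otimes>\<^sub>M lborel))
      = (\<integral>\<^sup>+t. (\<integral>\<^sup>+y. ennreal \<bar>corr g (\<lambda>x. v (t, x)) y\<bar> \<partial>lborel) \<partial>M)"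
    by (subst lborel.nn_integral_fst[symmetric]) (use m in auto)
  also have "\<dots> \<le> (\<integral>\<^sup>+t. (\<integral>\<^sup>+x. ennreal \<bar>g x\<bar> \<partial>lborel) * (\<integral>\<^sup>+x. ennreal \<bar>v (t, x)\<bar> \<partial>lborel) \<partial>M)"
    by (intro nn_integral_mono nn_integral_corr_le) measurable
  also have "\<dots> = (\<integral>\<^sup>+x. ennreal \<bar>g x\<bar> \<partial>lborel) * (\<integral>\<^sup>+t. (\<integral>\<^sup>+x. ennreal \<bar>v (t, x)\<bar> \<partial>lborel) \<partial>M)"
    by (rule nn_integral_cmult) measurable
  also have "(\<integral>\<^sup>+t. (\<integral>\<^sup>+x. ennreal \<bar>v (t, x)\<bar> \<partial>lborel) \<partial>M) = (\<integral>\<^sup>+w. ennreal \<bar>v w\<bar> \<partial>(M \<Otimes>\<^sub>M lborel))"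
    by (subst lborel.nn_integral_fst[symmetric]) auto
  also have "(\<integral>\<^sup>+x. ennreal \<bar>g x\<bar> \<partial>lborel) * \<dots> < \<infinity>"
    using g v by (auto simp: integrable_iff_bounded ennreal_mult_less_top)
  finally show "(\<integral>\<^sup>+ w. ennreal (norm (corr g (\<lambda>x. v (fst w, x)) (snd w))) \<partial>(M \<Otimes>\<^sub>M lborel)) < \<infinity>" .
qed

text \<open>As \<open>\<rho>\<close> has mass 1, \<open>corr \<rho> f - f\<close> is the
  \<open>\<rho>\<close>-average of the differences \<open>f (y + h) - f y\<close>; Tonelli bounds
  its norm by the average of their norms.\<close>

lemma mollify_close:
  fixes f :: "'a::euclidean_space \<Rightarrow> real"
  assumes f: "integrable lborel f" and r: "integrable lborel \<rho>" "\<And>x. 0 \<le> \<rho> x"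
    "\<And>x. \<rho> x \<noteq> 0 \<Longrightarrow> norm x < d" "(\<integral>x. \<rho> x \<partial>lborel) = 1" and rb: "\<And>x. \<bar>\<rho> x\<bar> \<le> C"
    and e: "\<And>h. norm h < d \<Longrightarrow> (\<integral>x. \<bar>f (x + h) - f x\<bar> \<partial>lborel) \<le> e"
  shows "(\<integral>y. \<bar>corr \<rho> f y - f y\<bar> \<partial>lborel) \<le> e"
proof -
  have [measurable]: "\<rho> \<in> borel_measurable borel" "f \<in> borel_measurable borel"
    using r f by (auto dest: borel_measurable_integrable)
  \<comment> \<open>A function of integral 1 is nonzero somewhere, so \<open>d\<close> is positive
    and \<open>h = 0\<close> is admissible in the last hypothesis.\<close>
  have e0: "e \<ge> 0"
  proof (cases "\<exists>x. \<rho> x \<noteq> 0")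
    case True
    then have "norm (0::'a) < d" using r(3) by (metis norm_ge_zero norm_zero le_less_trans)
    from e[OF this] show ?thesis by simp
  next
    case False then show ?thesis using r(4) by simp
  qed
  have pw: "ennreal \<bar>corr \<rho> f y - f y\<bar> \<le> (\<integral>\<^sup>+h. ennreal (\<rho> h) * ennreal \<bar>f (y + h) - f y\<bar> \<partial>lborel)" for y
  proof -
    have i: "integrable lborel (\<lambda>h. \<rho> h * f (y + h))"
      using lborel_shift_integrable(1)[OF corr_integrand_integrable[OF f _ rb, where y=y], where t=y]
      by (simp add: add.commute)
    have "corr \<rho> f y - f y = (\<integral>h. \<rho> h * f (y + h) \<partial>lborel) - (\<integral>h. \<rho> h * f y \<partial>lborel)"
      using r(4) by (simp add: corr_eq)
    also have "\<dots> = (\<integral>h. \<rho> h * f (y + h) - \<rho> h * f y \<partial>lborel)"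
      using i r(1) by simp
    finally have "ennreal \<bar>corr \<rho> f y - f y\<bar> \<le> (\<integral>\<^sup>+h. ennreal (norm (\<rho> h * f (y + h) - \<rho> h * f y)) \<partial>lborel)"
      using integral_norm_le_nn_integral[of lborel "\<lambda>h. \<rho> h * f (y + h) - \<rho> h * f y"] by simp
    also have "\<dots> = (\<integral>\<^sup>+h. ennreal (\<rho> h) * ennreal \<bar>f (y + h) - f y\<bar> \<partial>lborel)"
      using r(2) by (intro nn_integral_cong) (simp add: abs_mult ennreal_mult' flip: right_diff_distrib)
    finally show ?thesis .
  qed
  have "(\<integral>\<^sup>+y. ennreal \<bar>corr \<rho> f y - f y\<bar> \<partial>lborel) \<le> (\<integral>\<^sup>+y. (\<integral>\<^sup>+h. ennreal (\<rho> h) * ennreal \<bar>f (y + h) - f y\<bar> \<partial>lborel) \<partial>lborel)"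
    by (intro nn_integral_mono pw)
  also have "\<dots> = (\<integral>\<^sup>+h. (\<integral>\<^sup>+y. ennreal (\<rho> h) * ennreal \<bar>f (y + h) - f y\<bar> \<partial>lborel) \<partial>lborel)"
    by (rule lborel_pair.Fubini') measurable
  also have "\<dots> \<le> (\<integral>\<^sup>+h. ennreal (\<rho> h) * ennreal e \<partial>lborel)"
  proof (intro nn_integral_mono)
    fix h
    have "(\<integral>\<^sup>+y. ennreal \<bar>f (y + h) - f y\<bar> \<partial>lborel) \<le> ennreal e" if "\<rho> h \<noteq> 0"
    proof -
      have "(\<integral>\<^sup>+y. ennreal \<bar>f (y + h) - f y\<bar> \<partial>lborel) = ennreal (\<integral>y. \<bar>f (y + h) - f y\<bar> \<partial>lborel)"
        by (rule nn_integral_eq_integral) (use f lborel_shift_integrable(1)[OF f] in auto)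
      then show ?thesis using e[OF r(3)[OF that]] by (simp add: ennreal_leI)
    qed
    then show "(\<integral>\<^sup>+y. ennreal (\<rho> h) * ennreal \<bar>f (y + h) - f y\<bar> \<partial>lborel) \<le> ennreal (\<rho> h) * ennreal e"
      by (cases "\<rho> h = 0") (auto simp: nn_integral_cmult intro: mult_left_mono)
  qed
  also have "\<dots> = ennreal e"
    using r by (simp add: nn_integral_multc nn_integral_eq_integral)
  finally have "(\<integral>\<^sup>+y. ennreal \<bar>corr \<rho> f y - f y\<bar> \<partial>lborel) \<le> ennreal e" .
  moreover have "(\<integral>\<^sup>+y. ennreal \<bar>corr \<rho> f y - f y\<bar> \<partial>lborel) = ennreal (\<integral>y. \<bar>corr \<rho> f y - f y\<bar> \<partial>lborel)"
    by (rule nn_integral_eq_integral) (use corr_integrable[OF r(1) f] f in auto)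
  ultimately show ?thesis using e0 by (simp add: ennreal_le_iff)
qed

lemma C11_abs: "C11 C f \<Longrightarrow> \<bar>f x\<bar> \<le> C" unfolding C11_def by blast
lemma C11_second_diff: "C11 C f \<Longrightarrow> \<bar>second_diff f x z\<bar> \<le> C * min 1 ((norm z)\<^sup>2)"
  unfolding C11_def by blast
lemma C11_continuous: "C11 C f \<Longrightarrow> continuous_on UNIV f" unfolding C11_def by blast
lemma C11I:
  "continuous_on UNIV f \<Longrightarrow> (\<And>x. \<bar>f x\<bar> \<le> C) \<Longrightarrow> (\<And>x z. \<bar>second_diff f x z\<bar> \<le> C * min 1 ((norm z)\<^sup>2)) \<Longrightarrow> C11 C f"
  unfolding C11_def by blast

lemma integrable_product_mult:
  fixes f :: "'b \<Rightarrow> real" and g :: "'c \<Rightarrow> real"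
  assumes M: "sigma_finite_measure M" and N: "sigma_finite_measure N"
    and f: "integrable M f" and g: "integrable N g"
  shows "integrable (M \<Otimes>\<^sub>M N) (\<lambda>(x, y). f x * g y)"
proof -
  interpret M: sigma_finite_measure M by fact
  interpret N: sigma_finite_measure N by fact
  interpret pair_sigma_finite M N ..
  have [measurable]: "f \<in> borel_measurable M" "g \<in> borel_measurable N" using f g by auto
  show ?thesis
  proof (rule Fubini_integrable)
    show "(\<lambda>(x, y). f x * g y) \<in> borel_measurable (M \<Otimes>\<^sub>M N)" by measurable
    show "integrable M (\<lambda>x. \<integral>y. norm (case (x, y) of (x, y) \<Rightarrow> f x * g y) \<partial>N)"
      using f by (simp add: abs_mult)
    show "AE x in M. integrable N (\<lambda>y. case (x, y) of (x, y) \<Rightarrow> f x * g y)"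
      using g by simp
  qed
qed

lemma second_diff_corr:
  assumes r: "C11 C \<rho>" and f: "integrable lborel f"
  shows "second_diff (corr \<rho> f) y z = (\<integral>x. second_diff \<rho> (x - y) z * f x \<partial>lborel)"
proof -
  have [measurable]: "\<rho> \<in> borel_measurable borel" by (rule C11_measurable[OF r])
  have i: "integrable lborel (\<lambda>x. \<rho> (x - w) * f x)" for w
    by (rule corr_integrand_integrable[OF f _ C11_abs[OF r]]) simp
  have "second_diff (corr \<rho> f) y z = (\<integral>x. 2 * (\<rho> (x - y) * f x) - \<rho> (x - (y + z)) * f x - \<rho> (x - (y - z)) * f x \<partial>lborel)"
    using i[of y] i[of "y + z"] i[of "y - z"] by (simp add: second_diff_def corr_def)
  also have "\<dots> = (\<integral>x. second_diff \<rho> (x - y) z * f x \<partial>lborel)"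
    by (intro Bochner_Integration.integral_cong refl) (simp add: second_diff_def algebra_simps)
  finally show ?thesis .
qed

text \<open>All second differences fall on the bump, so a merely integrable \<open>f\<close> becomes
  \<open>C11\<close> after mollification. This is what permits applying \<open>fl s\<close> to a
  mollified weak solution.\<close>

lemma corr_C11_L1:
  assumes r: "C11 C \<rho>" and f: "integrable lborel f"
  shows "C11 (C * (\<integral>x. \<bar>f x\<bar> \<partial>lborel)) (corr \<rho> f)"
proof (rule C11I)
  have rm [measurable]: "\<rho> \<in> borel_measurable borel" by (rule C11_measurable[OF r])
  have fm [measurable]: "f \<in> borel_measurable borel" using f by auto
  have C: "0 \<le> C" by (rule C11_nonneg[OF r])
  show "continuous_on UNIV (corr \<rho> f)"
    unfolding continuous_on_sequentially
  proof (intro ballI allI impI)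
    fix y and w :: "nat \<Rightarrow> 'a" assume "(\<forall>n. w n \<in> UNIV) \<and> w \<longlonglongrightarrow> y"
    then have w: "w \<longlonglongrightarrow> y" by simp
    have "(\<lambda>n. \<integral>x. \<rho> (x - w n) * f x \<partial>lborel) \<longlonglongrightarrow> (\<integral>x. \<rho> (x - y) * f x \<partial>lborel)"
    proof (rule integral_dominated_convergence)
      show "integrable lborel (\<lambda>x. C * \<bar>f x\<bar>)" using f by simp
      show "AE x in lborel. (\<lambda>n. \<rho> (x - w n) * f x) \<longlonglongrightarrow> \<rho> (x - y) * f x"
        by (intro AE_I2 tendsto_intros continuous_on_tendsto_compose[OF C11_continuous[OF r]] w) auto
      show "AE x in lborel. norm (\<rho> (x - w n) * f x) \<le> C * \<bar>f x\<bar>" for n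
        using C11_abs[OF r] by (intro AE_I2) (simp add: abs_mult mult_right_mono)
    qed measurable
    then show "((corr \<rho> f) \<circ> w) \<longlonglongrightarrow> corr \<rho> f y" by (simp add: corr_def o_def)
  qed
  have bound: "\<bar>\<integral>x. g x * f x \<partial>lborel\<bar> \<le> c * (\<integral>x. \<bar>f x\<bar> \<partial>lborel)"
    if [measurable]: "g \<in> borel_measurable borel" and g: "\<And>x. \<bar>g x\<bar> \<le> c" for g :: "'a \<Rightarrow> real" and c
  proof -
    have i: "integrable lborel (\<lambda>x. g x * f x)"
      using corr_integrand_integrable[OF f that(1) g, of 0] by simp
    have "\<bar>\<integral>x. g x * f x \<partial>lborel\<bar> \<le> (\<integral>x. \<bar>g x * f x\<bar> \<partial>lborel)" by (rule integral_abs_bound)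
    also have "\<dots> \<le> (\<integral>x. c * \<bar>f x\<bar> \<partial>lborel)"
    proof (rule integral_mono)
      show "integrable lborel (\<lambda>x. \<bar>g x * f x\<bar>)" using i by (rule integrable_abs)
      show "integrable lborel (\<lambda>x. c * \<bar>f x\<bar>)" using f by simp
      show "\<bar>g x * f x\<bar> \<le> c * \<bar>f x\<bar>" for x using g[of x] by (simp add: abs_mult mult_right_mono)
    qed
    finally show ?thesis by simp
  qed
  show "\<bar>corr \<rho> f x\<bar> \<le> C * (\<integral>x. \<bar>f x\<bar> \<partial>lborel)" for x
    unfolding corr_def by (rule bound) (auto intro: C11_abs[OF r])
  show "\<bar>second_diff (corr \<rho> f) x z\<bar> \<le> C * (\<integral>x. \<bar>f x\<bar> \<partial>lborel) * min 1 ((norm z)\<^sup>2)" for x z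
  proof -
    have "\<bar>second_diff (corr \<rho> f) x z\<bar> \<le> (C * min 1 ((norm z)\<^sup>2)) * (\<integral>x. \<bar>f x\<bar> \<partial>lborel)"
      unfolding second_diff_corr[OF r f] by (rule bound) (auto intro: C11_second_diff[OF r])
    then show ?thesis by (simp only: mult_ac)
  qed
qed

lemma second_diff_corr':
  assumes r: "integrable lborel \<rho>" and B: "C11 C B"
  shows "second_diff (corr \<rho> B) y z = (\<integral>x. \<rho> (x - y) * second_diff B x z \<partial>lborel)"
proof -
  have [measurable]: "\<rho> \<in> borel_measurable borel" using r by auto
  have [measurable]: "B \<in> borel_measurable borel" by (rule C11_measurable[OF B])
  have i: "integrable lborel (\<lambda>x. \<rho> (x - w) * B x)" for w
    by (rule corr_integrand_integrable'[OF r _ C11_abs[OF B]]) simp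
  have sh: "corr \<rho> B (y + w) = (\<integral>x. \<rho> (x - y) * B (x + w) \<partial>lborel)" for w
  proof -
    have "(\<integral>x. \<rho> (x - (y + w)) * B x \<partial>lborel) = (\<integral>x. \<rho> (x + w - (y + w)) * B (x + w) \<partial>lborel)"
      by (rule lborel_shift(1)[symmetric, of "\<lambda>x. \<rho> (x - (y + w)) * B x"]) measurable
    then show ?thesis by (simp add: corr_def)
  qed
  have i2: "integrable lborel (\<lambda>x. \<rho> (x - y) * B (x + w))" for w
    using lborel_shift_integrable(1)[OF i[of "y + w"], of w] by simp
  have "second_diff (corr \<rho> B) y z = (\<integral>x. 2 * (\<rho> (x - y) * B x) - \<rho> (x - y) * B (x + z) - \<rho> (x - y) * B (x - z) \<partial>lborel)"
    using i[of y] i2[of z] i2[of "- z"] sh[of z] sh[of "- z"] by (simp add: second_diff_def corr_def)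
  also have "\<dots> = (\<integral>x. \<rho> (x - y) * second_diff B x z \<partial>lborel)"
    by (intro Bochner_Integration.integral_cong refl) (simp add: second_diff_def algebra_simps)
  finally show ?thesis .
qed

text \<open>The counterpart for barriers, which are bounded but not integrable: here the second
  differences fall on \<open>B\<close>, and \<open>\<rho>\<close> only needs to be
  integrable.\<close>

lemma corr_C11_bdd:
  assumes r: "integrable lborel \<rho>" and B: "C11 C B"
  shows "C11 (C * (\<integral>x. \<bar>\<rho> x\<bar> \<partial>lborel)) (corr \<rho> B)"
proof (rule C11I)
  have rm [measurable]: "\<rho> \<in> borel_measurable borel" using r by auto
  have Bm [measurable]: "B \<in> borel_measurable borel" by (rule C11_measurable[OF B])
  show "continuous_on UNIV (corr \<rho> B)"
    unfolding continuous_on_sequentially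
  proof (intro ballI allI impI)
    fix y and w :: "nat \<Rightarrow> 'a" assume "(\<forall>n. w n \<in> UNIV) \<and> w \<longlonglongrightarrow> y"
    then have w: "w \<longlonglongrightarrow> y" by simp
    have "(\<lambda>n. \<integral>x. \<rho> x * B (w n + x) \<partial>lborel) \<longlonglongrightarrow> (\<integral>x. \<rho> x * B (y + x) \<partial>lborel)"
    proof (rule integral_dominated_convergence)
      show "integrable lborel (\<lambda>x. C * \<bar>\<rho> x\<bar>)" using r by simp
      show "AE x in lborel. (\<lambda>n. \<rho> x * B (w n + x)) \<longlonglongrightarrow> \<rho> x * B (y + x)"
        by (intro AE_I2 tendsto_intros continuous_on_tendsto_compose[OF C11_continuous[OF B]] w) auto
      show "AE x in lborel. norm (\<rho> x * B (w n + x)) \<le> C * \<bar>\<rho> x\<bar>" for n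
      proof (intro AE_I2)
        fix x show "norm (\<rho> x * B (w n + x)) \<le> C * \<bar>\<rho> x\<bar>"
          using mult_right_mono[OF C11_abs[OF B, of "w n + x"], of "\<bar>\<rho> x\<bar>"] by (simp add: abs_mult mult.commute)
      qed
    qed measurable
    then show "((corr \<rho> B) \<circ> w) \<longlonglongrightarrow> corr \<rho> B y" by (simp add: corr_eq o_def)
  qed
  have bound: "\<bar>\<integral>x. \<rho> (x - y) * g x \<partial>lborel\<bar> \<le> c * (\<integral>x. \<bar>\<rho> x\<bar> \<partial>lborel)"
    if [measurable]: "g \<in> borel_measurable borel" and g: "\<And>x. \<bar>g x\<bar> \<le> c" for g :: "'a \<Rightarrow> real" and c y
  proof -
    have i: "integrable lborel (\<lambda>x. \<rho> (x - y) * g x)"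
      by (rule corr_integrand_integrable'[OF r that(1) g])
    have r': "integrable lborel (\<lambda>x. \<rho> (x - y))" by (rule lborel_shift_integrable(2)[OF r])
    have "\<bar>\<integral>x. \<rho> (x - y) * g x \<partial>lborel\<bar> \<le> (\<integral>x. \<bar>\<rho> (x - y) * g x\<bar> \<partial>lborel)" by (rule integral_abs_bound)
    also have "\<dots> \<le> (\<integral>x. c * \<bar>\<rho> (x - y)\<bar> \<partial>lborel)"
    proof (rule integral_mono)
      show "integrable lborel (\<lambda>x. \<bar>\<rho> (x - y) * g x\<bar>)" using i by (rule integrable_abs)
      show "integrable lborel (\<lambda>x. c * \<bar>\<rho> (x - y)\<bar>)" using r' by simp
      show "\<bar>\<rho> (x - y) * g x\<bar> \<le> c * \<bar>\<rho> (x - y)\<bar>" for x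
        using mult_right_mono[OF g[of x], of "\<bar>\<rho> (x - y)\<bar>"] by (simp add: abs_mult mult.commute)
    qed
    also have "\<dots> = c * (\<integral>x. \<bar>\<rho> x\<bar> \<partial>lborel)"
      using lborel_shift(2)[of "\<lambda>x. \<bar>\<rho> x\<bar>" y] by simp
    finally show ?thesis .
  qed
  show "\<bar>corr \<rho> B x\<bar> \<le> C * (\<integral>x. \<bar>\<rho> x\<bar> \<partial>lborel)" for x
    unfolding corr_def by (rule bound) (auto intro: C11_abs[OF B])
  show "\<bar>second_diff (corr \<rho> B) x z\<bar> \<le> C * (\<integral>x. \<bar>\<rho> x\<bar> \<partial>lborel) * min 1 ((norm z)\<^sup>2)" for x z
  proof -
    have "\<bar>second_diff (corr \<rho> B) x z\<bar> \<le> (C * min 1 ((norm z)\<^sup>2)) * (\<integral>x. \<bar>\<rho> x\<bar> \<partial>lborel)"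
      unfolding second_diff_corr'[OF r B] by (rule bound) (auto intro: C11_second_diff[OF B])
    then show ?thesis by (simp only: mult_ac)
  qed
qed

text \<open>Symmetry of the operator: testing \<open>f\<close> against the fractional Laplacian of
  the bump is the same as applying the operator to the mollified \<open>f\<close>. Fubini is
  justified by the majorant \<open>C * min 1 ((norm z)^2) * levy s z\<close> times the absolute
  value of \<open>f\<close>.\<close>

lemma corr_fl_L1:
  assumes s: "0 < s" "s < 1" and r: "C11 C \<rho>" and f: "integrable lborel f"
  shows "corr (fl s \<rho>) f y = fl s (corr \<rho> f) (y::'a::euclidean_space)"
proof -
  have rm [measurable]: "\<rho> \<in> borel_measurable borel" by (rule C11_measurable[OF r])
  have fm [measurable]: "f \<in> borel_measurable borel" using f by auto
  define q where "q = (\<lambda>(x, z). second_diff \<rho> (x - y) z * levy s z * f x)"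
  have [measurable]: "q \<in> borel_measurable (borel \<Otimes>\<^sub>M borel)" unfolding q_def by measurable
  have qi: "integrable (lborel \<Otimes>\<^sub>M lborel) q"
  proof (rule Bochner_Integration.integrable_bound)
    show "integrable (lborel \<Otimes>\<^sub>M lborel) (\<lambda>(x, z :: 'a). f x * (C * (min 1 ((norm z)\<^sup>2) * levy s z)))"
      by (intro integrable_product_mult f integrable_mult_right levy_mass_integrable s sigma_finite_lborel)
    show "AE w in lborel \<Otimes>\<^sub>M lborel. norm (q w) \<le> norm (case w of (x, z :: 'a) \<Rightarrow> f x * (C * (min 1 ((norm z)\<^sup>2) * levy s z)))"
    proof (intro AE_I2)
      fix w :: "'a \<times> 'a"
      obtain x z where w: "w = (x, z)" by (cases w)
      have "\<bar>second_diff \<rho> (x - y) z\<bar> * (levy s z * \<bar>f x\<bar>) \<le> C * min 1 ((norm z)\<^sup>2) * (levy s z * \<bar>f x\<bar>)"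
        by (intro mult_right_mono C11_second_diff[OF r]) auto
      then show "norm (q w) \<le> norm (case w of (x, z :: 'a) \<Rightarrow> f x * (C * (min 1 ((norm z)\<^sup>2) * levy s z)))"
        using C11_nonneg[OF r] by (simp add: q_def w abs_mult mult_ac)
    qed
  qed simp
  have "corr (fl s \<rho>) f y = (\<integral>x. frac_const DIM('a) s / 2 * (\<integral>z. second_diff \<rho> (x - y) z * levy s z \<partial>lborel) * f x \<partial>lborel)"
    by (simp add: corr_def fl_def)
  also have "\<dots> = (\<integral>x. frac_const DIM('a) s / 2 * (\<integral>z. q (x, z) \<partial>lborel) \<partial>lborel)"
  proof (intro Bochner_Integration.integral_cong refl)
    fix x
    have "(\<integral>z. q (x, z) \<partial>lborel) = (\<integral>z. second_diff \<rho> (x - y) z * levy s z \<partial>lborel) * f x"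
      by (simp add: q_def)
    then show "frac_const DIM('a) s / 2 * (\<integral>z. second_diff \<rho> (x - y) z * levy s z \<partial>lborel) * f x = frac_const DIM('a) s / 2 * (\<integral>z. q (x, z) \<partial>lborel)"
      by simp
  qed
  also have "\<dots> = frac_const DIM('a) s / 2 * (\<integral>x. (\<integral>z. q (x, z) \<partial>lborel) \<partial>lborel)" by simp
  also have "(\<integral>x. (\<integral>z. q (x, z) \<partial>lborel) \<partial>lborel) = (\<integral>z. (\<integral>x. q (x, z) \<partial>lborel) \<partial>lborel)"
    by (rule lborel_pair.Fubini_integral[symmetric]) (use qi in simp)
  also have "\<dots> = (\<integral>z. second_diff (corr \<rho> f) y z * levy s z \<partial>lborel)"
  proof (intro Bochner_Integration.integral_cong refl)
    fix z
    have "(\<integral>x. q (x, z) \<partial>lborel) = (\<integral>x. levy s z * (second_diff \<rho> (x - y) z * f x) \<partial>lborel)"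
      by (intro Bochner_Integration.integral_cong refl) (simp add: q_def mult_ac)
    also have "\<dots> = levy s z * (\<integral>x. second_diff \<rho> (x - y) z * f x \<partial>lborel)" by simp
    finally show "(\<integral>x. q (x, z) \<partial>lborel) = second_diff (corr \<rho> f) y z * levy s z"
      by (simp only: second_diff_corr[OF r f] mult.commute)
  qed
  finally show ?thesis by (simp only: fl_def[of s "corr \<rho> f" y])
qed

lemma corr_fl_bdd:
  assumes s: "0 < s" "s < 1" and r: "integrable lborel \<rho>" and B: "C11 C B"
  shows "corr \<rho> (fl s B) y = fl s (corr \<rho> B) (y::'a::euclidean_space)"
proof -
  have rm [measurable]: "\<rho> \<in> borel_measurable borel" using r by auto
  have Bm [measurable]: "B \<in> borel_measurable borel" by (rule C11_measurable[OF B])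
  define q where "q = (\<lambda>(x, z). \<rho> (x - y) * (second_diff B x z * levy s z))"
  have [measurable]: "q \<in> borel_measurable (borel \<Otimes>\<^sub>M borel)" unfolding q_def by measurable
  have qi: "integrable (lborel \<Otimes>\<^sub>M lborel) q"
  proof (rule Bochner_Integration.integrable_bound)
    show "integrable (lborel \<Otimes>\<^sub>M lborel) (\<lambda>(x, z :: 'a). \<rho> (x - y) * (C * (min 1 ((norm z)\<^sup>2) * levy s z)))"
      by (intro integrable_product_mult lborel_shift_integrable(2) r integrable_mult_right levy_mass_integrable s sigma_finite_lborel)
    show "AE w in lborel \<Otimes>\<^sub>M lborel. norm (q w) \<le> norm (case w of (x, z :: 'a) \<Rightarrow> \<rho> (x - y) * (C * (min 1 ((norm z)\<^sup>2) * levy s z)))"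
    proof (intro AE_I2)
      fix w :: "'a \<times> 'a"
      obtain x z where w: "w = (x, z)" by (cases w)
      have "\<bar>second_diff B x z\<bar> * (levy s z * \<bar>\<rho> (x - y)\<bar>) \<le> C * min 1 ((norm z)\<^sup>2) * (levy s z * \<bar>\<rho> (x - y)\<bar>)"
        by (intro mult_right_mono C11_second_diff[OF B]) auto
      then show "norm (q w) \<le> norm (case w of (x, z :: 'a) \<Rightarrow> \<rho> (x - y) * (C * (min 1 ((norm z)\<^sup>2) * levy s z)))"
        using C11_nonneg[OF B] by (simp add: q_def w abs_mult mult_ac)
    qed
  qed simp
  have "corr \<rho> (fl s B) y = (\<integral>x. frac_const DIM('a) s / 2 * (\<rho> (x - y) * (\<integral>z. second_diff B x z * levy s z \<partial>lborel)) \<partial>lborel)"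
    unfolding corr_def by (intro Bochner_Integration.integral_cong refl) (simp add: fl_def)
  also have "\<dots> = frac_const DIM('a) s / 2 * (\<integral>x. (\<integral>z. q (x, z) \<partial>lborel) \<partial>lborel)"
    by (simp add: q_def)
  also have "(\<integral>x. (\<integral>z. q (x, z) \<partial>lborel) \<partial>lborel) = (\<integral>z. (\<integral>x. q (x, z) \<partial>lborel) \<partial>lborel)"
    by (rule lborel_pair.Fubini_integral[symmetric]) (use qi in simp)
  also have "\<dots> = (\<integral>z. second_diff (corr \<rho> B) y z * levy s z \<partial>lborel)"
  proof (intro Bochner_Integration.integral_cong refl)
    fix z
    have "(\<integral>x. q (x, z) \<partial>lborel) = (\<integral>x. levy s z * (\<rho> (x - y) * second_diff B x z) \<partial>lborel)"
      by (intro Bochner_Integration.integral_cong refl) (simp add: q_def mult_ac)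
    also have "\<dots> = levy s z * (\<integral>x. \<rho> (x - y) * second_diff B x z \<partial>lborel)" by simp
    finally show "(\<integral>x. q (x, z) \<partial>lborel) = second_diff (corr \<rho> B) y z * levy s z"
      by (simp only: second_diff_corr'[OF r B] mult.commute)
  qed
  finally show ?thesis by (simp only: fl_def[of s "corr \<rho> B" y])
qed

section \<open>The Kato inequality\<close>

text \<open>\<open>jj\<close> is a convex substitute for the positive part with Lipschitz derivative \<open>jd\<close>.\<close>

definition jd :: "real \<Rightarrow> real" where "jd r = max 0 (min 1 r)"
definition jj :: "real \<Rightarrow> real" where "jj r = jd r * r - (jd r)\<^sup>2 / 2"

lemma jd_measurable [measurable]: "jd \<in> borel_measurable borel"
  unfolding jd_def[abs_def] by measurable
lemma jj_measurable [measurable]: "jj \<in> borel_measurable borel"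
  unfolding jj_def[abs_def] by measurable
lemma jd_nonneg [simp]: "0 \<le> jd r" and jd_le1 [simp]: "jd r \<le> 1" and jd_le: "jd r \<le> max 0 r"
  by (auto simp: jd_def)
lemma jd_nonpos [simp]: "r \<le> 0 \<Longrightarrow> jd r = 0" by (simp add: jd_def)
lemma jj_nonpos [simp]: "r \<le> 0 \<Longrightarrow> jj r = 0" by (simp add: jj_def)
lemma continuous_on_jd: "continuous_on UNIV jd"
  unfolding jd_def[abs_def] by (intro continuous_intros)
lemma continuous_on_jj: "continuous_on UNIV jj"
  unfolding jj_def[abs_def] jd_def[abs_def] by (intro continuous_intros) auto

text \<open>\<open>jj b\<close> is the maximum of \<open>\<theta> * b - \<theta>^2 / 2\<close> over
  \<open>\<theta>\<close> in the unit interval, attained at \<open>\<theta> = jd b\<close>. As a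
  supremum of affine functions it is convex, and the tangent inequality needs no
  differentiation.\<close>

lemma jj_Legendre:
  assumes "0 \<le> \<theta>" "\<theta> \<le> 1"
  shows "\<theta> * b - \<theta>\<^sup>2 / 2 \<le> jj b"
proof -
  consider "b \<le> 0" | "0 \<le> b" "b \<le> 1" | "1 \<le> b" by linarith
  then show ?thesis
  proof cases
    case 1
    then have "\<theta> * b \<le> 0" using assms by (simp add: mult_nonneg_nonpos)
    moreover have "0 \<le> \<theta>\<^sup>2" by simp
    ultimately show ?thesis using jj_nonpos[OF 1] by linarith
  next
    case 2
    have "0 \<le> (\<theta> - b)\<^sup>2" by simp
    then show ?thesis using 2 by (simp add: jj_def jd_def power2_eq_square algebra_simps)
  next
    case 3
    have "0 \<le> (1 - \<theta>) * (2 * b - 1 - \<theta>)" using 3 assms by (intro mult_nonneg_nonneg) auto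
    then show ?thesis using 3 by (simp add: jj_def jd_def power2_eq_square algebra_simps)
  qed
qed

lemma jj_convex: "jj a - jj b \<le> jd a * (a - b)"
  using jj_Legendre[of "jd a" b] by (simp add: jj_def[of a] algebra_simps)

lemma jj_nonneg [simp]: "0 \<le> jj r"
  using jj_Legendre[of 0 r] by simp

lemma jj_le: "jj r \<le> max 0 r"
  using jj_convex[of r 0] jd_le1[of r]
  by (cases "r \<le> 0") (auto intro: order_trans[OF _ mult_left_le_one_le])

lemma jj_eq_0: "jj r \<le> 0 \<Longrightarrow> r \<le> 0"
proof (rule ccontr)
  assume *: "jj r \<le> 0" "\<not> r \<le> 0"
  define t where "t = min 1 r"
  have t: "0 < t" "t \<le> 1" "t \<le> r" using * by (auto simp: t_def)
  have "t * r - t\<^sup>2 / 2 \<le> 0" using jj_Legendre[of t r] t * by linarith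
  moreover have "t * t \<le> t * r" using t by (intro mult_left_mono) auto
  moreover have "0 < t * t" using t by simp
  ultimately show False by (simp add: power2_eq_square)
qed

text \<open>Convexity bounds the second difference of \<open>jj (h y)\<close> by
  \<open>jd (h y)\<close> times that of \<open>h\<close>. Integrated over \<open>y\<close> the
  former vanishes by translation invariance; weighting with the kernel in \<open>z\<close> gives the
  claim. Only the positive part of \<open>h\<close> has to be integrable.\<close>

lemma kato_space:
  fixes h :: "'a::euclidean_space \<Rightarrow> real"
  assumes s: "0 < s" "s < 1" and h: "C11 K h" and hp: "integrable lborel (\<lambda>y. max 0 (h y))"
  shows "0 \<le> (\<integral>y. jd (h y) * fl s h y \<partial>lborel)"
proof -
  have hm [measurable]: "h \<in> borel_measurable borel" by (rule C11_measurable[OF h])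
  have Pi: "integrable lborel (\<lambda>y. jd (h y))"
  proof (rule Bochner_Integration.integrable_bound[OF hp])
    have "\<bar>jd (h y)\<bar> \<le> \<bar>max 0 (h y)\<bar>" for y using jd_le[of "h y"] jd_nonneg[of "h y"] by linarith
    then show "AE y in lborel. norm (jd (h y)) \<le> norm (max 0 (h y))" by simp
  qed measurable
  define J where "J y = jj (h y)" for y
  have Jm [measurable]: "J \<in> borel_measurable borel" unfolding J_def by measurable
  have Ji: "integrable lborel J"
  proof (rule Bochner_Integration.integrable_bound[OF hp])
    have "\<bar>jj (h y)\<bar> \<le> \<bar>max 0 (h y)\<bar>" for y using jj_le[of "h y"] jj_nonneg[of "h y"] by linarith
    then show "AE y in lborel. norm (J y) \<le> norm (max 0 (h y))" by (simp add: J_def)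
  qed measurable
  have inner: "0 \<le> (\<integral>y. jd (h y) * second_diff h y z \<partial>lborel)" for z
  proof -
    have Js: "integrable lborel (\<lambda>y. J (y + z))" "integrable lborel (\<lambda>y. J (y - z))"
      using lborel_shift_integrable[OF Ji] by auto
    have "0 = (\<integral>y. second_diff J y z \<partial>lborel)"
      using Ji Js lborel_shift(1,2)[OF Jm, of z] by (simp add: second_diff_def)
    also have "\<dots> \<le> (\<integral>y. jd (h y) * second_diff h y z \<partial>lborel)"
    proof (rule integral_mono)
      show "integrable lborel (\<lambda>y. second_diff J y z)"
        unfolding second_diff_def using Ji Js by simp
      show "integrable lborel (\<lambda>y. jd (h y) * second_diff h y z)"
      proof (rule Bochner_Integration.integrable_bound)
        show "integrable lborel (\<lambda>y. (K * min 1 ((norm z)\<^sup>2)) * jd (h y))" using Pi by simp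
        show "AE y in lborel. norm (jd (h y) * second_diff h y z) \<le> norm (K * min 1 ((norm z)\<^sup>2) * jd (h y))"
        proof (intro AE_I2)
          fix y
          have "jd (h y) * \<bar>second_diff h y z\<bar> \<le> jd (h y) * (K * min 1 ((norm z)\<^sup>2))"
            by (intro mult_left_mono C11_second_diff[OF h]) simp
          then show "norm (jd (h y) * second_diff h y z) \<le> norm (K * min 1 ((norm z)\<^sup>2) * jd (h y))"
            using C11_nonneg[OF h] by (simp add: abs_mult mult.commute)
        qed
      qed measurable
      show "second_diff J y z \<le> jd (h y) * second_diff h y z" for y
        using jj_convex[of "h y" "h (y + z)"] jj_convex[of "h y" "h (y - z)"]
        by (simp add: second_diff_def J_def algebra_simps)
    qed
    finally show ?thesis .
  qed
  define q where "q = (\<lambda>(y, z). jd (h y) * (second_diff h y z * levy s z))"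
  have [measurable]: "q \<in> borel_measurable (borel \<Otimes>\<^sub>M borel)" unfolding q_def by measurable
  \<comment> \<open>Exchanging the two integrals is legitimate because \<open>jd (h y)\<close>,
    unlike \<open>h\<close>, is integrable in \<open>y\<close>.\<close>
  have qi: "integrable (lborel \<Otimes>\<^sub>M lborel) q"
  proof (rule Bochner_Integration.integrable_bound)
    show "integrable (lborel \<Otimes>\<^sub>M lborel) (\<lambda>(y, z :: 'a). jd (h y) * (K * (min 1 ((norm z)\<^sup>2) * levy s z)))"
      by (intro integrable_product_mult Pi integrable_mult_right levy_mass_integrable s sigma_finite_lborel)
    show "AE w in lborel \<Otimes>\<^sub>M lborel. norm (q w) \<le> norm (case w of (y, z :: 'a) \<Rightarrow> jd (h y) * (K * (min 1 ((norm z)\<^sup>2) * levy s z)))"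
    proof (intro AE_I2)
      fix w :: "'a \<times> 'a"
      obtain y z where w: "w = (y, z)" by (cases w)
      have "\<bar>second_diff h y z\<bar> * (levy s z * jd (h y)) \<le> K * min 1 ((norm z)\<^sup>2) * (levy s z * jd (h y))"
        by (intro mult_right_mono C11_second_diff[OF h]) auto
      then show "norm (q w) \<le> norm (case w of (y, z :: 'a) \<Rightarrow> jd (h y) * (K * (min 1 ((norm z)\<^sup>2) * levy s z)))"
        using C11_nonneg[OF h] by (simp add: q_def w abs_mult mult_ac)
    qed
  qed simp
  have "(\<integral>y. jd (h y) * fl s h y \<partial>lborel) = (\<integral>y. frac_const DIM('a) s / 2 * (\<integral>z. q (y, z) \<partial>lborel) \<partial>lborel)"
    by (intro Bochner_Integration.integral_cong refl) (simp add: q_def fl_def)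
  also have "\<dots> = frac_const DIM('a) s / 2 * (\<integral>z. (\<integral>y. q (y, z) \<partial>lborel) \<partial>lborel)"
    using lborel_pair.Fubini_integral[of "\<lambda>y z. q (y, z)"] qi by simp
  also have "(\<integral>z. (\<integral>y. q (y, z) \<partial>lborel) \<partial>lborel) = (\<integral>z. levy s z * (\<integral>y. jd (h y) * second_diff h y z \<partial>lborel) \<partial>lborel)"
  proof (intro Bochner_Integration.integral_cong refl)
    fix z
    have "(\<integral>y. q (y, z) \<partial>lborel) = (\<integral>y. levy s z * (jd (h y) * second_diff h y z) \<partial>lborel)"
      by (intro Bochner_Integration.integral_cong refl) (simp add: q_def)
    then show "(\<integral>y. q (y, z) \<partial>lborel) = levy s z * (\<integral>y. jd (h y) * second_diff h y z \<partial>lborel)" by simp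
  qed
  finally have "(\<integral>y. jd (h y) * fl s h y \<partial>lborel) = frac_const DIM('a) s / 2 * (\<integral>z. levy s z * (\<integral>y. jd (h y) * second_diff h y z \<partial>lborel) \<partial>lborel)" .
  moreover have "0 \<le> (\<integral>z. levy s z * (\<integral>y. jd (h y) * second_diff h y z \<partial>lborel) \<partial>lborel)"
  proof (rule Bochner_Integration.integral_nonneg)
    fix z show "0 \<le> levy s z * (\<integral>y. jd (h y) * second_diff h y z \<partial>lborel)"
      by (rule mult_nonneg_nonneg[OF levy_nonneg inner])
  qed
  moreover have "0 \<le> X" if "X = c / 2 * Y" "0 \<le> Y" "0 < c" for X Y c :: real unfolding that(1) using that(2,3) by (intro mult_nonneg_nonneg) auto
  ultimately show ?thesis using frac_const_pos[OF s, of "DIM('a)"] by blast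
qed

section \<open>The time interval as a measure and the chain rule in time\<close>

text \<open>Lebesgue measure of the interval, kept as a measure on the whole line so that functions
  of time and product measures need no restriction of their domain.\<close>

definition tmeas :: "real \<Rightarrow> real measure" where
  "tmeas T = density lborel (\<lambda>t. ennreal (indicator {0<..<T} t))"

lemma sets_tmeas [simp, measurable_cong]: "sets (tmeas T) = sets borel"
  by (simp add: tmeas_def)
lemma space_tmeas [simp]: "space (tmeas T) = UNIV"
  by (simp add: tmeas_def)

lemma finite_measure_tmeas: "finite_measure (tmeas T)"
  using emeasure_bounded_finite[of "{0<..<T}"]
  by (intro finite_measureI) (auto simp: tmeas_def emeasure_density ennreal_indicator less_top)

lemma sigma_finite_tmeas: "sigma_finite_measure (tmeas T)"
  using finite_measure_tmeas finite_measure.axioms(1) by blast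

lemma pair_sigma_finite_tmeas: "pair_sigma_finite (tmeas T) (lborel :: 'a::euclidean_space measure)"
  by (intro pair_sigma_finite.intro sigma_finite_tmeas sigma_finite_lborel)

lemma AE_tmeas: "(AE t in tmeas T. P t) \<longleftrightarrow> (AE t in lborel. 0 < t \<and> t < T \<longrightarrow> P t)"
  unfolding tmeas_def by (subst AE_density) (auto simp: indicator_def)

lemma AE_tmeas_bounds: "AE t in tmeas T. 0 < t \<and> t < T"
  by (simp add: AE_tmeas)

lemma AE_tmeas_neq: "AE t in tmeas T. t \<noteq> c"
  unfolding AE_tmeas using AE_lborel_singleton[of c] by eventually_elim simp

lemma integral_tmeas:
  fixes f :: "real \<Rightarrow> real"
  assumes "f \<in> borel_measurable borel"
  shows "(\<integral>t. f t \<partial>tmeas T) = (\<integral>t. indicator {0<..<T} t * f t \<partial>lborel)"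
  unfolding tmeas_def using assms by (subst integral_density) (auto simp: indicator_def)

lemma tmeas_integral_indicator:
  assumes "0 \<le> r" "r \<le> T"
  shows "(\<integral>t. indicator {r..} t \<partial>tmeas T) = T - r"
proof -
  have "(\<integral>t. (indicator {r..} t :: real) \<partial>tmeas T) = (\<integral>t. indicator {0<..<T} t * (indicator {r..} t :: real) \<partial>lborel)"
    using integral_tmeas[of "\<lambda>t. indicator {r..} t" T] by simp
  also have "\<dots> = (\<integral>t. indicator {r..<T} t \<partial>(lborel :: real measure))"
  proof (rule integral_cong_AE)
    show "AE t in lborel. indicator {0<..<T} t * indicator {r..} t = (indicator {r..<T} t :: real)"
      using AE_lborel_singleton[of 0] by eventually_elim (use assms in \<open>auto simp: indicator_def\<close>)
  qed measurable
  also have "\<dots> = T - r" using assms by simp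
  finally show ?thesis .
qed

text \<open>A chain rule for a \<open>W\<close> that is continuous and satisfies only a one-sided
  increment bound. On a fine partition convexity gives increments with \<open>jd\<close> frozen at
  the right end point; uniform continuity of \<open>jd (W r)\<close> unfreezes it at the cost of
  \<open>e\<close> times the integral of the absolute value of \<open>G\<close>.\<close>

lemma time_chain:
  fixes W G :: "real \<Rightarrow> real" and M :: "real measure"
  assumes M [measurable_cong]: "sets M = sets borel"
    and Wm [measurable]: "W \<in> borel_measurable borel"
    and cont: "continuous_on {0..T} W" and G: "integrable M G"
    and inc: "\<And>a b. 0 \<le> a \<Longrightarrow> a \<le> b \<Longrightarrow> b \<le> T \<Longrightarrow> W b - W a \<le> - (\<integral>r. indicator {a<..b} r * G r \<partial>M)"
    and t: "0 \<le> t" "t \<le> T"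
  shows "jj (W t) \<le> jj (W 0) - (\<integral>r. indicator {0<..t} r * (jd (W r) * G r) \<partial>M)"
proof -
  have Gm [measurable]: "G \<in> borel_measurable M" using G by auto
  have Gi: "integrable M (\<lambda>r. indicator {a<..b} r * G r)" for a b :: real
    by (rule Bochner_Integration.integrable_bound[OF G]) (auto simp: indicator_def)
  have aGi: "integrable M (\<lambda>r. indicator {a<..b} r * \<bar>G r\<bar>)" for a b :: real
    by (rule Bochner_Integration.integrable_bound[OF G]) (auto simp: indicator_def)
  have PGi: "integrable M (\<lambda>r. indicator {a<..b} r * (jd (W r) * G r))" for a b :: real
    by (rule Bochner_Integration.integrable_bound[OF G]) (auto simp: indicator_def abs_mult intro!: mult_left_le_one_le)
  define I where "I b = (\<integral>r. indicator {0<..b} r * (jd (W r) * G r) \<partial>M)" for b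
  define J where "J b = (\<integral>r. indicator {0<..b} r * \<bar>G r\<bar> \<partial>M)" for b
  have split: "(\<integral>r. indicator {0<..b} r * f r \<partial>M) = (\<integral>r. indicator {0<..a} r * f r \<partial>M) + (\<integral>r. indicator {a<..b} r * f r \<partial>M)"
    if "0 \<le> a" "a \<le> b" "\<And>a b. integrable M (\<lambda>r. indicator {a<..b} r * f r)" for a b and f :: "real \<Rightarrow> real"
  proof -
    have "(\<integral>r. indicator {0<..b} r * f r \<partial>M) = (\<integral>r. indicator {0<..a} r * f r + indicator {a<..b} r * f r \<partial>M)"
      using that(1,2) by (intro Bochner_Integration.integral_cong refl) (auto simp: indicator_def)
    then show ?thesis using that(3) by simp
  qed
  have main: "jj (W t) \<le> jj (W 0) - I t + e * J t" if e: "e > 0" for e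
  proof (cases "t = 0")
    case True then show ?thesis by (simp add: I_def J_def)
  next
    case False
    then have t0: "t > 0" using t by simp
    have "uniformly_continuous_on {0..T} (\<lambda>r. jd (W r))"
      by (intro compact_uniformly_continuous continuous_on_compose2[OF continuous_on_jd cont]) auto
    then obtain d where d: "d > 0" "\<And>x y. x \<in> {0..T} \<Longrightarrow> y \<in> {0..T} \<Longrightarrow> dist x y < d \<Longrightarrow> dist (jd (W x)) (jd (W y)) < e"
      using e unfolding uniformly_continuous_on_def by metis
    obtain n :: nat where n: "t / d < real n" using reals_Archimedean2 by blast
    have n0: "n > 0" using n t0 d by (cases n) (auto simp: field_simps)
    define p where "p i = t * real i / real n" for i
    have "t < d * real n" using n d by (simp add: field_simps)
    then have step: "p (Suc i) - p i < d" for i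
      using n0 d by (simp add: p_def field_simps)
    have pm: "p i \<le> p (Suc i)" "0 \<le> p i" for i using t0 n0 by (auto simp: p_def field_simps)
    have pT: "p i \<le> T" if "i \<le> n" for i
    proof -
      have "p i \<le> t" using that t0 n0 by (simp add: p_def field_simps)
      then show ?thesis using t by simp
    qed
    have "i \<le> n \<Longrightarrow> jj (W (p i)) \<le> jj (W 0) - I (p i) + e * J (p i)" for i
    proof (induction i)
      case 0 then show ?case by (simp add: p_def I_def J_def)
    next
      case (Suc i)
      define a b where "a = p i" and "b = p (Suc i)"
      have ab: "0 \<le> a" "a \<le> b" "b \<le> T" "b - a < d"
        using pm pT[OF Suc.prems] step by (auto simp: a_def b_def)
      \<comment> \<open>The tangent is taken at the later time \<open>b\<close>. As
        \<open>jd\<close> is nonnegative, the increment bound may be multiplied by it.\<close>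
      have "jj (W b) - jj (W a) \<le> jd (W b) * (W b - W a)" by (rule jj_convex)
      also have "\<dots> \<le> jd (W b) * (- (\<integral>r. indicator {a<..b} r * G r \<partial>M))"
        using ab by (intro mult_left_mono inc) auto
      also have "\<dots> = (\<integral>r. - (jd (W b) * (indicator {a<..b} r * G r)) \<partial>M)" by simp
      also have "\<dots> \<le> (\<integral>r. - (indicator {a<..b} r * (jd (W r) * G r)) + e * (indicator {a<..b} r * \<bar>G r\<bar>) \<partial>M)"
      proof (rule integral_mono)
        show "integrable M (\<lambda>r. - (jd (W b) * (indicator {a<..b} r * G r)))" using Gi by simp
        show "integrable M (\<lambda>r. - (indicator {a<..b} r * (jd (W r) * G r)) + e * (indicator {a<..b} r * \<bar>G r\<bar>))"
          using PGi aGi by simp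
        fix r
        show "- (jd (W b) * (indicator {a<..b} r * G r)) \<le> - (indicator {a<..b} r * (jd (W r) * G r)) + e * (indicator {a<..b} r * \<bar>G r\<bar>)"
        proof (cases "r \<in> {a<..b}")
          case True
          have "dist (jd (W r)) (jd (W b)) < e" using True ab by (intro d(2)) (auto simp: dist_real_def)
          then have "\<bar>jd (W r) - jd (W b)\<bar> * \<bar>G r\<bar> \<le> e * \<bar>G r\<bar>"
            by (intro mult_right_mono) (auto simp: dist_real_def)
          then have "(jd (W r) - jd (W b)) * G r \<le> e * \<bar>G r\<bar>"
            by (metis abs_mult abs_ge_self order_trans)
          then show ?thesis using True by (simp add: algebra_simps)
        qed simp
      qed
      also have "\<dots> = - (\<integral>r. indicator {a<..b} r * (jd (W r) * G r) \<partial>M) + e * (\<integral>r. indicator {a<..b} r * \<bar>G r\<bar> \<partial>M)"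
        using PGi aGi by simp
      finally have *: "jj (W b) - jj (W a) \<le> - (\<integral>r. indicator {a<..b} r * (jd (W r) * G r) \<partial>M) + e * (\<integral>r. indicator {a<..b} r * \<bar>G r\<bar> \<partial>M)" .
      have IH: "jj (W a) \<le> jj (W 0) - I a + e * J a" using Suc by (simp add: a_def)
      have "I b = I a + (\<integral>r. indicator {a<..b} r * (jd (W r) * G r) \<partial>M)"
        unfolding I_def by (rule split) (use ab PGi in auto)
      moreover have "J b = J a + (\<integral>r. indicator {a<..b} r * \<bar>G r\<bar> \<partial>M)"
        unfolding J_def by (rule split) (use ab aGi in auto)
      ultimately have "jj (W b) \<le> jj (W 0) - I b + e * J b" using * IH by (simp add: distrib_left)
      then show ?case by (simp add: b_def)
    qed
    from this[of n] show ?thesis using n0 by (simp add: p_def)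
  qed
  have J0: "J t \<ge> 0" unfolding J_def by (intro Bochner_Integration.integral_nonneg) auto
  have "jj (W t) \<le> jj (W 0) - I t"
  proof (rule field_le_epsilon)
    fix e :: real assume e: "e > 0"
    \<comment> \<open>The added 1 guards against \<open>J t = 0\<close>.\<close>
    have "e / (J t + 1) * J t \<le> e" using e J0 by (simp add: field_simps)
    then show "jj (W t) \<le> jj (W 0) - I t + e" using main[of "e / (J t + 1)"] e J0 by fastforce
  qed
  then show ?thesis by (simp add: I_def)
qed

text \<open>The equation of a mollified solution is known only for almost every time, so the chain
  rule is put into a form that ignores null sets by integrating it once more in time.\<close>

lemma time_chain_integrated:
  fixes W G :: "real \<Rightarrow> real"
  assumes T: "T > 0" and Wm [measurable]: "W \<in> borel_measurable borel"
    and cont: "continuous_on {0..T} W" and G: "integrable (tmeas T) G"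
    and inc: "\<And>a b. 0 \<le> a \<Longrightarrow> a \<le> b \<Longrightarrow> b \<le> T \<Longrightarrow> W b - W a \<le> - (\<integral>r. indicator {a<..b} r * G r \<partial>tmeas T)"
    and W0: "W 0 \<le> 0"
  shows "(\<integral>t. jj (W t) \<partial>tmeas T) \<le> - (\<integral>r. (T - r) * (jd (W r) * G r) \<partial>tmeas T)"
proof -
  interpret M: finite_measure "tmeas T" by (rule finite_measure_tmeas)
  interpret pair_sigma_finite "tmeas T" "tmeas T" ..
  have Gm [measurable]: "G \<in> borel_measurable borel" using borel_measurable_integrable[OF G] by (simp cong: measurable_cong_sets)
  define g where "g r = jd (W r) * G r" for r
  have [measurable]: "g \<in> borel_measurable borel" unfolding g_def[abs_def] by measurable
  have gi: "integrable (tmeas T) g" unfolding g_def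
    by (rule Bochner_Integration.integrable_bound[OF G]) (auto simp: abs_mult intro!: mult_left_le_one_le)
  have pw: "jj (W t) \<le> - (\<integral>r. indicator {0<..t} r * g r \<partial>tmeas T)" if "0 \<le> t" "t \<le> T" for t
    using time_chain[OF _ Wm cont G inc that] W0 by (simp add: g_def)
  define q where "q t r = indicator {0<..t} r * g r" for t r :: real
  have qm [measurable]: "(\<lambda>(t, r). q t r) \<in> borel_measurable (borel \<Otimes>\<^sub>M borel)"
  proof -
    have "(\<lambda>(t, r). q t r) = (\<lambda>w. if 0 < snd w \<and> snd w \<le> fst w then g (snd w) else 0)"
      by (auto simp: q_def indicator_def fun_eq_iff)
    then show ?thesis by simp
  qed
  have qi: "integrable (tmeas T \<Otimes>\<^sub>M tmeas T) (\<lambda>(t, r). q t r)"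
  proof (rule Bochner_Integration.integrable_bound)
    show "integrable (tmeas T \<Otimes>\<^sub>M tmeas T) (\<lambda>(t::real, r). 1 * g r)"
      by (intro integrable_product_mult gi sigma_finite_tmeas) simp
    show "(\<lambda>(t, r). q t r) \<in> borel_measurable (tmeas T \<Otimes>\<^sub>M tmeas T)"
      using qm by (simp cong: measurable_cong_sets)
  qed (auto simp: q_def indicator_def)
  have "compact (W ` {0..T})" by (intro compact_continuous_image cont) simp
  then have "bounded (W ` {0..T})" by (rule compact_imp_bounded)
  then obtain K where K: "\<And>x. x \<in> {0..T} \<Longrightarrow> norm (W x) \<le> K"
    unfolding bounded_iff by (metis image_eqI)
  have "integrable (tmeas T) (\<lambda>t. jj (W t))"
  proof (rule M.integrable_const_bound)
    have "norm (jj (W t)) \<le> K" if "0 < t \<and> t < T" for t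
      using jj_le[of "W t"] K[of t] that by auto
    then show "AE t in tmeas T. norm (jj (W t)) \<le> K"
      using AE_tmeas_bounds[of T] by auto
  qed measurable
  then have "(\<integral>t. jj (W t) \<partial>tmeas T) \<le> (\<integral>t. - (\<integral>r. q t r \<partial>tmeas T) \<partial>tmeas T)"
  proof (rule integral_mono_AE)
    show "integrable (tmeas T) (\<lambda>t. - (\<integral>r. q t r \<partial>tmeas T))"
      using integrable_fst[OF qi] by simp
    show "AE t in tmeas T. jj (W t) \<le> - (\<integral>r. q t r \<partial>tmeas T)"
      using AE_tmeas_bounds[of T] by eventually_elim (use pw in \<open>auto simp: q_def\<close>)
  qed
  also have "\<dots> = - (\<integral>r. (\<integral>t. q t r \<partial>tmeas T) \<partial>tmeas T)"
    using Fubini_integral[OF qi] by simp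
  \<comment> \<open>Fubini on the triangle \<open>r \<le> t\<close>: a time \<open>r\<close> is
    counted for all later \<open>t\<close>, a set of length \<open>T - r\<close>.\<close>
  also have "(\<integral>r. (\<integral>t. q t r \<partial>tmeas T) \<partial>tmeas T) = (\<integral>r. (T - r) * g r \<partial>tmeas T)"
  proof (rule integral_cong_AE)
    show "(\<lambda>r. \<integral>t. q t r \<partial>tmeas T) \<in> borel_measurable (tmeas T)"
      using integrable_snd[OF qi] by auto
    show "AE r in tmeas T. (\<integral>t. q t r \<partial>tmeas T) = (T - r) * g r"
      using AE_tmeas_bounds[of T]
    proof eventually_elim
      case (elim r)
      have "(\<integral>t. q t r \<partial>tmeas T) = (\<integral>t. indicator {r..} t * g r \<partial>tmeas T)"
        using elim by (intro Bochner_Integration.integral_cong refl) (auto simp: q_def indicator_def)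
      also have "\<dots> = (T - r) * g r" using tmeas_integral_indicator[of r T] elim by simp
      finally show ?case .
    qed
  qed measurable
  finally show ?thesis by (simp add: g_def)
qed

section \<open>Bump functions, solutions and barriers at a fixed mollification\<close>

definition bump_fn :: "real \<Rightarrow> real \<Rightarrow> ('a::euclidean_space \<Rightarrow> real) \<Rightarrow> bool" where
  "bump_fn C r \<rho> \<longleftrightarrow> C11 C \<rho> \<and> (\<forall>x. 0 \<le> \<rho> x) \<and> (\<forall>x. \<rho> x \<noteq> 0 \<longrightarrow> norm x < r)"

lemma bump_C11: "bump_fn C r \<rho> \<Longrightarrow> C11 C \<rho>" and bump_nonneg: "bump_fn C r \<rho> \<Longrightarrow> 0 \<le> \<rho> x"
  and bump_supp: "bump_fn C r \<rho> \<Longrightarrow> \<rho> x \<noteq> 0 \<Longrightarrow> norm x < r"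
  unfolding bump_fn_def by blast+

lemma integrable_cball [simp]: "integrable lborel (indicator (cball (c::'a::euclidean_space) r) :: 'a \<Rightarrow> real)"
  using emeasure_cball_finite[of c r] by (intro integrable_real_indicator) (auto intro: borel_closed)

lemma cball_measurable [measurable]: "cball (c::'a::euclidean_space) r \<in> sets borel"
  by (intro borel_closed) simp

lemma bump_integrable:
  assumes "bump_fn C r \<rho>"
  shows "integrable lborel (\<rho> :: 'a::euclidean_space \<Rightarrow> real)"
proof (rule Bochner_Integration.integrable_bound)
  show "integrable lborel (\<lambda>x::'a. C * indicator (cball 0 r) x)" by simp
  show "\<rho> \<in> borel_measurable lborel" using C11_measurable[OF bump_C11[OF assms]] by simp
  have "norm (\<rho> x) \<le> norm (C * indicator (cball 0 r) x)" for x
  proof (cases "\<rho> x = 0")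
    case False
    then have "norm x < r" by (rule bump_supp[OF assms])
    then show ?thesis using C11_abs[OF bump_C11[OF assms], of x] by (auto simp: indicator_def)
  qed simp
  then show "AE x in lborel. norm (\<rho> x) \<le> norm (C * indicator (cball 0 r) x)" by simp
qed

text \<open>Although \<open>fl s \<rho>\<close> does not have compact support, it is integrable: for
  fixed \<open>z\<close> the second difference lives on three balls of radius \<open>r\<close>, so
  its \<open>L^1\<close> norm in \<open>x\<close> is at most
  \<open>3 * V * C * min 1 ((norm z)^2)\<close>, which the kernel can integrate. Mollifying an
  \<open>L^1\<close> function with \<open>fl s \<rho>\<close> thus stays in
  \<open>L^1\<close>.\<close>

lemma bump_fl_integrable:
  assumes s: "0 < s" "s < 1" and b: "bump_fn C r \<rho>"
  shows "integrable lborel (fl s \<rho> :: 'a::euclidean_space \<Rightarrow> real)"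
proof -
  have C: "C11 C \<rho>" by (rule bump_C11[OF b])
  have [measurable]: "\<rho> \<in> borel_measurable borel" by (rule C11_measurable[OF C])
  define q where "q = (\<lambda>(x, z). second_diff \<rho> x z * levy s z)"
  have qm [measurable]: "q \<in> borel_measurable (borel \<Otimes>\<^sub>M borel)" unfolding q_def by measurable
  define S where "S z x = (indicator (cball 0 r) x + indicator (cball (- z) r) x + indicator (cball z r) x :: real)" for z x :: 'a
  have S: "S z x = indicator (cball 0 r) x + indicator (cball 0 r) (x + z) + indicator (cball 0 r) (x - z)" for z x
    by (simp add: S_def indicator_def dist_norm norm_minus_commute add.commute)
  have bd: "\<bar>second_diff \<rho> x z\<bar> \<le> C * min 1 ((norm z)\<^sup>2) * S z x" for x z
  proof (cases "\<rho> x = 0 \<and> \<rho> (x + z) = 0 \<and> \<rho> (x - z) = 0")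
    case True then show ?thesis using C11_nonneg[OF C] by (simp add: second_diff_def S_def)
  next
    case False
    then have "norm x < r \<or> norm (x + z) < r \<or> norm (x - z) < r" using bump_supp[OF b] by blast
    then have "1 \<le> S z x" unfolding S by (auto simp: indicator_def)
    then have "C * min 1 ((norm z)\<^sup>2) * 1 \<le> C * min 1 ((norm z)\<^sup>2) * S z x"
      using C11_nonneg[OF C] by (intro mult_left_mono) auto
    then show ?thesis using C11_second_diff[OF C, of x z] by simp
  qed
  define V where "V = measure lborel (cball (0::'a) r)"
  have Si: "integrable lborel (S z)" for z unfolding S_def by simp
  have Sint: "(\<integral>x. S z x \<partial>lborel) = 3 * V" for z
  proof -
    have i: "integrable lborel (\<lambda>x. indicator (cball 0 r) (x + z) :: real)" "integrable lborel (\<lambda>x. indicator (cball 0 r) (x - z) :: real)"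
      using lborel_shift_integrable[OF integrable_cball[of 0 r]] by auto
    have "(\<integral>x. S z x \<partial>lborel) = (\<integral>x. indicator (cball (0::'a) r) x \<partial>lborel) + (\<integral>x. indicator (cball 0 r) (x + z) \<partial>lborel) + (\<integral>x. indicator (cball 0 r) (x - z) \<partial>lborel)"
      unfolding S using i by simp
    also have "\<dots> = 3 * (\<integral>x. indicator (cball (0::'a) r) x \<partial>lborel)"
      using lborel_shift(1,2)[of "indicator (cball 0 r) :: 'a \<Rightarrow> real" z] by simp
    finally show ?thesis by (simp add: V_def)
  qed
  have Si2: "integrable lborel (\<lambda>x. \<bar>second_diff \<rho> x z\<bar>)" for z
  proof (rule Bochner_Integration.integrable_bound)
    show "integrable lborel (\<lambda>x. C * min 1 ((norm z)\<^sup>2) * S z x)" using Si by simp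
    show "AE x in lborel. norm \<bar>second_diff \<rho> x z\<bar> \<le> norm (C * min 1 ((norm z)\<^sup>2) * S z x)"
      using bd by (intro AE_I2) (simp add: order_trans[OF _ abs_ge_self])
  qed measurable
  have "integrable (lborel \<Otimes>\<^sub>M lborel) (\<lambda>(z, x). q (x, z))"
  proof (rule lborel_pair.Fubini_integrable)
    show "(\<lambda>(z, x). q (x, z)) \<in> borel_measurable (lborel \<Otimes>\<^sub>M lborel)" by measurable
    show "AE z in lborel. integrable lborel (\<lambda>x. case (z, x) of (z, x) \<Rightarrow> q (x, z))"
    proof (intro AE_I2)
      fix z
      have "integrable lborel (\<lambda>x. second_diff \<rho> x z)" using Si2[of z] by (rule integrable_abs_cancel) measurable
      then show "integrable lborel (\<lambda>x. case (z, x) of (z, x) \<Rightarrow> q (x, z))" by (simp add: q_def)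
    qed
    show "integrable lborel (\<lambda>z. \<integral>x. norm (case (z, x) of (z, x) \<Rightarrow> q (x, z)) \<partial>lborel)"
    proof (rule Bochner_Integration.integrable_bound)
      show "integrable lborel (\<lambda>z::'a. (3 * V * C) * (min 1 ((norm z)\<^sup>2) * levy s z))"
        by (intro integrable_mult_right levy_mass_integrable s)
      show "AE z::'a in lborel. norm (\<integral>x. norm (case (z, x) of (z, x) \<Rightarrow> q (x, z)) \<partial>lborel) \<le> norm ((3 * V * C) * (min 1 ((norm z)\<^sup>2) * levy s z))"
      proof (intro AE_I2)
        fix z :: 'a
        have "(\<integral>x. \<bar>second_diff \<rho> x z\<bar> \<partial>lborel) \<le> (\<integral>x. C * min 1 ((norm z)\<^sup>2) * S z x \<partial>lborel)"
          by (rule integral_mono) (use Si2 Si bd in auto)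
        also have "\<dots> = C * min 1 ((norm z)\<^sup>2) * (3 * V)" by (simp add: Sint)
        finally have "(\<integral>x. \<bar>second_diff \<rho> x z\<bar> \<partial>lborel) * levy s z \<le> C * min 1 ((norm z)\<^sup>2) * (3 * V) * levy s z"
          by (intro mult_right_mono) auto
        moreover have "(\<integral>x. norm (case (z, x) of (z, x) \<Rightarrow> q (x, z)) \<partial>lborel) = (\<integral>x. \<bar>second_diff \<rho> x z\<bar> \<partial>lborel) * levy s z"
          by (simp add: q_def abs_mult)
        ultimately have "(\<integral>x. norm (case (z, x) of (z, x) \<Rightarrow> q (x, z)) \<partial>lborel) \<le> 3 * V * C * (min 1 ((norm z)\<^sup>2) * levy s z)"
          by (simp only: mult_ac)
        moreover have "0 \<le> (\<integral>x. norm (case (z, x) of (z, x) \<Rightarrow> q (x, z)) \<partial>lborel)" by (intro Bochner_Integration.integral_nonneg) simp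
        ultimately show "norm (\<integral>x. norm (case (z, x) of (z, x) \<Rightarrow> q (x, z)) \<partial>lborel) \<le> norm ((3 * V * C) * (min 1 ((norm z)\<^sup>2) * levy s z))"
          by simp
      qed
    qed measurable
  qed
  then have "integrable lborel (\<lambda>x. \<integral>z. q (x, z) \<partial>lborel)"
    by (rule lborel_pair.integrable_snd)
  then show ?thesis unfolding fl_def[abs_def] q_def by simp
qed

lemma corr_time_integrable:
  assumes v: "integrable (tmeas T \<Otimes>\<^sub>M lborel) v" and [measurable]: "g \<in> borel_measurable borel"
    and g: "\<And>x::'a::euclidean_space. \<bar>g x\<bar> \<le> C"
  shows "integrable (tmeas T) (\<lambda>t. corr g (\<lambda>x. v (t, x)) y)"
proof -
  interpret pair_sigma_finite "tmeas T" "lborel :: 'a measure" by (rule pair_sigma_finite_tmeas)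
  have [measurable]: "v \<in> borel_measurable (tmeas T \<Otimes>\<^sub>M lborel)" using v by auto
  have "integrable (tmeas T \<Otimes>\<^sub>M lborel) (\<lambda>w. g (snd w - y) * v w)"
  proof (rule Bochner_Integration.integrable_bound)
    show "integrable (tmeas T \<Otimes>\<^sub>M lborel) (\<lambda>w. C * v w)" using v by simp
    show "AE w in tmeas T \<Otimes>\<^sub>M lborel. norm (g (snd w - y) * v w) \<le> norm (C * v w)"
    proof (intro AE_I2)
      fix w
      have "\<bar>g (snd w - y)\<bar> * \<bar>v w\<bar> \<le> \<bar>C\<bar> * \<bar>v w\<bar>"
        using g[of "snd w - y"] by (intro mult_right_mono) auto
      then show "norm (g (snd w - y) * v w) \<le> norm (C * v w)" by (simp add: abs_mult)
    qed
  qed measurable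
  from integrable_fst'[OF this] show ?thesis by (simp add: corr_def)
qed

lemma AE_pair_fst:
  assumes "AE t in M. Q t" "sigma_finite_measure N"
  shows "AE w in M \<Otimes>\<^sub>M N. Q (fst w)"
proof -
  interpret N: sigma_finite_measure N by fact
  obtain A where A: "{t \<in> space M. \<not> Q t} \<subseteq> A" "A \<in> null_sets M"
    using assms(1) by (auto elim: AE_E simp: null_sets_def)
  have "A \<times> space N \<in> null_sets (M \<Otimes>\<^sub>M N)"
    using A by (auto simp: null_sets_def N.emeasure_pair_measure_Times)
  then show ?thesis
    by (rule AE_I') (use A in \<open>auto simp: space_pair_measure\<close>)
qed

lemma tmeas_integral_continuous:
  assumes g: "integrable (tmeas T) g"
  shows "continuous_on UNIV (\<lambda>t. \<integral>r. indicator {0<..t} r * (g r :: real) \<partial>tmeas T)"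
  unfolding continuous_on_sequentially
proof (intro ballI allI impI)
  have [measurable]: "g \<in> borel_measurable (tmeas T)" using g by auto
  fix t and w :: "nat \<Rightarrow> real" assume "(\<forall>n. w n \<in> UNIV) \<and> w \<longlonglongrightarrow> t"
  then have w: "w \<longlonglongrightarrow> t" by simp
  have "(\<lambda>n. \<integral>r. indicator {0<..w n} r * g r \<partial>tmeas T) \<longlonglongrightarrow> (\<integral>r. indicator {0<..t} r * g r \<partial>tmeas T)"
  proof (rule integral_dominated_convergence)
    show "integrable (tmeas T) (\<lambda>r. \<bar>g r\<bar>)" using g by simp
    show "AE r in tmeas T. (\<lambda>n. indicator {0<..w n} r * g r) \<longlonglongrightarrow> indicator {0<..t} r * g r"
      using AE_tmeas_neq[of t T]
    proof eventually_elim
      case (elim r)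
      have "\<forall>\<^sub>F n in sequentially. indicator {0<..w n} r = (indicator {0<..t} r :: real)"
      proof (cases "r < t")
        case True
        then show ?thesis using order_tendstoD(1)[OF w True] by (auto elim!: eventually_mono simp: indicator_def)
      next
        case False
        then have "t < r" using elim by simp
        then show ?thesis using order_tendstoD(2)[OF w \<open>t < r\<close>] by (auto elim!: eventually_mono simp: indicator_def)
      qed
      then show ?case by (intro tendsto_eventually) (auto elim!: eventually_mono)
    qed
  qed (auto simp: indicator_def)
  then show "((\<lambda>t. \<integral>r. indicator {0<..t} r * g r \<partial>tmeas T) \<circ> w) \<longlonglongrightarrow> (\<integral>r. indicator {0<..t} r * g r \<partial>tmeas T)"
    by (simp add: o_def)
qed

text \<open>A distributional solution of \<open>v\<^sub>t + (-\<Delta>)\<^sup>s v + F = 0\<close> on \<open>(0,T)\<close> with initial value \<open>\<mu>\<close>, tested with bump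
  functions in space only and integrated in time.\<close>

definition lin_sol :: "real \<Rightarrow> real \<Rightarrow> (real \<times> 'a::euclidean_space \<Rightarrow> real) \<Rightarrow> (real \<times> 'a \<Rightarrow> real) \<Rightarrow> ('a \<Rightarrow> real) \<Rightarrow> bool" where
  "lin_sol s T v F \<mu> \<longleftrightarrow>
     v \<in> borel_measurable (borel \<Otimes>\<^sub>M borel) \<and> F \<in> borel_measurable (borel \<Otimes>\<^sub>M borel) \<and>
     integrable (tmeas T \<Otimes>\<^sub>M lborel) v \<and> integrable (tmeas T \<Otimes>\<^sub>M lborel) F \<and> integrable lborel \<mu> \<and>
     (\<forall>C r \<rho> y. bump_fn C r \<rho> \<longrightarrow> (AE t in tmeas T. corr \<rho> (\<lambda>x. v (t, x)) y = corr \<rho> \<mu> y -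
        (\<integral>r. indicator {0<..t} r * (corr (fl s \<rho>) (\<lambda>x. v (r, x)) y + corr \<rho> (\<lambda>x. F (r, x)) y) \<partial>tmeas T)))"

text \<open>A classical solution of \<open>B\<^sub>t + (-\<Delta>)\<^sup>s B + H \<le> 0\<close>, integrated in time so that finitely many
  kinks are allowed; \<open>LB\<close> stands for \<open>(-\<Delta>)\<^sup>s B\<close>.\<close>

definition barrier :: "real \<Rightarrow> real \<Rightarrow> real \<Rightarrow> (real \<times> 'a::euclidean_space \<Rightarrow> real) \<Rightarrow> (real \<times> 'a \<Rightarrow> real) \<Rightarrow> (real \<times> 'a \<Rightarrow> real) \<Rightarrow> bool" where
  "barrier s T K B LB H \<longleftrightarrow>
     B \<in> borel_measurable (borel \<Otimes>\<^sub>M borel) \<and> LB \<in> borel_measurable (borel \<Otimes>\<^sub>M borel) \<and> H \<in> borel_measurable (borel \<Otimes>\<^sub>M borel) \<and>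
     (\<forall>t. 0 \<le> t \<and> t \<le> T \<longrightarrow> C11 K (\<lambda>x. B (t, x))) \<and>
     (\<forall>t x. 0 < t \<and> t < T \<longrightarrow> LB (t, x) = fl s (\<lambda>x. B (t, x)) x) \<and>
     integrable (tmeas T \<Otimes>\<^sub>M lborel) H \<and>
     (\<forall>x. continuous_on {0..T} (\<lambda>t. B (t, x))) \<and>
     (\<forall>x a b. 0 \<le> a \<longrightarrow> a \<le> b \<longrightarrow> b \<le> T \<longrightarrow>
        B (b, x) - B (a, x) \<le> - (\<integral>r. indicator {a<..b} r * (LB (r, x) + H (r, x)) \<partial>tmeas T))"

text \<open>At a fixed centre \<open>y\<close> the mollified sum of solution and barrier is a scalar
  function of time. The solution contributes an exact integral equation, the barrier an increment
  inequality averaged over space, and the chain rule in time applies to their sum.\<close>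

lemma kato_pointwise:
  fixes v F B LB H :: "real \<times> 'a::euclidean_space \<Rightarrow> real"
  assumes s: "0 < s" "s < 1" and T: "T > 0" and sol: "lin_sol s T v F \<mu>"
    and bar: "barrier s T K B LB H" and bump: "bump_fn C r0 \<rho>"
    and init: "AE x in lborel. \<mu> x + B (0, x) \<le> 0"
  defines "m \<equiv> \<lambda>t y. corr \<rho> (\<lambda>x. v (t, x)) y + corr \<rho> (\<lambda>x. B (t, x)) y"
    and "G \<equiv> \<lambda>t y. (corr (fl s \<rho>) (\<lambda>x. v (t, x)) y + corr \<rho> (\<lambda>x. LB (t, x)) y) +
       (corr \<rho> (\<lambda>x. F (t, x)) y + corr \<rho> (\<lambda>x. H (t, x)) y)"
  shows "(\<integral>t. jj (m t y) \<partial>tmeas T) \<le> - (\<integral>t. (T - t) * (jd (m t y) * G t y) \<partial>tmeas T)"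
proof -
  interpret M: finite_measure "tmeas T" by (rule finite_measure_tmeas)
  interpret pair_sigma_finite "tmeas T" "lborel :: 'a measure" by (rule pair_sigma_finite_tmeas)
  have vm [measurable]: "v \<in> borel_measurable (borel \<Otimes>\<^sub>M borel)" and Fm [measurable]: "F \<in> borel_measurable (borel \<Otimes>\<^sub>M borel)"
    and vi: "integrable (tmeas T \<Otimes>\<^sub>M lborel) v" and Fi: "integrable (tmeas T \<Otimes>\<^sub>M lborel) F" and \<mu>i: "integrable lborel \<mu>"
    and eq: "AE t in tmeas T. corr \<rho> (\<lambda>x. v (t, x)) y = corr \<rho> \<mu> y -
        (\<integral>r. indicator {0<..t} r * (corr (fl s \<rho>) (\<lambda>x. v (r, x)) y + corr \<rho> (\<lambda>x. F (r, x)) y) \<partial>tmeas T)"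
    using sol bump unfolding lin_sol_def by blast+
  have Bm [measurable]: "B \<in> borel_measurable (borel \<Otimes>\<^sub>M borel)" and LBm [measurable]: "LB \<in> borel_measurable (borel \<Otimes>\<^sub>M borel)"
    and Hm [measurable]: "H \<in> borel_measurable (borel \<Otimes>\<^sub>M borel)"
    and BC: "\<And>t. 0 \<le> t \<Longrightarrow> t \<le> T \<Longrightarrow> C11 K (\<lambda>x. B (t, x))"
    and LB: "\<And>t x. 0 < t \<Longrightarrow> t < T \<Longrightarrow> LB (t, x) = fl s (\<lambda>x. B (t, x)) x"
    and Hi: "integrable (tmeas T \<Otimes>\<^sub>M lborel) H" and Bc: "\<And>x. continuous_on {0..T} (\<lambda>t. B (t, x))"
    and Binc: "\<And>x a b. 0 \<le> a \<Longrightarrow> a \<le> b \<Longrightarrow> b \<le> T \<Longrightarrow>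
        B (b, x) - B (a, x) \<le> - (\<integral>r. indicator {a<..b} r * (LB (r, x) + H (r, x)) \<partial>tmeas T)"
    using bar unfolding barrier_def by blast+
  note \<rho>C = bump_C11[OF bump] and \<rho>0 = bump_nonneg[OF bump] and \<rho>i = bump_integrable[OF bump]
  have \<rho>m [measurable]: "\<rho> \<in> borel_measurable borel" by (rule C11_measurable[OF \<rho>C])
  have \<mu>m [measurable]: "\<mu> \<in> borel_measurable borel" using \<mu>i by auto
  define L where "L = K * levy_mass TYPE('a) s"
  have LBb: "\<bar>LB (t, x)\<bar> \<le> L" if "0 < t \<and> t < T" for t x
    using fl_bound[OF s BC[of t], of x] that by (simp add: LB L_def)
  have flb: "\<bar>fl s \<rho> x\<bar> \<le> C * levy_mass TYPE('a) s" for x by (rule fl_bound[OF s \<rho>C])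
  define Gv where "Gv t = corr (fl s \<rho>) (\<lambda>x. v (t, x)) y + corr \<rho> (\<lambda>x. F (t, x)) y" for t
  define GB where "GB t = corr \<rho> (\<lambda>x. LB (t, x)) y + corr \<rho> (\<lambda>x. H (t, x)) y" for t
  have Gvi: "integrable (tmeas T) Gv" unfolding Gv_def
    by (intro Bochner_Integration.integrable_add corr_time_integrable[OF vi _ flb] corr_time_integrable[OF Fi _ C11_abs[OF \<rho>C]]) auto
  \<comment> \<open>the product integrability that justifies exchanging the mollifier with the time integral\<close>
  have LBi: "integrable (tmeas T \<Otimes>\<^sub>M lborel) (\<lambda>w. \<rho> (snd w - y) * LB w)"
  proof (rule Bochner_Integration.integrable_bound)
    show "integrable (tmeas T \<Otimes>\<^sub>M lborel) (\<lambda>(t::real, x). L * \<rho> (x - y))"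
      by (intro integrable_product_mult sigma_finite_tmeas sigma_finite_lborel lborel_shift_integrable(2) \<rho>i) simp
    show "AE w in tmeas T \<Otimes>\<^sub>M lborel. norm (\<rho> (snd w - y) * LB w) \<le> norm (case w of (t, x) \<Rightarrow> L * \<rho> (x - y))"
      using AE_pair_fst[OF AE_tmeas_bounds[of T] sigma_finite_lborel]
    proof eventually_elim
      case (elim w)
      obtain t x where w: "w = (t, x)" by (cases w)
      have "\<rho> (x - y) * \<bar>LB (t, x)\<bar> \<le> \<rho> (x - y) * L"
        using elim by (intro mult_left_mono LBb \<rho>0) (simp add: w)
      moreover have "0 \<le> L" using LBb[of t x] elim by (simp add: w)
      ultimately show ?case using \<rho>0[of "x - y"] by (simp add: w abs_mult mult.commute)
    qed
  qed measurable
  have Hi': "integrable (tmeas T \<Otimes>\<^sub>M lborel) (\<lambda>w. \<rho> (snd w - y) * H w)"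
  proof (rule Bochner_Integration.integrable_bound)
    show "integrable (tmeas T \<Otimes>\<^sub>M lborel) (\<lambda>w. C * H w)" using Hi by simp
    show "AE w in tmeas T \<Otimes>\<^sub>M lborel. norm (\<rho> (snd w - y) * H w) \<le> norm (C * H w)"
    proof (intro AE_I2)
      fix w
      have "\<bar>\<rho> (snd w - y)\<bar> * \<bar>H w\<bar> \<le> C * \<bar>H w\<bar>" by (intro mult_right_mono C11_abs[OF \<rho>C]) simp
      then show "norm (\<rho> (snd w - y) * H w) \<le> norm (C * H w)" using C11_nonneg[OF \<rho>C] by (simp add: abs_mult)
    qed
  qed measurable
  have GBi: "integrable (tmeas T) GB"
    using integrable_fst'[OF LBi] integrable_fst'[OF Hi'] unfolding GB_def corr_def by simp
  \<comment> \<open>The right-hand side of the mollified equation, which is continuous in time. It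
    agrees with the mollified solution for almost every time, and that suffices after
    integration.\<close>
  define V where "V t = corr \<rho> \<mu> y - (\<integral>r. indicator {0<..t} r * Gv r \<partial>tmeas T)" for t
  define D where "D t = corr \<rho> (\<lambda>x. B (t, x)) y" for t
  define W where "W t = V t + D t" for t
  have Vc: "continuous_on UNIV V" unfolding V_def
    by (intro continuous_intros tmeas_integral_continuous Gvi)
  have Vm [measurable]: "V \<in> borel_measurable borel" by (rule borel_measurable_continuous_onI[OF Vc])
  have Dm [measurable]: "D \<in> borel_measurable borel" unfolding D_def corr_def by measurable
  have BI: "integrable lborel (\<lambda>x. \<rho> (x - y) * B (t, x))" if "0 \<le> t" "t \<le> T" for t
    by (rule corr_integrand_integrable'[OF \<rho>i _ C11_abs[OF BC[OF that]]]) simp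
  have Dc: "continuous_on {0..T} D"
    unfolding continuous_on_sequentially
  proof (intro ballI allI impI)
    fix t and w :: "nat \<Rightarrow> real" assume t: "t \<in> {0..T}" and "(\<forall>n. w n \<in> {0..T}) \<and> w \<longlonglongrightarrow> t"
    then have w: "w \<longlonglongrightarrow> t" "\<And>n. w n \<in> {0..T}" by auto
    have "(\<lambda>n. \<integral>x. \<rho> (x - y) * B (w n, x) \<partial>lborel) \<longlonglongrightarrow> (\<integral>x. \<rho> (x - y) * B (t, x) \<partial>lborel)"
    proof (rule integral_dominated_convergence)
      show "integrable lborel (\<lambda>x. K * \<rho> (x - y))" using lborel_shift_integrable(2)[OF \<rho>i] by simp
      show "AE x in lborel. (\<lambda>n. \<rho> (x - y) * B (w n, x)) \<longlonglongrightarrow> \<rho> (x - y) * B (t, x)"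
        by (intro AE_I2 tendsto_intros continuous_on_tendsto_compose[OF Bc w(1) t]) (use w(2) in auto)
      show "AE x in lborel. norm (\<rho> (x - y) * B (w n, x)) \<le> K * \<rho> (x - y)" for n
      proof (intro AE_I2)
        fix x
        have "\<rho> (x - y) * \<bar>B (w n, x)\<bar> \<le> \<rho> (x - y) * K"
          using w(2)[of n] by (intro mult_left_mono C11_abs[OF BC] \<rho>0) auto
        then show "norm (\<rho> (x - y) * B (w n, x)) \<le> K * \<rho> (x - y)" using \<rho>0[of "x - y"] by (simp add: abs_mult mult.commute)
      qed
    qed measurable
    then show "(D \<circ> w) \<longlonglongrightarrow> D t" by (simp add: o_def D_def corr_def)
  qed
  have Wc: "continuous_on {0..T} W" unfolding W_def[abs_def]
    by (intro continuous_on_add Dc continuous_on_subset[OF Vc]) simp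
  have Wm [measurable]: "W \<in> borel_measurable borel" unfolding W_def[abs_def] by measurable
  have indi: "integrable (tmeas T) (\<lambda>r. indicator {a<..b} r * g r)" if "integrable (tmeas T) g" for a b :: real and g :: "real \<Rightarrow> real"
    by (rule Bochner_Integration.integrable_bound[OF that]) (use that in \<open>auto simp: indicator_def\<close>)
  have inc: "W b - W a \<le> - (\<integral>r. indicator {a<..b} r * (Gv r + GB r) \<partial>tmeas T)"
    if ab: "0 \<le> a" "a \<le> b" "b \<le> T" for a b
  proof -
    have "(\<integral>r. indicator {0<..b} r * Gv r \<partial>tmeas T) = (\<integral>r. indicator {0<..a} r * Gv r + indicator {a<..b} r * Gv r \<partial>tmeas T)"
      using ab by (intro Bochner_Integration.integral_cong refl) (auto simp: indicator_def)
    then have Vd: "V b - V a = - (\<integral>r. indicator {a<..b} r * Gv r \<partial>tmeas T)"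
      using indi[OF Gvi] by (simp add: V_def)
    define q where "q r x = indicator {a<..b} r * (\<rho> (x - y) * (LB (r, x) + H (r, x)))" for r x
    have qi: "integrable (tmeas T \<Otimes>\<^sub>M lborel) (\<lambda>(r, x). q r x)"
    proof (rule Bochner_Integration.integrable_bound)
      show "integrable (tmeas T \<Otimes>\<^sub>M lborel) (\<lambda>w. \<rho> (snd w - y) * LB w + \<rho> (snd w - y) * H w)"
        using LBi Hi' by simp
      show "(\<lambda>(r, x). q r x) \<in> borel_measurable (tmeas T \<Otimes>\<^sub>M lborel)" unfolding q_def by measurable
    qed (auto simp: q_def indicator_def distrib_left)
    have "D b - D a = (\<integral>x. \<rho> (x - y) * (B (b, x) - B (a, x)) \<partial>lborel)"
      using BI[of a] BI[of b] ab by (simp add: D_def corr_def right_diff_distrib)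
    also have "\<dots> \<le> (\<integral>x. - (\<integral>r. q r x \<partial>tmeas T) \<partial>lborel)"
    proof (rule integral_mono)
      show "integrable lborel (\<lambda>x. \<rho> (x - y) * (B (b, x) - B (a, x)))"
        using BI[of a] BI[of b] ab by (simp add: right_diff_distrib)
      show "integrable lborel (\<lambda>x. - (\<integral>r. q r x \<partial>tmeas T))" using integrable_snd[OF qi] by simp
      fix x
      have "\<rho> (x - y) * (B (b, x) - B (a, x)) \<le> \<rho> (x - y) * - (\<integral>r. indicator {a<..b} r * (LB (r, x) + H (r, x)) \<partial>tmeas T)"
        by (intro mult_left_mono Binc ab \<rho>0)
      also have "\<dots> = - (\<integral>r. \<rho> (x - y) * (indicator {a<..b} r * (LB (r, x) + H (r, x))) \<partial>tmeas T)" by simp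
      also have "(\<integral>r. \<rho> (x - y) * (indicator {a<..b} r * (LB (r, x) + H (r, x))) \<partial>tmeas T) = (\<integral>r. q r x \<partial>tmeas T)"
        by (intro Bochner_Integration.integral_cong refl) (simp add: q_def)
      finally show "\<rho> (x - y) * (B (b, x) - B (a, x)) \<le> - (\<integral>r. q r x \<partial>tmeas T)" .
    qed
    also have "\<dots> = - (\<integral>r. (\<integral>x. q r x \<partial>lborel) \<partial>tmeas T)"
      using Fubini_integral[OF qi] by simp
    also have "(\<integral>r. (\<integral>x. q r x \<partial>lborel) \<partial>tmeas T) = (\<integral>r. indicator {a<..b} r * GB r \<partial>tmeas T)"
    proof (rule integral_cong_AE)
      show "(\<lambda>r. \<integral>x. q r x \<partial>lborel) \<in> borel_measurable (tmeas T)" using integrable_fst[OF qi] by auto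
      show "(\<lambda>r. indicator {a<..b} r * GB r) \<in> borel_measurable (tmeas T)" using indi[OF GBi] by auto
      show "AE r in tmeas T. (\<integral>x. q r x \<partial>lborel) = indicator {a<..b} r * GB r"
        using AE_integrable_fst'[OF LBi] AE_integrable_fst'[OF Hi']
        by eventually_elim (simp add: q_def GB_def corr_def distrib_left)
    qed
    finally have "D b - D a \<le> - (\<integral>r. indicator {a<..b} r * GB r \<partial>tmeas T)" .
    then show ?thesis using Vd indi[OF Gvi] indi[OF GBi] by (simp add: W_def distrib_left)
  qed
  have W0: "W 0 \<le> 0"
  proof -
    have "W 0 = (\<integral>x. \<rho> (x - y) * \<mu> x + \<rho> (x - y) * B (0, x) \<partial>lborel)"
      using BI[of 0] T corr_integrand_integrable[OF \<mu>i \<rho>m C11_abs[OF \<rho>C], of y]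
      by (simp add: W_def V_def D_def corr_def)
    also have "\<dots> \<le> (\<integral>x. 0 \<partial>(lborel :: 'a measure))"
    proof (rule integral_mono_AE)
      show "integrable lborel (\<lambda>x. \<rho> (x - y) * \<mu> x + \<rho> (x - y) * B (0, x))"
        using BI[of 0] T corr_integrand_integrable[OF \<mu>i \<rho>m C11_abs[OF \<rho>C], of y] by simp
      show "AE x in lborel. \<rho> (x - y) * \<mu> x + \<rho> (x - y) * B (0, x) \<le> 0"
        using init by eventually_elim (simp add: \<rho>0 mult_nonneg_nonpos flip: distrib_left)
    qed simp
    finally show ?thesis by simp
  qed
  have ch: "(\<integral>t. jj (W t) \<partial>tmeas T) \<le> - (\<integral>t. (T - t) * (jd (W t) * (Gv t + GB t)) \<partial>tmeas T)"
    by (rule time_chain_integrated[OF T Wm Wc _ inc W0]) (use Gvi GBi in auto)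
  have Wm': "AE t in tmeas T. W t = m t y"
    using eq by eventually_elim (simp add: W_def V_def D_def m_def Gv_def)
  have mm [measurable]: "(\<lambda>t. m t y) \<in> borel_measurable borel" unfolding m_def corr_def by measurable
  have GG: "G t y = Gv t + GB t" for t by (simp add: G_def Gv_def GB_def)
  have Gm [measurable]: "(\<lambda>t. Gv t + GB t) \<in> borel_measurable (tmeas T)" using Gvi GBi by auto
  have "(\<integral>t. jj (W t) \<partial>tmeas T) = (\<integral>t. jj (m t y) \<partial>tmeas T)"
    by (rule integral_cong_AE) (use Wm' in auto)
  moreover have "(\<integral>t. (T - t) * (jd (W t) * (Gv t + GB t)) \<partial>tmeas T) = (\<integral>t. (T - t) * (jd (m t y) * G t y) \<partial>tmeas T)"
    unfolding GG by (rule integral_cong_AE) (use Wm' in auto)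
  ultimately show ?thesis using ch by simp
qed

text \<open>Integrating over the centre \<open>y\<close> as well, the part of the source coming from
  the operator has a sign by Kato's inequality in space; only the zero-order terms of solution and
  barrier remain.\<close>

lemma kato_integrated:
  fixes v F B LB H :: "real \<times> 'a::euclidean_space \<Rightarrow> real"
  assumes s: "0 < s" "s < 1" and T: "T > 0" and sol: "lin_sol s T v F \<mu>"
    and bar: "barrier s T K B LB H" and bump: "bump_fn C r0 \<rho>"
    and init: "AE x in lborel. \<mu> x + B (0, x) \<le> 0"
    and wplus: "integrable (tmeas T \<Otimes>\<^sub>M lborel) (\<lambda>w. max 0 (v w + B w))"
  defines "m \<equiv> \<lambda>w. corr \<rho> (\<lambda>x. v (fst w, x)) (snd w) + corr \<rho> (\<lambda>x. B (fst w, x)) (snd w)"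
    and "f \<equiv> \<lambda>w. corr \<rho> (\<lambda>x. F (fst w, x)) (snd w) + corr \<rho> (\<lambda>x. H (fst w, x)) (snd w)"
  shows "integrable (tmeas T \<Otimes>\<^sub>M lborel) (\<lambda>w. jj (m w))"
    and "(\<integral>w. jj (m w) \<partial>(tmeas T \<Otimes>\<^sub>M lborel)) \<le> - (\<integral>w. (T - fst w) * (jd (m w) * f w) \<partial>(tmeas T \<Otimes>\<^sub>M lborel))"
proof -
  let ?N = "tmeas T \<Otimes>\<^sub>M (lborel :: 'a measure)"
  interpret M: finite_measure "tmeas T" by (rule finite_measure_tmeas)
  interpret pair_sigma_finite "tmeas T" "lborel :: 'a measure" by (rule pair_sigma_finite_tmeas)
  have vm [measurable]: "v \<in> borel_measurable (borel \<Otimes>\<^sub>M borel)" and Fm [measurable]: "F \<in> borel_measurable (borel \<Otimes>\<^sub>M borel)"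
    and vi: "integrable ?N v" and Fi: "integrable ?N F"
    using sol unfolding lin_sol_def by blast+
  have Bm [measurable]: "B \<in> borel_measurable (borel \<Otimes>\<^sub>M borel)" and LBm [measurable]: "LB \<in> borel_measurable (borel \<Otimes>\<^sub>M borel)"
    and Hm [measurable]: "H \<in> borel_measurable (borel \<Otimes>\<^sub>M borel)"
    and BC: "\<And>t. 0 \<le> t \<Longrightarrow> t \<le> T \<Longrightarrow> C11 K (\<lambda>x. B (t, x))"
    and LB: "\<And>t x. 0 < t \<Longrightarrow> t < T \<Longrightarrow> LB (t, x) = fl s (\<lambda>x. B (t, x)) x"
    and Hi: "integrable ?N H"
    using bar unfolding barrier_def by blast+
  note \<rho>C = bump_C11[OF bump] and \<rho>0 = bump_nonneg[OF bump] and \<rho>i = bump_integrable[OF bump]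
  have \<rho>m [measurable]: "\<rho> \<in> borel_measurable borel" by (rule C11_measurable[OF \<rho>C])
  note fli = bump_fl_integrable[OF s bump]
  note [measurable] = corr_measurable_pair
  have mm [measurable]: "m \<in> borel_measurable (borel \<Otimes>\<^sub>M borel)" unfolding m_def by measurable
  define wp where "wp w = max 0 (v w + B w)" for w
  have wpi: "integrable ?N wp" using wplus by (simp add: wp_def[abs_def])
  \<comment> \<open>The barrier is only bounded, so the mollified sum need not be integrable. Its
    positive part lies below the mollified positive part, which is integrable by hypothesis.\<close>
  define cw where "cw w = corr \<rho> (\<lambda>x. wp (fst w, x)) (snd w)" for w
  have cwi: "integrable ?N cw" unfolding cw_def[abs_def]
    by (rule corr_integrable_pair[OF sigma_finite_tmeas \<rho>i wpi])
  have vt: "AE t in tmeas T. integrable lborel (\<lambda>x. v (t, x)) \<and> integrable lborel (\<lambda>x. wp (t, x)) \<and> 0 < t \<and> t < T"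
    using AE_integrable_fst'[OF vi] AE_integrable_fst'[OF wpi] AE_tmeas_bounds[of T] by auto
  have m_le: "max 0 (m (t, y)) \<le> cw (t, y)"
    if t: "integrable lborel (\<lambda>x. v (t, x)) \<and> integrable lborel (\<lambda>x. wp (t, x)) \<and> 0 < t \<and> t < T" for t y
  proof -
    have i1: "integrable lborel (\<lambda>x. \<rho> (x - y) * v (t, x))"
      by (rule corr_integrand_integrable[OF _ \<rho>m C11_abs[OF \<rho>C]]) (use t in simp)
    have i2: "integrable lborel (\<lambda>x. \<rho> (x - y) * B (t, x))"
      by (rule corr_integrand_integrable'[OF \<rho>i _ C11_abs[OF BC]]) (use t in auto)
    have i3: "integrable lborel (\<lambda>x. \<rho> (x - y) * wp (t, x))"
      by (rule corr_integrand_integrable[OF _ \<rho>m C11_abs[OF \<rho>C]]) (use t in simp)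
    have "m (t, y) = (\<integral>x. \<rho> (x - y) * v (t, x) + \<rho> (x - y) * B (t, x) \<partial>lborel)"
      using i1 i2 by (simp add: m_def corr_def)
    also have "\<dots> \<le> (\<integral>x. \<rho> (x - y) * wp (t, x) \<partial>lborel)"
    proof (rule integral_mono)
      show "\<rho> (x - y) * v (t, x) + \<rho> (x - y) * B (t, x) \<le> \<rho> (x - y) * wp (t, x)" for x
        unfolding distrib_left[symmetric] by (intro mult_left_mono \<rho>0) (simp add: wp_def)
    qed (use i1 i2 i3 in auto)
    finally have "m (t, y) \<le> cw (t, y)" by (simp add: cw_def corr_def)
    moreover have "0 \<le> cw (t, y)" unfolding cw_def corr_def
      by (intro Bochner_Integration.integral_nonneg mult_nonneg_nonneg \<rho>0) (simp add: wp_def)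
    ultimately show ?thesis by simp
  qed
  have m_leN: "AE w in ?N. max 0 (m w) \<le> cw w"
    using AE_pair_fst[OF vt sigma_finite_lborel]
    by eventually_elim (metis m_le prod.collapse)
  show ji: "integrable ?N (\<lambda>w. jj (m w))"
  proof (rule Bochner_Integration.integrable_bound[OF cwi])
    show "AE w in ?N. norm (jj (m w)) \<le> norm (cw w)"
      using m_leN
    proof eventually_elim
      case (elim w)
      have "\<bar>jj (m w)\<bar> \<le> \<bar>cw w\<bar>" using jj_le[of "m w"] jj_nonneg[of "m w"] elim by linarith
      then show ?case by simp
    qed
  qed measurable
  have jdi: "integrable ?N (\<lambda>w. jd (m w))"
  proof (rule Bochner_Integration.integrable_bound[OF cwi])
    show "AE w in ?N. norm (jd (m w)) \<le> norm (cw w)"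
      using m_leN
    proof eventually_elim
      case (elim w)
      have "\<bar>jd (m w)\<bar> \<le> \<bar>cw w\<bar>" using jd_le[of "m w"] jd_nonneg[of "m w"] elim by linarith
      then show ?case by simp
    qed
  qed measurable
  define P where "P w = (T - fst w) * jd (m w)" for w
  have [measurable]: "P \<in> borel_measurable (borel \<Otimes>\<^sub>M borel)" unfolding P_def[abs_def] by measurable
  have bnd: "AE w in ?N. 0 < fst w \<and> fst w < T" by (rule AE_pair_fst[OF AE_tmeas_bounds sigma_finite_lborel])
  have Pb: "AE w in ?N. \<bar>P w\<bar> \<le> T"
    using bnd
  proof eventually_elim
    case (elim w)
    have "(T - fst w) * jd (m w) \<le> T * 1" using elim by (intro mult_mono) auto
    then show ?case using elim by (simp add: P_def abs_mult)
  qed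
  have Pmul: "integrable ?N (\<lambda>w. P w * g w)" if g: "integrable ?N g" for g
  proof (rule Bochner_Integration.integrable_bound)
    show "integrable ?N (\<lambda>w. T * g w)" using g by simp
    have [measurable]: "g \<in> borel_measurable ?N" using g by auto
    show "(\<lambda>w. P w * g w) \<in> borel_measurable ?N" by measurable
    show "AE w in ?N. norm (P w * g w) \<le> norm (T * g w)"
      using Pb by eventually_elim (use T in \<open>simp add: abs_mult mult_right_mono\<close>)
  qed
  have Pi: "integrable ?N P"
  proof -
    show ?thesis
    proof (rule Bochner_Integration.integrable_bound)
      show "integrable ?N (\<lambda>w. T * jd (m w))" using jdi by simp
      show "AE w in ?N. norm (P w) \<le> norm (T * jd (m w))"
        using bnd by eventually_elim (use T in \<open>simp add: P_def abs_mult mult_right_mono\<close>)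
    qed measurable
  qed
  define G1 where "G1 w = corr (fl s \<rho>) (\<lambda>x. v (fst w, x)) (snd w) + corr \<rho> (\<lambda>x. LB (fst w, x)) (snd w)" for w
  define L where "L = K * (\<integral>x. \<bar>\<rho> x\<bar> \<partial>lborel) * levy_mass TYPE('a) s"
  have cLB: "corr \<rho> (\<lambda>x. LB (t, x)) y = fl s (corr \<rho> (\<lambda>x. B (t, x))) y" if "0 < t \<and> t < T" for t y
    using corr_fl_bdd[OF s \<rho>i BC[of t], of y] that by (simp add: LB)
  have cLBb: "\<bar>corr \<rho> (\<lambda>x. LB (t, x)) y\<bar> \<le> L" if "0 < t \<and> t < T" for t y
    unfolding cLB[OF that] L_def by (rule fl_bound[OF s corr_C11_bdd[OF \<rho>i BC]]) (use that in auto)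
  \<comment> \<open>The operator applied to the mollified barrier is bounded but not known to be
    integrable; the integrable weight \<open>P\<close> compensates.\<close>
  have PLB: "integrable ?N (\<lambda>w. P w * corr \<rho> (\<lambda>x. LB (fst w, x)) (snd w))"
  proof (rule Bochner_Integration.integrable_bound)
    show "integrable ?N (\<lambda>w. L * P w)" using Pi by simp
    show "AE w in ?N. norm (P w * corr \<rho> (\<lambda>x. LB (fst w, x)) (snd w)) \<le> norm (L * P w)"
      using bnd
    proof eventually_elim
      case (elim w)
      have "\<bar>P w\<bar> * \<bar>corr \<rho> (\<lambda>x. LB (fst w, x)) (snd w)\<bar> \<le> \<bar>P w\<bar> * L"
        by (intro mult_left_mono cLBb elim) simp
      moreover have "0 \<le> L" using cLBb[OF elim, of 0] by linarith
      ultimately show ?case by (simp add: abs_mult mult.commute)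
    qed
  qed measurable
  have PG1: "integrable ?N (\<lambda>w. P w * G1 w)"
    unfolding G1_def distrib_left
    by (intro Bochner_Integration.integrable_add PLB Pmul corr_integrable_pair[OF sigma_finite_tmeas fli vi])
  have Pf: "integrable ?N (\<lambda>w. P w * f w)"
    unfolding f_def distrib_left
    by (intro Bochner_Integration.integrable_add Pmul corr_integrable_pair[OF sigma_finite_tmeas \<rho>i] Fi Hi)
  \<comment> \<open>For almost every time the mollified sum is \<open>C11\<close> in space with
    integrable positive part, so \<open>kato_space\<close> applies on that time slice.\<close>
  have pos: "0 \<le> (\<integral>w. P w * G1 w \<partial>?N)"
  proof -
    have "(\<integral>w. P w * G1 w \<partial>?N) = (\<integral>t. (\<integral>y. P (t, y) * G1 (t, y) \<partial>lborel) \<partial>tmeas T)"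
      by (rule integral_fst'[symmetric, OF PG1])
    also have "\<dots> \<ge> 0"
    proof (rule integral_nonneg_AE)
      show "AE t in tmeas T. 0 \<le> (\<integral>y. P (t, y) * G1 (t, y) \<partial>lborel)"
        using vt
      proof eventually_elim
        case (elim t)
        define h where "h y = corr \<rho> (\<lambda>x. v (t, x)) y + corr \<rho> (\<lambda>x. B (t, x)) y" for y
        have c1: "C11 (C * (\<integral>x. \<bar>v (t, x)\<bar> \<partial>lborel)) (corr \<rho> (\<lambda>x. v (t, x)))"
          using elim by (intro corr_C11_L1[OF \<rho>C]) simp
        have c2: "C11 (K * (\<integral>x. \<bar>\<rho> x\<bar> \<partial>lborel)) (corr \<rho> (\<lambda>x. B (t, x)))"
          using elim by (intro corr_C11_bdd[OF \<rho>i BC]) auto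
        note hC = C11_add[OF c1 c2, folded h_def]
        have [measurable]: "h \<in> borel_measurable borel" by (rule C11_measurable[OF hC])
        have "integrable lborel (corr \<rho> (\<lambda>x. wp (t, x)))"
          using elim by (intro corr_integrable \<rho>i) simp
        then have "integrable lborel (\<lambda>y. max 0 (h y))"
        proof (rule Bochner_Integration.integrable_bound)
          show "AE y in lborel. norm (max 0 (h y)) \<le> norm (corr \<rho> (\<lambda>x. wp (t, x)) y)"
          proof (intro AE_I2)
            fix y
            have "max 0 (h y) \<le> corr \<rho> (\<lambda>x. wp (t, x)) y" using m_le[OF elim, of y] by (simp add: m_def h_def cw_def)
            then show "norm (max 0 (h y)) \<le> norm (corr \<rho> (\<lambda>x. wp (t, x)) y)" by (simp add: abs_le_iff)
          qed
        qed measurable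
        from kato_space[OF s hC this] have k: "0 \<le> (\<integral>y. jd (h y) * fl s h y \<partial>lborel)" .
        have "P (t, y) * G1 (t, y) = (T - t) * (jd (h y) * fl s h y)" for y
        proof -
          have "corr (fl s \<rho>) (\<lambda>x. v (t, x)) y = fl s (corr \<rho> (\<lambda>x. v (t, x))) y"
            using elim by (intro corr_fl_L1[OF s \<rho>C]) simp
          then have "G1 (t, y) = fl s h y"
            using fl_add[OF s c1 c2, of y] cLB[of t y] elim by (simp add: G1_def h_def[abs_def])
          then show ?thesis by (simp add: P_def m_def h_def)
        qed
        then have "(\<integral>y. P (t, y) * G1 (t, y) \<partial>lborel) = (T - t) * (\<integral>y. jd (h y) * fl s h y \<partial>lborel)" by simp
        then show ?case using k elim by (simp add: mult_nonneg_nonneg)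
      qed
    qed
    finally show ?thesis .
  qed
  have "(\<integral>w. jj (m w) \<partial>?N) = (\<integral>y. (\<integral>t. jj (m (t, y)) \<partial>tmeas T) \<partial>lborel)"
    using integral_snd[of "\<lambda>t y. jj (m (t, y))"] ji by (simp add: case_prod_beta')
  also have "\<dots> \<le> (\<integral>y. - (\<integral>t. P (t, y) * G1 (t, y) + P (t, y) * f (t, y) \<partial>tmeas T) \<partial>lborel)"
  proof (rule integral_mono)
    show "integrable lborel (\<lambda>y. \<integral>t. jj (m (t, y)) \<partial>tmeas T)"
      using integrable_snd[of "\<lambda>t y. jj (m (t, y))"] ji by (simp add: case_prod_beta')
    show "integrable lborel (\<lambda>y. - (\<integral>t. P (t, y) * G1 (t, y) + P (t, y) * f (t, y) \<partial>tmeas T))"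
      using integrable_snd[of "\<lambda>t y. P (t, y) * G1 (t, y) + P (t, y) * f (t, y)"] PG1 Pf by (simp add: case_prod_beta')
    fix y
    have "(\<integral>t. jj (m (t, y)) \<partial>tmeas T) \<le> - (\<integral>t. (T - t) * (jd (m (t, y)) * (G1 (t, y) + f (t, y))) \<partial>tmeas T)"
      using kato_pointwise[OF s T sol bar bump init, of y] by (simp add: m_def G1_def f_def)
    also have "(\<integral>t. (T - t) * (jd (m (t, y)) * (G1 (t, y) + f (t, y))) \<partial>tmeas T) = (\<integral>t. P (t, y) * G1 (t, y) + P (t, y) * f (t, y) \<partial>tmeas T)"
      by (intro Bochner_Integration.integral_cong refl) (simp add: P_def algebra_simps)
    finally show "(\<integral>t. jj (m (t, y)) \<partial>tmeas T) \<le> - (\<integral>t. P (t, y) * G1 (t, y) + P (t, y) * f (t, y) \<partial>tmeas T)" .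
  qed
  also have "\<dots> = - (\<integral>w. P w * G1 w + P w * f w \<partial>?N)"
    using integral_snd[of "\<lambda>t y. P (t, y) * G1 (t, y) + P (t, y) * f (t, y)"] PG1 Pf by (simp add: case_prod_beta')
  also have "\<dots> = - (\<integral>w. P w * G1 w \<partial>?N) - (\<integral>w. P w * f w \<partial>?N)" using PG1 Pf by simp
  also have "\<dots> \<le> - (\<integral>w. P w * f w \<partial>?N)" using pos by simp
  also have "(\<integral>w. P w * f w \<partial>?N) = (\<integral>w. (T - fst w) * (jd (m w) * f w) \<partial>?N)"
    by (simp add: P_def mult.assoc)
  finally show "(\<integral>w. jj (m w) \<partial>?N) \<le> - (\<integral>w. (T - fst w) * (jd (m w) * f w) \<partial>?N)" .
qed

section \<open>Approximate identities\<close>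

definition mollifier :: "(nat \<Rightarrow> 'a::euclidean_space \<Rightarrow> real) \<Rightarrow> bool" where
  "mollifier \<rho> \<longleftrightarrow> (\<forall>k. (\<exists>C. bump_fn C (1 / real (Suc k)) (\<rho> k)) \<and> (\<integral>x. \<rho> k x \<partial>lborel) = 1)"

text \<open>The second bound, uniform in \<open>k\<close>, is the majorant needed to integrate the
  convergence over time.\<close>

lemma mollify_L1_space:
  fixes f :: "'a::euclidean_space \<Rightarrow> real"
  assumes mol: "mollifier \<rho>" and f: "integrable lborel f"
  shows "(\<lambda>k. \<integral>y. \<bar>corr (\<rho> k) f y - f y\<bar> \<partial>lborel) \<longlonglongrightarrow> 0"
    and "(\<integral>y. \<bar>corr (\<rho> k) f y - f y\<bar> \<partial>lborel) \<le> 2 * (\<integral>y. \<bar>f y\<bar> \<partial>lborel)"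
proof -
  have close: "(\<integral>y. \<bar>corr (\<rho> k) f y - f y\<bar> \<partial>lborel) \<le> e"
    if "\<And>h. norm h < 1 / real (Suc k) \<Longrightarrow> (\<integral>x. \<bar>f (x + h) - f x\<bar> \<partial>lborel) \<le> e" for e k
  proof -
    obtain C where C: "bump_fn C (1 / real (Suc k)) (\<rho> k)" "(\<integral>x. \<rho> k x \<partial>lborel) = 1"
      using mol unfolding mollifier_def by blast
    show ?thesis
      by (rule mollify_close[OF f bump_integrable[OF C(1)] bump_nonneg[OF C(1)] bump_supp[OF C(1)] C(2) C11_abs[OF bump_C11[OF C(1)]]])
        (use that in auto)
  qed
  show "(\<lambda>k. \<integral>y. \<bar>corr (\<rho> k) f y - f y\<bar> \<partial>lborel) \<longlonglongrightarrow> 0"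
  proof (rule LIMSEQ_I)
    fix e :: real assume e: "e > 0"
    obtain d where d: "d > 0" "\<And>h. norm h < d \<Longrightarrow> (\<integral>x. \<bar>f (x + h) - f x\<bar> \<partial>lborel) < e / 2"
      using translation_continuous_L1[OF f, of "e / 2"] e by auto
    obtain k0 :: nat where k0: "1 / d < real k0" using reals_Archimedean2 by blast
    have "norm ((\<integral>y. \<bar>corr (\<rho> k) f y - f y\<bar> \<partial>lborel) - 0) < e" if k: "k \<ge> k0" for k
    proof -
      have "1 / real (Suc k) \<le> d" using k k0 d by (simp add: field_simps) (smt (verit) mult_left_mono of_nat_mono)
      then have "(\<integral>y. \<bar>corr (\<rho> k) f y - f y\<bar> \<partial>lborel) \<le> e / 2"
        by (intro close less_imp_le[OF d(2)]) simp
      then show ?thesis using e by simp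
    qed
    then show "\<exists>k0. \<forall>k\<ge>k0. norm ((\<integral>y. \<bar>corr (\<rho> k) f y - f y\<bar> \<partial>lborel) - 0) < e" by blast
  qed
  show "(\<integral>y. \<bar>corr (\<rho> k) f y - f y\<bar> \<partial>lborel) \<le> 2 * (\<integral>y. \<bar>f y\<bar> \<partial>lborel)"
  proof (rule close)
    fix h :: 'a
    have [measurable]: "f \<in> borel_measurable borel" using f by auto
    have fh: "integrable lborel (\<lambda>x. f (x + h))" by (rule lborel_shift_integrable(1)[OF f])
    have "(\<integral>x. \<bar>f (x + h) - f x\<bar> \<partial>lborel) \<le> (\<integral>x. \<bar>f (x + h)\<bar> + \<bar>f x\<bar> \<partial>lborel)"
      by (rule integral_mono) (use f fh in auto)
    also have "\<dots> = 2 * (\<integral>y. \<bar>f y\<bar> \<partial>lborel)"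
      using f fh lborel_shift(1)[of "\<lambda>x. \<bar>f x\<bar>" h] by simp
    finally show "(\<integral>x. \<bar>f (x + h) - f x\<bar> \<partial>lborel) \<le> 2 * (\<integral>y. \<bar>f y\<bar> \<partial>lborel)" .
  qed
qed

lemma mollify_L1:
  fixes v :: "real \<times> 'a::euclidean_space \<Rightarrow> real"
  assumes mol: "mollifier \<rho>" and v: "integrable (tmeas T \<Otimes>\<^sub>M lborel) v"
  shows "integrable (tmeas T \<Otimes>\<^sub>M lborel) (\<lambda>w. corr (\<rho> k) (\<lambda>x. v (fst w, x)) (snd w))"
    and "(\<lambda>k. \<integral>w. \<bar>corr (\<rho> k) (\<lambda>x. v (fst w, x)) (snd w) - v w\<bar> \<partial>(tmeas T \<Otimes>\<^sub>M lborel)) \<longlonglongrightarrow> 0"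
proof -
  let ?N = "tmeas T \<Otimes>\<^sub>M (lborel :: 'a measure)"
  interpret pair_sigma_finite "tmeas T" "lborel :: 'a measure" by (rule pair_sigma_finite_tmeas)
  have i: "integrable ?N (\<lambda>w. corr (\<rho> k) (\<lambda>x. v (fst w, x)) (snd w))" for k
    using mol bump_integrable unfolding mollifier_def by (intro corr_integrable_pair[OF sigma_finite_tmeas _ v]) blast
  then show "integrable ?N (\<lambda>w. corr (\<rho> k) (\<lambda>x. v (fst w, x)) (snd w))" .
  define a where "a k t = (\<integral>y. \<bar>corr (\<rho> k) (\<lambda>x. v (t, x)) y - v (t, y)\<bar> \<partial>lborel)" for k t
  have di: "integrable ?N (\<lambda>w. \<bar>corr (\<rho> k) (\<lambda>x. v (fst w, x)) (snd w) - v w\<bar>)" for k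
    using i[of k] v by auto
  have "(\<lambda>k. \<integral>t. a k t \<partial>tmeas T) \<longlonglongrightarrow> (\<integral>t. 0 \<partial>tmeas T)"
  proof (rule integral_dominated_convergence)
    have "integrable ?N (\<lambda>w. \<bar>v w\<bar>)" using v by simp
    from integrable_fst'[OF this] show "integrable (tmeas T) (\<lambda>t. 2 * (\<integral>y. \<bar>v (t, y)\<bar> \<partial>lborel))" by simp
    show "a k \<in> borel_measurable (tmeas T)" for k
      using integrable_fst'[OF di[of k]] by (auto simp: a_def[abs_def])
    show "AE t in tmeas T. (\<lambda>k. a k t) \<longlonglongrightarrow> 0"
      using AE_integrable_fst'[OF v] by eventually_elim (simp add: a_def mollify_L1_space[OF mol])
    show "AE t in tmeas T. norm (a k t) \<le> 2 * (\<integral>y. \<bar>v (t, y)\<bar> \<partial>lborel)" for k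
      using AE_integrable_fst'[OF v]
    proof eventually_elim
      case (elim t)
      have "0 \<le> a k t" unfolding a_def by (intro Bochner_Integration.integral_nonneg) simp
      then show ?case using mollify_L1_space(2)[OF mol elim, of k] by (simp add: a_def)
    qed
  qed simp
  moreover have "(\<integral>w. \<bar>corr (\<rho> k) (\<lambda>x. v (fst w, x)) (snd w) - v w\<bar> \<partial>?N) = (\<integral>t. a k t \<partial>tmeas T)" for k
    using integral_fst'[OF di[of k]] by (simp add: a_def)
  ultimately show "(\<lambda>k. \<integral>w. \<bar>corr (\<rho> k) (\<lambda>x. v (fst w, x)) (snd w) - v w\<bar> \<partial>?N) \<longlonglongrightarrow> 0" by simp
qed

lemma mollify_continuous:
  fixes B :: "'a::euclidean_space \<Rightarrow> real"
  assumes mol: "mollifier \<rho>" and B: "C11 K B"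
  shows "(\<lambda>k. corr (\<rho> k) B y) \<longlonglongrightarrow> B y"
proof (rule LIMSEQ_I)
  fix e :: real assume e: "e > 0"
  have Bm [measurable]: "B \<in> borel_measurable borel" by (rule C11_measurable[OF B])
  have "isCont B y" using C11_continuous[OF B] by (simp add: continuous_on_eq_continuous_at)
  then obtain d where d: "d > 0" "\<And>x. dist x y < d \<Longrightarrow> dist (B x) (B y) < e / 2"
    using e unfolding continuous_at_eps_delta by (metis half_gt_zero)
  obtain k0 :: nat where k0: "1 / d < real k0" using reals_Archimedean2 by blast
  have "norm (corr (\<rho> k) B y - B y) < e" if k: "k \<ge> k0" for k
  proof -
    obtain C where C: "bump_fn C (1 / real (Suc k)) (\<rho> k)" "(\<integral>x. \<rho> k x \<partial>lborel) = 1"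
      using mol unfolding mollifier_def by blast
    have \<rho>i: "integrable lborel (\<lambda>x. \<rho> k (x - y))"
      by (rule lborel_shift_integrable(2)[OF bump_integrable[OF C(1)]])
    have [measurable]: "\<rho> k \<in> borel_measurable borel" by (rule C11_measurable[OF bump_C11[OF C(1)]])
    have \<rho>1: "(\<integral>x. \<rho> k (x - y) \<partial>lborel) = 1" using lborel_shift(2)[of "\<rho> k" y] C(2) by simp
    have kd: "1 / real (Suc k) \<le> d" using k k0 d by (simp add: field_simps) (smt (verit) mult_left_mono of_nat_mono)
    have Bi: "integrable lborel (\<lambda>x. \<rho> k (x - y) * B x)"
      by (rule corr_integrand_integrable'[OF bump_integrable[OF C(1)] Bm C11_abs[OF B]])
    have "corr (\<rho> k) B y - B y = (\<integral>x. \<rho> k (x - y) * B x - \<rho> k (x - y) * B y \<partial>lborel)"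
      using Bi \<rho>i \<rho>1 by (simp add: corr_def)
    also have "\<bar>\<dots>\<bar> \<le> (\<integral>x. \<bar>\<rho> k (x - y) * B x - \<rho> k (x - y) * B y\<bar> \<partial>lborel)" by (rule integral_abs_bound)
    also have "\<dots> \<le> (\<integral>x. \<rho> k (x - y) * (e / 2) \<partial>lborel)"
    proof (rule integral_mono)
      show "integrable lborel (\<lambda>x. \<bar>\<rho> k (x - y) * B x - \<rho> k (x - y) * B y\<bar>)" using Bi \<rho>i by simp
      show "integrable lborel (\<lambda>x. \<rho> k (x - y) * (e / 2))" using \<rho>i by simp
      fix x
      show "\<bar>\<rho> k (x - y) * B x - \<rho> k (x - y) * B y\<bar> \<le> \<rho> k (x - y) * (e / 2)"
      proof (cases "\<rho> k (x - y) = 0")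
        case False
        then have "norm (x - y) < 1 / real (Suc k)" by (rule bump_supp[OF C(1)])
        then have "dist x y < d" using kd by (simp add: dist_norm)
        then have "\<bar>B x - B y\<bar> \<le> e / 2" using d(2)[of x] by (simp add: dist_real_def)
        then have "\<rho> k (x - y) * \<bar>B x - B y\<bar> \<le> \<rho> k (x - y) * (e / 2)"
          by (intro mult_left_mono bump_nonneg[OF C(1)])
        then show ?thesis using bump_nonneg[OF C(1), of "x - y"]
          by (simp only: right_diff_distrib[symmetric] abs_mult abs_of_nonneg)
      qed simp
    qed
    also have "\<dots> = e / 2" using \<rho>1 by simp
    finally show ?thesis using e by simp
  qed
  then show "\<exists>k0. \<forall>k\<ge>k0. norm (corr (\<rho> k) B y - B y) < e" by blast
qed

section \<open>The comparison principle\<close>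

text \<open>The mollifier is removed from the integrated Kato inequality. On the right the
  zero-order terms converge in \<open>L^1\<close> and the limit has a sign by \<open>sgn\<close>; on
  the left Fatou's lemma suffices, and it yields that the integral of \<open>jj (v w + B w)\<close>
  is zero.\<close>

theorem comparison:
  fixes v F B LB H :: "real \<times> 'a::euclidean_space \<Rightarrow> real"
  assumes s: "0 < s" "s < 1" and T: "T > 0" and sol: "lin_sol s T v F \<mu>"
    and bar: "barrier s T K B LB H" and mol: "mollifier (\<rho> :: nat \<Rightarrow> 'a \<Rightarrow> real)"
    and init: "AE x in lborel. \<mu> x + B (0, x) \<le> 0"
    and wplus: "integrable (tmeas T \<Otimes>\<^sub>M lborel) (\<lambda>w. max 0 (v w + B w))"
    and sgn: "AE w in tmeas T \<Otimes>\<^sub>M lborel. v w + B w > 0 \<longrightarrow> 0 \<le> F w + H w"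
  shows "AE w in tmeas T \<Otimes>\<^sub>M lborel. v w + B w \<le> 0"
proof -
  let ?N = "tmeas T \<Otimes>\<^sub>M (lborel :: 'a measure)"
  interpret M: finite_measure "tmeas T" by (rule finite_measure_tmeas)
  have vm [measurable]: "v \<in> borel_measurable (borel \<Otimes>\<^sub>M borel)" and Fm [measurable]: "F \<in> borel_measurable (borel \<Otimes>\<^sub>M borel)"
    and vi: "integrable ?N v" and Fi: "integrable ?N F"
    using sol unfolding lin_sol_def by blast+
  have Bm [measurable]: "B \<in> borel_measurable (borel \<Otimes>\<^sub>M borel)"
    and Hm [measurable]: "H \<in> borel_measurable (borel \<Otimes>\<^sub>M borel)"
    and BC: "\<And>t. 0 \<le> t \<Longrightarrow> t \<le> T \<Longrightarrow> C11 K (\<lambda>x. B (t, x))"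
    and Hi: "integrable ?N H"
    using bar unfolding barrier_def by blast+
  obtain Cf where bump: "\<And>k. bump_fn (Cf k) (1 / real (Suc k)) (\<rho> k)"
    using mol unfolding mollifier_def by metis
  have \<rho>m [measurable]: "\<rho> k \<in> borel_measurable borel" for k by (rule C11_measurable[OF bump_C11[OF bump]])
  note [measurable] = corr_measurable_pair
  define m where "m k w = corr (\<rho> k) (\<lambda>x. v (fst w, x)) (snd w) + corr (\<rho> k) (\<lambda>x. B (fst w, x)) (snd w)" for k w
  define g where "g k w = corr (\<rho> k) (\<lambda>x. F (fst w, x)) (snd w) + corr (\<rho> k) (\<lambda>x. H (fst w, x)) (snd w)" for k w
  define f where "f w = F w + H w" for w
  have mm [measurable]: "m k \<in> borel_measurable (borel \<Otimes>\<^sub>M borel)" for k unfolding m_def by measurable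
  have gm [measurable]: "g k \<in> borel_measurable (borel \<Otimes>\<^sub>M borel)" for k unfolding g_def by measurable
  have fm [measurable]: "f \<in> borel_measurable (borel \<Otimes>\<^sub>M borel)" unfolding f_def by measurable
  have fi: "integrable ?N f" unfolding f_def using Fi Hi by simp
  have gi: "integrable ?N (g k)" for k
    unfolding g_def by (intro Bochner_Integration.integrable_add mollify_L1(1)[OF mol] Fi Hi)
  have K: "integrable ?N (\<lambda>w. jj (m k w))"
    "(\<integral>w. jj (m k w) \<partial>?N) \<le> - (\<integral>w. (T - fst w) * (jd (m k w) * g k w) \<partial>?N)" for k
    unfolding m_def g_def by (rule kato_integrated[OF s T sol bar bump[of k] init wplus])+
  have g_L1: "(\<lambda>k. \<integral>w. \<bar>g k w - f w\<bar> \<partial>?N) \<longlonglongrightarrow> 0"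
  proof -
    define a where "a k = (\<integral>w. \<bar>corr (\<rho> k) (\<lambda>x. F (fst w, x)) (snd w) - F w\<bar> \<partial>?N)" for k
    define b where "b k = (\<integral>w. \<bar>corr (\<rho> k) (\<lambda>x. H (fst w, x)) (snd w) - H w\<bar> \<partial>?N)" for k
    have a0: "a \<longlonglongrightarrow> 0" unfolding a_def[abs_def] by (rule mollify_L1(2)[OF mol Fi])
    have b0: "b \<longlonglongrightarrow> 0" unfolding b_def[abs_def] by (rule mollify_L1(2)[OF mol Hi])
    have lim: "(\<lambda>k. a k + b k) \<longlonglongrightarrow> 0" using tendsto_add[OF a0 b0] by simp
    have le: "norm (\<integral>w. \<bar>g k w - f w\<bar> \<partial>?N) \<le> a k + b k" for k
    proof -
      have i: "integrable ?N (\<lambda>w. \<bar>corr (\<rho> k) (\<lambda>x. F (fst w, x)) (snd w) - F w\<bar>)"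
        "integrable ?N (\<lambda>w. \<bar>corr (\<rho> k) (\<lambda>x. H (fst w, x)) (snd w) - H w\<bar>)"
        by (rule integrable_abs[OF Bochner_Integration.integrable_diff[OF mollify_L1(1)[OF mol Fi] Fi]],
            rule integrable_abs[OF Bochner_Integration.integrable_diff[OF mollify_L1(1)[OF mol Hi] Hi]])
      have "(\<integral>w. \<bar>g k w - f w\<bar> \<partial>?N) \<le> (\<integral>w. \<bar>corr (\<rho> k) (\<lambda>x. F (fst w, x)) (snd w) - F w\<bar> + \<bar>corr (\<rho> k) (\<lambda>x. H (fst w, x)) (snd w) - H w\<bar> \<partial>?N)"
      proof (rule integral_mono)
        show "integrable ?N (\<lambda>w. \<bar>g k w - f w\<bar>)" using gi[of k] fi by simp
        show "integrable ?N (\<lambda>w. \<bar>corr (\<rho> k) (\<lambda>x. F (fst w, x)) (snd w) - F w\<bar> + \<bar>corr (\<rho> k) (\<lambda>x. H (fst w, x)) (snd w) - H w\<bar>)"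
          using i by simp
      qed (simp add: g_def f_def)
      also have "\<dots> = a k + b k" using i by (simp add: a_def b_def)
      finally show ?thesis by (simp add: Bochner_Integration.integral_nonneg)
    qed
    show ?thesis by (rule Lim_null_comparison[OF always_eventually[OF allI[OF le]] lim])
  qed
  \<comment> \<open>Convergence in \<open>L^1\<close> gives pointwise convergence along a
    subsequence; the nonlinear factor \<open>jd\<close> and Fatou's lemma need pointwise
    limits.\<close>
  have "\<exists>r::nat \<Rightarrow> nat. strict_mono r \<and> (AE w in ?N. (\<lambda>k. corr (\<rho> (r k)) (\<lambda>x. v (fst w, x)) (snd w) - v w) \<longlonglongrightarrow> 0)"
  proof (rule tendsto_L1_AE_subseq)
    show "integrable ?N (\<lambda>w. corr (\<rho> k) (\<lambda>x. v (fst w, x)) (snd w) - v w)" for k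
      using mollify_L1(1)[OF mol vi, of k] vi by simp
    show "(\<lambda>k. \<integral>w. norm (corr (\<rho> k) (\<lambda>x. v (fst w, x)) (snd w) - v w) \<partial>?N) \<longlonglongrightarrow> 0"
      using mollify_L1(2)[OF mol vi] by simp
  qed
  then obtain r :: "nat \<Rightarrow> nat" where r: "strict_mono r"
    "AE w in ?N. (\<lambda>k. corr (\<rho> (r k)) (\<lambda>x. v (fst w, x)) (snd w) - v w) \<longlonglongrightarrow> 0" by blast
  have bnd: "AE w in ?N. 0 < fst w \<and> fst w < T" by (rule AE_pair_fst[OF AE_tmeas_bounds sigma_finite_lborel])
  have conv: "AE w in ?N. (\<lambda>k. m (r k) w) \<longlonglongrightarrow> v w + B w"
    using r(2) bnd
  proof eventually_elim
    case (elim w)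
    have "(\<lambda>k. corr (\<rho> k) (\<lambda>x. B (fst w, x)) (snd w)) \<longlonglongrightarrow> B (fst w, snd w)"
      using elim by (intro mollify_continuous[OF mol BC]) auto
    then have "(\<lambda>k. corr (\<rho> (r k)) (\<lambda>x. B (fst w, x)) (snd w)) \<longlonglongrightarrow> B w"
      using LIMSEQ_subseq_LIMSEQ[OF _ r(1)] by (simp add: o_def)
    moreover have "(\<lambda>k. corr (\<rho> (r k)) (\<lambda>x. v (fst w, x)) (snd w)) \<longlonglongrightarrow> v w"
      using elim by (simp add: LIM_zero_iff)
    ultimately show ?case unfolding m_def by (intro tendsto_add)
  qed
  define c where "c k = (\<integral>w. (T - fst w) * (jd (m (r k) w) * g (r k) w) \<partial>?N)" for k
  define c' where "c' = (\<integral>w. (T - fst w) * (jd (v w + B w) * f w) \<partial>?N)"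
  have mulb: "\<bar>(T - t) * (jd z * q)\<bar> \<le> T * \<bar>q\<bar>" if "0 < t \<and> t < T" for t z q
  proof -
    have "(T - t) * (jd z * \<bar>q\<bar>) \<le> T * (1 * \<bar>q\<bar>)" using that by (intro mult_mono mult_right_mono) auto
    then show ?thesis using that by (simp add: abs_mult)
  qed
  have muli: "integrable ?N (\<lambda>w. (T - fst w) * (jd (z w) * q w))" if "integrable ?N q" and [measurable]: "z \<in> borel_measurable (borel \<Otimes>\<^sub>M borel)" for q z
  proof (rule Bochner_Integration.integrable_bound)
    show "integrable ?N (\<lambda>w. T * q w)" using that by simp
    have [measurable]: "q \<in> borel_measurable ?N" using that by auto
    show "(\<lambda>w. (T - fst w) * (jd (z w) * q w)) \<in> borel_measurable ?N" by measurable
    show "AE w in ?N. norm ((T - fst w) * (jd (z w) * q w)) \<le> norm (T * q w)"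
      using bnd
    proof eventually_elim
      case (elim w)
      then have "\<bar>(T - fst w) * (jd (z w) * q w)\<bar> \<le> T * \<bar>q w\<bar>" by (rule mulb)
      then show ?case using T by (simp only: real_norm_def abs_mult[of T] abs_of_pos)
    qed
  qed
  have c_lim: "c \<longlonglongrightarrow> c'"
  proof -
    \<comment> \<open>The mollified source is split as \<open>(g - f) + f\<close>: the first part
      vanishes in \<open>L^1\<close> because the weight is bounded by \<open>T\<close>, the second
      converges by dominated convergence.\<close>
    have "(\<lambda>k. \<integral>w. (T - fst w) * (jd (m (r k) w) * (g (r k) w - f w)) \<partial>?N) \<longlonglongrightarrow> 0"
    proof (rule Lim_null_comparison)
      have "(\<lambda>k. \<integral>w. \<bar>g (r k) w - f w\<bar> \<partial>?N) \<longlonglongrightarrow> 0"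
        using LIMSEQ_subseq_LIMSEQ[OF g_L1 r(1)] by (simp add: o_def)
      then show "(\<lambda>k. T * (\<integral>w. \<bar>g (r k) w - f w\<bar> \<partial>?N)) \<longlonglongrightarrow> 0"
        by (rule tendsto_mult_right_zero)
      have "\<bar>\<integral>w. (T - fst w) * (jd (m k w) * (g k w - f w)) \<partial>?N\<bar> \<le> T * (\<integral>w. \<bar>g k w - f w\<bar> \<partial>?N)" for k
      proof -
        have i: "integrable ?N (\<lambda>w. g k w - f w)" using gi fi by simp
        have "\<bar>\<integral>w. (T - fst w) * (jd (m k w) * (g k w - f w)) \<partial>?N\<bar> \<le> (\<integral>w. \<bar>(T - fst w) * (jd (m k w) * (g k w - f w))\<bar> \<partial>?N)"
          by (rule integral_abs_bound)
        also have "\<dots> \<le> (\<integral>w. T * \<bar>g k w - f w\<bar> \<partial>?N)"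
        proof (rule integral_mono_AE)
          show "integrable ?N (\<lambda>w. \<bar>(T - fst w) * (jd (m k w) * (g k w - f w))\<bar>)"
            using muli[OF i, of "m k"] by (intro integrable_abs) simp
          show "integrable ?N (\<lambda>w. T * \<bar>g k w - f w\<bar>)" using i by simp
          show "AE w in ?N. \<bar>(T - fst w) * (jd (m k w) * (g k w - f w))\<bar> \<le> T * \<bar>g k w - f w\<bar>"
            using bnd by eventually_elim (rule mulb)
        qed
        finally show ?thesis by simp
      qed
      then show "\<forall>\<^sub>F k in sequentially. norm (\<integral>w. (T - fst w) * (jd (m (r k) w) * (g (r k) w - f w)) \<partial>?N) \<le> T * (\<integral>w. \<bar>g (r k) w - f w\<bar> \<partial>?N)"
        by (simp add: always_eventually)
    qed
    moreover have "(\<lambda>k. \<integral>w. (T - fst w) * (jd (m (r k) w) * f w) \<partial>?N) \<longlonglongrightarrow> c'"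
      unfolding c'_def
    proof (rule integral_dominated_convergence)
      show "integrable ?N (\<lambda>w. T * \<bar>f w\<bar>)" using fi by simp
      show "AE w in ?N. (\<lambda>k. (T - fst w) * (jd (m (r k) w) * f w)) \<longlonglongrightarrow> (T - fst w) * (jd (v w + B w) * f w)"
        using conv
      proof eventually_elim
        case (elim w)
        have "(\<lambda>k. jd (m (r k) w)) \<longlonglongrightarrow> jd (v w + B w)"
          by (rule continuous_on_tendsto_compose[OF continuous_on_jd elim]) auto
        then show ?case by (intro tendsto_mult tendsto_const)
      qed
      show "AE w in ?N. norm ((T - fst w) * (jd (m (r k) w) * f w)) \<le> T * \<bar>f w\<bar>" for k
        using bnd by eventually_elim (simp only: real_norm_def mulb)
    qed measurable
    ultimately have "(\<lambda>k. (\<integral>w. (T - fst w) * (jd (m (r k) w) * (g (r k) w - f w)) \<partial>?N) + (\<integral>w. (T - fst w) * (jd (m (r k) w) * f w) \<partial>?N)) \<longlonglongrightarrow> 0 + c'"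
      by (rule tendsto_add)
    moreover have "(\<integral>w. (T - fst w) * (jd (m (r k) w) * (g (r k) w - f w)) \<partial>?N) + (\<integral>w. (T - fst w) * (jd (m (r k) w) * f w) \<partial>?N) = c k" for k
    proof -
      have i: "integrable ?N (\<lambda>w. g (r k) w - f w)" using gi fi by simp
      have "(\<integral>w. (T - fst w) * (jd (m (r k) w) * (g (r k) w - f w)) \<partial>?N) + (\<integral>w. (T - fst w) * (jd (m (r k) w) * f w) \<partial>?N)
        = (\<integral>w. (T - fst w) * (jd (m (r k) w) * (g (r k) w - f w)) + (T - fst w) * (jd (m (r k) w) * f w) \<partial>?N)"
        by (rule Bochner_Integration.integral_add[symmetric]) (intro muli i fi mm)+
      also have "\<dots> = c k" unfolding c_def
        by (intro Bochner_Integration.integral_cong refl) (simp add: algebra_simps)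
      finally show ?thesis .
    qed
    ultimately show ?thesis by (simp add: c_def[abs_def])
  qed
  \<comment> \<open>Where \<open>v w + B w\<close> is not positive the factor \<open>jd\<close>
    vanishes, so the sign of the source matters only on the set covered by
    \<open>sgn\<close>.\<close>
  have c'0: "0 \<le> c'" unfolding c'_def
  proof (rule integral_nonneg_AE)
    show "AE w in ?N. 0 \<le> (T - fst w) * (jd (v w + B w) * f w)"
      using sgn bnd
    proof eventually_elim
      case (elim w)
      show ?case
      proof (cases "v w + B w > 0")
        case True then show ?thesis using elim by (intro mult_nonneg_nonneg) (auto simp: f_def)
      next
        case False then show ?thesis by simp
      qed
    qed
  qed
  have "(\<integral>\<^sup>+w. ennreal (jj (v w + B w)) \<partial>?N) = (\<integral>\<^sup>+w. liminf (\<lambda>k. ennreal (jj (m (r k) w))) \<partial>?N)"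
  proof (rule nn_integral_cong_AE)
    show "AE w in ?N. ennreal (jj (v w + B w)) = liminf (\<lambda>k. ennreal (jj (m (r k) w)))"
      using conv
    proof eventually_elim
      case (elim w)
      have "(\<lambda>k. ennreal (jj (m (r k) w))) \<longlonglongrightarrow> ennreal (jj (v w + B w))"
        by (rule tendsto_ennrealI[OF continuous_on_tendsto_compose[OF continuous_on_jj elim]]) auto
      then show ?case by (intro lim_imp_Liminf[symmetric]) auto
    qed
  qed
  also have "\<dots> \<le> liminf (\<lambda>k. \<integral>\<^sup>+w. ennreal (jj (m (r k) w)) \<partial>?N)"
    by (rule nn_integral_liminf) measurable
  also have "\<dots> \<le> liminf (\<lambda>k. ennreal (- c k))"
  proof (rule Liminf_mono[OF always_eventually], rule allI)
    fix k
    have "(\<integral>\<^sup>+w. ennreal (jj (m (r k) w)) \<partial>?N) = ennreal (\<integral>w. jj (m (r k) w) \<partial>?N)"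
      by (rule nn_integral_eq_integral[OF K(1)]) simp
    then show "(\<integral>\<^sup>+w. ennreal (jj (m (r k) w)) \<partial>?N) \<le> ennreal (- c k)"
      using K(2)[of "r k"] by (simp add: c_def ennreal_leI)
  qed
  also have "\<dots> = ennreal (- c')"
    by (intro lim_imp_Liminf tendsto_ennrealI tendsto_minus c_lim) simp
  also have "\<dots> = 0" using c'0 by (simp add: ennreal_neg)
  finally have "(\<integral>\<^sup>+w. ennreal (jj (v w + B w)) \<partial>?N) = 0" by simp
  then have "AE w in ?N. ennreal (jj (v w + B w)) = 0"
    by (subst (asm) nn_integral_0_iff_AE) measurable
  then show ?thesis
    by eventually_elim (rule jj_eq_0, simp add: ennreal_eq_0_iff)
qed

section \<open>Bump functions\<close>

text \<open>Taylor expansion of the squared positive part, whose second derivative lies between 0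
  and 2 where it exists. That the remainder is nonnegative is as important later as its
  size.\<close>

lemma pos_square_expansion:
  fixes r d :: real
  shows "0 \<le> (max 0 (r + d))\<^sup>2 - (max 0 r)\<^sup>2 - 2 * max 0 r * d"
    and "(max 0 (r + d))\<^sup>2 - (max 0 r)\<^sup>2 - 2 * max 0 r * d \<le> d\<^sup>2"
proof -
  have "0 \<le> (max 0 (r + d))\<^sup>2 - (max 0 r)\<^sup>2 - 2 * max 0 r * d \<and> (max 0 (r + d))\<^sup>2 - (max 0 r)\<^sup>2 - 2 * max 0 r * d \<le> d\<^sup>2"
  proof (cases "0 \<le> r")
    case r: True
    show ?thesis
    proof (cases "0 \<le> r + d")
      case True then show ?thesis using r by (simp add: power2_eq_square algebra_simps)
    next
      case False
      have "0 \<le> r * (- (r + d))" using r False by (intro mult_nonneg_nonneg) auto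
      then have a: "r * r + r * d \<le> 0" by (simp add: algebra_simps)
      have "0 \<le> (r + d) * (r + d)" by (rule zero_le_square)
      then have b: "0 \<le> r * r + 2 * (r * d) + d * d" by (simp add: algebra_simps)
      have c: "0 \<le> r * r" by (rule zero_le_square)
      have m: "max 0 (r + d) = 0" "max 0 r = r" using r False by auto
      show ?thesis unfolding m power2_eq_square using a b c by (simp only: mult.assoc mult_zero_left; linarith)
    qed
  next
    case r: False
    show ?thesis
    proof (cases "0 \<le> r + d")
      case True
      then have "(r + d)\<^sup>2 \<le> d\<^sup>2" using r by (intro power_mono) auto
      then show ?thesis using r True by simp
    next
      case False then show ?thesis using r by simp
    qed
  qed
  then show "0 \<le> (max 0 (r + d))\<^sup>2 - (max 0 r)\<^sup>2 - 2 * max 0 r * d"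
    and "(max 0 (r + d))\<^sup>2 - (max 0 r)\<^sup>2 - 2 * max 0 r * d \<le> d\<^sup>2" by auto
qed

text \<open>A polynomial profile rather than an exponential one: squaring the positive part gives
  exactly the \<open>C^{1,1}\<close> regularity that is needed, with elementary constants.\<close>

definition bump0 :: "'a::euclidean_space \<Rightarrow> real" where
  "bump0 x = (max 0 (1 - (norm x)\<^sup>2))\<^sup>2"

lemma bump0_bounds: "0 \<le> bump0 x" "bump0 x \<le> 1"
  by (auto simp: bump0_def intro!: power_le_one)

lemma bump0_zero: "1 \<le> norm x \<Longrightarrow> bump0 x = 0"
  by (simp add: bump0_def one_le_power)

lemma bump0_continuous: "continuous_on UNIV bump0"
  unfolding bump0_def[abs_def] by (intro continuous_intros)

text \<open>If \<open>norm x \<ge> 2\<close> all terms vanish. Otherwise the increment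
  \<open>d\<close> of \<open>1 - (norm x)^2\<close> is at most \<open>5 * norm z\<close>, and the
  expansion of the squared positive part gives \<open>35 = 2 * 5 + 25\<close> and
  \<open>54 = 4 + 2 * 25\<close>.\<close>

lemma bump0_diff:
  fixes x z :: "'a::euclidean_space"
  assumes z: "norm z \<le> 1"
  shows "\<bar>bump0 (x + z) - bump0 x\<bar> \<le> 35 * norm z" and "\<bar>second_diff bump0 x z\<bar> \<le> 54 * (norm z)\<^sup>2"
proof -
  have *: "\<bar>bump0 (x + z) - bump0 x\<bar> \<le> 35 * norm z \<and> \<bar>second_diff bump0 x z\<bar> \<le> 54 * (norm z)\<^sup>2"
  proof (cases "norm x \<ge> 2")
    case True
    have "1 \<le> norm (x + z)" using norm_triangle_ineq2[of x "- z"] True z by simp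
    moreover have "1 \<le> norm (x - z)" using norm_triangle_ineq2[of x z] True z by simp
    ultimately show ?thesis using True by (simp add: second_diff_def bump0_zero)
  next
    case False
    define r where "r = 1 - (norm x)\<^sup>2"
    define d where "d = (\<lambda>z::'a. - 2 * (x \<bullet> z) - (norm z)\<^sup>2)"
    have sh: "1 - (norm (x + z))\<^sup>2 = r + d z" for z
      by (simp add: r_def d_def power2_norm_eq_inner inner_add_left inner_add_right inner_commute)
    \<comment> \<open>\<open>2 * norm x * norm z + (norm z)^2\<close>, with
      \<open>norm x < 2\<close> and \<open>norm z \<le> 1\<close>.\<close>
    have db: "\<bar>d y\<bar> \<le> 5 * norm z" if "norm y = norm z" for y
    proof -
      have "\<bar>x \<bullet> y\<bar> \<le> norm x * norm y" by (rule Cauchy_Schwarz_ineq2)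
      also have "\<dots> \<le> 2 * norm z" using False that by (intro mult_mono) auto
      finally have "\<bar>x \<bullet> y\<bar> \<le> 2 * norm z" .
      moreover have "(norm y)\<^sup>2 \<le> 1 * norm z" unfolding power2_eq_square that using z by (intro mult_right_mono) auto
      moreover have "0 \<le> (norm y)\<^sup>2" by simp
      ultimately show ?thesis unfolding d_def by linarith
    qed
    have r1: "0 \<le> max 0 r" "max 0 r \<le> 1" by (auto simp: r_def)
    define E where "E = (\<lambda>y. bump0 (x + y) - bump0 x - 2 * max 0 r * d y)"
    have E: "0 \<le> E y" "E y \<le> (d y)\<^sup>2" for y
      using pos_square_expansion[of r "d y"] by (simp_all add: E_def bump0_def sh r_def)
    have d2: "(d y)\<^sup>2 \<le> 25 * (norm z)\<^sup>2" if "norm y = norm z" for y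
    proof -
      have "(d y)\<^sup>2 \<le> (5 * norm z)\<^sup>2" using db[OF that] by (rule abs_le_square_iff[THEN iffD1, OF order_trans]) simp
      then show ?thesis by (simp add: power_mult_distrib)
    qed
    have z2: "(norm z)\<^sup>2 \<le> norm z" unfolding power2_eq_square using z by (simp add: mult_left_le_one_le)
    have rd: "\<bar>max 0 r * d z\<bar> \<le> 1 * (5 * norm z)"
      unfolding abs_mult using r1 by (intro mult_mono db) auto
    have A: "\<bar>bump0 (x + z) - bump0 x\<bar> \<le> 35 * norm z"
    proof -
      have "bump0 (x + z) - bump0 x = 2 * (max 0 r * d z) + E z" by (simp add: E_def)
      then show ?thesis using E[of z] d2[of z] z2 rd by linarith
    qed
    have "d z + d (- z) = - 2 * (norm z)\<^sup>2" by (simp add: d_def)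
    then have dd: "2 * max 0 r * d z + 2 * max 0 r * d (- z) = - 4 * (max 0 r * (norm z)\<^sup>2)"
      unfolding distrib_left[symmetric] by (simp add: algebra_simps)
    have "second_diff bump0 x z = - (2 * max 0 r * d z + 2 * max 0 r * d (- z)) - E z - E (- z)"
      by (simp add: second_diff_def E_def)
    then have "second_diff bump0 x z = 4 * (max 0 r * (norm z)\<^sup>2) - E z - E (- z)" using dd by simp
    moreover have "max 0 r * (norm z)\<^sup>2 \<le> 1 * (norm z)\<^sup>2" using r1 by (intro mult_right_mono) auto
    moreover have "0 \<le> max 0 r * (norm z)\<^sup>2" using r1 by simp
    ultimately have "\<bar>second_diff bump0 x z\<bar> \<le> 54 * (norm z)\<^sup>2"
      using E[of z] E[of "- z"] d2[OF refl] d2[OF norm_minus_cancel] by linarith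
    with A show ?thesis by simp
  qed
  then show "\<bar>bump0 (x + z) - bump0 x\<bar> \<le> 35 * norm z" "\<bar>second_diff bump0 x z\<bar> \<le> 54 * (norm z)\<^sup>2" by auto
qed

lemma bump0_C11: "C11 54 (bump0 :: 'a::euclidean_space \<Rightarrow> real)"
proof (rule C11I[OF bump0_continuous])
  show "\<bar>bump0 x\<bar> \<le> 54" for x :: 'a using bump0_bounds[of x] by simp
  show "\<bar>second_diff bump0 x z\<bar> \<le> 54 * min 1 ((norm z)\<^sup>2)" for x z :: 'a
  proof (cases "norm z \<le> 1")
    case True
    then have "min 1 ((norm z)\<^sup>2) = (norm z)\<^sup>2" by (simp add: power_le_one min_absorb2)
    then show ?thesis using bump0_diff(2)[OF True] by simp
  next
    case False
    then have "min 1 ((norm z)\<^sup>2) = 1" by (simp add: one_le_power min_absorb1)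
    moreover have "\<bar>second_diff bump0 x z\<bar> \<le> 2"
      using bump0_bounds[of x] bump0_bounds[of "x + z"] bump0_bounds[of "x - z"] by (simp add: second_diff_def abs_le_iff)
    ultimately show ?thesis by simp
  qed
qed

lemma bump0_lipschitz: "\<bar>bump0 (x + z) - bump0 x\<bar> \<le> 35 * min 1 (norm z)"
proof (cases "norm z \<le> 1")
  case True then show ?thesis using bump0_diff(1)[OF True] by simp
next
  case False
  then show ?thesis using bump0_bounds[of x] bump0_bounds[of "x + z"] by (simp add: abs_le_iff)
qed

lemma bump0_scaled_bump_fn:
  assumes c: "c > 0" and a: "a \<ge> 0"
  shows "\<exists>C. bump_fn C c (\<lambda>x::'a::euclidean_space. a * bump0 (x /\<^sub>R c))"
proof -
  have "C11 (\<bar>a\<bar> * (54 * max 1 (1 / c\<^sup>2))) (\<lambda>x::'a. a * bump0 (x /\<^sub>R c))"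
    by (intro C11_cmult C11_scale c bump0_C11)
  moreover have "norm x < c" if "a * bump0 (x /\<^sub>R c) \<noteq> 0" for x :: 'a
  proof (rule ccontr)
    assume "\<not> norm x < c"
    then have "1 \<le> norm (x /\<^sub>R c)" using c by (simp add: field_simps)
    then have "bump0 (x /\<^sub>R c) = 0" by (rule bump0_zero)
    then show False using that by simp
  qed
  ultimately show ?thesis using a bump0_bounds unfolding bump_fn_def by (metis mult_nonneg_nonneg)
qed

lemma mollifier_exists: "\<exists>\<rho> :: nat \<Rightarrow> 'a::euclidean_space \<Rightarrow> real. mollifier \<rho>"
proof -
  define I where "I k = (\<integral>x. bump0 (x /\<^sub>R (1 / real (Suc k))) \<partial>(lborel :: 'a measure))" for k
  define \<rho> where "\<rho> k x = 1 / I k * bump0 (x /\<^sub>R (1 / real (Suc k)) :: 'a)" for k x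
  have I: "I k > 0" for k
  proof -
    let ?c = "1 / real (Suc k)"
    define f where "f x = bump0 (x /\<^sub>R ?c :: 'a)" for x
    obtain C where "bump_fn C ?c (\<lambda>x::'a. 1 * bump0 (x /\<^sub>R ?c))" using bump0_scaled_bump_fn[of ?c 1] by auto
    then have fi: "integrable lborel f" using bump_integrable by (simp add: f_def[abs_def])
    have nn: "AE x in lborel. 0 \<le> f x" by (simp add: f_def bump0_bounds)
    have "(\<integral>x. f x \<partial>lborel) \<noteq> 0"
    proof
      assume "(\<integral>x. f x \<partial>lborel) = 0"
      then have "AE x in lborel. f x = 0"
        using integral_nonneg_eq_0_iff_AE[OF fi nn] by simp
      then have "AE x in lborel. x \<notin> ball (0::'a) ?c"
      proof eventually_elim
        case (elim x)
        have "bump0 y \<noteq> 0" if "norm y < 1" for y :: 'a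
          using that power_less_one_iff[of "norm y" 2] by (simp add: bump0_def)
        then have "\<not> norm (x /\<^sub>R ?c) < 1" using elim unfolding f_def by blast
        moreover have "norm (x /\<^sub>R ?c) = norm x * real (Suc k)" by (simp only: norm_scaleR) (simp add: mult.commute)
        ultimately have "1 \<le> norm x * real (Suc k)" by linarith
        then show ?case by (simp add: divide_le_eq not_less)
      qed
      then have "ball (0::'a) ?c \<in> null_sets lborel" by (subst AE_iff_null_sets) auto
      then have "negligible (ball (0::'a) ?c)" by (simp add: negligible_iff_null_sets null_sets_completionI)
      then show False using open_not_negligible[of "ball (0::'a) ?c"] by simp
    qed
    moreover have "0 \<le> (\<integral>x. f x \<partial>lborel)" using bump0_bounds by (intro Bochner_Integration.integral_nonneg) (simp add: f_def)
    ultimately show ?thesis by (simp add: I_def f_def)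
  qed
  have "\<exists>C. bump_fn C (1 / real (Suc k)) (\<rho> k)" for k
    unfolding \<rho>_def using I[of k] by (intro bump0_scaled_bump_fn) auto
  moreover have "(\<integral>x. \<rho> k x \<partial>lborel) = 1" for k
    using I[of k] by (simp add: \<rho>_def I_def)
  ultimately have "mollifier \<rho>" unfolding mollifier_def by blast
  then show ?thesis by blast
qed

text \<open>The second difference of the square is \<open>2 * max 0 (g x)\<close> times that of
  \<open>g\<close>, minus two nonnegative remainders. Dropping the remainders leaves an upper bound
  that carries the square root of the function as a factor and so degenerates where the function
  vanishes.\<close>

lemma pos_square_second_diff:
  assumes g: "continuous_on UNIV g" "\<And>x::'a::euclidean_space. g x \<le> 1" "\<And>x z. \<bar>second_diff g x z\<bar> \<le> C * min 1 ((norm z)\<^sup>2)"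
    and L: "\<And>x z. \<bar>g (x + z) - g x\<bar> \<le> L * min 1 (norm z)"
  shows "C11 (1 + 2 * C + 2 * L\<^sup>2) (\<lambda>x. (max 0 (g x))\<^sup>2)"
    and "second_diff (\<lambda>x. (max 0 (g x))\<^sup>2) x z \<le> 2 * max 0 (g x) * (C * min 1 ((norm z)\<^sup>2))"
proof -
  let ?f = "\<lambda>x. (max 0 (g x))\<^sup>2"
  \<comment> \<open>Any unit vector \<open>z\<close> does, since the weight equals 1 there.\<close>
  have C: "0 \<le> C" using g(3)[of 0 "SOME b. b \<in> Basis"] by (simp add: SOME_Basis norm_Basis)
  define d where "d x y = g (x + y) - g x" for x y
  define E where "E x y = ?f (x + y) - ?f x - 2 * max 0 (g x) * d x y" for x y
  have E: "0 \<le> E x y" "E x y \<le> (d x y)\<^sup>2" for x y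
    using pos_square_expansion[of "g x" "d x y"] by (simp_all add: E_def d_def)
  have d2: "(d x y)\<^sup>2 \<le> L\<^sup>2 * min 1 ((norm y)\<^sup>2)" for x y
  proof -
    have "(d x y)\<^sup>2 \<le> (L * min 1 (norm y))\<^sup>2"
      using L[of x y] by (intro abs_le_square_iff[THEN iffD1]) (simp add: d_def)
    also have "\<dots> = L\<^sup>2 * (min 1 (norm y))\<^sup>2" by (simp add: power_mult_distrib)
    also have "(min 1 (norm y))\<^sup>2 = min 1 ((norm y)\<^sup>2)"
    proof (cases "norm y \<le> 1")
      case True
      then have "(norm y)\<^sup>2 \<le> 1" by (simp add: power_le_one)
      then show ?thesis using True by (simp add: min_absorb2)
    next
      case False
      then have "1 \<le> (norm y)\<^sup>2" by (simp add: one_le_power)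
      then show ?thesis using False by (simp add: min_absorb1)
    qed
    finally show ?thesis .
  qed
  have sd: "second_diff ?f x z = 2 * max 0 (g x) * second_diff g x z - E x z - E x (- z)" for x z
  proof -
    have e: "E x (- z) = ?f (x - z) - ?f x - 2 * max 0 (g x) * (g (x - z) - g x)" by (simp add: E_def d_def)
    have "2 * P - Q - R = 2 * M * (2 * gx - gp - gm) - (Q - P - 2 * M * (gp - gx)) - (R - P - 2 * M * (gm - gx))"
      for P Q R M gx gp gm :: real by (simp add: algebra_simps)
    then show ?thesis unfolding second_diff_def e E_def[of x z] d_def by blast
  qed
  have up: "second_diff ?f x z \<le> 2 * max 0 (g x) * (C * min 1 ((norm z)\<^sup>2))" for x z
  proof -
    have "2 * max 0 (g x) * second_diff g x z \<le> 2 * max 0 (g x) * (C * min 1 ((norm z)\<^sup>2))"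
      using g(3)[of x z] by (intro mult_left_mono) auto
    then show ?thesis using sd[of x z] E[of x z] E[of x "- z"] by linarith
  qed
  show "second_diff ?f x z \<le> 2 * max 0 (g x) * (C * min 1 ((norm z)\<^sup>2))" by (rule up)
  show "C11 (1 + 2 * C + 2 * L\<^sup>2) ?f"
  proof (rule C11I)
    show "continuous_on UNIV ?f" by (intro continuous_intros g)
    show "\<bar>?f x\<bar> \<le> 1 + 2 * C + 2 * L\<^sup>2" for x
    proof -
      have "?f x \<le> 1" using g(2)[of x] by (intro power_le_one) auto
      moreover have "0 \<le> L\<^sup>2" "0 \<le> ?f x" by simp_all
      ultimately show ?thesis using C by linarith
    qed
    show "\<bar>second_diff ?f x z\<bar> \<le> (1 + 2 * C + 2 * L\<^sup>2) * min 1 ((norm z)\<^sup>2)" for x z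
    proof -
      let ?m = "min 1 ((norm z)\<^sup>2)"
      have m: "0 \<le> ?m" by simp
      have "\<bar>max 0 (g x) * second_diff g x z\<bar> \<le> 1 * (C * ?m)"
        unfolding abs_mult using g(2)[of x] g(3)[of x z] by (intro mult_mono) auto
      then have "\<bar>second_diff ?f x z\<bar> \<le> 2 * (C * ?m) + (L\<^sup>2 * ?m + L\<^sup>2 * ?m)"
        using sd[of x z] E[of x z] E[of x "- z"] d2[of x z] d2[of x "- z"] unfolding norm_minus_cancel by linarith
      also have "\<dots> \<le> (1 + 2 * C + 2 * L\<^sup>2) * ?m" using m by (simp add: algebra_simps)
      finally show ?thesis .
    qed
  qed
qed

section \<open>Weak solutions as solutions tested in space\<close>

text \<open>Connects iterated integrals in time and space with the integrals over the strip
  \<open>Q_upto T\<close> that occur in the weak formulation.\<close>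

lemma pair_tmeas_eq:
  "tmeas T \<Otimes>\<^sub>M (lborel :: 'a::euclidean_space measure) = density lborel (\<lambda>w. ennreal (indicator {0<..<T} (fst w)))"
proof -
  have "tmeas T \<Otimes>\<^sub>M (lborel :: 'a measure) = density lborel (\<lambda>t. ennreal (indicator {0<..<T} t)) \<Otimes>\<^sub>M density lborel (\<lambda>_. 1)"
    by (simp add: tmeas_def density_1)
  also have "\<dots> = density (lborel \<Otimes>\<^sub>M lborel) (\<lambda>(t, x). ennreal (indicator {0<..<T} t) * 1)"
    by (rule pair_measure_density) (auto simp: density_1 sigma_finite_lborel)
  also have "\<dots> = density lborel (\<lambda>w. ennreal (indicator {0<..<T} (fst w)))"
    by (simp add: lborel_prod case_prod_beta')
  finally show ?thesis .
qed

lemma integrable_pair_tmeas: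
  fixes f :: "real \<times> 'a::euclidean_space \<Rightarrow> real"
  assumes [measurable]: "f \<in> borel_measurable borel"
  shows "integrable (tmeas T \<Otimes>\<^sub>M lborel) f \<longleftrightarrow> integrable lborel (\<lambda>w. indicator {0<..<T} (fst w) * f w)"
    and "integral\<^sup>L (tmeas T \<Otimes>\<^sub>M lborel) f = (\<integral>w. indicator {0<..<T} (fst w) * f w \<partial>lborel)"
proof -
  have [measurable]: "(fst :: real \<times> 'a \<Rightarrow> real) \<in> borel_measurable borel"
    by (intro borel_measurable_continuous_onI continuous_intros)
  have m: "(\<lambda>w::real \<times> 'a. indicator {0<..<T} (fst w) :: real) \<in> borel_measurable lborel" by measurable
  show "integrable (tmeas T \<Otimes>\<^sub>M lborel) f \<longleftrightarrow> integrable lborel (\<lambda>w. indicator {0<..<T} (fst w) * f w)"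
    unfolding pair_tmeas_eq by (subst integrable_density) (use m in auto)
  show "integral\<^sup>L (tmeas T \<Otimes>\<^sub>M lborel) f = (\<integral>w. indicator {0<..<T} (fst w) * f w \<partial>lborel)"
    unfolding pair_tmeas_eq by (subst integral_density) (use m in auto)
qed

lemma AE_pair_tmeas:
  fixes P :: "real \<times> 'a::euclidean_space \<Rightarrow> bool"
  shows "(AE w in tmeas T \<Otimes>\<^sub>M lborel. P w) \<longleftrightarrow> (AE w in lborel. 0 < fst w \<and> fst w < T \<longrightarrow> P w)"
proof -
  have [measurable]: "(fst :: real \<times> 'a \<Rightarrow> real) \<in> borel_measurable borel"
    by (intro borel_measurable_continuous_onI continuous_intros)
  show ?thesis unfolding pair_tmeas_eq by (subst AE_density) (auto simp: indicator_def)
qed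

text \<open>Du Bois-Reymond's lemma with continuous test functions: they approximate the indicators
  of rays, so the measures with densities the positive and the negative part of \<open>q\<close>
  agree on rays and hence coincide.\<close>

lemma tmeas_zero_AE:
  assumes q: "integrable (tmeas T) q"
    and z: "\<And>h. continuous_on UNIV h \<Longrightarrow> (\<integral>t. h t * q t \<partial>tmeas T) = (0::real)"
  shows "AE t in tmeas T. q t = 0"
proof -
  interpret M: finite_measure "tmeas T" by (rule finite_measure_tmeas)
  have [measurable]: "q \<in> borel_measurable (tmeas T)" using q by auto
  have ind: "(\<integral>t. indicator {x<..} t * q t \<partial>tmeas T) = 0" for x
  proof -
    \<comment> \<open>Continuous ramps from 0 at \<open>x\<close> to 1 at \<open>x + 1 / n\<close>,
      converging pointwise to the indicator of the open ray.\<close>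
    define h where "h n t = min 1 (real n * max 0 (t - x))" for n t
    have [measurable]: "h n \<in> borel_measurable borel" for n unfolding h_def[abs_def] by measurable
    have "(\<lambda>n. \<integral>t. h n t * q t \<partial>tmeas T) \<longlonglongrightarrow> (\<integral>t. indicator {x<..} t * q t \<partial>tmeas T)"
    proof (rule integral_dominated_convergence)
      show "integrable (tmeas T) (\<lambda>t. \<bar>q t\<bar>)" using q by simp
      show "AE t in tmeas T. norm (h n t * q t) \<le> \<bar>q t\<bar>" for n
        by (intro AE_I2) (auto simp: h_def abs_mult intro!: mult_left_le_one_le)
      show "AE t in tmeas T. (\<lambda>n. h n t * q t) \<longlonglongrightarrow> indicator {x<..} t * q t"
      proof (intro AE_I2 tendsto_mult tendsto_const)
        fix t
        show "(\<lambda>n. h n t) \<longlonglongrightarrow> indicator {x<..} t"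
        proof (cases "t > x")
          case True
          obtain n0 :: nat where n0: "1 / (t - x) < real n0" using reals_Archimedean2 by blast
          have "h n t = 1" if "n \<ge> n0" for n
          proof -
            have "1 < real n0 * (t - x)" using n0 True by (simp add: field_simps)
            also have "\<dots> \<le> real n * (t - x)" using that True by (intro mult_right_mono) auto
            finally show ?thesis using True by (simp add: h_def)
          qed
          then have "\<forall>\<^sub>F n in sequentially. h n t = indicator {x<..} t"
            using True by (auto simp: eventually_sequentially)
          then show ?thesis by (rule tendsto_eventually)
        next
          case False then show ?thesis by (simp add: h_def)
        qed
      qed
    qed measurable
    moreover have "(\<integral>t. h n t * q t \<partial>tmeas T) = 0" for n
      by (rule z) (auto simp: h_def[abs_def] intro!: continuous_intros)
    ultimately show ?thesis by (simp add: LIMSEQ_const_iff)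
  qed
  define P where "P t = ennreal (q t)" for t
  define N where "N t = ennreal (- q t)" for t
  have [measurable]: "P \<in> borel_measurable (tmeas T)" "N \<in> borel_measurable (tmeas T)"
    unfolding P_def N_def by measurable
  have em: "emeasure (density (tmeas T) (\<lambda>t. ennreal (f t))) {x<..} = ennreal (\<integral>t. indicator {x<..} t * max 0 (f t) \<partial>tmeas T)"
    if f: "integrable (tmeas T) f" for f x
  proof -
    have [measurable]: "f \<in> borel_measurable (tmeas T)" using f by auto
    have "emeasure (density (tmeas T) (\<lambda>t. ennreal (f t))) {x<..} = (\<integral>\<^sup>+t. ennreal (indicator {x<..} t * max 0 (f t)) \<partial>tmeas T)"
      by (subst emeasure_density) (auto intro!: nn_integral_cong simp: indicator_def max_def ennreal_neg)
    also have "\<dots> = ennreal (\<integral>t. indicator {x<..} t * max 0 (f t) \<partial>tmeas T)"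
    proof (rule nn_integral_eq_integral)
      show "integrable (tmeas T) (\<lambda>t. indicator {x<..} t * max 0 (f t))"
        by (rule Bochner_Integration.integrable_bound[OF f]) (auto simp: indicator_def)
    qed (simp add: indicator_def)
    finally show ?thesis .
  qed
  have "density (tmeas T) P = density (tmeas T) N"
  proof (rule measure_eqI_lessThan)
    show "sets (density (tmeas T) P) = sets borel" "sets (density (tmeas T) N) = sets borel" by simp_all
    fix x
    show "emeasure (density (tmeas T) P) {x<..} < \<infinity>" unfolding P_def by (simp add: em[OF q])
    have i: "integrable (tmeas T) (\<lambda>t. indicator {x<..} t * max 0 (q t))" "integrable (tmeas T) (\<lambda>t. indicator {x<..} t * max 0 (- q t))"
      by (rule Bochner_Integration.integrable_bound[OF q]; auto simp: indicator_def)+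
    have "(\<integral>t. indicator {x<..} t * max 0 (q t) \<partial>tmeas T) - (\<integral>t. indicator {x<..} t * max 0 (- q t) \<partial>tmeas T)
       = (\<integral>t. indicator {x<..} t * q t \<partial>tmeas T)"
      unfolding Bochner_Integration.integral_diff[OF i, symmetric]
      by (intro Bochner_Integration.integral_cong refl) (auto simp: indicator_def)
    then show "emeasure (density (tmeas T) P) {x<..} = emeasure (density (tmeas T) N) {x<..}"
      unfolding P_def N_def using q by (simp add: em ind)
  qed
  then have "AE t in tmeas T. P t = N t" by (intro M.density_unique) auto
  then show ?thesis
  proof eventually_elim
    case (elim t)
    show ?case
    proof (cases "q t \<ge> 0")
      case True then show ?thesis using elim by (simp add: P_def N_def ennreal_neg)
    next
      case False then show ?thesis using elim by (simp add: P_def N_def ennreal_neg eq_commute[of 0])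
    qed
  qed
qed

text \<open>The essential supremum of a non-measurable function is infinite by convention, so a
  pointwise bound alone is not enough and measurability on \<open>A\<close> is part of the
  work.\<close>

lemma Linf_normI:
  fixes f :: "'b::euclidean_space \<Rightarrow> real"
  assumes A: "A \<in> sets borel" and f: "(\<lambda>w. indicator A w * f w) \<in> borel_measurable borel"
    and M: "\<And>w. w \<in> A \<Longrightarrow> \<bar>f w\<bar> \<le> M"
  shows "Linf_norm A f \<le> ereal M"
proof -
  have "(\<lambda>w. indicator A w *\<^sub>R f w) \<in> borel_measurable lebesgue"
    using measurable_completion[of "\<lambda>w. indicator A w * f w" lborel borel] f by simp
  then have [measurable]: "f \<in> borel_measurable (lebesgue_on A)"
    using A by (subst borel_measurable_restrict_space_iff) auto
  show ?thesis unfolding Linf_norm_def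
  proof (rule esssup_I)
    show "(\<lambda>z. ereal \<bar>f z\<bar>) \<in> borel_measurable (lebesgue_on A)" by measurable
    show "AE z in lebesgue_on A. ereal \<bar>f z\<bar> \<le> ereal M"
      using M by (intro AE_I2) (auto simp: space_restrict_space)
  qed
qed

lemma frac_lap_eps_measurable:
  assumes s: "0 < s" "s < 1" and f: "C11 C f" and e: "\<epsilon> > 0"
  shows "frac_lap_eps s \<epsilon> f \<in> borel_measurable borel"
proof -
  have [measurable]: "f \<in> borel_measurable borel" by (rule C11_measurable[OF f])
  show ?thesis unfolding frac_lap_eps_eq[OF s f e, abs_def] by measurable
qed

text \<open>The primitive of \<open>-h\<close> that vanishes at the final time: the time factor of a
  test function whose time derivative is prescribed by \<open>h\<close>.\<close>

definition prim :: "real \<Rightarrow> (real \<Rightarrow> real) \<Rightarrow> real \<Rightarrow> real" where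
  "prim T h t = integral {0..T} h - integral {0..t} h"

lemma prim_deriv:
  assumes "continuous_on UNIV h" "0 < t" "t < T"
  shows "(prim T h has_real_derivative - h t) (at t)"
proof -
  have "((\<lambda>t. integral {0..t} h) has_real_derivative h t) (at t within {0..T})"
    by (rule integral_has_real_derivative) (use assms in \<open>auto intro: continuous_on_subset\<close>)
  then have "((\<lambda>t. integral {0..t} h) has_real_derivative h t) (at t)"
    using assms by (simp add: at_within_Icc_at)
  then show ?thesis unfolding prim_def[abs_def] by (auto intro!: derivative_eq_intros)
qed

lemma prim_lipschitz:
  assumes h: "continuous_on UNIV h"
  shows "\<exists>L\<ge>0. (\<forall>t\<in>{0..T}. \<bar>h t\<bar> \<le> L) \<and> (\<forall>a\<in>{0..T}. \<forall>b\<in>{0..T}. \<bar>prim T h a - prim T h b\<bar> \<le> L * \<bar>a - b\<bar>)"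
proof -
  have "compact (h ` {0..T})" by (intro compact_continuous_image continuous_on_subset[OF h]) auto
  then have "bounded (h ` {0..T})" by (rule compact_imp_bounded)
  then obtain L0 where L0: "\<And>t. t \<in> {0..T} \<Longrightarrow> \<bar>h t\<bar> \<le> L0" unfolding bounded_iff by fastforce
  define L where "L = max 0 L0"
  have L: "\<bar>h t\<bar> \<le> L" if "t \<in> {0..T}" for t using L0[OF that] by (simp add: L_def)
  have d: "(prim T h has_real_derivative - h t) (at t within {0..T})" if "t \<in> {0..T}" for t
  proof -
    have "((\<lambda>t. integral {0..t} h) has_real_derivative h t) (at t within {0..T})"
      by (rule integral_has_real_derivative) (use h that in \<open>auto intro: continuous_on_subset\<close>)
    then show ?thesis unfolding prim_def[abs_def] by (auto intro!: derivative_eq_intros)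
  qed
  have "\<bar>prim T h a - prim T h b\<bar> \<le> L * \<bar>a - b\<bar>" if "a \<in> {0..T}" "b \<in> {0..T}" for a b
    using field_differentiable_bound[of "{0..T}" "prim T h" "\<lambda>t. - h t" L a b] d L that by auto
  then show ?thesis using L by (intro exI[of _ L]) (auto simp: L_def)
qed

lemma prim_eq_tmeas:
  assumes h: "continuous_on UNIV h" and t: "0 \<le> t" "t \<le> T"
  shows "prim T h t = (\<integral>r. indicator {t..} r * h r \<partial>tmeas T)"
proof -
  have hm [measurable]: "h \<in> borel_measurable borel" using h by (rule borel_measurable_continuous_onI)
  have "set_integrable lborel {t..T} h" by (rule borel_integrable_atLeastAtMost') (use h in \<open>auto intro: continuous_on_subset\<close>)
  then have "(LBINT r:{t..T}. h r) = integral {t..T} h" by (rule set_borel_integral_eq_integral(2))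
  moreover have "integral {0..t} h + integral {t..T} h = integral {0..T} h"
    using t by (intro Henstock_Kurzweil_Integration.integral_combine integrable_continuous_real continuous_on_subset[OF h]) auto
  moreover have "(LBINT r:{t..T}. h r) = (\<integral>r. indicator {0<..<T} r * (indicator {t..} r * h r) \<partial>lborel)"
    unfolding set_lebesgue_integral_def
  proof (rule integral_cong_AE)
    show "AE r in lborel. indicator {t..T} r *\<^sub>R h r = indicator {0<..<T} r * (indicator {t..} r * h r)"
      using AE_lborel_singleton[of 0] AE_lborel_singleton[of T]
      by eventually_elim (use t in \<open>auto simp: indicator_def\<close>)
  qed measurable
  moreover have "(\<integral>r. indicator {t..} r * h r \<partial>tmeas T) = (\<integral>r. indicator {0<..<T} r * (indicator {t..} r * h r) \<partial>lborel)"
    by (rule integral_tmeas) measurable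
  ultimately show ?thesis by (simp add: prim_def)
qed

text \<open>Continuity of \<open>h\<close> suffices, because the space asks only for a bounded time
  derivative and Lipschitz dependence on time. The spatial conditions hold because a multiple of a
  translated bump is \<open>C11\<close>.\<close>

lemma test_function_in_Y_space:
  fixes \<rho> :: "'a::euclidean_space \<Rightarrow> real"
  assumes s: "0 < s" "s < 1" and T: "T > 0" and bump: "bump_fn C r \<rho>" and h: "continuous_on UNIV h"
  shows "(\<lambda>t x. prim T h t * \<rho> (x - y)) \<in> Y_space s T"
proof -
  have \<rho>C: "C11 C (\<lambda>x. \<rho> (x - y))" by (rule C11_shift[OF bump_C11[OF bump]])
  have \<rho>m [measurable]: "\<rho> \<in> borel_measurable borel" by (rule C11_measurable[OF bump_C11[OF bump]])
  have hm [measurable]: "h \<in> borel_measurable borel" using h by (rule borel_measurable_continuous_onI)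
  have [measurable]: "(fst :: real \<times> 'a \<Rightarrow> real) \<in> borel_measurable borel" "(snd :: real \<times> 'a \<Rightarrow> 'a) \<in> borel_measurable borel"
    by (intro borel_measurable_continuous_onI continuous_intros)+
  have Qb: "Q_upto T \<in> sets (borel :: (real \<times> 'a) measure)"
    unfolding Q_upto_def by (intro borel_open open_Times) auto
  have Q: "w \<in> Q_upto T \<longleftrightarrow> 0 < fst w \<and> fst w < T" for w :: "real \<times> 'a"
    by (cases w) (auto simp: Q_upto_def)
  obtain L where L: "L \<ge> 0" "\<And>t. t \<in> {0..T} \<Longrightarrow> \<bar>h t\<bar> \<le> L"
    "\<And>a b. a \<in> {0..T} \<Longrightarrow> b \<in> {0..T} \<Longrightarrow> \<bar>prim T h a - prim T h b\<bar> \<le> L * \<bar>a - b\<bar>"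
    using prim_lipschitz[OF h, of T] by blast
  have pT: "prim T h T = 0" by (simp add: prim_def)
  have pb: "\<bar>prim T h t\<bar> \<le> L * T" if "t \<in> {0..T}" for t
  proof -
    have "\<bar>prim T h t - prim T h T\<bar> \<le> L * \<bar>t - T\<bar>" using that T by (intro L(3)) auto
    also have "\<dots> \<le> L * T" using that L(1) by (intro mult_left_mono) auto
    finally show ?thesis using pT by simp
  qed
  \<comment> \<open>Cutting the time factor to the open interval makes it Borel measurable on the
    whole line.\<close>
  define P where "P t = indicator {0<..<T} t * prim T h t" for t
  have Pm [measurable]: "P \<in> borel_measurable borel"
  proof -
    have "continuous_on {0<..<T} (prim T h)"
      by (rule DERIV_continuous_on[of _ _ "\<lambda>t. - h t"]) (auto intro: DERIV_subset[OF prim_deriv[OF h]])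
    then show ?thesis unfolding P_def[abs_def]
      using borel_measurable_continuous_on_indicator[of "{0<..<T}" "prim T h"] by simp
  qed
  have Pb: "\<bar>P t\<bar> \<le> L * T" for t using pb[of t] L(1) T by (auto simp: P_def indicator_def)
  have C0: "0 \<le> C" using C11_nonneg[OF \<rho>C] .
  have iP: "indicator (Q_upto T) w * (prim T h (fst w) * g) = P (fst w) * g" for w :: "real \<times> 'a" and g
    by (auto simp: P_def indicator_def Q)
  have xiC: "C11 (\<bar>prim T h t\<bar> * C) (\<lambda>x. prim T h t * \<rho> (x - y))" for t
    by (rule C11_cmult[OF \<rho>C])
  have flb: "\<bar>fl s \<rho> x\<bar> \<le> C * levy_mass TYPE('a) s" for x by (rule fl_bound[OF s bump_C11[OF bump]])
  have fleq: "frac_lap s (\<lambda>x. prim T h t * \<rho> (x - y)) x = prim T h t * fl s \<rho> (x - y)" for t x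
    unfolding frac_lap_eq_fl[OF s xiC] fl_cmult fl_shift ..
  have c1: "set_integrable lebesgue (Q_upto T) (\<lambda>(t, x). prim T h t * \<rho> (x - y))"
  proof -
    have "integrable (lborel \<Otimes>\<^sub>M lborel) (\<lambda>(t, x). P t * \<rho> (x - y))"
    proof (intro integrable_product_mult sigma_finite_lborel lborel_shift_integrable(2) bump_integrable[OF bump])
      have "integrable lborel (indicator {0<..<T} :: real \<Rightarrow> real)"
        using T by (intro integrable_real_indicator) auto
      then have "integrable lborel (\<lambda>t. L * T * indicator {0<..<T} t)" by (rule integrable_mult_right)
      then show "integrable lborel P"
      proof (rule Bochner_Integration.integrable_bound)
        show "AE t in lborel. norm (P t) \<le> norm (L * T * indicator {0<..<T} t)"
        proof (intro AE_I2)
          fix t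
          have "\<bar>P t\<bar> \<le> L * T * indicator {0<..<T} t" using Pb[of t] by (cases "0 < t \<and> t < T") (auto simp: P_def)
          then show "norm (P t) \<le> norm (L * T * indicator {0<..<T} t)" by simp
        qed
      qed measurable
    qed
    then have "integrable lborel (\<lambda>w. P (fst w) * \<rho> (snd w - y))" by (simp add: lborel_prod case_prod_beta')
    then have "integrable lebesgue (\<lambda>w. P (fst w) * \<rho> (snd w - y))"
      by (subst integrable_completion) measurable
    then show ?thesis
      unfolding set_integrable_def by (simp add: case_prod_beta' iP)
  qed
  have c2: "Linf_norm (Q_upto T) (\<lambda>(t, x). prim T h t * \<rho> (x - y)) < \<infinity>"
  proof -
    have "Linf_norm (Q_upto T) (\<lambda>(t, x). prim T h t * \<rho> (x - y)) \<le> ereal (L * T * C)"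
    proof (rule Linf_normI[OF Qb])
      show "(\<lambda>w. indicator (Q_upto T) w * (case w of (t, x) \<Rightarrow> prim T h t * \<rho> (x - y))) \<in> borel_measurable borel"
        by (simp add: case_prod_beta' iP) measurable
      show "\<bar>case w of (t, x) \<Rightarrow> prim T h t * \<rho> (x - y)\<bar> \<le> L * T * C" if "w \<in> Q_upto T" for w
        using that C11_abs[OF \<rho>C, of "snd w"] pb[of "fst w"] L(1) T C0
        by (auto simp: case_prod_beta' abs_mult Q intro!: mult_mono)
    qed
    then show ?thesis by (rule le_less_trans) simp
  qed
  have c3: "(\<bar>\<rho> (x - y)\<bar> * L)-lipschitz_on {0..T} (\<lambda>t. prim T h t * \<rho> (x - y))" for x
  proof (rule lipschitz_onI)
    show "0 \<le> \<bar>\<rho> (x - y)\<bar> * L" using L(1) by simp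
    fix a b assume ab: "a \<in> {0..T}" "b \<in> {0..T}"
    have "\<bar>prim T h a - prim T h b\<bar> * \<bar>\<rho> (x - y)\<bar> \<le> L * \<bar>a - b\<bar> * \<bar>\<rho> (x - y)\<bar>"
      by (intro mult_right_mono L(3) ab) simp
    then show "dist (prim T h a * \<rho> (x - y)) (prim T h b * \<rho> (x - y)) \<le> \<bar>\<rho> (x - y)\<bar> * L * dist a b"
      unfolding dist_real_def left_diff_distrib[symmetric] abs_mult by (simp only: mult_ac)
  qed
  have dx: "deriv (\<lambda>r. prim T h r * \<rho> (x - y)) t = - h t * \<rho> (x - y)" if "0 < t" "t < T" for t x
    by (rule DERIV_imp_deriv) (rule DERIV_cmult_right[OF prim_deriv[OF h that]])
  have c4: "Linf_norm (Q_upto T) (\<lambda>(t, x). deriv (\<lambda>r. prim T h r * \<rho> (x - y)) t) < \<infinity>"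
  proof -
    have "Linf_norm (Q_upto T) (\<lambda>(t, x). deriv (\<lambda>r. prim T h r * \<rho> (x - y)) t) \<le> ereal (L * C)"
    proof (rule Linf_normI[OF Qb])
      have "(\<lambda>w. indicator (Q_upto T) w * (case w of (t, x) \<Rightarrow> deriv (\<lambda>r. prim T h r * \<rho> (x - y)) t)) =
        (\<lambda>w. indicator {0<..<T} (fst w) * (- h (fst w) * \<rho> (snd w - y)))"
        by (auto simp: fun_eq_iff indicator_def Q dx)
      then show "(\<lambda>w. indicator (Q_upto T) w * (case w of (t, x) \<Rightarrow> deriv (\<lambda>r. prim T h r * \<rho> (x - y)) t)) \<in> borel_measurable borel"
        by simp
      show "\<bar>case w of (t, x) \<Rightarrow> deriv (\<lambda>r. prim T h r * \<rho> (x - y)) t\<bar> \<le> L * C" if "w \<in> Q_upto T" for w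
      proof -
        have "\<bar>h (fst w)\<bar> * \<bar>\<rho> (snd w - y)\<bar> \<le> L * C"
          using that L(1) by (intro mult_mono L(2) C11_abs[OF \<rho>C]) (auto simp: Q)
        then show ?thesis using that by (auto simp: case_prod_beta' dx Q abs_mult)
      qed
    qed
    then show ?thesis by (rule le_less_trans) simp
  qed
  have c5: "\<exists>l. ((\<lambda>\<epsilon>. frac_lap_eps s \<epsilon> (\<lambda>x. prim T h t * \<rho> (x - y)) x) \<longlongrightarrow> l) (at_right 0)" for t x
    using frac_lap_eps_tendsto[OF s xiC] by blast
  have c6: "Linf_norm (Q_upto T) (\<lambda>(t, x). frac_lap s (\<lambda>x. prim T h t * \<rho> (x - y)) x) < \<infinity>"
  proof -
    have "Linf_norm (Q_upto T) (\<lambda>(t, x). frac_lap s (\<lambda>x. prim T h t * \<rho> (x - y)) x) \<le> ereal (L * T * (C * levy_mass TYPE('a) s))"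
    proof (rule Linf_normI[OF Qb])
      have "(\<lambda>w. indicator (Q_upto T) w * (case w of (t, x) \<Rightarrow> frac_lap s (\<lambda>x. prim T h t * \<rho> (x - y)) x)) =
        (\<lambda>w. P (fst w) * fl s \<rho> (snd w - y))"
        by (auto simp: fun_eq_iff fleq case_prod_beta' iP)
      then show "(\<lambda>w. indicator (Q_upto T) w * (case w of (t, x) \<Rightarrow> frac_lap s (\<lambda>x. prim T h t * \<rho> (x - y)) x)) \<in> borel_measurable borel"
        by simp
      show "\<bar>case w of (t, x) \<Rightarrow> frac_lap s (\<lambda>x. prim T h t * \<rho> (x - y)) x\<bar> \<le> L * T * (C * levy_mass TYPE('a) s)" if "w \<in> Q_upto T" for w
      proof -
        have "\<bar>prim T h (fst w)\<bar> * \<bar>fl s \<rho> (snd w - y)\<bar> \<le> L * T * (C * levy_mass TYPE('a) s)"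
          using that L(1) T by (intro mult_mono pb flb) (auto simp: Q)
        then show ?thesis by (simp add: case_prod_beta' fleq abs_mult)
      qed
    qed
    then show ?thesis by (rule le_less_trans) simp
  qed
  have c7: "\<exists>M>0. \<exists>\<epsilon>\<^sub>0>0. \<forall>\<epsilon>. 0 < \<epsilon> \<and> \<epsilon> \<le> \<epsilon>\<^sub>0 \<longrightarrow>
           Linf_norm UNIV (frac_lap_eps s \<epsilon> (\<lambda>x. prim T h t * \<rho> (x - y))) \<le> ereal M" for t
  proof -
    define M where "M = max 1 (\<bar>prim T h t\<bar> * C * levy_mass TYPE('a) s)"
    have "Linf_norm UNIV (frac_lap_eps s \<epsilon> (\<lambda>x. prim T h t * \<rho> (x - y))) \<le> ereal M" if e: "\<epsilon> > 0" for \<epsilon>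
    proof (rule Linf_normI)
      show "(\<lambda>w. indicator UNIV w * frac_lap_eps s \<epsilon> (\<lambda>x. prim T h t * \<rho> (x - y)) w) \<in> borel_measurable borel"
        using frac_lap_eps_measurable[OF s xiC e] by simp
      show "\<bar>frac_lap_eps s \<epsilon> (\<lambda>x. prim T h t * \<rho> (x - y)) w\<bar> \<le> M" for w
        using frac_lap_eps_bound[OF s xiC e, of t w] unfolding M_def by (rule order_trans[OF _ max.cobounded2])
    qed simp
    moreover have "M > 0" by (simp add: M_def)
    ultimately show ?thesis by (intro exI[of _ M] conjI exI[of _ 1]) auto
  qed
  have c8: "prim T h T * \<rho> (x - y) = 0" for x by (simp add: pT)
  show ?thesis
    unfolding Y_space_def using c1 c2 c3 c4 c5 c6 c7 c8 by blast
qed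

text \<open>Testing with \<open>prim T h t * \<rho> (x - y)\<close> and exchanging integrals turns
  the weak formulation into the vanishing of an integral of \<open>h\<close> times a fixed function
  of time. As \<open>h\<close> is an arbitrary continuous function, that fixed function is zero
  almost everywhere, which is the integral equation. A Borel representative replaces
  \<open>u\<close>, since \<open>u\<close> is only Lebesgue measurable.\<close>

lemma weak_solution_lin_sol:
  fixes u :: "real \<Rightarrow> 'a::euclidean_space \<Rightarrow> real"
  assumes s: "0 < s" "s < 1" and ws: "weak_solution s \<beta> p \<mu> u" and \<mu>: "integrable lebesgue \<mu>"
    and \<mu>': "\<mu>' \<in> borel_measurable borel" "AE x in lborel. \<mu> x = \<mu>' x"
  obtains v :: "real \<times> 'a \<Rightarrow> real" where "v \<in> borel_measurable borel" "\<And>w. 0 \<le> v w"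
    "AE w in lborel. 0 < fst w \<longrightarrow> v w = u (fst w) (snd w)"
    "\<And>T. T > 0 \<Longrightarrow> lin_sol s T v (\<lambda>w. fst w powr \<beta> * v w powr p) \<mu>'"
proof -
  have fstm [measurable]: "(fst :: real \<times> 'a \<Rightarrow> real) \<in> borel_measurable borel" "(snd :: real \<times> 'a \<Rightarrow> 'a) \<in> borel_measurable borel"
    by (intro borel_measurable_continuous_onI continuous_intros)+
  have Q: "w \<in> Q_upto T \<longleftrightarrow> 0 < fst w \<and> fst w < T" for w :: "real \<times> 'a" and T
    by (cases w) (auto simp: Q_upto_def)
  have Qi: "w \<in> Q_inf \<longleftrightarrow> 0 < fst w" for w :: "real \<times> 'a"
    by (cases w) (auto simp: Q_inf_def)
  have Qinfb: "Q_inf \<in> sets (borel :: (real \<times> 'a) measure)"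
    unfolding Q_inf_def by (intro borel_open open_Times) auto
  have ui: "set_integrable lebesgue (Q_upto T) (\<lambda>(t, x). u t x)"
    and Fi: "set_integrable lebesgue (Q_upto T) (\<lambda>(t, x). t powr \<beta> * u t x powr p)"
    and idt: "\<And>\<xi>. \<xi> \<in> Y_space s T \<Longrightarrow> set_lebesgue_integral lebesgue (Q_upto T)
             (\<lambda>(t, x). (- deriv (\<lambda>r. \<xi> r x) t + frac_lap s (\<xi> t) x) * u t x
                        + t powr \<beta> * u t x powr p * \<xi> t x) = (LINT x|lebesgue. \<xi> 0 x * \<mu> x)" if "T > 0" for T
    using ws that unfolding weak_solution_def by blast+
  have upos: "AE w in lborel. 0 < fst w \<longrightarrow> 0 \<le> u (fst w) (snd w)"
  proof -
    have "AE w in lebesgue_on Q_inf. 0 \<le> u (fst w) (snd w)"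
      using ws by (simp add: weak_solution_def case_prod_beta')
    then have "AE w in lebesgue. w \<in> Q_inf \<longrightarrow> 0 \<le> u (fst w) (snd w)"
      using Qinfb by (subst (asm) AE_restrict_space_iff) auto
    then show ?thesis by (simp add: AE_completion_iff Qi)
  qed
  \<comment> \<open>Integrability is given on bounded time strips only; measurability on all
    positive times follows by exhausting them.\<close>
  define g where "g w = indicator Q_inf w * u (fst w) (snd w)" for w :: "real \<times> 'a"
  have gm: "g \<in> borel_measurable lebesgue"
  proof (rule borel_measurable_LIMSEQ_metric)
    fix n :: nat
    show "(\<lambda>w. indicator (Q_upto (real (Suc n))) w *\<^sub>R (case w of (t, x) \<Rightarrow> u t x)) \<in> borel_measurable lebesgue"
      using ui[of "real (Suc n)"] unfolding set_integrable_def by (intro borel_measurable_integrable) simp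
  next
    fix w :: "real \<times> 'a"
    obtain n0 :: nat where n0: "fst w < real n0" using reals_Archimedean2 by blast
    have "\<forall>\<^sub>F n in sequentially. indicator (Q_upto (real (Suc n))) w *\<^sub>R (case w of (t, x) \<Rightarrow> u t x) = g w"
      unfolding eventually_sequentially
      by (rule exI[of _ n0]) (use n0 in \<open>auto simp: g_def indicator_def Q Qi case_prod_beta'\<close>)
    then show "(\<lambda>n. indicator (Q_upto (real (Suc n))) w *\<^sub>R (case w of (t, x) \<Rightarrow> u t x)) \<longlonglongrightarrow> g w"
      by (rule tendsto_eventually)
  qed
  from completion_ex_borel_measurable_real[OF gm] obtain g' where g': "g' \<in> borel_measurable lborel" "AE w in lborel. g w = g' w"
    by blast
  have [measurable]: "g' \<in> borel_measurable borel" using g' by simp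
  \<comment> \<open>Truncation at 0 changes \<open>g'\<close> on positive times only on a null set
    and makes \<open>v\<close> nonnegative everywhere, as the monotonicity of
    \<open>r powr p\<close> will require.\<close>
  define v where "v w = indicator {0<..} (fst w) * max 0 (g' w)" for w
  have vm [measurable]: "v \<in> borel_measurable borel" unfolding v_def[abs_def] by measurable
  have v0: "0 \<le> v w" for w by (simp add: v_def)
  have vu: "AE w in lborel. 0 < fst w \<longrightarrow> v w = u (fst w) (snd w)"
    using g'(2) upos
  proof eventually_elim
    case (elim w)
    show ?case
    proof
      assume "0 < fst w"
      then show "v w = u (fst w) (snd w)" using elim by (simp add: v_def g_def Qi)
    qed
  qed
  define F where "F w = fst w powr \<beta> * v w powr p" for w
  have Fm [measurable]: "F \<in> borel_measurable borel" unfolding F_def[abs_def] by measurable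
  have intQ: "integrable (tmeas T \<Otimes>\<^sub>M lborel) f"
    if f [measurable]: "f \<in> borel_measurable borel" and fu: "AE w in lborel. 0 < fst w \<longrightarrow> f w = k w" and k: "set_integrable lebesgue (Q_upto T) k"
    for f k :: "real \<times> 'a \<Rightarrow> real" and T
  proof -
    have m: "(\<lambda>w. indicator {0<..<T} (fst w) * f w) \<in> borel_measurable lborel" by measurable
    have "integrable lebesgue (\<lambda>w. indicator {0<..<T} (fst w) * f w)"
    proof (rule integrable_cong_AE_imp)
      show "integrable lebesgue (\<lambda>w. indicator (Q_upto T) w *\<^sub>R k w)" using k by (simp add: set_integrable_def)
      show "(\<lambda>w. indicator {0<..<T} (fst w) * f w) \<in> borel_measurable lebesgue"
        by (rule measurable_completion[OF m])
      show "AE w in lebesgue. indicator (Q_upto T) w *\<^sub>R k w = indicator {0<..<T} (fst w) * f w"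
        using AE_completion[OF fu] by eventually_elim (auto simp: indicator_def Q)
    qed
    then have "integrable lborel (\<lambda>w. indicator {0<..<T} (fst w) * f w)"
      by (subst (asm) integrable_completion[OF m])
    then show ?thesis by (subst integrable_pair_tmeas(1)[OF f])
  qed
  have Fu: "AE w in lborel. 0 < fst w \<longrightarrow> F w = (case w of (t, x) \<Rightarrow> t powr \<beta> * u t x powr p)"
    using vu by eventually_elim (auto simp: F_def case_prod_beta')
  have vi: "integrable (tmeas T \<Otimes>\<^sub>M lborel) v" if "T > 0" for T
    by (rule intQ[OF vm _ ui[OF that]]) (use vu in \<open>simp add: case_prod_beta'\<close>)
  have Fii: "integrable (tmeas T \<Otimes>\<^sub>M lborel) F" if "T > 0" for T
    by (rule intQ[OF Fm Fu Fi[OF that]])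
  have \<mu>i: "integrable lborel \<mu>'"
  proof -
    have "integrable lebesgue \<mu>'"
      using integrable_cong_AE_imp[OF \<mu> _ AE_completion[OF \<mu>'(2)]] \<mu>'(1) by (simp add: measurable_completion)
    then show ?thesis using \<mu>'(1) by (simp add: integrable_completion)
  qed
  have sol: "lin_sol s T v F \<mu>'" if T: "T > 0" for T
    unfolding lin_sol_def
  proof (intro conjI allI impI)
    show "v \<in> borel_measurable (borel \<Otimes>\<^sub>M borel)" "F \<in> borel_measurable (borel \<Otimes>\<^sub>M borel)"
      by (simp_all add: borel_prod)
    show "integrable (tmeas T \<Otimes>\<^sub>M lborel) v" "integrable (tmeas T \<Otimes>\<^sub>M lborel) F" "integrable lborel \<mu>'"
      using vi[OF T] Fii[OF T] \<mu>i by auto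
    fix C r and \<rho> :: "'a \<Rightarrow> real" and y
    assume bump: "bump_fn C r \<rho>"
    interpret M: finite_measure "tmeas T" by (rule finite_measure_tmeas)
    interpret pair_sigma_finite "tmeas T" "lborel :: 'a measure" by (rule pair_sigma_finite_tmeas)
    have \<rho>C: "C11 C \<rho>" by (rule bump_C11[OF bump])
    have \<rho>m [measurable]: "\<rho> \<in> borel_measurable borel" by (rule C11_measurable[OF \<rho>C])
    have flb: "\<bar>fl s \<rho> x\<bar> \<le> C * levy_mass TYPE('a) s" for x by (rule fl_bound[OF s \<rho>C])
    define A where "A t = corr \<rho> (\<lambda>x. v (t, x)) y" for t
    define G where "G t = corr (fl s \<rho>) (\<lambda>x. v (t, x)) y + corr \<rho> (\<lambda>x. F (t, x)) y" for t
    have Ai: "integrable (tmeas T) A" unfolding A_def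
      by (rule corr_time_integrable[OF vi[OF T] \<rho>m C11_abs[OF \<rho>C]])
    have Gi: "integrable (tmeas T) G" unfolding G_def
      by (intro Bochner_Integration.integrable_add corr_time_integrable[OF vi[OF T] _ flb] corr_time_integrable[OF Fii[OF T] \<rho>m C11_abs[OF \<rho>C]]) simp
    define \<Psi> where "\<Psi> t = (\<integral>r. indicator {0<..t} r * G r \<partial>tmeas T)" for t
    have \<Psi>c: "continuous_on UNIV \<Psi>" unfolding \<Psi>_def[abs_def] by (rule tmeas_integral_continuous[OF Gi])
    define c where "c = corr \<rho> \<mu>' y"
    have \<Psi>i: "integrable (tmeas T) \<Psi>"
    proof (rule M.integrable_const_bound)
      show "\<Psi> \<in> borel_measurable (tmeas T)" using borel_measurable_continuous_onI[OF \<Psi>c] by simp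
      show "AE t in tmeas T. norm (\<Psi> t) \<le> (\<integral>r. \<bar>G r\<bar> \<partial>tmeas T)"
      proof (intro AE_I2)
        fix t
        have i: "integrable (tmeas T) (\<lambda>r. indicator {0<..t} r * G r)"
          by (rule Bochner_Integration.integrable_bound[OF Gi]) (use Gi in \<open>auto simp: indicator_def\<close>)
        have "\<bar>\<Psi> t\<bar> \<le> (\<integral>r. \<bar>indicator {0<..t} r * G r\<bar> \<partial>tmeas T)" unfolding \<Psi>_def by (rule integral_abs_bound)
        also have "\<dots> \<le> (\<integral>r. \<bar>G r\<bar> \<partial>tmeas T)"
        proof (rule integral_mono)
          show "integrable (tmeas T) (\<lambda>r. \<bar>indicator {0<..t} r * G r\<bar>)" using i by (rule integrable_abs)
          show "integrable (tmeas T) (\<lambda>r. \<bar>G r\<bar>)" using Gi by (rule integrable_abs)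
        qed (simp add: indicator_def)
        finally show "norm (\<Psi> t) \<le> (\<integral>r. \<bar>G r\<bar> \<partial>tmeas T)" by simp
      qed
    qed
    \<comment> \<open>The defect in the integral equation, to be shown to vanish for almost every
      time.\<close>
    define q where "q t = A t + \<Psi> t - c" for t
    have qi: "integrable (tmeas T) q" unfolding q_def[abs_def] using Ai \<Psi>i by simp
    have "AE t in tmeas T. q t = 0"
    proof (rule tmeas_zero_AE[OF qi])
      fix h :: "real \<Rightarrow> real" assume h: "continuous_on UNIV h"
      have hm [measurable]: "h \<in> borel_measurable borel" using h by (rule borel_measurable_continuous_onI)
      obtain L where L: "L \<ge> 0" "\<And>t. t \<in> {0..T} \<Longrightarrow> \<bar>h t\<bar> \<le> L"
        "\<And>a b. a \<in> {0..T} \<Longrightarrow> b \<in> {0..T} \<Longrightarrow> \<bar>prim T h a - prim T h b\<bar> \<le> L * \<bar>a - b\<bar>"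
        using prim_lipschitz[OF h, of T] by blast
      \<comment> \<open>The tail integral of \<open>h\<close>. It arises when \<open>h\<close> is
        integrated against the time integral \<open>\<Psi>\<close>, and on \<open>[0, T]\<close> it
        coincides with the time factor \<open>prim T h\<close> of the test function.\<close>
      define \<theta> where "\<theta> t = (\<integral>r. indicator {t..} r * h r \<partial>tmeas T)" for t
      have hi: "integrable (tmeas T) h"
      proof (rule M.integrable_const_bound[of _ L])
        show "AE t in tmeas T. norm (h t) \<le> L"
          using AE_tmeas_bounds[of T] by eventually_elim (use L(2) in auto)
      qed simp
      have mul_h: "integrable (tmeas T) (\<lambda>t. h t * f t)" if f: "integrable (tmeas T) f" for f
      proof (rule Bochner_Integration.integrable_bound)
        show "integrable (tmeas T) (\<lambda>t. L * f t)" using f by simp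
        show "(\<lambda>t. h t * f t) \<in> borel_measurable (tmeas T)" using f by simp
        show "AE t in tmeas T. norm (h t * f t) \<le> norm (L * f t)"
          using AE_tmeas_bounds[of T]
        proof eventually_elim
          case (elim t)
          have "\<bar>h t\<bar> * \<bar>f t\<bar> \<le> L * \<bar>f t\<bar>" using elim by (intro mult_right_mono L(2)) auto
          then show ?case using L(1) by (simp add: abs_mult)
        qed
      qed
      define qq where "qq t r = indicator {0<..t} r * (h t * G r)" for t r :: real
      have Gm [measurable]: "G \<in> borel_measurable borel" using borel_measurable_integrable[OF Gi] by (simp cong: measurable_cong_sets)
      have qqm: "(\<lambda>(t, r). qq t r) \<in> borel_measurable (borel \<Otimes>\<^sub>M borel)"
      proof -
        have "(\<lambda>(t, r). qq t r) = (\<lambda>w. if 0 < snd w \<and> snd w \<le> fst w then h (fst w) * G (snd w) else 0)"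
          by (auto simp: qq_def indicator_def fun_eq_iff)
        then show ?thesis by simp
      qed
      interpret MM: pair_sigma_finite "tmeas T" "tmeas T" by (intro pair_sigma_finite.intro sigma_finite_tmeas)
      have qqi: "integrable (tmeas T \<Otimes>\<^sub>M tmeas T) (\<lambda>(t, r). qq t r)"
      proof (rule Bochner_Integration.integrable_bound)
        show "integrable (tmeas T \<Otimes>\<^sub>M tmeas T) (\<lambda>(t, r). h t * G r)"
          by (intro integrable_product_mult sigma_finite_tmeas hi Gi)
        show "(\<lambda>(t, r). qq t r) \<in> borel_measurable (tmeas T \<Otimes>\<^sub>M tmeas T)"
          using qqm by (simp cong: measurable_cong_sets)
      qed (auto simp: qq_def indicator_def)
      have "\<theta> \<in> borel_measurable borel"
      proof -
        have "(\<lambda>w. indicator {fst w..} (snd w) :: real) = (\<lambda>w::real \<times> real. if fst w \<le> snd w then 1 else 0)"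
          by (auto simp: indicator_def)
        then have [measurable]: "(\<lambda>w. indicator {fst w..} (snd w) :: real) \<in> borel_measurable (borel \<Otimes>\<^sub>M borel :: (real \<times> real) measure)" by simp
        have "(\<lambda>w. indicator {fst w..} (snd w) * h (snd w)) \<in> borel_measurable (borel \<Otimes>\<^sub>M tmeas T)" by measurable
        then show ?thesis unfolding \<theta>_def[abs_def]
          using M.borel_measurable_lebesgue_integral[of "\<lambda>t r. indicator {t..} r * h r" borel] by (simp add: case_prod_beta')
      qed
      then have \<theta>Gm: "(\<lambda>r. \<theta> r * G r) \<in> borel_measurable (tmeas T)" by simp
      have "(\<integral>t. h t * \<Psi> t \<partial>tmeas T) = (\<integral>t. (\<integral>r. qq t r \<partial>tmeas T) \<partial>tmeas T)"
      proof (intro Bochner_Integration.integral_cong refl)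
        fix t
        have "(\<integral>r. qq t r \<partial>tmeas T) = (\<integral>r. h t * (indicator {0<..t} r * G r) \<partial>tmeas T)"
          by (intro Bochner_Integration.integral_cong refl) (simp add: qq_def)
        then show "h t * \<Psi> t = (\<integral>r. qq t r \<partial>tmeas T)" by (simp add: \<Psi>_def)
      qed
      also have "\<dots> = (\<integral>r. (\<integral>t. qq t r \<partial>tmeas T) \<partial>tmeas T)"
        by (rule MM.Fubini_integral[OF qqi, symmetric])
      also have "\<dots> = (\<integral>r. \<theta> r * G r \<partial>tmeas T)"
      proof (rule integral_cong_AE)
        show m1: "(\<lambda>r. \<integral>t. qq t r \<partial>tmeas T) \<in> borel_measurable (tmeas T)"
          using MM.integrable_snd[OF qqi] by auto
        have ae: "(\<integral>t. qq t r \<partial>tmeas T) = \<theta> r * G r" if "0 < r" for r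
        proof -
          have "(\<integral>t. qq t r \<partial>tmeas T) = (\<integral>t. (indicator {r..} t * h t) * G r \<partial>tmeas T)"
            using that by (intro Bochner_Integration.integral_cong refl) (auto simp: qq_def indicator_def)
          then show ?thesis by (simp add: \<theta>_def)
        qed
        show "AE r in tmeas T. (\<integral>t. qq t r \<partial>tmeas T) = \<theta> r * G r"
          using AE_tmeas_bounds[of T] by eventually_elim (simp add: ae)
        show "(\<lambda>r. \<theta> r * G r) \<in> borel_measurable (tmeas T)" by (rule \<theta>Gm)
      qed
      finally have e1: "(\<integral>t. h t * \<Psi> t \<partial>tmeas T) = (\<integral>r. \<theta> r * G r \<partial>tmeas T)" .
      have \<theta>p: "prim T h t = \<theta> t" if "0 \<le> t" "t \<le> T" for t
        unfolding \<theta>_def by (rule prim_eq_tmeas[OF h that])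
      define \<xi> where "\<xi> t x = prim T h t * \<rho> (x - y)" for t x
      have \<xi>Y: "\<xi> \<in> Y_space s T"
        unfolding \<xi>_def[abs_def] by (rule test_function_in_Y_space[OF s T bump h])
      define k where "k w = (h (fst w) * \<rho> (snd w - y) + prim T h (fst w) * fl s \<rho> (snd w - y)) * v w + F w * (prim T h (fst w) * \<rho> (snd w - y))" for w
      have pm: "(\<lambda>t. indicator {0<..<T} t * prim T h t) \<in> borel_measurable borel"
      proof -
        have "continuous_on {0<..<T} (prim T h)"
          by (rule DERIV_continuous_on[of _ _ "\<lambda>t. - h t"]) (auto intro: DERIV_subset[OF prim_deriv[OF h]])
        then show ?thesis
          using borel_measurable_continuous_on_indicator[of "{0<..<T}" "prim T h"] by simp
      qed
      define P where "P t = indicator {0<..<T} t * prim T h t" for t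
      have Pm [measurable]: "P \<in> borel_measurable borel" unfolding P_def[abs_def] by (rule pm)
      define kk where "kk w = (h (fst w) * \<rho> (snd w - y) + P (fst w) * fl s \<rho> (snd w - y)) * v w + F w * (P (fst w) * \<rho> (snd w - y))" for w
      have kkm [measurable]: "kk \<in> borel_measurable borel" unfolding kk_def[abs_def] by measurable
      have "(LINT x|lebesgue. \<xi> 0 x * \<mu> x) = \<theta> 0 * c"
      proof -
        have [measurable]: "\<mu>' \<in> borel_measurable borel" by (rule \<mu>'(1))
        have "(LINT x|lebesgue. \<xi> 0 x * \<mu> x) = (LINT x|lebesgue. prim T h 0 * (\<rho> (x - y) * \<mu>' x))"
        proof (rule integral_cong_AE)
          have m: "(\<lambda>x. \<rho> (x - y)) \<in> borel_measurable lebesgue" by (rule measurable_completion) simp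
          show "(\<lambda>x. \<xi> 0 x * \<mu> x) \<in> borel_measurable lebesgue" using m \<mu> by (auto simp: \<xi>_def)
          show "(\<lambda>x. prim T h 0 * (\<rho> (x - y) * \<mu>' x)) \<in> borel_measurable lebesgue" by (rule measurable_completion) simp
          show "AE x in lebesgue. \<xi> 0 x * \<mu> x = prim T h 0 * (\<rho> (x - y) * \<mu>' x)"
            using AE_completion[OF \<mu>'(2)] by eventually_elim (simp add: \<xi>_def)
        qed
        also have "\<dots> = (LINT x|lborel. prim T h 0 * (\<rho> (x - y) * \<mu>' x))" by (rule integral_completion) simp
        also have "\<dots> = \<theta> 0 * c" using \<theta>p[of 0] T by (simp add: c_def corr_def)
        finally show ?thesis .
      qed
      moreover have "set_lebesgue_integral lebesgue (Q_upto T)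
             (\<lambda>(t, x). (- deriv (\<lambda>r. \<xi> r x) t + frac_lap s (\<xi> t) x) * u t x + t powr \<beta> * u t x powr p * \<xi> t x)
          = (\<integral>w. kk w \<partial>(tmeas T \<Otimes>\<^sub>M lborel))"
      proof -
        have m: "(\<lambda>w. indicator {0<..<T} (fst w) * kk w) \<in> borel_measurable lborel" by measurable
        have "set_lebesgue_integral lebesgue (Q_upto T)
             (\<lambda>(t, x). (- deriv (\<lambda>r. \<xi> r x) t + frac_lap s (\<xi> t) x) * u t x + t powr \<beta> * u t x powr p * \<xi> t x)
           = (\<integral>w. indicator {0<..<T} (fst w) * kk w \<partial>lebesgue)"
          unfolding set_lebesgue_integral_def
        proof (rule integral_cong_AE)
          show m2: "(\<lambda>w. indicator {0<..<T} (fst w) * kk w) \<in> borel_measurable lebesgue" by (rule measurable_completion[OF m])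
          have fd: "frac_lap s (\<xi> (fst w)) (snd w) = prim T h (fst w) * fl s \<rho> (snd w - y)"
            "deriv (\<lambda>r. \<xi> r (snd w)) (fst w) = - h (fst w) * \<rho> (snd w - y)"
            if True: "0 < fst w \<and> fst w < T" for w
          proof -
            have xiC: "C11 (\<bar>prim T h (fst w)\<bar> * C) (\<xi> (fst w))"
              unfolding \<xi>_def by (rule C11_cmult[OF C11_shift[OF \<rho>C]])
            show "frac_lap s (\<xi> (fst w)) (snd w) = prim T h (fst w) * fl s \<rho> (snd w - y)"
              unfolding frac_lap_eq_fl[OF s xiC] unfolding \<xi>_def fl_cmult fl_shift ..
            show "deriv (\<lambda>r. \<xi> r (snd w)) (fst w) = - h (fst w) * \<rho> (snd w - y)"
              unfolding \<xi>_def using True by (intro DERIV_imp_deriv DERIV_cmult_right prim_deriv[OF h]) auto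
          qed
          have pw: "indicator (Q_upto T) w *\<^sub>R (case w of (t, x) \<Rightarrow> (- deriv (\<lambda>r. \<xi> r x) t + frac_lap s (\<xi> t) x) * u t x + t powr \<beta> * u t x powr p * \<xi> t x)
              = indicator {0<..<T} (fst w) * kk w" if vw: "0 < fst w \<longrightarrow> v w = u (fst w) (snd w)" for w
          proof (cases "0 < fst w \<and> fst w < T")
            case True
            show ?thesis using fd[OF True] True vw
              by (simp add: case_prod_beta' kk_def P_def F_def \<xi>_def Q)
          next
            case False
            then have "w \<notin> Q_upto T" by (simp add: Q)
            then show ?thesis using False by simp
          qed
          show ae: "AE w in lebesgue. indicator (Q_upto T) w *\<^sub>R (case w of (t, x) \<Rightarrow> (- deriv (\<lambda>r. \<xi> r x) t + frac_lap s (\<xi> t) x) * u t x + t powr \<beta> * u t x powr p * \<xi> t x)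
              = indicator {0<..<T} (fst w) * kk w"
            using AE_completion[OF vu] by eventually_elim (rule pw)
          \<comment> \<open>Equality almost everywhere gives equal integrals only for measurable
            functions, so the original integrand is expressed through the Lebesgue measurable
            \<open>g\<close>.\<close>
          show "(\<lambda>w. indicator (Q_upto T) w *\<^sub>R (case w of (t, x) \<Rightarrow> (- deriv (\<lambda>r. \<xi> r x) t + frac_lap s (\<xi> t) x) * u t x + t powr \<beta> * u t x powr p * \<xi> t x)) \<in> borel_measurable lebesgue"
          proof -
            have [measurable]: "g \<in> borel_measurable lebesgue" by (rule gm)
            have a1 [measurable]: "(\<lambda>w. indicator {0<..<T} (fst w) * (h (fst w) * \<rho> (snd w - y) + P (fst w) * fl s \<rho> (snd w - y))) \<in> borel_measurable (lebesgue :: (real \<times> 'a) measure)"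
              by (rule measurable_completion) measurable
            have a2 [measurable]: "(\<lambda>w. indicator {0<..<T} (fst w) * (fst w powr \<beta> * (P (fst w) * \<rho> (snd w - y)))) \<in> borel_measurable (lebesgue :: (real \<times> 'a) measure)"
              by (rule measurable_completion) measurable
            have "indicator (Q_upto T) w *\<^sub>R (case w of (t, x) \<Rightarrow> (- deriv (\<lambda>r. \<xi> r x) t + frac_lap s (\<xi> t) x) * u t x + t powr \<beta> * u t x powr p * \<xi> t x)
              = (indicator {0<..<T} (fst w) * (h (fst w) * \<rho> (snd w - y) + P (fst w) * fl s \<rho> (snd w - y))) * g w +
                (indicator {0<..<T} (fst w) * (fst w powr \<beta> * (P (fst w) * \<rho> (snd w - y)))) * g w powr p" for w
            proof (cases "0 < fst w \<and> fst w < T")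
              case True
              then show ?thesis using fd[OF True] by (simp add: case_prod_beta' P_def g_def \<xi>_def Q Qi)
            next
              case False
              then have "w \<notin> Q_upto T" by (simp add: Q)
              then show ?thesis using False by simp
            qed
            then show ?thesis by simp
          qed
        qed
        also have "\<dots> = (\<integral>w. indicator {0<..<T} (fst w) * kk w \<partial>lborel)" by (rule integral_completion[OF m])
        also have "\<dots> = (\<integral>w. kk w \<partial>(tmeas T \<Otimes>\<^sub>M lborel))" by (rule integrable_pair_tmeas(2)[OF kkm, symmetric])
        finally show ?thesis .
      qed
      ultimately have e2: "(\<integral>w. kk w \<partial>(tmeas T \<Otimes>\<^sub>M lborel)) = \<theta> 0 * c"
        using idt[OF T \<xi>Y] by simp
      have Pb: "\<bar>P t\<bar> \<le> L * T" for t
      proof (cases "0 < t \<and> t < T")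
        case True
        have "prim T h T = 0" by (simp add: prim_def)
        moreover have "\<bar>prim T h t - prim T h T\<bar> \<le> L * \<bar>t - T\<bar>" using True by (intro L(3)) auto
        moreover have "L * \<bar>t - T\<bar> \<le> L * T" using True L(1) by (intro mult_left_mono) auto
        ultimately show ?thesis using True by (simp add: P_def)
      next
        case False then show ?thesis using L(1) T by (auto simp: P_def indicator_def)
      qed
      have bmul: "integrable (tmeas T \<Otimes>\<^sub>M lborel) (\<lambda>w. a w * f w)"
        if f: "integrable (tmeas T \<Otimes>\<^sub>M lborel) f" and am [measurable]: "a \<in> borel_measurable borel"
          and ab: "\<And>w. 0 < fst w \<Longrightarrow> fst w < T \<Longrightarrow> \<bar>a w\<bar> \<le> K" for a f :: "real \<times> 'a \<Rightarrow> real" and K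
      proof (rule Bochner_Integration.integrable_bound)
        show "integrable (tmeas T \<Otimes>\<^sub>M lborel) (\<lambda>w. K * f w)" using f by simp
        have [measurable]: "f \<in> borel_measurable (tmeas T \<Otimes>\<^sub>M lborel)" using f by auto
        have [measurable]: "a \<in> borel_measurable (tmeas T \<Otimes>\<^sub>M lborel)" unfolding pair_tmeas_eq using am by simp
        show "(\<lambda>w. a w * f w) \<in> borel_measurable (tmeas T \<Otimes>\<^sub>M lborel)" by measurable
        show "AE w in tmeas T \<Otimes>\<^sub>M lborel. norm (a w * f w) \<le> norm (K * f w)"
          using AE_pair_fst[OF AE_tmeas_bounds[of T] sigma_finite_lborel]
        proof eventually_elim
          case (elim w)
          have "\<bar>a w\<bar> * \<bar>f w\<bar> \<le> \<bar>K\<bar> * \<bar>f w\<bar>" using ab[of w] elim by (intro mult_right_mono) auto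
          then show ?case by (simp add: abs_mult)
        qed
      qed
      have k1: "integrable (tmeas T \<Otimes>\<^sub>M lborel) (\<lambda>w. (h (fst w) * \<rho> (snd w - y)) * v w)"
      proof (rule bmul[OF vi[OF T]])
        show "\<bar>h (fst w) * \<rho> (snd w - y)\<bar> \<le> L * C" if "0 < fst w" "fst w < T" for w :: "real \<times> 'a"
          unfolding abs_mult using that L(1) by (intro mult_mono L(2) C11_abs[OF \<rho>C]) auto
      qed measurable
      have k2: "integrable (tmeas T \<Otimes>\<^sub>M lborel) (\<lambda>w. (P (fst w) * fl s \<rho> (snd w - y)) * v w)"
      proof (rule bmul[OF vi[OF T]])
        show "\<bar>P (fst w) * fl s \<rho> (snd w - y)\<bar> \<le> L * T * (C * levy_mass TYPE('a) s)" for w :: "real \<times> 'a"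
          unfolding abs_mult using L(1) T by (intro mult_mono Pb flb) auto
      qed measurable
      have k3: "integrable (tmeas T \<Otimes>\<^sub>M lborel) (\<lambda>w. (P (fst w) * \<rho> (snd w - y)) * F w)"
      proof (rule bmul[OF Fii[OF T]])
        show "\<bar>P (fst w) * \<rho> (snd w - y)\<bar> \<le> L * T * C" for w :: "real \<times> 'a"
          unfolding abs_mult using L(1) T by (intro mult_mono Pb C11_abs[OF \<rho>C]) auto
      qed measurable
      have kk_eq: "kk w = (h (fst w) * \<rho> (snd w - y)) * v w + (P (fst w) * fl s \<rho> (snd w - y)) * v w + (P (fst w) * \<rho> (snd w - y)) * F w" for w
        by (simp add: kk_def algebra_simps)
      have kki: "integrable (tmeas T \<Otimes>\<^sub>M lborel) kk"
        unfolding kk_eq[abs_def] by (intro Bochner_Integration.integrable_add k1 k2 k3)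
      have PGi: "integrable (tmeas T) (\<lambda>t. P t * G t)"
      proof (rule Bochner_Integration.integrable_bound)
        show "integrable (tmeas T) (\<lambda>t. (L * T) * G t)" using Gi by simp
        show "AE t in tmeas T. norm (P t * G t) \<le> norm ((L * T) * G t)"
        proof (intro AE_I2)
          fix t
          have "\<bar>P t\<bar> * \<bar>G t\<bar> \<le> \<bar>L * T\<bar> * \<bar>G t\<bar>" using Pb[of t] by (intro mult_right_mono) auto
          then show "norm (P t * G t) \<le> norm ((L * T) * G t)" by (simp add: abs_mult)
        qed
      qed measurable
      \<comment> \<open>Integrating over space first separates the terms carrying \<open>h\<close>
        from those carrying its primitive.\<close>
      have "(\<integral>w. kk w \<partial>(tmeas T \<Otimes>\<^sub>M lborel)) = (\<integral>t. (\<integral>x. kk (t, x) \<partial>lborel) \<partial>tmeas T)"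
        by (rule integral_fst'[OF kki, symmetric])
      also have "\<dots> = (\<integral>t. h t * A t + P t * G t \<partial>tmeas T)"
      proof (rule integral_cong_AE)
        show "(\<lambda>t. \<integral>x. kk (t, x) \<partial>lborel) \<in> borel_measurable (tmeas T)" using integrable_fst'[OF kki] by auto
        show "(\<lambda>t. h t * A t + P t * G t) \<in> borel_measurable (tmeas T)" using mul_h[OF Ai] PGi by auto
        show "AE t in tmeas T. (\<integral>x. kk (t, x) \<partial>lborel) = h t * A t + P t * G t"
          using AE_integrable_fst'[OF vi[OF T]] AE_integrable_fst'[OF Fii[OF T]]
        proof eventually_elim
          case (elim t)
          have i1: "integrable lborel (\<lambda>x. \<rho> (x - y) * v (t, x))" by (rule corr_integrand_integrable[OF elim(1) \<rho>m C11_abs[OF \<rho>C]])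
          have i2: "integrable lborel (\<lambda>x. fl s \<rho> (x - y) * v (t, x))" by (rule corr_integrand_integrable[OF elim(1) fl_measurable[OF \<rho>m] flb])
          have i3: "integrable lborel (\<lambda>x. \<rho> (x - y) * F (t, x))" by (rule corr_integrand_integrable[OF elim(2) \<rho>m C11_abs[OF \<rho>C]])
          have "(\<integral>x. kk (t, x) \<partial>lborel) = (\<integral>x. h t * (\<rho> (x - y) * v (t, x)) + P t * (fl s \<rho> (x - y) * v (t, x)) + P t * (\<rho> (x - y) * F (t, x)) \<partial>lborel)"
            by (intro Bochner_Integration.integral_cong refl) (simp add: kk_eq)
          also have "\<dots> = h t * A t + P t * G t"
            using i1 i2 i3 by (simp add: A_def G_def corr_def distrib_left)
          finally show ?case .
        qed
      qed
      also have "\<dots> = (\<integral>t. h t * A t \<partial>tmeas T) + (\<integral>t. P t * G t \<partial>tmeas T)"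
        using mul_h[OF Ai] PGi by simp
      also have "(\<integral>t. P t * G t \<partial>tmeas T) = (\<integral>t. h t * \<Psi> t \<partial>tmeas T)"
        unfolding e1
      proof (rule integral_cong_AE)
        show "(\<lambda>t. P t * G t) \<in> borel_measurable (tmeas T)" using PGi by auto
        show "(\<lambda>t. \<theta> t * G t) \<in> borel_measurable (tmeas T)" by (rule \<theta>Gm)
        show "AE t in tmeas T. P t * G t = \<theta> t * G t"
          using AE_tmeas_bounds[of T] by eventually_elim (simp add: P_def \<theta>p)
      qed
      finally have e3: "\<theta> 0 * c = (\<integral>t. h t * A t \<partial>tmeas T) + (\<integral>t. h t * \<Psi> t \<partial>tmeas T)" using e2 by simp
      have e4: "\<theta> 0 = (\<integral>t. h t \<partial>tmeas T)"
        unfolding \<theta>_def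
      proof (rule integral_cong_AE)
        show "AE r in tmeas T. indicator {0..} r * h r = h r"
          using AE_tmeas_bounds[of T] by eventually_elim simp
      qed measurable
      have "(\<integral>t. h t * q t \<partial>tmeas T) = (\<integral>t. h t * A t + h t * \<Psi> t - h t * c \<partial>tmeas T)"
        by (intro Bochner_Integration.integral_cong refl) (simp add: q_def algebra_simps)
      also have "\<dots> = (\<integral>t. h t * A t \<partial>tmeas T) + (\<integral>t. h t * \<Psi> t \<partial>tmeas T) - (\<integral>t. h t \<partial>tmeas T) * c"
        using mul_h[OF Ai] mul_h[OF \<Psi>i] hi by simp
      finally show "(\<integral>t. h t * q t \<partial>tmeas T) = 0" using e3 e4 by simp
    qed
    then show "AE t in tmeas T. corr \<rho> (\<lambda>x. v (t, x)) y = corr \<rho> \<mu>' y -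
        (\<integral>r. indicator {0<..t} r * (corr (fl s \<rho>) (\<lambda>x. v (r, x)) y + corr \<rho> (\<lambda>x. F (r, x)) y) \<partial>tmeas T)"
      by eventually_elim (simp add: q_def A_def \<Psi>_def G_def c_def)
  qed
  show ?thesis
    by (rule that[of v]) (use vm v0 vu sol in \<open>auto simp: F_def[abs_def]\<close>)
qed

section \<open>Barriers\<close>

lemma integrable_tmeas:
  fixes f :: "real \<Rightarrow> real"
  assumes "f \<in> borel_measurable borel"
  shows "integrable (tmeas T) f \<longleftrightarrow> integrable lborel (\<lambda>t. indicator {0<..<T} t * f t)"
  unfolding tmeas_def using assms by (subst integrable_density) (auto simp: indicator_def)

text \<open>The absorption weight is integrable down to time 0 because
  \<open>\<beta> > -1\<close>.\<close>

lemma powr_integrable_tmeas: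
  assumes b: "\<beta> > -1" and T: "T > 0"
  shows "integrable (tmeas T) (\<lambda>t. t powr \<beta>)"
proof -
  have "(\<lambda>t. t powr \<beta>) absolutely_integrable_on {0..T}"
    using has_integral_powr_from_0[OF b, of T] T by (intro nonnegative_absolutely_integrable_1) auto
  then have "integrable lebesgue (\<lambda>t. indicator {0..T} t * t powr \<beta>)" by (simp add: set_integrable_def)
  then have "integrable lborel (\<lambda>t. indicator {0..T} t * t powr \<beta>)" by (subst (asm) integrable_completion) measurable
  then have "integrable lborel (\<lambda>t. indicator {0<..<T} t * t powr \<beta>)"
    by (rule Bochner_Integration.integrable_bound) (auto simp: indicator_def)
  then show ?thesis by (subst integrable_tmeas) measurable
qed

text \<open>Passes from \<open>tmeas\<close> to the gauge integral, in which the fundamental theorem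
  of calculus tolerates finitely many exceptional points.\<close>

lemma tmeas_integral_Icc:
  fixes f :: "real \<Rightarrow> real"
  assumes f: "integrable (tmeas T) f" and ab: "0 \<le> a" "a \<le> b" "b \<le> T"
  shows "(f has_integral (\<integral>r. indicator {a<..b} r * f r \<partial>tmeas T)) {a..b}"
proof -
  have fm [measurable]: "f \<in> borel_measurable borel" using borel_measurable_integrable[OF f] by (simp cong: measurable_cong_sets)
  have i: "integrable lborel (\<lambda>t. indicator {0<..<T} t * f t)" using f by (subst (asm) integrable_tmeas) auto
  have si: "set_integrable lborel {a..b} f"
    unfolding set_integrable_def
  proof (rule integrable_cong_AE_imp)
    show "integrable lborel (\<lambda>t. indicator {a..b} t * (indicator {0<..<T} t * f t))"
      by (rule Bochner_Integration.integrable_bound[OF i]) (auto simp: indicator_def)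
    show "AE t in lborel. indicator {a..b} t * (indicator {0<..<T} t * f t) = indicator {a..b} t *\<^sub>R f t"
      using AE_lborel_singleton[of 0] AE_lborel_singleton[of T]
      by eventually_elim (use ab in \<open>auto simp: indicator_def\<close>)
  qed measurable
  have "(\<integral>r. indicator {a<..b} r * f r \<partial>tmeas T) = (\<integral>r. indicator {0<..<T} r * (indicator {a<..b} r * f r) \<partial>lborel)"
    by (rule integral_tmeas) measurable
  also have "\<dots> = (LBINT r:{a..b}. f r)"
    unfolding set_lebesgue_integral_def
  proof (rule integral_cong_AE)
    show "AE r in lborel. indicator {0<..<T} r * (indicator {a<..b} r * f r) = indicator {a..b} r *\<^sub>R f r"
      using AE_lborel_singleton[of a] AE_lborel_singleton[of T]
      by eventually_elim (use ab in \<open>auto simp: indicator_def\<close>)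
  qed measurable
  also have "\<dots> = integral {a..b} f" by (rule set_borel_integral_eq_integral(2)[OF si])
  finally show ?thesis using set_borel_integral_eq_integral(1)[OF si] by (simp add: integrable_integral)
qed

text \<open>All barriers have the form \<open>a0 + a1 * f1 + a2 * f2\<close> with coefficients
  depending on time and profiles on space. The operator then acts on fixed profiles, and the
  integrated inequality reduces to a differential inequality off the finite set \<open>S\<close> of
  kinks.\<close>

lemma barrier_intro:
  fixes f1 f2 :: "'a::euclidean_space \<Rightarrow> real"
  assumes s: "0 < s" "s < 1" and T: "T > 0"
    and c: "continuous_on {0..T} a0" "continuous_on {0..T} a1" "continuous_on {0..T} a2"
    and am: "a0 \<in> borel_measurable borel" "a1 \<in> borel_measurable borel" "a2 \<in> borel_measurable borel"
    and C1: "C11 K1 f1" and C2: "C11 K2 f2" and S: "finite S"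
    and der: "\<And>t. 0 < t \<Longrightarrow> t < T \<Longrightarrow> t \<notin> S \<Longrightarrow> (a0 has_real_derivative da t) (at t)"
      "\<And>t. 0 < t \<Longrightarrow> t < T \<Longrightarrow> t \<notin> S \<Longrightarrow> (a1 has_real_derivative db t) (at t)"
      "\<And>t. 0 < t \<Longrightarrow> t < T \<Longrightarrow> t \<notin> S \<Longrightarrow> (a2 has_real_derivative dc t) (at t)"
    and Hm: "H \<in> borel_measurable borel" and Hi: "integrable (tmeas T \<Otimes>\<^sub>M lborel) H"
    and Ht: "\<And>x. integrable (tmeas T) (\<lambda>t. H (t, x))"
    and sub: "\<And>t x. 0 < t \<Longrightarrow> t < T \<Longrightarrow> t \<notin> S \<Longrightarrow>
       da t + db t * f1 x + dc t * f2 x + (a1 t * fl s f1 x + a2 t * fl s f2 x) + H (t, x) \<le> 0"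
  shows "\<exists>K. barrier s T K (\<lambda>w. a0 (fst w) + a1 (fst w) * f1 (snd w) + a2 (fst w) * f2 (snd w))
     (\<lambda>w. a1 (fst w) * fl s f1 (snd w) + a2 (fst w) * fl s f2 (snd w)) H"
proof -
  interpret M: finite_measure "tmeas T" by (rule finite_measure_tmeas)
  note [measurable] = am
  have [measurable]: "f1 \<in> borel_measurable borel" "f2 \<in> borel_measurable borel"
    using C11_measurable C1 C2 by blast+
  have bdd: "\<exists>A\<ge>0. \<forall>t\<in>{0..T}. \<bar>a t\<bar> \<le> A" if "continuous_on {0..T} a" for a :: "real \<Rightarrow> real"
  proof -
    have "bounded (a ` {0..T})" using that by (intro compact_imp_bounded compact_continuous_image) auto
    then obtain A where "\<forall>t\<in>{0..T}. \<bar>a t\<bar> \<le> A" unfolding bounded_iff by fastforce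
    then show ?thesis by (intro exI[of _ "max 0 A"]) force
  qed
  obtain A0 A1 A2 where A: "A0 \<ge> 0" "A1 \<ge> 0" "A2 \<ge> 0" "\<And>t. t \<in> {0..T} \<Longrightarrow> \<bar>a0 t\<bar> \<le> A0"
    "\<And>t. t \<in> {0..T} \<Longrightarrow> \<bar>a1 t\<bar> \<le> A1" "\<And>t. t \<in> {0..T} \<Longrightarrow> \<bar>a2 t\<bar> \<le> A2"
    using bdd[OF c(1)] bdd[OF c(2)] bdd[OF c(3)] by metis
  define K where "K = A0 + A1 * K1 + A2 * K2"
  have CB0: "C11 (\<bar>a0 t\<bar> + \<bar>a1 t\<bar> * K1 + \<bar>a2 t\<bar> * K2) (\<lambda>x. a0 t + a1 t * f1 x + a2 t * f2 x)" for t
    by (intro C11_add C11_const C11_cmult C1 C2)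
  have CB: "C11 K (\<lambda>x. a0 t + a1 t * f1 x + a2 t * f2 x)" if "0 \<le> t" "t \<le> T" for t
    by (rule C11_mono[OF CB0]) (use that C11_nonneg[OF C1] C11_nonneg[OF C2] in \<open>auto simp: K_def intro!: add_mono mult_right_mono A(4-6)\<close>)
  have flB: "fl s (\<lambda>x. a0 t + a1 t * f1 x + a2 t * f2 x) x = a1 t * fl s f1 x + a2 t * fl s f2 x" for t x
  proof -
    have "fl s (\<lambda>x. a0 t + a1 t * f1 x + a2 t * f2 x) x = fl s (\<lambda>x. a0 t + a1 t * f1 x) x + fl s (\<lambda>x. a2 t * f2 x) x"
      by (rule fl_add[OF s C11_add[OF C11_const C11_cmult[OF C1]] C11_cmult[OF C2]])
    also have "fl s (\<lambda>x. a0 t + a1 t * f1 x) x = fl s (\<lambda>x. a0 t) x + fl s (\<lambda>x. a1 t * f1 x) x"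
      by (rule fl_add[OF s C11_const C11_cmult[OF C1]])
    finally show ?thesis by (simp add: fl_cmult fl_const)
  qed
  have inc: "(a0 b + a1 b * f1 x + a2 b * f2 x) - (a0 a + a1 a * f1 x + a2 a * f2 x)
      \<le> - (\<integral>r. indicator {a<..b} r * ((a1 r * fl s f1 x + a2 r * fl s f2 x) + H (r, x)) \<partial>tmeas T)"
    if ab: "0 \<le> a" "a \<le> b" "b \<le> T" for x a b
  proof -
    define E where "E r = (a1 r * fl s f1 x + a2 r * fl s f2 x) + H (r, x)" for r
    define D where "D r = da r + db r * f1 x + dc r * f2 x" for r
    define B where "B r = a0 r + a1 r * f1 x + a2 r * f2 x" for r
    have "integrable (tmeas T) (\<lambda>r. a1 r * fl s f1 x + a2 r * fl s f2 x)"
    proof (rule M.integrable_const_bound)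
      show "AE r in tmeas T. norm (a1 r * fl s f1 x + a2 r * fl s f2 x) \<le> A1 * \<bar>fl s f1 x\<bar> + A2 * \<bar>fl s f2 x\<bar>"
        using AE_tmeas_bounds[of T]
      proof eventually_elim
        case (elim r)
        have "\<bar>a1 r * fl s f1 x + a2 r * fl s f2 x\<bar> \<le> \<bar>a1 r\<bar> * \<bar>fl s f1 x\<bar> + \<bar>a2 r\<bar> * \<bar>fl s f2 x\<bar>"
          unfolding abs_mult[symmetric] by (rule abs_triangle_ineq)
        also have "\<dots> \<le> A1 * \<bar>fl s f1 x\<bar> + A2 * \<bar>fl s f2 x\<bar>"
          using elim by (intro add_mono mult_right_mono A) auto
        finally show ?case by simp
      qed
    qed measurable
    then have Ei: "integrable (tmeas T) E" unfolding E_def using Ht by simp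
    have "(D has_integral (B b - B a)) {a..b}"
    proof (rule fundamental_theorem_of_calculus_interior_strong[OF S ab(2)])
      show "(B has_vector_derivative D t) (at t)" if "t \<in> {a<..<b} - S" for t
        unfolding has_real_derivative_iff_has_vector_derivative[symmetric] B_def[abs_def] D_def
        using der[of t] that ab by (auto intro!: derivative_eq_intros)
      show "continuous_on {a..b} B" unfolding B_def[abs_def]
        by (intro continuous_intros continuous_on_subset[OF c(1)] continuous_on_subset[OF c(2)] continuous_on_subset[OF c(3)]) (use ab in auto)
    qed
    then have "((\<lambda>t. if t \<in> S \<union> {a, b} then - E t else D t) has_integral (B b - B a)) {a..b}"
      by (rule has_integral_spike_finite[of "S \<union> {a, b}", rotated 2]) (use S in auto)
    moreover have "((\<lambda>t. - E t) has_integral - (\<integral>r. indicator {a<..b} r * E r \<partial>tmeas T)) {a..b}"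
      by (intro has_integral_neg tmeas_integral_Icc[OF Ei ab])
    ultimately have "B b - B a \<le> - (\<integral>r. indicator {a<..b} r * E r \<partial>tmeas T)"
    proof (rule has_integral_le)
      fix t assume t: "t \<in> {a..b}"
      show "(if t \<in> S \<union> {a, b} then - E t else D t) \<le> - E t"
        using sub[of t x] t ab by (auto simp: E_def D_def)
    qed
    then show ?thesis by (simp add: B_def E_def)
  qed
  have "barrier s T K (\<lambda>w. a0 (fst w) + a1 (fst w) * f1 (snd w) + a2 (fst w) * f2 (snd w))
     (\<lambda>w. a1 (fst w) * fl s f1 (snd w) + a2 (fst w) * fl s f2 (snd w)) H"
    unfolding barrier_def
  proof (intro conjI allI impI)
    show "H \<in> borel_measurable (borel \<Otimes>\<^sub>M borel)" using Hm by (simp add: borel_prod)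
    show "integrable (tmeas T \<Otimes>\<^sub>M lborel) H" by (rule Hi)
  qed (use CB flB inc in \<open>auto intro!: continuous_intros c\<close>)
  then show ?thesis by blast
qed

section \<open>Spatial cut-offs\<close>

definition outer :: "real \<Rightarrow> 'a::euclidean_space \<Rightarrow> real" where
  "outer R x = 1 - bump0 (x /\<^sub>R R)"

lemma outer_bounds: "0 \<le> outer R x" "outer R x \<le> 1"
  using bump0_bounds[of "x /\<^sub>R R"] by (auto simp: outer_def)

lemma outer_eq_1: "R > 0 \<Longrightarrow> R \<le> norm x \<Longrightarrow> outer R x = 1"
  by (simp add: outer_def bump0_zero divide_inverse[symmetric] field_simps)

lemma outer_C11:
  assumes "R > 0"
  shows "\<exists>K. C11 K (outer R :: 'a::euclidean_space \<Rightarrow> real)"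
proof -
  have "C11 (\<bar>1\<bar> + \<bar>-1\<bar> * (54 * max 1 (1 / R\<^sup>2))) (\<lambda>x::'a. 1 + (-1) * bump0 (x /\<^sub>R R))"
    by (intro C11_add C11_const C11_cmult C11_scale bump0_C11 assms)
  moreover have "(\<lambda>x::'a. 1 + (-1) * bump0 (x /\<^sub>R R)) = outer R" by (auto simp: outer_def)
  ultimately show ?thesis by metis
qed

text \<open>Scaling from the profile of radius 1, whose \<open>C11\<close> constant is
  \<open>55 = 1 + 54\<close>.\<close>

lemma outer_fl_bound:
  assumes s: "0 < s" "s < 1" and R: "R > 0"
  shows "\<bar>fl s (outer R) (x::'a::euclidean_space)\<bar> \<le> R powr (- (2 * s)) * (55 * levy_mass TYPE('a) s)"
proof -
  have "C11 (\<bar>1\<bar> + \<bar>-1\<bar> * 54) (\<lambda>x::'a. 1 + (-1) * bump0 x)"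
    by (intro C11_add C11_const C11_cmult bump0_C11)
  then have c: "C11 55 (\<lambda>x::'a. 1 - bump0 x)" by simp
  have "fl s (outer R) x = R powr (- (2 * s)) * fl s (\<lambda>x. 1 - bump0 x) (x /\<^sub>R R)"
    using fl_scale[OF R, of "\<lambda>x. 1 - bump0 x" s x] C11_measurable[OF c] by (simp add: outer_def[abs_def])
  then show ?thesis using fl_bound[OF s c, of "x /\<^sub>R R"] by (simp add: abs_mult mult_left_mono)
qed

lemma outer_tendsto: "(\<lambda>k. outer (real k) x) \<longlonglongrightarrow> 0"
proof -
  have "(\<lambda>k. (norm x / real k)\<^sup>2) \<longlonglongrightarrow> 0\<^sup>2" by (intro tendsto_power lim_const_over_n)
  then have "(\<lambda>k. 1 - (max 0 (1 - (norm x / real k)\<^sup>2))\<^sup>2) \<longlonglongrightarrow> 1 - (max 0 (1 - 0\<^sup>2))\<^sup>2"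
    by (intro tendsto_intros)
  then show ?thesis by (simp add: outer_def bump0_def divide_inverse mult.commute)
qed

text \<open>The factor 2 makes the positive part vanish on the unit ball, where
  \<open>bump0 (x /\<^sub>R 2)\<close> is at least 9/16. The outer square is there for the
  degenerate bound on second differences.\<close>

definition inner_cut :: "'a::euclidean_space \<Rightarrow> real" where
  "inner_cut x = (max 0 (1 - 2 * bump0 (x /\<^sub>R 2)))\<^sup>2"

lemma inner_cut_bounds: "0 \<le> inner_cut x" "inner_cut x \<le> 1"
  using bump0_bounds[of "x /\<^sub>R 2"] by (auto simp: inner_cut_def intro!: power_le_one)

lemma inner_cut_eq_1: "2 \<le> norm x \<Longrightarrow> inner_cut x = 1"
  by (simp add: inner_cut_def bump0_zero)

lemma inner_cut_eq_0:
  assumes "norm x \<le> 1"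
  shows "inner_cut x = 0"
proof -
  have "(norm x / 2)\<^sup>2 \<le> (1 / 2)\<^sup>2" using assms by (intro power_mono) auto
  then have "(3 / 4)\<^sup>2 \<le> (max 0 (1 - (norm x / 2)\<^sup>2))\<^sup>2" by (intro power_mono) (auto simp: power2_eq_square)
  then have "1 / 2 \<le> bump0 (x /\<^sub>R 2)" by (simp add: bump0_def power2_eq_square)
  then show ?thesis by (simp add: inner_cut_def)
qed

text \<open>The inner function \<open>1 - 2 * bump0 (x /\<^sub>R 2)\<close> has \<open>C11\<close>
  constant \<open>109 = 1 + 2 * 54\<close> and Lipschitz constant
  \<open>70 = 2 * 35\<close>.\<close>

lemma inner_cut_second_diff:
  obtains K C where "C11 K (inner_cut :: 'a::euclidean_space \<Rightarrow> real)" "0 \<le> C"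
    "\<And>x z :: 'a. second_diff inner_cut x z \<le> 2 * max 0 (1 - 2 * bump0 (x /\<^sub>R 2)) * (C * min 1 ((norm z)\<^sup>2))"
proof -
  define g where "g x = 1 - 2 * bump0 (x /\<^sub>R 2 :: 'a)" for x
  have "C11 (\<bar>1\<bar> + \<bar>-2\<bar> * (54 * max 1 (1 / 2\<^sup>2))) (\<lambda>x::'a. 1 + (-2) * bump0 (x /\<^sub>R 2))"
    by (intro C11_add C11_const C11_cmult C11_scale bump0_C11) simp
  then have gC: "C11 109 g" by (simp add: g_def[abs_def])
  have g1: "g x \<le> 1" for x using bump0_bounds[of "x /\<^sub>R 2"] by (simp add: g_def)
  have gL: "\<bar>g (x + z) - g x\<bar> \<le> 70 * min 1 (norm z)" for x z
  proof -
    have "\<bar>bump0 (x /\<^sub>R 2 + z /\<^sub>R 2) - bump0 (x /\<^sub>R 2)\<bar> \<le> 35 * min 1 (norm (z /\<^sub>R 2))" by (rule bump0_lipschitz)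
    also have "\<dots> \<le> 35 * min 1 (norm z)" by (intro mult_left_mono min.mono) auto
    finally show ?thesis by (simp add: g_def scaleR_right_distrib)
  qed
  have f: "inner_cut = (\<lambda>x::'a. (max 0 (g x))\<^sup>2)" by (auto simp: inner_cut_def g_def)
  show ?thesis
  proof (rule that[of _ 109])
    show "C11 (1 + 2 * 109 + 2 * 70\<^sup>2) (inner_cut :: 'a \<Rightarrow> real)"
      unfolding f by (rule pos_square_second_diff(1)[OF C11_continuous[OF gC] g1 C11_second_diff[OF gC] gL])
    show "second_diff inner_cut x z \<le> 2 * max 0 (1 - 2 * bump0 (x /\<^sub>R 2)) * (109 * min 1 ((norm z)\<^sup>2))" for x z :: 'a
      using pos_square_second_diff(2)[OF C11_continuous[OF gC] g1 C11_second_diff[OF gC] gL, of x z]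
      unfolding f by (simp add: g_def)
  qed simp
qed

text \<open>Since \<open>inner_cut\<close> is a square, its second differences are bounded above by a multiple of its
  square root. By AM-GM this root costs only half of the negative far-field contribution.\<close>

lemma inner_cut_fl:
  assumes s: "0 < s" "s < 1"
  obtains \<kappa> C where "0 < \<kappa>" "0 \<le> C" "\<And>x::'a::euclidean_space. fl s inner_cut x \<le> - \<kappa> + C * inner_cut x"
proof -
  obtain K C where KC: "C11 K (inner_cut :: 'a \<Rightarrow> real)" "0 \<le> C"
    "\<And>x z :: 'a. second_diff inner_cut x z \<le> 2 * max 0 (1 - 2 * bump0 (x /\<^sub>R 2)) * (C * min 1 ((norm z)\<^sup>2))"
    by (rule inner_cut_second_diff) blast
  define c where "c = frac_const DIM('a) s"
  have c: "c > 0" unfolding c_def by (rule frac_const_pos[OF s])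
  define m1 where "m1 = (\<integral>z. min 1 ((norm z)\<^sup>2) * levy s z \<partial>(lborel :: 'a measure))"
  define m4 where "m4 = (\<integral>z. indicator {z. norm z > 4} z * levy s z \<partial>(lborel :: 'a measure))"
  have i4: "integrable lborel (\<lambda>z::'a. indicator {z. norm z > 4} z * levy s z)"
    by (rule levy_away_integrable[OF s]) simp
  have m1: "0 \<le> m1" unfolding m1_def by (intro Bochner_Integration.integral_nonneg mult_nonneg_nonneg levy_nonneg) auto
  \<comment> \<open>The kernel is positive on a ball of radius 1 around a point at distance 5, which
    lies outside the closed ball of radius 4.\<close>
  have m4: "0 < m4"
  proof -
    have "0 \<le> m4" unfolding m4_def by (intro Bochner_Integration.integral_nonneg mult_nonneg_nonneg levy_nonneg) auto
    moreover have "m4 \<noteq> 0"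
    proof
      assume "m4 = 0"
      then have "AE z in lborel. indicator {z. norm z > 4} z * levy s (z::'a) = 0"
        using integral_nonneg_eq_0_iff_AE[OF i4] by (simp add: m4_def)
      then have "AE z in lborel. z \<notin> ball (5 *\<^sub>R (SOME b::'a. b \<in> Basis)) 1"
      proof eventually_elim
        case (elim z)
        let ?b = "SOME b::'a. b \<in> Basis"
        have nb: "norm (5 *\<^sub>R ?b) = 5" by (simp add: SOME_Basis)
        have "levy s z \<noteq> 0" if "norm z > 4" using that by (auto simp: levy_def)
        then have "\<not> norm z > 4" using elim by (auto simp: indicator_def)
        then show ?case using norm_triangle_ineq2[of "5 *\<^sub>R ?b" "5 *\<^sub>R ?b - z"] nb by (auto simp: dist_norm)
      qed
      then have "ball (5 *\<^sub>R (SOME b::'a. b \<in> Basis)) 1 \<in> null_sets lborel" by (subst AE_iff_null_sets) auto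
      then have "negligible (ball (5 *\<^sub>R (SOME b::'a. b \<in> Basis)) 1)" by (simp add: negligible_iff_null_sets null_sets_completionI)
      then show False using open_not_negligible[of "ball (5 *\<^sub>R (SOME b::'a. b \<in> Basis)) 1"] by simp
    qed
    ultimately show ?thesis by simp
  qed
  define a where "a = c * C * m1"
  define k0 where "k0 = c * m4"
  have k0: "0 < k0" using c m4 by (simp add: k0_def)
  \<comment> \<open>From a point with \<open>norm x \<le> 2\<close>, jumps longer than 4 in either
    direction end where \<open>inner_cut\<close> is 1 and contribute exactly
    \<open>2 * inner_cut x - 2\<close>. This is the negative far field; shorter jumps obey the
    degenerate bound.\<close>
  have near: "fl s inner_cut x \<le> a * max 0 (1 - 2 * bump0 (x /\<^sub>R 2)) - k0 + k0 * inner_cut x" if x: "norm x \<le> 2" for x :: 'a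
  proof -
    define h where "h = max 0 (1 - 2 * bump0 (x /\<^sub>R 2))"
    have h0: "0 \<le> h" by (simp add: h_def)
    have pw: "second_diff inner_cut x z * levy s z \<le> (2 * h * C) * (min 1 ((norm z)\<^sup>2) * levy s z) + (2 * inner_cut x - 2) * (indicator {z. norm z > 4} z * levy s z)" for z
    proof -
      have "second_diff inner_cut x z \<le> 2 * h * C * min 1 ((norm z)\<^sup>2) + (2 * inner_cut x - 2) * indicator {z. norm z > 4} z"
      proof (cases "norm z > 4")
        case True
        have "2 \<le> norm (x + z)" using norm_triangle_ineq2[of z "- x"] x True by (simp add: add.commute)
        moreover have "2 \<le> norm (x - z)" using norm_triangle_ineq2[of z x] x True by (simp add: norm_minus_commute)
        ultimately have "second_diff inner_cut x z = 2 * inner_cut x - 2" by (simp add: second_diff_def inner_cut_eq_1)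
        moreover have "0 \<le> 2 * h * C * min 1 ((norm z)\<^sup>2)" using h0 KC(2) by (intro mult_nonneg_nonneg) auto
        ultimately show ?thesis using True by simp
      next
        case False then show ?thesis using KC(3)[of x z] by (simp add: h_def mult.assoc)
      qed
      from mult_right_mono[OF this levy_nonneg[of s z]] show ?thesis by (simp add: distrib_right mult.assoc)
    qed
    have "(\<integral>z. second_diff inner_cut x z * levy s z \<partial>lborel) \<le> (\<integral>z. (2 * h * C) * (min 1 ((norm z)\<^sup>2) * levy s z) + (2 * inner_cut x - 2) * (indicator {z. norm z > 4} z * levy s z) \<partial>(lborel :: 'a measure))"
      by (rule integral_mono) (use pw in \<open>auto intro!: fl_integrable[OF s KC(1)] Bochner_Integration.integrable_add integrable_mult_right levy_mass_integrable s i4\<close>)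
    also have "\<dots> = (\<integral>z. (2 * h * C) * (min 1 ((norm z)\<^sup>2) * levy s z) \<partial>(lborel :: 'a measure)) + (\<integral>z. (2 * inner_cut x - 2) * (indicator {z. norm z > 4} z * levy s z) \<partial>(lborel :: 'a measure))"
      by (rule Bochner_Integration.integral_add) (intro integrable_mult_right levy_mass_integrable s i4)+
    also have "\<dots> = 2 * h * C * m1 + (2 * inner_cut x - 2) * m4"
      by (simp only: integral_mult_right_zero m1_def m4_def)
    finally have "c / 2 * (\<integral>z. second_diff inner_cut x z * levy s z \<partial>lborel) \<le> c / 2 * (2 * h * C * m1 + (2 * inner_cut x - 2) * m4)"
      using c by (intro mult_left_mono) auto
    then show ?thesis unfolding fl_def c_def[symmetric] a_def k0_def h_def[symmetric] by (simp add: algebra_simps)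
  qed
  define F where "F = K * levy_mass TYPE('a) s"
  \<comment> \<open>The first entry serves \<open>norm x \<le> 2\<close>; the second serves the
    rest, where \<open>inner_cut x = 1\<close> and any bounded quantity can be absorbed.\<close>
  define C' where "C' = max (k0 + a\<^sup>2 / (2 * k0)) (\<bar>F\<bar> + k0)"
  show ?thesis
  proof (rule that[of "k0 / 2" C'])
    show "0 < k0 / 2" using k0 by simp
    show "0 \<le> C'" using k0 by (simp add: C'_def le_max_iff_disj)
    fix x :: 'a
    show "fl s inner_cut x \<le> - (k0 / 2) + C' * inner_cut x"
    proof (cases "norm x \<le> 2")
      case True
      define h where "h = max 0 (1 - 2 * bump0 (x /\<^sub>R 2))"
      have hh: "h\<^sup>2 = inner_cut x" by (simp add: h_def inner_cut_def)
      \<comment> \<open>The inequality of means for \<open>a * h\<close> and \<open>k0\<close>: the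
        linear term in the root \<open>h\<close> costs \<open>k0 / 2\<close> plus a multiple of
        \<open>h^2 = inner_cut x\<close>.\<close>
      have "0 \<le> (a * h - k0)\<^sup>2" by simp
      then have "2 * k0 * (a * h) \<le> k0 * k0 + a\<^sup>2 * h\<^sup>2" by (simp add: power2_eq_square algebra_simps)
      then have "a * h \<le> k0 / 2 + a\<^sup>2 / (2 * k0) * h\<^sup>2" using k0 by (simp add: field_simps)
      then have "fl s inner_cut x \<le> - (k0 / 2) + (k0 + a\<^sup>2 / (2 * k0)) * inner_cut x"
        using near[OF True, folded h_def] unfolding hh by (simp add: distrib_right)
      also have "\<dots> \<le> - (k0 / 2) + C' * inner_cut x"
        using inner_cut_bounds(1)[of x] by (intro add_left_mono mult_right_mono) (auto simp: C'_def)
      finally show ?thesis .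
    next
      case False
      have "fl s inner_cut x \<le> \<bar>F\<bar>" using fl_bound[OF s KC(1), of x] by (simp add: F_def abs_le_iff)
      also have "\<dots> \<le> - (k0 / 2) + (\<bar>F\<bar> + k0)" using k0 by simp
      also have "\<dots> \<le> - (k0 / 2) + C'" by (simp add: C'_def)
      finally show ?thesis using False by (simp add: inner_cut_eq_1)
    qed
  qed
qed

text \<open>The spatially constant solution of \<open>U' + t powr \<beta> * U powr p = 0\<close> with \<open>U 0 = c\<close>.\<close>

definition decay :: "real \<Rightarrow> real \<Rightarrow> real \<Rightarrow> real \<Rightarrow> real" where
  "decay \<beta> p c t = (c powr (1 - p) + (p - 1) / (1 + \<beta>) * t powr (1 + \<beta>)) powr (- (1 / (p - 1)))"

lemma decay_measurable [measurable]: "decay \<beta> p c \<in> borel_measurable borel"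
  unfolding decay_def[abs_def] by measurable

text \<open>The formula for \<open>decay\<close> with the term \<open>c powr (1 - p)\<close>
  removed: \<open>flat_solution\<close> is formally the case of infinite initial value.\<close>

lemma flat_solution_eq:
  assumes bp: "\<beta> > -1" "p > 1" and t: "t > 0"
  shows "((p - 1) / (1 + \<beta>) * t powr (1 + \<beta>)) powr (- (1 / (p - 1))) = flat_solution \<beta> p t"
proof -
  have "((p - 1) / (1 + \<beta>) * t powr (1 + \<beta>)) powr (- (1 / (p - 1))) =
      ((p - 1) / (1 + \<beta>)) powr (- (1 / (p - 1))) * (t powr (1 + \<beta>)) powr (- (1 / (p - 1)))"
    by (rule powr_mult)
  moreover have "((p - 1) / (1 + \<beta>)) powr (- (1 / (p - 1))) = ((1 + \<beta>) / (p - 1)) powr (1 / (p - 1))"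
    using bp by (simp add: powr_divide powr_minus divide_simps)
  moreover have "(t powr (1 + \<beta>)) powr (- (1 / (p - 1))) = t powr (- ((1 + \<beta>) / (p - 1)))"
    by (simp add: powr_powr)
  ultimately show ?thesis by (simp only: flat_solution_def)
qed

context
  fixes \<beta> p c :: real
  assumes bp: "\<beta> > -1" "p > 1" and c: "c > 0"
begin

lemma decay_base: "c powr (1 - p) \<le> c powr (1 - p) + (p - 1) / (1 + \<beta>) * t powr (1 + \<beta>)"
  using bp by simp

lemma decay_base_pos: "0 < c powr (1 - p) + (p - 1) / (1 + \<beta>) * t powr (1 + \<beta>)"
  using decay_base[of t] c by (smt (verit) powr_gt_zero)

lemma decay_pos: "0 < decay \<beta> p c t"
  using decay_base_pos[of t] by (simp add: decay_def)

lemma powr_root: "(c powr (1 - p)) powr (- (1 / (p - 1))) = c"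
proof -
  have "(1 - p) * (- (1 / (p - 1))) = 1" using bp by (simp add: field_simps)
  then show ?thesis using c by (simp add: powr_powr)
qed

lemma decay_le: "decay \<beta> p c t \<le> c"
proof -
  have "decay \<beta> p c t \<le> (c powr (1 - p)) powr (- (1 / (p - 1)))"
    unfolding decay_def by (rule powr_mono2') (use bp c decay_base in auto)
  then show ?thesis by (simp add: powr_root)
qed

lemma decay_0: "decay \<beta> p c 0 = c"
  by (simp add: decay_def powr_root)

lemma decay_deriv:
  assumes t: "t > 0"
  shows "(decay \<beta> p c has_real_derivative - (t powr \<beta> * decay \<beta> p c t powr p)) (at t)"
proof -
  define E where "E t = c powr (1 - p) + (p - 1) / (1 + \<beta>) * t powr (1 + \<beta>)" for t
  have E0: "0 < E t" using decay_base_pos by (simp add: E_def)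
  have dE: "(E has_real_derivative (p - 1) * t powr \<beta>) (at t)"
    unfolding E_def[abs_def] using t bp by (auto intro!: derivative_eq_intros)
  have "((\<lambda>t. E t powr (- (1 / (p - 1)))) has_real_derivative (- (1 / (p - 1))) * E t powr (- (1 / (p - 1)) - 1) * ((p - 1) * t powr \<beta>)) (at t)"
    using DERIV_fun_powr[OF dE E0, of "- (1 / (p - 1))"] by simp
  moreover have "(- (1 / (p - 1))) * E t powr (- (1 / (p - 1)) - 1) * ((p - 1) * t powr \<beta>) = - (t powr \<beta> * decay \<beta> p c t powr p)"
  proof -
    have "- (1 / (p - 1)) - 1 = - (1 / (p - 1)) * p" using bp by (simp add: field_simps)
    then have "E t powr (- (1 / (p - 1)) - 1) = decay \<beta> p c t powr p"
      by (simp only: decay_def E_def powr_powr)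
    then show ?thesis using bp by simp
  qed
  ultimately show ?thesis by (simp add: decay_def[abs_def] E_def)
qed

lemma decay_continuous: "continuous_on {0..} (decay \<beta> p c)"
  unfolding decay_def[abs_def]
  by (intro continuous_on_powr' continuous_intros) (use bp decay_base_pos in \<open>auto simp: less_imp_neq[symmetric] less_imp_le\<close>)

lemma decay_le_flat:
  assumes "t > 0"
  shows "decay \<beta> p c t \<le> flat_solution \<beta> p t"
proof -
  have pos: "0 < (p - 1) / (1 + \<beta>) * t powr (1 + \<beta>)" using bp assms by simp
  have "decay \<beta> p c t \<le> ((p - 1) / (1 + \<beta>) * t powr (1 + \<beta>)) powr (- (1 / (p - 1)))"
    unfolding decay_def by (rule powr_mono2') (use bp pos in auto)
  also have "\<dots> = flat_solution \<beta> p t" by (rule flat_solution_eq[OF bp assms])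
  finally show ?thesis .
qed

end

lemma decay_tendsto_flat:
  assumes bp: "\<beta> > -1" "p > 1" and t: "t > 0"
  shows "(\<lambda>n. decay \<beta> p (real n) t) \<longlonglongrightarrow> flat_solution \<beta> p t"
proof -
  have pos: "0 < (p - 1) / (1 + \<beta>) * t powr (1 + \<beta>)" using bp t by simp
  have "(\<lambda>n. real n powr (1 - p)) \<longlonglongrightarrow> 0"
    by (rule tendsto_neg_powr) (use bp in \<open>auto intro: filterlim_real_sequentially\<close>)
  then have "(\<lambda>n. decay \<beta> p (real n) t) \<longlonglongrightarrow> (0 + (p - 1) / (1 + \<beta>) * t powr (1 + \<beta>)) powr (- (1 / (p - 1)))"
    unfolding decay_def by (intro tendsto_intros) (use pos in auto)
  then show ?thesis by (simp only: add_0_left flat_solution_eq[OF bp t])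
qed

section \<open>Differences of solutions\<close>

lemma corr_diff:
  assumes "integrable lborel (\<lambda>x. \<rho> (x - y) * f x)" "integrable lborel (\<lambda>x. \<rho> (x - y) * g x)"
  shows "corr \<rho> (\<lambda>x. f x - g x) y = corr \<rho> f y - corr \<rho> g y"
  using assms by (simp add: corr_def right_diff_distrib)

text \<open>Subtracting a solution from this one negates it, which turns a bound from below into an
  instance of the comparison.\<close>

lemma lin_sol_zero: "lin_sol s T (\<lambda>_. 0) (\<lambda>_. 0) (\<lambda>_. 0)"
  by (simp add: lin_sol_def corr_def)

text \<open>\<open>lin_sol\<close> is linear in solution, source and datum jointly, as the
  absorption enters it only as a given source.\<close>

lemma lin_sol_diff:
  fixes v1 v2 F1 F2 :: "real \<times> 'a::euclidean_space \<Rightarrow> real"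
  assumes s: "0 < s" "s < 1" and sol1: "lin_sol s T v1 F1 \<mu>1" and sol2: "lin_sol s T v2 F2 \<mu>2"
  shows "lin_sol s T (\<lambda>w. v1 w - v2 w) (\<lambda>w. F1 w - F2 w) (\<lambda>x. \<mu>1 x - \<mu>2 x)"
proof -
  interpret pair_sigma_finite "tmeas T" "lborel :: 'a measure" by (rule pair_sigma_finite_tmeas)
  have m1 [measurable]: "v1 \<in> borel_measurable (borel \<Otimes>\<^sub>M borel)" "F1 \<in> borel_measurable (borel \<Otimes>\<^sub>M borel)"
    and i1: "integrable (tmeas T \<Otimes>\<^sub>M lborel) v1" "integrable (tmeas T \<Otimes>\<^sub>M lborel) F1" "integrable lborel \<mu>1"
    and e1: "\<And>C r \<rho> y. bump_fn C r \<rho> \<Longrightarrow> AE t in tmeas T. corr \<rho> (\<lambda>x. v1 (t, x)) y = corr \<rho> \<mu>1 y -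
        (\<integral>r. indicator {0<..t} r * (corr (fl s \<rho>) (\<lambda>x. v1 (r, x)) y + corr \<rho> (\<lambda>x. F1 (r, x)) y) \<partial>tmeas T)"
    using sol1 unfolding lin_sol_def by blast+
  have m2 [measurable]: "v2 \<in> borel_measurable (borel \<Otimes>\<^sub>M borel)" "F2 \<in> borel_measurable (borel \<Otimes>\<^sub>M borel)"
    and i2: "integrable (tmeas T \<Otimes>\<^sub>M lborel) v2" "integrable (tmeas T \<Otimes>\<^sub>M lborel) F2" "integrable lborel \<mu>2"
    and e2: "\<And>C r \<rho> y. bump_fn C r \<rho> \<Longrightarrow> AE t in tmeas T. corr \<rho> (\<lambda>x. v2 (t, x)) y = corr \<rho> \<mu>2 y -
        (\<integral>r. indicator {0<..t} r * (corr (fl s \<rho>) (\<lambda>x. v2 (r, x)) y + corr \<rho> (\<lambda>x. F2 (r, x)) y) \<partial>tmeas T)"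
    using sol2 unfolding lin_sol_def by blast+
  show ?thesis unfolding lin_sol_def
  proof (intro conjI allI impI)
    show "(\<lambda>w. v1 w - v2 w) \<in> borel_measurable (borel \<Otimes>\<^sub>M borel)" "(\<lambda>w. F1 w - F2 w) \<in> borel_measurable (borel \<Otimes>\<^sub>M borel)"
      by measurable
    show "integrable (tmeas T \<Otimes>\<^sub>M lborel) (\<lambda>w. v1 w - v2 w)" "integrable (tmeas T \<Otimes>\<^sub>M lborel) (\<lambda>w. F1 w - F2 w)"
      "integrable lborel (\<lambda>x. \<mu>1 x - \<mu>2 x)" using i1 i2 by auto
    fix C r y and \<rho> :: "'a \<Rightarrow> real" assume bump: "bump_fn C r \<rho>"
    have \<rho>C: "C11 C \<rho>" by (rule bump_C11[OF bump])
    have \<rho>m [measurable]: "\<rho> \<in> borel_measurable borel" by (rule C11_measurable[OF \<rho>C])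
    have flb: "\<bar>fl s \<rho> x\<bar> \<le> C * levy_mass TYPE('a) s" for x by (rule fl_bound[OF s \<rho>C])
    note ci = corr_integrand_integrable[OF _ \<rho>m C11_abs[OF \<rho>C]] and ci' = corr_integrand_integrable[OF _ fl_measurable[OF \<rho>m] flb]
    note ti = corr_time_integrable[OF _ \<rho>m C11_abs[OF \<rho>C]] and ti' = corr_time_integrable[OF _ fl_measurable[OF \<rho>m] flb]
    define G1 where "G1 r = corr (fl s \<rho>) (\<lambda>x. v1 (r, x)) y + corr \<rho> (\<lambda>x. F1 (r, x)) y" for r
    define G2 where "G2 r = corr (fl s \<rho>) (\<lambda>x. v2 (r, x)) y + corr \<rho> (\<lambda>x. F2 (r, x)) y" for r
    define G where "G r = corr (fl s \<rho>) (\<lambda>x. v1 (r, x) - v2 (r, x)) y + corr \<rho> (\<lambda>x. F1 (r, x) - F2 (r, x)) y" for r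
    have G1i: "integrable (tmeas T) G1" unfolding G1_def[abs_def]
      by (intro Bochner_Integration.integrable_add ti'[OF i1(1)] ti[OF i1(2)])
    have G2i: "integrable (tmeas T) G2" unfolding G2_def[abs_def]
      by (intro Bochner_Integration.integrable_add ti'[OF i2(1)] ti[OF i2(2)])
    have d1: "integrable (tmeas T \<Otimes>\<^sub>M lborel) (\<lambda>w. v1 w - v2 w)" using i1 i2 by auto
    have d2: "integrable (tmeas T \<Otimes>\<^sub>M lborel) (\<lambda>w. F1 w - F2 w)" using i1 i2 by auto
    have Gi: "integrable (tmeas T) G" unfolding G_def[abs_def]
      using Bochner_Integration.integrable_add[OF ti'[OF d1, of y] ti[OF d2, of y]] by simp
    have Geq: "AE r in tmeas T. G r = G1 r - G2 r"
      using AE_integrable_fst'[OF i1(1)] AE_integrable_fst'[OF i1(2)] AE_integrable_fst'[OF i2(1)] AE_integrable_fst'[OF i2(2)]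
    proof eventually_elim
      case (elim r)
      show ?case
        using corr_diff[OF ci'[OF elim(1)] ci'[OF elim(3)]] corr_diff[OF ci[OF elim(2)] ci[OF elim(4)]]
        by (simp add: G_def G1_def G2_def)
    qed
    have ind: "integrable (tmeas T) (\<lambda>r. indicator {0<..t} r * g r)" if "integrable (tmeas T) g" for g :: "real \<Rightarrow> real" and t :: real
      by (rule Bochner_Integration.integrable_bound[OF that]) (use that in \<open>auto simp: indicator_def\<close>)
    have int_eq: "(\<integral>r. indicator {0<..t} r * G r \<partial>tmeas T) = (\<integral>r. indicator {0<..t} r * G1 r \<partial>tmeas T) - (\<integral>r. indicator {0<..t} r * G2 r \<partial>tmeas T)" for t
    proof -
      have "(\<integral>r. indicator {0<..t} r * G r \<partial>tmeas T) = (\<integral>r. indicator {0<..t} r * G1 r - indicator {0<..t} r * G2 r \<partial>tmeas T)"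
      proof (rule integral_cong_AE)
        show "(\<lambda>r. indicator {0<..t} r * G r) \<in> borel_measurable (tmeas T)" using ind[OF Gi] by auto
        show "(\<lambda>r. indicator {0<..t} r * G1 r - indicator {0<..t} r * G2 r) \<in> borel_measurable (tmeas T)"
          using ind[OF G1i, of t] ind[OF G2i, of t] by auto
        show "AE r in tmeas T. indicator {0<..t} r * G r = indicator {0<..t} r * G1 r - indicator {0<..t} r * G2 r"
          using Geq by eventually_elim (simp add: right_diff_distrib)
      qed
      then show ?thesis using ind[OF G1i, of t] ind[OF G2i, of t] by simp
    qed
    have \<mu>e: "corr \<rho> (\<lambda>x. \<mu>1 x - \<mu>2 x) y = corr \<rho> \<mu>1 y - corr \<rho> \<mu>2 y"
      by (rule corr_diff[OF ci[OF i1(3)] ci[OF i2(3)]])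
    show "AE t in tmeas T. corr \<rho> (\<lambda>x. v1 (t, x) - v2 (t, x)) y = corr \<rho> (\<lambda>x. \<mu>1 x - \<mu>2 x) y -
        (\<integral>r. indicator {0<..t} r * (corr (fl s \<rho>) (\<lambda>x. v1 (r, x) - v2 (r, x)) y + corr \<rho> (\<lambda>x. F1 (r, x) - F2 (r, x)) y) \<partial>tmeas T)"
      using e1[OF bump, of y] e2[OF bump, of y] AE_integrable_fst'[OF i1(1)] AE_integrable_fst'[OF i2(1)]
    proof eventually_elim
      case (elim t)
      show ?case
        using corr_diff[OF ci[OF elim(3)] ci[OF elim(4)], of y] elim(1,2) \<mu>e int_eq[of t]
        unfolding G_def G1_def G2_def by simp
    qed
  qed
qed

lemma AE_all_times:
  assumes "\<And>n::nat. AE w in lborel. 0 < fst w \<and> fst w < real (Suc n) \<longrightarrow> P w"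
  shows "AE w in lborel. 0 < (fst w :: real) \<longrightarrow> P w"
proof -
  have "AE w in lborel. \<forall>n::nat. 0 < fst w \<and> fst w < real (Suc n) \<longrightarrow> P w"
    using assms by (subst AE_all_countable) blast
  then show ?thesis
  proof eventually_elim
    case (elim w)
    obtain n :: nat where "fst w < real n" using reals_Archimedean2 by blast
    then show ?case using elim[rule_format, of n] by auto
  qed
qed

lemma C11_zero: "C11 0 (\<lambda>_. 0)"
  using C11_const[of 0] by simp

text \<open>With this barrier the comparison compares two solutions with each other.\<close>

lemma barrier_zero:
  assumes "0 < s" "s < 1"
  shows "barrier s T 0 (\<lambda>_. 0) (\<lambda>_. 0) (\<lambda>_. 0)"
  by (simp add: barrier_def fl_const C11_zero)

section \<open>Comparison of weak solutions with flat solutions\<close>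

text \<open>The difference of the two solutions is compared with the zero barrier; the sign
  condition is the monotonicity of \<open>r powr p\<close>. Applied to a single datum from both
  sides it also gives uniqueness.\<close>

lemma weak_comparison:
  fixes u1 u2 :: "real \<Rightarrow> 'a::euclidean_space \<Rightarrow> real"
  assumes s: "0 < s" "s < 1" and p: "p > 1"
    and ws1: "weak_solution s \<beta> p \<mu>1 u1" and ws2: "weak_solution s \<beta> p \<mu>2 u2"
    and \<mu>: "integrable lebesgue \<mu>1" "integrable lebesgue \<mu>2" and le: "AE x in lborel. \<mu>1 x \<le> \<mu>2 x"
  shows "AE w in lborel. 0 < fst w \<longrightarrow> u1 (fst w) (snd w) \<le> u2 (fst w) (snd w)"
proof -
  obtain \<mu>1' where \<mu>1': "\<mu>1' \<in> borel_measurable lborel" "AE x in lborel. \<mu>1 x = \<mu>1' x"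
    using completion_ex_borel_measurable_real[OF borel_measurable_integrable[OF \<mu>(1)]] by blast
  obtain \<mu>2' where \<mu>2': "\<mu>2' \<in> borel_measurable lborel" "AE x in lborel. \<mu>2 x = \<mu>2' x"
    using completion_ex_borel_measurable_real[OF borel_measurable_integrable[OF \<mu>(2)]] by blast
  obtain v1 where v1: "v1 \<in> borel_measurable borel" "\<And>w. 0 \<le> v1 w"
    "AE w in lborel. 0 < fst w \<longrightarrow> v1 w = u1 (fst w) (snd w)"
    "\<And>T. T > 0 \<Longrightarrow> lin_sol s T v1 (\<lambda>w. fst w powr \<beta> * v1 w powr p) \<mu>1'"
    using weak_solution_lin_sol[OF s ws1 \<mu>(1) _ \<mu>1'(2)] \<mu>1'(1) by auto
  obtain v2 where v2: "v2 \<in> borel_measurable borel" "\<And>w. 0 \<le> v2 w"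
    "AE w in lborel. 0 < fst w \<longrightarrow> v2 w = u2 (fst w) (snd w)"
    "\<And>T. T > 0 \<Longrightarrow> lin_sol s T v2 (\<lambda>w. fst w powr \<beta> * v2 w powr p) \<mu>2'"
    using weak_solution_lin_sol[OF s ws2 \<mu>(2) _ \<mu>2'(2)] \<mu>2'(1) by auto
  obtain \<rho> :: "nat \<Rightarrow> 'a \<Rightarrow> real" where mol: "mollifier \<rho>" using mollifier_exists by blast
  have "AE w in lborel. 0 < fst w \<and> fst w < T \<longrightarrow> v1 w - v2 w \<le> 0" if T: "T > 0" for T
  proof -
    let ?N = "tmeas T \<Otimes>\<^sub>M (lborel :: 'a measure)"
    note sol = lin_sol_diff[OF s v1(4)[OF T] v2(4)[OF T]]
    have vi: "integrable ?N (\<lambda>w. v1 w - v2 w)" using sol unfolding lin_sol_def by blast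
    have "AE w in ?N. (v1 w - v2 w) + 0 \<le> 0"
    proof (rule comparison[OF s T sol barrier_zero[OF s] mol])
      show "AE x in lborel. \<mu>1' x - \<mu>2' x + 0 \<le> 0" using le \<mu>1'(2) \<mu>2'(2) by eventually_elim simp
      show "integrable ?N (\<lambda>w. max 0 (v1 w - v2 w + 0))"
      proof (rule Bochner_Integration.integrable_bound[OF vi])
        show "(\<lambda>w. max 0 (v1 w - v2 w + 0)) \<in> borel_measurable ?N"
          using borel_measurable_max[OF borel_measurable_integrable[OF vi] borel_measurable_const[of 0]] by simp
      qed (simp add: max_def)
      show "AE w in ?N. v1 w - v2 w + 0 > 0 \<longrightarrow> 0 \<le> fst w powr \<beta> * v1 w powr p - fst w powr \<beta> * v2 w powr p + 0"
      proof (intro AE_I2 impI)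
        fix w assume "v1 w - v2 w + 0 > 0"
        then have "v2 w powr p \<le> v1 w powr p" using v2(2)[of w] p by (intro powr_mono2) auto
        then have "fst w powr \<beta> * v2 w powr p \<le> fst w powr \<beta> * v1 w powr p" by (intro mult_left_mono) auto
        then show "0 \<le> fst w powr \<beta> * v1 w powr p - fst w powr \<beta> * v2 w powr p + 0" by simp
      qed
    qed
    then show ?thesis by (simp add: AE_pair_tmeas)
  qed
  then have "AE w in lborel. 0 < fst w \<longrightarrow> v1 w - v2 w \<le> 0" by (intro AE_all_times) simp
  then show ?thesis using v1(3) v2(3) by eventually_elim auto
qed

text \<open>The supersolution \<open>U + (c - U) * outer R + k R * t\<close> lies between
  \<open>U\<close> and the constant \<open>c\<close> apart from its last term, which pays for the
  cut-off. It is sent to \<open>U\<close> by letting \<open>R\<close> tend to infinity at fixed time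
  and place.\<close>

lemma weak_upper:
  fixes u :: "real \<Rightarrow> 'a::euclidean_space \<Rightarrow> real"
  assumes s: "0 < s" "s < 1" and bp: "\<beta> > -1" "p > 1" and ws: "weak_solution s \<beta> p \<mu> u"
    and \<mu>: "integrable lebesgue \<mu>" and c: "c > 0" and le: "AE x in lborel. \<mu> x \<le> c"
  shows "AE w in lborel. 0 < fst w \<longrightarrow> u (fst w) (snd w) \<le> decay \<beta> p c (fst w)"
proof -
  obtain \<mu>' where \<mu>': "\<mu>' \<in> borel_measurable lborel" "AE x in lborel. \<mu> x = \<mu>' x"
    using completion_ex_borel_measurable_real[OF borel_measurable_integrable[OF \<mu>]] by blast
  obtain v where v: "v \<in> borel_measurable borel" "\<And>w. 0 \<le> v w"
    "AE w in lborel. 0 < fst w \<longrightarrow> v w = u (fst w) (snd w)"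
    "\<And>T. T > 0 \<Longrightarrow> lin_sol s T v (\<lambda>w. fst w powr \<beta> * v w powr p) \<mu>'"
    using weak_solution_lin_sol[OF s ws \<mu> _ \<mu>'(2)] \<mu>'(1) by auto
  obtain \<rho> :: "nat \<Rightarrow> 'a \<Rightarrow> real" where mol: "mollifier \<rho>" using mollifier_exists by blast
  define U where "U = decay \<beta> p c"
  have Um [measurable]: "U \<in> borel_measurable borel" unfolding U_def by measurable
  have U: "0 < U t" "U t \<le> c" for t using decay_pos[OF bp c] decay_le[OF bp c] by (auto simp: U_def)
  \<comment> \<open>A bound for \<open>(c - U)\<close> times the fractional Laplacian of the
    cut-off; the term \<open>k R * t\<close> in the barrier compensates it.\<close>
  define k where "k R = c * (R powr (- (2 * s)) * (55 * levy_mass TYPE('a) s))" for R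
  have k0: "0 \<le> k R" for R using c levy_mass_nonneg[OF s, where 'a='a] by (simp add: k_def)
  have main: "AE w in lborel. 0 < fst w \<and> fst w < T \<longrightarrow> v w \<le> U (fst w) + (c - U (fst w)) * outer R (snd w) + k R * fst w"
    if T: "T > 0" and R: "R > 0" for T R
  proof -
    let ?N = "tmeas T \<Otimes>\<^sub>M (lborel :: 'a measure)"
    obtain Ko where Ko: "C11 Ko (outer R :: 'a \<Rightarrow> real)" using outer_C11[OF R] by blast
    have [measurable]: "(outer R :: 'a \<Rightarrow> real) \<in> borel_measurable borel" by (rule C11_measurable[OF Ko])
    have fstm [measurable]: "(fst :: real \<times> 'a \<Rightarrow> real) \<in> borel_measurable borel" "(snd :: real \<times> 'a \<Rightarrow> 'a) \<in> borel_measurable borel"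
      by (intro borel_measurable_continuous_onI continuous_intros)+
    \<comment> \<open>The absorption of \<open>U\<close> with negative sign, weighted by
      \<open>1 - outer R\<close>. It cancels the time derivative of the cut-off flat part exactly,
      and its compact support in space makes it integrable.\<close>
    define H where "H w = - (fst w powr \<beta> * U (fst w) powr p) * (1 - outer R (snd w))" for w :: "real \<times> 'a"
    have Hm: "H \<in> borel_measurable borel" unfolding H_def[abs_def] by measurable
    have tU: "integrable (tmeas T) (\<lambda>t. - (t powr \<beta> * U t powr p))"
    proof (rule Bochner_Integration.integrable_bound)
      show "integrable (tmeas T) (\<lambda>t. c powr p * t powr \<beta>)" using powr_integrable_tmeas[OF bp(1) T] by simp
      show "AE t in tmeas T. norm (- (t powr \<beta> * U t powr p)) \<le> norm (c powr p * t powr \<beta>)"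
      proof (intro AE_I2)
        fix t
        have "U t powr p \<le> c powr p" using U[of t] bp by (intro powr_mono2) auto
        then show "norm (- (t powr \<beta> * U t powr p)) \<le> norm (c powr p * t powr \<beta>)"
          using mult_left_mono[of "U t powr p" "c powr p" "t powr \<beta>"] by (simp add: abs_mult mult.commute)
      qed
    qed measurable
    obtain Cb where "bump_fn Cb R (\<lambda>x::'a. 1 * bump0 (x /\<^sub>R R))" using bump0_scaled_bump_fn[OF R, of 1] by auto
    from bump_integrable[OF this] have oi: "integrable lborel (\<lambda>x::'a. 1 - outer R x)" by (simp add: outer_def)
    have Hi: "integrable ?N H"
      using integrable_product_mult[OF sigma_finite_tmeas sigma_finite_lborel tU oi] by (simp add: H_def[abs_def] case_prod_beta')
    have Ht: "integrable (tmeas T) (\<lambda>t. H (t, x))" for x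
      using integrable_mult_left[OF tU, of "1 - outer R x"] by (simp add: H_def)
    have Uc: "continuous_on {0..T} U" unfolding U_def by (rule continuous_on_subset[OF decay_continuous[OF bp c]]) auto
    have Ud: "(U has_real_derivative - (t powr \<beta> * U t powr p)) (at t)" if "t > 0" for t
      unfolding U_def by (rule decay_deriv[OF bp c that])
    \<comment> \<open>Only one spatial profile is needed, so the second slot of
      \<open>barrier_intro\<close> is filled with coefficient 0.\<close>
    have "\<exists>K. barrier s T K (\<lambda>w. - (U (fst w) + k R * fst w) + - (c - U (fst w)) * outer R (snd w) + 0 * outer R (snd w))
      (\<lambda>w. - (c - U (fst w)) * fl s (outer R) (snd w) + 0 * fl s (outer R) (snd w)) H"
    proof (rule barrier_intro[OF s T _ _ _ _ _ _ Ko Ko finite.emptyI _ _ _ Hm Hi Ht, where dc = "\<lambda>_. 0"])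
      show "continuous_on {0..T} (\<lambda>t. - (U t + k R * t))" "continuous_on {0..T} (\<lambda>t. - (c - U t))" "continuous_on {0..T} (\<lambda>t. 0::real)"
        by (intro continuous_intros Uc)+
      show "((\<lambda>t. - (U t + k R * t)) has_real_derivative t powr \<beta> * U t powr p - k R) (at t)" if "0 < t" for t
        by (rule derivative_eq_intros Ud[OF that] | simp)+
      show "((\<lambda>t. - (c - U t)) has_real_derivative - (t powr \<beta> * U t powr p)) (at t)" if "0 < t" for t
        by (rule derivative_eq_intros Ud[OF that] | simp)+
      fix t :: real and x :: 'a assume "0 < t"
      have "\<bar>(c - U t) * fl s (outer R) x\<bar> \<le> c * (R powr (- (2 * s)) * (55 * levy_mass TYPE('a) s))"
        unfolding abs_mult using U[of t] c by (intro mult_mono outer_fl_bound[OF s R]) auto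
      then have "- (c - U t) * fl s (outer R) x \<le> k R" unfolding k_def mult_minus_left by linarith
      then show "t powr \<beta> * U t powr p - k R + - (t powr \<beta> * U t powr p) * outer R x + 0 * outer R x +
          (- (c - U t) * fl s (outer R) x + 0 * fl s (outer R) x) + H (t, x) \<le> 0"
        by (simp add: H_def algebra_simps)
    qed measurable
    then obtain K where bar: "barrier s T K (\<lambda>w. - (U (fst w) + k R * fst w) + - (c - U (fst w)) * outer R (snd w) + 0 * outer R (snd w))
      (\<lambda>w. - (c - U (fst w)) * fl s (outer R) (snd w) + 0 * fl s (outer R) (snd w)) H" by blast
    define B where "B = (\<lambda>w::real \<times> 'a. - (U (fst w) + k R * fst w) + - (c - U (fst w)) * outer R (snd w) + 0 * outer R (snd w))"
    have Bm [measurable]: "B \<in> borel_measurable borel" unfolding B_def by measurable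
    have BU: "B w \<le> - U (fst w)" if "0 < fst w" for w
    proof -
      have "0 \<le> k R * fst w" "0 \<le> (c - U (fst w)) * outer R (snd w)"
        using that k0[of R] U[of "fst w"] outer_bounds[of R "snd w"] by auto
      then show ?thesis unfolding B_def mult_minus_left mult_zero_left by linarith
    qed
    have bnd: "AE w in ?N. 0 < fst w \<and> fst w < T" by (rule AE_pair_fst[OF AE_tmeas_bounds sigma_finite_lborel])
    have vi: "integrable ?N v" using v(4)[OF T] unfolding lin_sol_def by blast
    have "AE w in ?N. v w + B w \<le> 0"
    proof (rule comparison[OF s T v(4)[OF T] bar[folded B_def] mol])
      show "AE x in lborel. \<mu>' x + B (0, x) \<le> 0"
        using le \<mu>'(2) by eventually_elim (simp add: B_def U_def decay_0[OF bp c])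
      show "integrable ?N (\<lambda>w. max 0 (v w + B w))"
      proof (rule Bochner_Integration.integrable_bound[OF vi])
        show "(\<lambda>w. max 0 (v w + B w)) \<in> borel_measurable ?N" unfolding pair_tmeas_eq using v(1) by simp
        show "AE w in ?N. norm (max 0 (v w + B w)) \<le> norm (v w)"
          using bnd
        proof eventually_elim
          case (elim w)
          then show ?case using BU[of w] U(1)[of "fst w"] v(2)[of w] by (simp add: max_def)
        qed
      qed
      show "AE w in ?N. v w + B w > 0 \<longrightarrow> 0 \<le> fst w powr \<beta> * v w powr p + H w"
        using bnd
      proof eventually_elim
        case (elim w)
        show ?case
        proof
          assume "v w + B w > 0"
          then have "U (fst w) \<le> v w" using BU[of w] elim by simp
          then have "U (fst w) powr p \<le> v w powr p" using U(1)[of "fst w"] bp by (intro powr_mono2) auto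
          then have a: "fst w powr \<beta> * U (fst w) powr p \<le> fst w powr \<beta> * v w powr p" by (intro mult_left_mono) auto
          have "fst w powr \<beta> * U (fst w) powr p * (1 - outer R (snd w)) \<le> fst w powr \<beta> * U (fst w) powr p"
            using outer_bounds[of R "snd w"] by (intro mult_right_le_one_le) auto
          with a show "0 \<le> fst w powr \<beta> * v w powr p + H w" by (simp add: H_def)
        qed
      qed
    qed
    then have "AE w in lborel. 0 < fst w \<and> fst w < T \<longrightarrow> v w + B w \<le> 0" by (simp add: AE_pair_tmeas)
    then show ?thesis
    proof eventually_elim
      case (elim w)
      show ?case
      proof
        assume "0 < fst w \<and> fst w < T"
        with elim have "v w + B w \<le> 0" by blast
        then show "v w \<le> U (fst w) + (c - U (fst w)) * outer R (snd w) + k R * fst w"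
          unfolding B_def mult_minus_left mult_zero_left by linarith
      qed
    qed
  qed
  \<comment> \<open>Radii are restricted to the integers so that countably many exceptional null
    sets can be united before the limit.\<close>
  have "AE w in lborel. 0 < fst w \<longrightarrow> v w \<le> U (fst w) + (c - U (fst w)) * outer (real (Suc m)) (snd w) + k (real (Suc m)) * fst w" for m
    by (rule AE_all_times, rule main) auto
  then have "AE w in lborel. \<forall>m. 0 < fst w \<longrightarrow> v w \<le> U (fst w) + (c - U (fst w)) * outer (real (Suc m)) (snd w) + k (real (Suc m)) * fst w"
    by (subst AE_all_countable) blast
  then show ?thesis
    using v(3)
  proof eventually_elim
    case (elim w)
    have "(\<lambda>m. c * (real m powr (- (2 * s)) * (55 * levy_mass TYPE('a) s))) \<longlonglongrightarrow> c * (0 * (55 * levy_mass TYPE('a) s))"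
      by (intro tendsto_intros tendsto_neg_powr filterlim_real_sequentially) (use s in auto)
    then have "(\<lambda>m. k (real m)) \<longlonglongrightarrow> 0" by (simp add: k_def)
    then have "(\<lambda>m. U (fst w) + (c - U (fst w)) * outer (real m) (snd w) + k (real m) * fst w) \<longlonglongrightarrow> U (fst w) + (c - U (fst w)) * 0 + 0 * fst w"
      by (intro tendsto_intros outer_tendsto)
    from LIMSEQ_Suc[OF this] have lim: "(\<lambda>m. U (fst w) + (c - U (fst w)) * outer (real (Suc m)) (snd w) + k (real (Suc m)) * fst w) \<longlonglongrightarrow> U (fst w)"
      by simp
    show ?case
    proof
      assume w: "0 < fst w"
      have "v w \<le> U (fst w)"
        by (rule LIMSEQ_le_const[OF lim]) (use elim(1) w in auto)
      then show "u (fst w) (snd w) \<le> decay \<beta> p c (fst w)" using elim w by (simp add: U_def)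
    qed
  qed
qed

text \<open>The subsolution is \<open>(1 - f) * b + f * a - c * outer R - k * t\<close> with
  \<open>f x = inner_cut (x /\<^sub>R n)\<close>. Outside the ball it follows \<open>a\<close>, the
  flat solution from \<open>c\<close> damped exponentially; inside it follows \<open>b\<close>, a
  linear ramp of duration \<open>\<tau>\<close> times the flat solution from \<open>M\<close>. The
  hypothesis \<open>gain\<close> says that the inflow, of rate
  \<open>\<kappa> * n powr (- (2 * s)) * (a - b)\<close>, pays for the slope of the ramp.\<close>

lemma weak_lower:
  fixes u :: "real \<Rightarrow> 'a::euclidean_space \<Rightarrow> real"
  assumes s: "0 < s" "s < 1" and bp: "\<beta> > -1" "p > 1" and ws: "weak_solution s \<beta> p \<mu> u"
    and \<mu>: "integrable lebesgue \<mu>" and \<mu>0: "AE x in lborel. 0 \<le> \<mu> x"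
    and \<mu>c: "AE x in lborel. n \<le> norm x \<and> norm x < R \<longrightarrow> c \<le> \<mu> x"
    and pos: "0 < c" "0 < n" "0 < R" "0 < T" "0 < \<tau>" "0 < M"
    and \<kappa>: "\<And>x::'a. fl s inner_cut x \<le> - \<kappa> + Ci * inner_cut x" and Ci: "0 \<le> Ci" "0 \<le> \<kappa>"
    and a_def: "\<And>t. a t = exp (- (Ci * n powr (- (2 * s)) * t)) * decay \<beta> p c t"
    and b_def: "\<And>t. b t = min 1 (t / \<tau>) * decay \<beta> p M t"
    and ba: "\<And>t. 0 \<le> t \<Longrightarrow> t \<le> T \<Longrightarrow> b t \<le> a t"
    and gain: "\<And>t. 0 < t \<Longrightarrow> t < T \<Longrightarrow> t < \<tau> \<Longrightarrow> M / \<tau> \<le> \<kappa> * n powr (- (2 * s)) * (a t - b t)"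
  shows "AE w in lborel. 0 < fst w \<and> fst w < T \<longrightarrow>
     b (fst w) - c * outer R (snd w) - c * (R powr (- (2 * s)) * (55 * levy_mass TYPE('a) s)) * fst w \<le> u (fst w) (snd w)"
proof -
  let ?N = "tmeas T \<Otimes>\<^sub>M (lborel :: 'a measure)"
  obtain \<mu>' where \<mu>': "\<mu>' \<in> borel_measurable lborel" "AE x in lborel. \<mu> x = \<mu>' x"
    using completion_ex_borel_measurable_real[OF borel_measurable_integrable[OF \<mu>]] by blast
  obtain v where v: "v \<in> borel_measurable borel" "\<And>w. 0 \<le> v w"
    "AE w in lborel. 0 < fst w \<longrightarrow> v w = u (fst w) (snd w)"
    "\<And>T. T > 0 \<Longrightarrow> lin_sol s T v (\<lambda>w. fst w powr \<beta> * v w powr p) \<mu>'"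
    using weak_solution_lin_sol[OF s ws \<mu> _ \<mu>'(2)] \<mu>'(1) by auto
  obtain \<rho> :: "nat \<Rightarrow> 'a \<Rightarrow> real" where mol: "mollifier \<rho>" using mollifier_exists by blast
  \<comment> \<open>The damping rate that absorbs the positive part \<open>Ci * f\<close> in the
    bound for the fractional Laplacian of the scaled cut-off.\<close>
  define m where "m = Ci * n powr (- (2 * s))"
  have m0: "0 \<le> m" using Ci by (simp add: m_def)
  define U where "U = decay \<beta> p c"
  define V where "V = decay \<beta> p M"
  have Um [measurable]: "U \<in> borel_measurable borel" unfolding U_def by measurable
  have Vm [measurable]: "V \<in> borel_measurable borel" unfolding V_def by measurable
  have U: "0 < U t" "U t \<le> c" for t using decay_pos[OF bp pos(1)] decay_le[OF bp pos(1)] by (auto simp: U_def)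
  have V: "0 < V t" "V t \<le> M" for t using decay_pos[OF bp pos(6)] decay_le[OF bp pos(6)] by (auto simp: V_def)
  have a: "a t = exp (- (m * t)) * U t" for t by (simp add: a_def m_def U_def)
  have b: "b t = min 1 (t / \<tau>) * V t" for t by (simp add: b_def V_def)
  have am [measurable]: "a \<in> borel_measurable borel" unfolding a[abs_def] by measurable
  have bm [measurable]: "b \<in> borel_measurable borel" unfolding b[abs_def] by measurable
  have a0: "0 < a t" for t using U by (simp add: a)
  have ac: "a t \<le> c" if "0 \<le> t" for t
  proof -
    have "exp (- (m * t)) * U t \<le> 1 * c" using U[of t] that m0 by (intro mult_mono) auto
    then show ?thesis by (simp add: a)
  qed
  have b0: "0 \<le> b t" if "0 \<le> t" for t using V[of t] that pos(5) by (simp add: b)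
  have b0': "0 < b t" if "0 < t" for t using V[of t] that pos(5) by (simp add: b)
  define k where "k = c * (R powr (- (2 * s)) * (55 * levy_mass TYPE('a) s))"
  have k0: "0 \<le> k" using pos levy_mass_nonneg[OF s, where 'a='a] by (simp add: k_def)
  obtain Ko where Ko: "C11 Ko (outer R :: 'a \<Rightarrow> real)" using outer_C11[OF pos(3)] by blast
  obtain Kin Cin where Kin: "C11 Kin (inner_cut :: 'a \<Rightarrow> real)" using inner_cut_second_diff by metis
  define f where "f x = inner_cut (x /\<^sub>R n :: 'a)" for x
  have fC: "C11 (Kin * max 1 (1 / n\<^sup>2)) f" unfolding f_def[abs_def] by (rule C11_scale[OF pos(2) Kin])
  have f01: "0 \<le> f x" "f x \<le> 1" for x using inner_cut_bounds by (auto simp: f_def)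
  have flf: "fl s f x \<le> n powr (- (2 * s)) * (- \<kappa> + Ci * f x)" for x
  proof -
    have "fl s f x = n powr (- (2 * s)) * fl s inner_cut (x /\<^sub>R n)"
      unfolding f_def[abs_def] by (rule fl_scale[OF pos(2) C11_measurable[OF Kin]])
    also have "\<dots> \<le> n powr (- (2 * s)) * (- \<kappa> + Ci * f x)"
      unfolding f_def by (intro mult_left_mono \<kappa>) simp
    finally show ?thesis .
  qed
  have [measurable]: "(outer R :: 'a \<Rightarrow> real) \<in> borel_measurable borel" by (rule C11_measurable[OF Ko])
  have [measurable]: "f \<in> borel_measurable borel" by (rule C11_measurable[OF fC])
  have fstm [measurable]: "(fst :: real \<times> 'a \<Rightarrow> real) \<in> borel_measurable borel" "(snd :: real \<times> 'a \<Rightarrow> 'a) \<in> borel_measurable borel"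
    by (intro borel_measurable_continuous_onI continuous_intros)+
  define B where "B = (\<lambda>w::real \<times> 'a. (b (fst w) - k * fst w) + (a (fst w) - b (fst w)) * f (snd w) + (- c) * outer R (snd w))"
  have Bm [measurable]: "B \<in> borel_measurable borel" unfolding B_def by measurable
  define Z where "Z t x = (1 - f x) * b t + f x * a t" for t x
  have BZ: "B (t, x) \<le> Z t x - c * outer R x" if "0 \<le> t" for t x
    using k0 that by (simp add: B_def Z_def algebra_simps)
  have Z0: "0 \<le> Z t x" if "0 \<le> t" for t x
    using f01[of x] b0[OF that] a0[of t] by (simp add: Z_def)
  have Zc: "Z t x \<le> c" if "0 \<le> t" "t \<le> T" for t x
  proof -
    have "(1 - f x) * b t + f x * a t \<le> (1 - f x) * c + f x * c"
      using f01[of x] ba[OF that] ac[OF that(1)] by (intro add_mono mult_left_mono) auto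
    then show ?thesis by (simp add: Z_def algebra_simps)
  qed
  have Bp: "max 0 (B (t, x)) \<le> c * indicator (cball 0 R) x" if "0 \<le> t" "t \<le> T" for t x
  proof (cases "norm x \<le> R")
    case True
    have "0 \<le> c * outer R x" using pos outer_bounds[of R x] by simp
    then have "B (t, x) \<le> c" using BZ[OF that(1), of x] Zc[OF that, of x] by linarith
    then show ?thesis using True pos by simp
  next
    case False
    then have "B (t, x) \<le> 0" using BZ[OF that(1), of x] Zc[OF that, of x] outer_eq_1[OF pos(3), of x] by simp
    then show ?thesis using pos by simp
  qed
  \<comment> \<open>Truncating at 0 gives \<open>H\<close> compact support in space, hence
    integrability; where the barrier is negative the nonnegative solution needs no control.\<close>
  define H where "H w = fst w powr \<beta> * (max 0 (B w)) powr p" for w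
  have Hm [measurable]: "H \<in> borel_measurable borel" unfolding H_def[abs_def] by measurable
  have bnd: "AE w in ?N. 0 < fst w \<and> fst w < T" by (rule AE_pair_fst[OF AE_tmeas_bounds sigma_finite_lborel])
  have Hb: "\<bar>H (t, x)\<bar> \<le> t powr \<beta> * (c powr p * indicator (cball 0 R) x)" if "0 < t \<and> t < T" for t x
  proof -
    have "(max 0 (B (t, x))) powr p \<le> (c * indicator (cball 0 R) x) powr p"
      using Bp[of t x] that bp by (intro powr_mono2) auto
    also have "\<dots> = c powr p * indicator (cball 0 R) x" by (simp add: indicator_def)
    finally show ?thesis by (simp add: H_def abs_mult mult_left_mono)
  qed
  have Hi: "integrable ?N H"
  proof (rule Bochner_Integration.integrable_bound)
    show "integrable ?N (\<lambda>(t, x). t powr \<beta> * (c powr p * indicator (cball 0 R) x))"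
      by (intro integrable_product_mult sigma_finite_tmeas sigma_finite_lborel powr_integrable_tmeas bp pos integrable_mult_right integrable_cball)
    show "H \<in> borel_measurable ?N" unfolding pair_tmeas_eq by simp
    show "AE w in ?N. norm (H w) \<le> norm (case w of (t, x) \<Rightarrow> t powr \<beta> * (c powr p * indicator (cball 0 R) x))"
      using bnd
    proof eventually_elim
      case (elim w)
      show ?case using Hb[OF elim, of "snd w"] by (simp add: case_prod_beta' order_trans[OF _ abs_ge_self])
    qed
  qed
  have Ht: "integrable (tmeas T) (\<lambda>t. H (t, x))" for x
  proof (rule Bochner_Integration.integrable_bound)
    show "integrable (tmeas T) (\<lambda>t. t powr \<beta> * (c powr p * indicator (cball 0 R) x))"
      using powr_integrable_tmeas[OF bp(1) pos(4)] by simp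
    show "(\<lambda>t. H (t, x)) \<in> borel_measurable (tmeas T)"
    proof -
      have "(\<lambda>t. (t, x)) \<in> borel_measurable borel" by (intro borel_measurable_continuous_onI continuous_intros)
      from measurable_compose[OF this Hm] show ?thesis by simp
    qed
    show "AE t in tmeas T. norm (H (t, x)) \<le> norm (t powr \<beta> * (c powr p * indicator (cball 0 R) x))"
      using AE_tmeas_bounds[of T]
    proof eventually_elim
      case (elim t) show ?case using Hb[OF elim, of x] by (simp add: order_trans[OF _ abs_ge_self])
    qed
  qed
  have Uc: "continuous_on {0..T} U" unfolding U_def by (rule continuous_on_subset[OF decay_continuous[OF bp pos(1)]]) auto
  have Vc: "continuous_on {0..T} V" unfolding V_def by (rule continuous_on_subset[OF decay_continuous[OF bp pos(6)]]) auto
  have acont: "continuous_on {0..T} a" unfolding a[abs_def] by (intro continuous_intros Uc)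
  have bcont: "continuous_on {0..T} b" unfolding b[abs_def] using pos by (intro continuous_intros Vc) auto
  have Ud: "(U has_real_derivative - (t powr \<beta> * U t powr p)) (at t)" if "t > 0" for t
    unfolding U_def by (rule decay_deriv[OF bp pos(1) that])
  have Vd: "(V has_real_derivative - (t powr \<beta> * V t powr p)) (at t)" if "t > 0" for t
    unfolding V_def by (rule decay_deriv[OF bp pos(6) that])
  define a' where "a' t = - m * a t - exp (- (m * t)) * (t powr \<beta> * U t powr p)" for t
  \<comment> \<open>The derivative on either side of the end \<open>\<tau>\<close> of the ramp, the
    only kink of the barrier.\<close>
  define b' where "b' t = (if t < \<tau> then V t / \<tau> - t / \<tau> * (t powr \<beta> * V t powr p) else - (t powr \<beta> * V t powr p))" for t
  have ad: "(a has_real_derivative a' t) (at t)" if "0 < t" for t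
    unfolding a[abs_def] a'_def
    by (rule derivative_eq_intros Ud[OF that] | simp add: a algebra_simps)+
  have bd: "(b has_real_derivative b' t) (at t)" if "0 < t" "t \<noteq> \<tau>" for t
  proof (cases "t < \<tau>")
    case True
    have "((\<lambda>t. t / \<tau> * V t) has_real_derivative b' t) (at t)"
      using True pos by (auto intro!: derivative_eq_intros Vd[OF that(1)] simp: b'_def diff_divide_distrib mult_ac)
    then show ?thesis
    proof (rule has_field_derivative_transform_within_open)
      show "open {..<\<tau>}" "t \<in> {..<\<tau>}" using True by auto
      show "x / \<tau> * V x = b x" if "x \<in> {..<\<tau>}" for x using that pos by (simp add: b min_absorb2)
    qed
  next
    case False
    have "(V has_real_derivative b' t) (at t)" using Vd[OF that(1)] False by (simp add: b'_def)
    then show ?thesis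
    proof (rule has_field_derivative_transform_within_open)
      show "open {\<tau><..}" "t \<in> {\<tau><..}" using False that by auto
      show "V x = b x" if "x \<in> {\<tau><..}" for x using that pos by (simp add: b min_absorb1)
    qed
  qed
  \<comment> \<open>A factor in \<open>(0, 1]\<close> decreases when raised to the power
    \<open>p > 1\<close>, so the damped flat solution remains a subsolution of the ordinary
    differential equation, with the whole gain \<open>- m * a t\<close> left over.\<close>
  have a_ineq: "a' t + t powr \<beta> * a t powr p \<le> - m * a t" if "0 < t" for t
  proof -
    have "a t powr p = exp (- (m * t)) powr p * U t powr p" by (simp add: a powr_mult)
    also have "exp (- (m * t)) powr p \<le> exp (- (m * t)) powr 1"
      using that m0 bp by (intro powr_mono') auto
    then have "exp (- (m * t)) powr p * U t powr p \<le> exp (- (m * t)) * U t powr p"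
      by (intro mult_right_mono) auto
    finally have "t powr \<beta> * a t powr p \<le> t powr \<beta> * (exp (- (m * t)) * U t powr p)" by (intro mult_left_mono) auto
    then show ?thesis by (simp add: a'_def mult.left_commute)
  qed
  \<comment> \<open>On the ramp \<open>(t / \<tau>) powr p \<le> t / \<tau>\<close> lets the
    absorption cancel, leaving at most the slope \<open>M / \<tau>\<close>. After the ramp
    \<open>b\<close> solves the equation exactly and the inflow is only needed to be
    nonnegative.\<close>
  have b_ineq: "b' t + t powr \<beta> * b t powr p \<le> \<kappa> * n powr (- (2 * s)) * (a t - b t)" if t: "0 < t" "t < T" "t \<noteq> \<tau>" for t
  proof (cases "t < \<tau>")
    case True
    have th: "0 < t / \<tau>" "t / \<tau> \<le> 1" using True t pos by auto
    have bt: "b t = t / \<tau> * V t" using True pos by (simp add: b min_absorb2)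
    have "b t powr p = (t / \<tau>) powr p * V t powr p" unfolding bt by (rule powr_mult)
    also have "(t / \<tau>) powr p \<le> (t / \<tau>) powr 1" using th bp by (intro powr_mono') auto
    then have "(t / \<tau>) powr p * V t powr p \<le> t / \<tau> * V t powr p" using th by (intro mult_right_mono) auto
    finally have "t powr \<beta> * b t powr p \<le> t powr \<beta> * (t / \<tau> * V t powr p)" by (intro mult_left_mono) auto
    then have "b' t + t powr \<beta> * b t powr p \<le> V t / \<tau>" using True by (simp add: b'_def mult.left_commute)
    also have "\<dots> \<le> M / \<tau>" using V pos by (intro divide_right_mono) auto
    also have "\<dots> \<le> \<kappa> * n powr (- (2 * s)) * (a t - b t)" by (rule gain[OF t(1,2) True])
    finally show ?thesis .
  next
    case False
    then have bt: "b t = V t" using t pos by (simp add: b min_absorb1)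
    have "b' t + t powr \<beta> * b t powr p = 0" using False by (simp add: b'_def bt)
    also have "0 \<le> \<kappa> * n powr (- (2 * s)) * (a t - b t)" using ba[of t] t Ci by (intro mult_nonneg_nonneg) auto
    finally show ?thesis .
  qed
  have "\<exists>K. barrier s T K (\<lambda>w. (b (fst w) - k * fst w) + (a (fst w) - b (fst w)) * f (snd w) + (- c) * outer R (snd w))
      (\<lambda>w. (a (fst w) - b (fst w)) * fl s f (snd w) + (- c) * fl s (outer R) (snd w)) H"
  proof (rule barrier_intro[OF s pos(4) _ _ _ _ _ _ fC Ko _ _ _ _ Hm Hi Ht, where da = "\<lambda>t. b' t - k" and db = "\<lambda>t. a' t - b' t" and dc = "\<lambda>_. 0" and S = "{\<tau>}"])
    show "continuous_on {0..T} (\<lambda>t. b t - k * t)" "continuous_on {0..T} (\<lambda>t. a t - b t)" "continuous_on {0..T} (\<lambda>t. - c)"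
      by (intro continuous_intros acont bcont)+
    show "((\<lambda>t. b t - k * t) has_real_derivative b' t - k) (at t)" if "0 < t" "t \<notin> {\<tau>}" for t
      using that by (auto intro!: derivative_eq_intros bd)
    show "((\<lambda>t. a t - b t) has_real_derivative a' t - b' t) (at t)" if "0 < t" "t \<notin> {\<tau>}" for t
      using that by (auto intro!: derivative_eq_intros ad bd)
    fix t :: real and x :: 'a assume t: "0 < t" "t < T" "t \<notin> {\<tau>}"
    define g where "g = a t - b t"
    define q where "q = n powr (- (2 * s))"
    have g0: "0 \<le> g" using ba[of t] t by (simp add: g_def)
    have q0: "0 \<le> q" by (simp add: q_def)
    have "\<bar>c * fl s (outer R) x\<bar> \<le> k"
      unfolding abs_mult k_def using pos outer_fl_bound[OF s pos(3), of x] by (intro mult_mono) auto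
    then have o: "(- c) * fl s (outer R) x \<le> k" unfolding mult_minus_left by linarith
    have i: "g * fl s f x \<le> g * (q * (- \<kappa> + Ci * f x))"
      using flf[of x] g0 by (intro mult_left_mono) (auto simp: q_def)
    have "max 0 (B (t, x)) \<le> Z t x" using BZ[of t x] Z0[of t x] t pos outer_bounds[of R x]
      by (smt (verit) mult_nonneg_nonneg)
    then have "(max 0 (B (t, x))) powr p \<le> Z t x powr p" using bp by (intro powr_mono2) auto
    \<comment> \<open>Convexity of the power separates the two levels; this is why the barrier is a
      convex combination of them.\<close>
    also have "Z t x powr p \<le> (1 - f x) * b t powr p + f x * a t powr p"
    proof -
      have "((1 - f x) *\<^sub>R b t + f x *\<^sub>R a t) powr p \<le> (1 - f x) * b t powr p + f x * a t powr p"
        by (rule convex_onD[OF powr_convex[of p]]) (use bp f01 b0' a0 t in auto)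
      then show ?thesis by (simp add: Z_def)
    qed
    finally have "t powr \<beta> * (max 0 (B (t, x))) powr p \<le> t powr \<beta> * ((1 - f x) * b t powr p + f x * a t powr p)"
      by (intro mult_left_mono) auto
    then have h: "H (t, x) \<le> (1 - f x) * (t powr \<beta> * b t powr p) + f x * (t powr \<beta> * a t powr p)"
      by (simp add: H_def algebra_simps)
    have bb: "(1 - f x) * (b' t + t powr \<beta> * b t powr p) \<le> (1 - f x) * (\<kappa> * q * g)"
      using b_ineq[of t] t f01[of x] by (intro mult_left_mono) (auto simp: q_def g_def)
    have "a' t + t powr \<beta> * a t powr p \<le> - m * g"
    proof -
      have "m * g \<le> m * a t" using m0 b0[of t] t by (intro mult_left_mono) (auto simp: g_def)
      then show ?thesis using a_ineq[OF t(1)] by simp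
    qed
    then have aa: "f x * (a' t + t powr \<beta> * a t powr p) \<le> f x * (- m * g)" using f01 by (intro mult_left_mono) auto
    \<comment> \<open>The damping cancels the \<open>Ci\<close> terms, and the inflow needed in the
      ball, weighted by \<open>1 - f x\<close>, leaves a surplus with a sign.\<close>
    have z: "(1 - f x) * (\<kappa> * q * g) + f x * (- m * g) + g * (q * (- \<kappa> + Ci * f x)) = - (f x * (\<kappa> * (q * g)))"
      unfolding m_def q_def[symmetric] by (simp add: algebra_simps)
    have "0 \<le> f x * (\<kappa> * (q * g))" using f01[of x] Ci q0 g0 by (intro mult_nonneg_nonneg) auto
    then have "(1 - f x) * (b' t + t powr \<beta> * b t powr p) + f x * (a' t + t powr \<beta> * a t powr p) + g * fl s f x \<le> 0"
      using aa bb i z by linarith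
    then have "(b' t + (a' t - b' t) * f x) + ((1 - f x) * (t powr \<beta> * b t powr p) + f x * (t powr \<beta> * a t powr p)) + g * fl s f x \<le> 0"
      by (simp add: algebra_simps)
    then have "b' t - k + (a' t - b' t) * f x + 0 * outer R x + (g * fl s f x + (- c) * fl s (outer R) x) + H (t, x) \<le> 0"
      using h o by (simp add: algebra_simps)
    then show "b' t - k + (a' t - b' t) * f x + 0 * outer R x + ((a t - b t) * fl s f x + (- c) * fl s (outer R) x) + H (t, x) \<le> 0"
      by (simp only: g_def)
  qed (use am bm in auto)
  then obtain K where bar: "barrier s T K B (\<lambda>w. (a (fst w) - b (fst w)) * fl s f (snd w) + (- c) * fl s (outer R) (snd w)) H"
    unfolding B_def by blast
  \<comment> \<open>The comparison bounds a sum from above, so the solution enters with a minus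
    sign.\<close>
  have sol: "lin_sol s T (\<lambda>w. 0 - v w) (\<lambda>w. 0 - fst w powr \<beta> * v w powr p) (\<lambda>x. 0 - \<mu>' x)"
    by (rule lin_sol_diff[OF s lin_sol_zero v(4)[OF pos(4)]])
  have "AE w in ?N. (0 - v w) + B w \<le> 0"
  proof (rule comparison[OF s pos(4) sol bar mol])
    show "AE x in lborel. 0 - \<mu>' x + B (0, x) \<le> 0"
      using \<mu>0 \<mu>c \<mu>'(2)
    proof eventually_elim
      case (elim x)
      \<comment> \<open>At time 0 the ramp vanishes and \<open>a\<close> equals \<open>c\<close>.
        The remaining profile is nonpositive for \<open>norm x < n\<close> and for
        \<open>norm x \<ge> R\<close>, where nothing beyond nonnegativity is known of the
        datum.\<close>
      have B0: "B (0, x) = c * (f x - outer R x)"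
        by (simp add: B_def a b U_def decay_0[OF bp pos(1)] algebra_simps)
      have "c * (f x - outer R x) \<le> \<mu> x"
      proof (cases "norm x < R")
        case False
        then have "f x - outer R x \<le> 0" using outer_eq_1[OF pos(3), of x] f01[of x] by simp
        then have "c * (f x - outer R x) \<le> 0" using pos by (intro mult_nonneg_nonpos) auto
        then show ?thesis using elim by simp
      next
        case True
        show ?thesis
        proof (cases "n \<le> norm x")
          case True
          have "f x - outer R x \<le> 1" using f01[of x] outer_bounds[of R x] by simp
          then have "c * (f x - outer R x) \<le> c * 1" using pos by (intro mult_left_mono) auto
          then show ?thesis using elim True \<open>norm x < R\<close> by simp
        next
          case False
          then have "norm (x /\<^sub>R n) \<le> 1" using pos by (simp add: field_simps)
          then have "f x = 0" by (simp add: f_def inner_cut_eq_0)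
          then have "c * (f x - outer R x) \<le> 0" using pos outer_bounds[of R x] by (simp add: mult_nonneg_nonneg)
          then show ?thesis using elim by simp
        qed
      qed
      then show ?case using elim B0 by simp
    qed
    show "integrable ?N (\<lambda>w. max 0 (0 - v w + B w))"
    proof (rule Bochner_Integration.integrable_bound)
      interpret M: finite_measure "tmeas T" by (rule finite_measure_tmeas)
      show "integrable ?N (\<lambda>(t::real, x). c * indicator (cball 0 R) x)"
        by (intro integrable_product_mult sigma_finite_tmeas sigma_finite_lborel integrable_cball) simp
      show "(\<lambda>w. max 0 (0 - v w + B w)) \<in> borel_measurable ?N" unfolding pair_tmeas_eq using v(1) by simp
      show "AE w in ?N. norm (max 0 (0 - v w + B w)) \<le> norm (case w of (t::real, x) \<Rightarrow> c * indicator (cball 0 R) x)"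
        using bnd
      proof eventually_elim
        case (elim w)
        have "max 0 (0 - v w + B w) \<le> c * indicator (cball 0 R) (snd w)"
          using Bp[of "fst w" "snd w"] elim v(2)[of w] by simp
        then show ?case by (simp add: case_prod_beta' abs_le_iff)
      qed
    qed
    show "AE w in ?N. 0 - v w + B w > 0 \<longrightarrow> 0 \<le> 0 - fst w powr \<beta> * v w powr p + H w"
    proof (intro AE_I2 impI)
      fix w assume "0 - v w + B w > 0"
      then have "v w powr p \<le> (max 0 (B w)) powr p" using v(2)[of w] bp by (intro powr_mono2) auto
      then have "fst w powr \<beta> * v w powr p \<le> H w" unfolding H_def by (intro mult_left_mono) auto
      then show "0 \<le> 0 - fst w powr \<beta> * v w powr p + H w" by simp
    qed
  qed
  then have "AE w in lborel. 0 < fst w \<and> fst w < T \<longrightarrow> (0 - v w) + B w \<le> 0" by (simp add: AE_pair_tmeas)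
  then show ?thesis
    using v(3)
  proof eventually_elim
    case (elim w)
    show ?case
    proof
      assume w: "0 < fst w \<and> fst w < T"
      have "0 \<le> (a (fst w) - b (fst w)) * f (snd w)" using ba[of "fst w"] w f01[of "snd w"] by simp
      then show "b (fst w) - c * outer R (snd w) - c * (R powr (- (2 * s)) * (55 * levy_mass TYPE('a) s)) * fst w \<le> u (fst w) (snd w)"
        using elim w unfolding B_def k_def by simp
    qed
  qed
qed

section \<open>Convergence to the flat solution\<close>

lemma locally_integrable_measurable:
  assumes "locally_integrable \<phi>"
  shows "\<phi> \<in> borel_measurable lebesgue"
proof (rule borel_measurable_LIMSEQ_metric)
  fix n :: nat
  show "(\<lambda>x. indicator (cball 0 (real n)) x *\<^sub>R \<phi> x) \<in> borel_measurable lebesgue"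
    using assms unfolding locally_integrable_def set_integrable_def by (intro borel_measurable_integrable) auto
next
  fix x :: 'a
  obtain n0 :: nat where n0: "norm x < real n0" using reals_Archimedean2 by blast
  have "\<forall>\<^sub>F n in sequentially. indicator (cball 0 (real n)) x *\<^sub>R \<phi> x = \<phi> x"
    unfolding eventually_sequentially by (rule exI[of _ n0]) (use n0 in \<open>auto simp: indicator_def\<close>)
  then show "(\<lambda>n. indicator (cball 0 (real n)) x *\<^sub>R \<phi> x) \<longlonglongrightarrow> \<phi> x" by (rule tendsto_eventually)
qed

section \<open>Essential infima over exteriors of balls\<close>

context
  fixes \<phi> :: "'a::euclidean_space \<Rightarrow> real"
  assumes m: "\<phi> \<in> borel_measurable lebesgue" and nn: "AE x in lebesgue. 0 \<le> \<phi> x"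
begin

lemma exterior_sets: "{z::'a. real n \<le> norm z} \<in> sets lebesgue"
proof -
  have "closed {z::'a. real n \<le> norm z}" by (intro closed_Collect_le continuous_intros)
  then show ?thesis by (metis borel_closed sets_completionI_sets sets_lborel)
qed

lemma AE_exterior: "(AE x in lebesgue_on {z::'a. real n \<le> norm z}. P x) \<longleftrightarrow> (AE x in lebesgue. real n \<le> norm x \<longrightarrow> P x)"
  using exterior_sets by (subst AE_restrict_space_iff) auto

lemma essinf_measurable: "(\<lambda>z. - ereal (\<phi> z)) \<in> borel_measurable (lebesgue_on {z. real n \<le> norm z})"
  using m by (intro measurable_restrict_space1) simp

lemma essinf_AE: "AE x in lebesgue. real n \<le> norm x \<longrightarrow> essinf_on {z. real n \<le> norm z} \<phi> \<le> ereal (\<phi> x)"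
  using esssup_AE[of "\<lambda>z. - ereal (\<phi> z)" "lebesgue_on {z. real n \<le> norm z}"]
  unfolding AE_exterior essinf_on_def by (simp add: ereal_uminus_le_reorder)

lemma essinf_ge: "AE x in lebesgue. real n \<le> norm x \<longrightarrow> K \<le> \<phi> x \<Longrightarrow> ereal K \<le> essinf_on {z. real n \<le> norm z} \<phi>"
proof -
  assume "AE x in lebesgue. real n \<le> norm x \<longrightarrow> K \<le> \<phi> x"
  then have "AE x in lebesgue_on {z. real n \<le> norm z}. - ereal (\<phi> x) \<le> - ereal K"
    unfolding AE_exterior by eventually_elim simp
  from esssup_I[OF essinf_measurable this] show ?thesis
    unfolding essinf_on_def by (metis ereal_minus_le_minus ereal_uminus_uminus)
qed

text \<open>The exterior contains a ball, hence is not a null set; on a null set the essential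
  infimum would be infinite.\<close>

lemma essinf_finite: "essinf_on {z. real n \<le> norm z} \<phi> < \<infinity>"
proof (rule ccontr)
  assume "\<not> essinf_on {z. real n \<le> norm z} \<phi> < \<infinity>"
  then have "AE x in lebesgue. \<not> real n \<le> norm (x::'a)" using essinf_AE[of n] by auto
  then have "AE x in lborel. \<not> real n \<le> norm (x::'a)" by (simp add: AE_completion_iff)
  then have "AE x in lborel. x \<notin> ball ((real n + 1) *\<^sub>R (SOME b::'a. b \<in> Basis)) 1"
  proof eventually_elim
    case (elim x)
    let ?b = "SOME b::'a. b \<in> Basis"
    have nb: "norm ((real n + 1) *\<^sub>R ?b) = real n + 1" by (simp add: SOME_Basis)
    show ?case using norm_triangle_ineq2[of "(real n + 1) *\<^sub>R ?b" "(real n + 1) *\<^sub>R ?b - x"] nb elim by (auto simp: dist_norm)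
  qed
  then have "ball ((real n + 1) *\<^sub>R (SOME b::'a. b \<in> Basis)) 1 \<in> null_sets lborel" by (subst AE_iff_null_sets) auto
  then have "negligible (ball ((real n + 1) *\<^sub>R (SOME b::'a. b \<in> Basis)) 1)" by (simp add: negligible_iff_null_sets null_sets_completionI)
  then show False using open_not_negligible[of "ball ((real n + 1) *\<^sub>R (SOME b::'a. b \<in> Basis)) 1"] by simp
qed

text \<open>Finiteness ensures that the conversion to a real number in \<open>phi_lower\<close> does
  not fall back on its default value.\<close>

lemma essinf_eq: "essinf_on {z. real n \<le> norm z} \<phi> = ereal (phi_lower \<phi> n)"
proof -
  have "ereal 0 \<le> essinf_on {z. real n \<le> norm z} \<phi>"
    by (rule essinf_ge) (use nn in \<open>auto elim!: eventually_mono\<close>)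
  then show ?thesis using essinf_finite[of n] unfolding phi_lower_def
    by (cases "essinf_on {z. real n \<le> norm z} \<phi>") auto
qed

lemma phi_lower_AE: "AE x in lebesgue. real n \<le> norm x \<longrightarrow> phi_lower \<phi> n \<le> \<phi> x"
  using essinf_AE[of n] unfolding essinf_eq by simp

lemma phi_lower_ge: "AE x in lebesgue. real n \<le> norm x \<longrightarrow> K \<le> \<phi> x \<Longrightarrow> K \<le> phi_lower \<phi> n"
  using essinf_ge[of n K] unfolding essinf_eq by simp

lemma phi_lower_nonneg: "0 \<le> phi_lower \<phi> n"
  by (rule phi_lower_ge) (use nn in \<open>auto elim!: eventually_mono\<close>)

lemma phi_lower_mono: "phi_lower \<phi> n \<le> phi_lower \<phi> (Suc n)"
  by (rule phi_lower_ge) (use phi_lower_AE[of n] in \<open>auto elim!: eventually_mono\<close>)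

lemma nu_trunc_integrable: "integrable lebesgue (\<lambda>x. nu_trunc \<phi> n x * indicator (ball 0 (real k)) x)"
proof (rule Bochner_Integration.integrable_bound)
  have "integrable lborel (\<lambda>x::'a. phi_lower \<phi> n * indicator (cball 0 (real k)) x)" by simp
  then show "integrable lebesgue (\<lambda>x::'a. phi_lower \<phi> n * indicator (cball 0 (real k)) x)"
    by (subst integrable_completion) auto
  have [measurable]: "\<phi> \<in> borel_measurable lebesgue" by (rule m)
  have [measurable]: "(indicator (ball 0 (real k)) :: 'a \<Rightarrow> real) \<in> borel_measurable lebesgue"
    by (rule measurable_completion) (simp add: borel_measurable_indicator)
  show "(\<lambda>x. nu_trunc \<phi> n x * indicator (ball 0 (real k)) x) \<in> borel_measurable lebesgue"
    unfolding nu_trunc_def by measurable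
  show "AE x in lebesgue. norm (nu_trunc \<phi> n x * indicator (ball 0 (real k)) x) \<le> norm (phi_lower \<phi> n * indicator (cball 0 (real k)) x)"
    using nn by eventually_elim (use phi_lower_nonneg[of n] in \<open>auto simp: nu_trunc_def indicator_def\<close>)
qed

end

lemma growth_AE:
  assumes "ess_tends_to_infinity f"
  obtains b where "AE x in lebesgue. b \<le> norm x \<longrightarrow> Z \<le> f x"
proof -
  have "eventually (\<lambda>x. Z \<le> f x) (inf at_infinity (ae_filter lebesgue))"
    using assms unfolding ess_tends_to_infinity_def filterlim_at_top by blast
  then obtain Q R where QR: "eventually Q at_infinity" "eventually R (ae_filter lebesgue)" "\<And>x. Q x \<Longrightarrow> R x \<Longrightarrow> Z \<le> f x"
    unfolding eventually_inf by blast
  obtain b where b: "\<And>x. b \<le> norm x \<Longrightarrow> Q x" using QR(1) unfolding eventually_at_infinity by blast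
  have "AE x in lebesgue. b \<le> norm x \<longrightarrow> Z \<le> f x"
    using QR(2) by eventually_elim (use QR(3) b in blast)
  then show ?thesis by (rule that)
qed

section \<open>Elementary estimates for the flat solutions\<close>

text \<open>Raised to the power \<open>1 - p\<close>, the claim becomes an inequality between
  \<open>exp (m * t * (p - 1))\<close> times one affine function of
  \<open>t powr (1 + \<beta>)\<close> and another with the same slope. Their difference is worst at
  \<open>t = T\<close>, so \<open>E\<close> suffices for all earlier times.\<close>

lemma decay_exp_compare:
  assumes bp: "\<beta> > -1" "p > 1" and c: "c > 0" and M: "M > 0" and m: "m \<ge> 0" and t: "0 \<le> t" "t \<le> T"
    and E: "exp (m * T * (p - 1)) * (c powr (1 - p) + (p - 1) / (1 + \<beta>) * T powr (1 + \<beta>)) \<le> M powr (1 - p) + (p - 1) / (1 + \<beta>) * T powr (1 + \<beta>)"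
  shows "decay \<beta> p M t \<le> exp (- (m * t)) * decay \<beta> p c t"
proof -
  define A where "A = (p - 1) / (1 + \<beta>)"
  have A: "0 \<le> A" using bp by (simp add: A_def)
  define e where "e = exp (m * T * (p - 1))"
  have e1: "1 \<le> e" using m t bp by (simp add: e_def)
  have tT: "t powr (1 + \<beta>) \<le> T powr (1 + \<beta>)" using t bp by (intro powr_mono2) auto
  have cp: "0 < c powr (1 - p)" using c by simp
  have b0: "0 \<le> A * t powr (1 + \<beta>)" using A by simp
  have "(e - 1) * (A * t powr (1 + \<beta>)) \<le> (e - 1) * (A * T powr (1 + \<beta>))"
    using e1 A tT by (intro mult_left_mono) auto
  moreover have "e * c powr (1 - p) + e * (A * T powr (1 + \<beta>)) \<le> M powr (1 - p) + A * T powr (1 + \<beta>)"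
    using E by (simp add: e_def A_def distrib_left)
  ultimately have 1: "e * (c powr (1 - p) + A * t powr (1 + \<beta>)) \<le> M powr (1 - p) + A * t powr (1 + \<beta>)"
    by (simp add: algebra_simps)
  have "exp (m * t * (p - 1)) \<le> e" unfolding e_def using m t bp by (auto intro!: mult_left_mono mult_right_mono)
  then have "exp (m * t * (p - 1)) * (c powr (1 - p) + A * t powr (1 + \<beta>)) \<le> e * (c powr (1 - p) + A * t powr (1 + \<beta>))"
    using cp b0 by (intro mult_right_mono) auto
  with 1 have 2: "exp (m * t * (p - 1)) * (c powr (1 - p) + A * t powr (1 + \<beta>)) \<le> M powr (1 - p) + A * t powr (1 + \<beta>)" by simp
  have pos: "0 < exp (m * t * (p - 1)) * (c powr (1 - p) + A * t powr (1 + \<beta>))"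
    using cp b0 by (intro mult_pos_pos add_pos_nonneg) auto
  have "decay \<beta> p M t \<le> (exp (m * t * (p - 1)) * (c powr (1 - p) + A * t powr (1 + \<beta>))) powr (- (1 / (p - 1)))"
    unfolding decay_def A_def[symmetric] by (rule powr_mono2') (use bp pos 2 in auto)
  also have "\<dots> = exp (m * t * (p - 1)) powr (- (1 / (p - 1))) * decay \<beta> p c t"
    unfolding decay_def A_def[symmetric] by (rule powr_mult)
  also have "exp (m * t * (p - 1)) powr (- (1 / (p - 1))) = exp (- (m * t))"
    using bp by (simp add: powr_def)
  finally show ?thesis .
qed

text \<open>Up to this time the two summands in the base of \<open>decay\<close> are comparable, so
  the solution has lost at most a fixed factor that depends on \<open>\<beta>\<close> and
  \<open>p\<close> only.\<close>

lemma decay_early: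
  assumes bp: "\<beta> > -1" "p > 1" and c: "c > 0" and t: "0 \<le> t" "t \<le> c powr (- ((p - 1) / (1 + \<beta>)))"
  shows "c * (1 + (p - 1) / (1 + \<beta>)) powr (- (1 / (p - 1))) \<le> decay \<beta> p c t"
proof -
  define A where "A = (p - 1) / (1 + \<beta>)"
  have A: "0 \<le> A" using bp by (simp add: A_def)
  have "t powr (1 + \<beta>) \<le> (c powr (- A)) powr (1 + \<beta>)" using t bp by (intro powr_mono2) (auto simp: A_def)
  also have "\<dots> = c powr (1 - p)"
  proof -
    have "- A * (1 + \<beta>) = 1 - p" using bp by (simp add: A_def)
    then show ?thesis by (simp only: powr_powr)
  qed
  finally have "A * t powr (1 + \<beta>) \<le> A * c powr (1 - p)" using A by (intro mult_left_mono)
  then have le: "c powr (1 - p) + A * t powr (1 + \<beta>) \<le> c powr (1 - p) * (1 + A)" by (simp add: algebra_simps)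
  have pos: "0 < c powr (1 - p) + A * t powr (1 + \<beta>)" using decay_base_pos[OF bp c] by (simp add: A_def)
  have "c * (1 + A) powr (- (1 / (p - 1))) = (c powr (1 - p) * (1 + A)) powr (- (1 / (p - 1)))"
    unfolding powr_mult powr_root[OF bp c] ..
  also have "\<dots> \<le> decay \<beta> p c t"
    unfolding decay_def A_def[symmetric] by (rule powr_mono2') (use bp pos le in auto)
  finally show ?thesis by (simp add: A_def)
qed

theorem theoremL:
  fixes s \<beta> p :: real
    and \<phi> :: "'a::euclidean_space \<Rightarrow> real"
    and u :: "nat \<Rightarrow> real \<Rightarrow> 'a \<Rightarrow> real"
  assumes "0 < s" and "s < 1" and "\<beta> > -1"
    and "1 < p" and "p < 1 + 2 * s * (1 + \<beta>) / (1 + 2 * s)"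
    and "locally_integrable \<phi>"
    and "AE x in lebesgue. 0 \<le> \<phi> x"
    and "ess_tends_to_infinity (\<lambda>x. \<phi> x / norm x powr (2 * s * (\<beta> + 1) / (\<beta> + 2 - p)))"
    and "\<And>n. n \<ge> 1 \<Longrightarrow> limit_solution s \<beta> p (nu_trunc \<phi> n) (u n)"
  shows "(AE (t, x) in lebesgue_on Q_inf. mono_on {1..} (\<lambda>n. u n t x)) \<and>
         (AE (t, x) in lebesgue_on Q_inf. (\<lambda>n. u n t x) \<longlonglongrightarrow> flat_solution \<beta> p t)"
proof -
  note s = assms(1,2) and bp = assms(3,4)
  note \<phi>m = locally_integrable_measurable[OF assms(6)] and \<phi>0 = assms(7)
  define c where "c = phi_lower \<phi>"
  note c_AE = phi_lower_AE[OF \<phi>m \<phi>0, folded c_def] and c_ge = phi_lower_ge[OF \<phi>m \<phi>0, folded c_def]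
    and c_nonneg = phi_lower_nonneg[OF \<phi>m \<phi>0, folded c_def] and c_mono = phi_lower_mono[OF \<phi>m \<phi>0, folded c_def]
  have nu: "nu_trunc \<phi> n x = min (\<phi> x) (c n)" for n x by (simp add: nu_trunc_def c_def)
  have Qinfb: "Q_inf \<in> sets (borel :: (real \<times> 'a) measure)"
    unfolding Q_inf_def by (intro borel_open open_Times) auto
  have AE_Q: "(AE w in lebesgue_on Q_inf. P w) \<longleftrightarrow> (AE w in lborel. 0 < fst w \<longrightarrow> P w)" for P :: "real \<times> 'a \<Rightarrow> bool"
  proof -
    have "w \<in> Q_inf \<longleftrightarrow> 0 < fst w" for w :: "real \<times> 'a" by (cases w) (auto simp: Q_inf_def)
    then show ?thesis using Qinfb by (subst AE_restrict_space_iff) (auto simp: AE_completion_iff)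
  qed
  define N where "N n k x = nu_trunc \<phi> n x * indicator (ball 0 (real k)) x" for n k x
  have Ni: "integrable lebesgue (N n k)" for n k
    unfolding N_def[abs_def] by (rule nu_trunc_integrable[OF \<phi>m \<phi>0])
  define R where "R n v \<longleftrightarrow> (\<forall>k. weak_solution s \<beta> p (N n k) (v k)) \<and>
      (AE w in lborel. 0 < fst w \<longrightarrow> (\<lambda>k. v k (fst w) (snd w)) \<longlonglongrightarrow> u n (fst w) (snd w))"
    for n :: nat and v :: "nat \<Rightarrow> real \<Rightarrow> 'a \<Rightarrow> real"
  have "\<exists>v. R n v" if n: "1 \<le> n" for n
  proof -
    obtain v where v: "\<forall>k. weak_solution s \<beta> p (\<lambda>x. nu_trunc \<phi> n x * indicator (ball 0 (real k)) x) (v k)"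
      "AE (t, x) in lebesgue_on Q_inf. (\<lambda>k. v k t x) \<longlonglongrightarrow> u n t x"
      using assms(9)[OF n] unfolding limit_solution_def by (elim exE conjE)
    have "R n v" unfolding R_def N_def[abs_def]
      using v(1) v(2)[unfolded case_prod_beta' AE_Q] by (rule conjI)
    then show ?thesis by (rule exI[of "R n"])
  qed
  then obtain V where "\<And>n. 1 \<le> n \<Longrightarrow> R n (V n)" by metis
  then have V: "\<And>n k. 1 \<le> n \<Longrightarrow> weak_solution s \<beta> p (N n k) (V n k)"
    "\<And>n. 1 \<le> n \<Longrightarrow> AE w in lborel. 0 < fst w \<longrightarrow> (\<lambda>k. V n k (fst w) (snd w)) \<longlonglongrightarrow> u n (fst w) (snd w)"
    unfolding R_def by simp_all
  have lim: "AE w in lborel. \<forall>n. 1 \<le> n \<longrightarrow> 0 < fst w \<longrightarrow> (\<lambda>k. V n k (fst w) (snd w)) \<longlonglongrightarrow> u n (fst w) (snd w)"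
    using V(2) by (subst AE_all_countable) auto
  have "AE w in lborel. \<forall>n k. 1 \<le> n \<longrightarrow> 0 < fst w \<longrightarrow> V n k (fst w) (snd w) \<le> V (Suc n) k (fst w) (snd w)"
    unfolding AE_all_countable
  proof (intro allI)
    fix n k :: nat
    have "N n k x \<le> N (Suc n) k x" for x
      unfolding N_def nu using c_mono[of n] by (intro mult_right_mono) auto
    then show "AE w in lborel. 1 \<le> n \<longrightarrow> 0 < fst w \<longrightarrow> V n k (fst w) (snd w) \<le> V (Suc n) k (fst w) (snd w)"
      using weak_comparison[OF s bp(2) V(1)[of n k] V(1)[of "Suc n" k] Ni Ni] by (cases "1 \<le> n") auto
  qed
  then have mono: "AE w in lborel. 0 < fst w \<longrightarrow> (\<forall>n\<ge>1. u n (fst w) (snd w) \<le> u (Suc n) (fst w) (snd w))"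
    using lim
  proof eventually_elim
    case (elim w)
    show ?case
    proof (intro impI allI)
      fix n :: nat assume w: "0 < fst w" and n: "1 \<le> n"
      have l1: "(\<lambda>k. V n k (fst w) (snd w)) \<longlonglongrightarrow> u n (fst w) (snd w)" using elim(2) w n by blast
      have l2: "(\<lambda>k. V (Suc n) k (fst w) (snd w)) \<longlonglongrightarrow> u (Suc n) (fst w) (snd w)"
        using elim(2) w le_SucI[OF n] by blast
      show "u n (fst w) (snd w) \<le> u (Suc n) (fst w) (snd w)"
        by (rule LIMSEQ_le[OF l1 l2]) (use elim(1) w n in auto)
    qed
  qed
  have A1: "AE (t, x) in lebesgue_on Q_inf. mono_on {1..} (\<lambda>n. u n t x)"
    unfolding case_prod_beta' AE_Q using mono
  proof eventually_elim
    case (elim w)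
    show ?case
    proof (intro impI mono_onI)
      fix i j :: nat assume w: "0 < fst w" and ij: "i \<in> {1..}" "j \<in> {1..}" "i \<le> j"
      show "u i (fst w) (snd w) \<le> u j (fst w) (snd w)"
        using ij(3)
      proof (induction j rule: dec_induct)
        case (step j)
        have "1 \<le> j" using ij(1) step(1) by auto
        then have "u j (fst w) (snd w) \<le> u (Suc j) (fst w) (snd w)" using elim w by blast
        then show ?case using step by linarith
      qed simp
    qed
  qed
  have "AE w in lborel. \<forall>n k. 1 \<le> n \<longrightarrow> 0 < fst w \<longrightarrow> V n k (fst w) (snd w) \<le> flat_solution \<beta> p (fst w)"
    unfolding AE_all_countable
  proof (intro allI)
    fix n k :: nat
    \<comment> \<open>\<open>c n\<close> may be 0 for small \<open>n\<close>, whereas the upper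
      barrier starts from a positive constant.\<close>
    have c1: "0 < max 1 (c n)" by simp
    have le: "N n k x \<le> max 1 (c n)" for x using c_nonneg[of n] by (auto simp: N_def nu indicator_def)
    show "AE w in lborel. 1 \<le> n \<longrightarrow> 0 < fst w \<longrightarrow> V n k (fst w) (snd w) \<le> flat_solution \<beta> p (fst w)"
    proof (cases "1 \<le> n")
      case True
      have "AE w in lborel. 0 < fst w \<longrightarrow> V n k (fst w) (snd w) \<le> decay \<beta> p (max 1 (c n)) (fst w)"
        by (rule weak_upper[OF s bp V(1)[OF True] Ni c1]) (simp add: le)
      then show ?thesis by eventually_elim (meson decay_le_flat[OF bp c1] order_trans)
    qed simp
  qed
  then have upper: "AE w in lborel. 0 < fst w \<longrightarrow> (\<forall>n\<ge>1. u n (fst w) (snd w) \<le> flat_solution \<beta> p (fst w))"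
    using lim
  proof eventually_elim
    case (elim w)
    show ?case
    proof (intro impI allI)
      fix n :: nat assume w: "0 < fst w" and n: "1 \<le> n"
      have l1: "(\<lambda>k. V n k (fst w) (snd w)) \<longlonglongrightarrow> u n (fst w) (snd w)" using elim(2) w n by blast
      show "u n (fst w) (snd w) \<le> flat_solution \<beta> p (fst w)"
        by (rule LIMSEQ_le_const2[OF l1]) (use elim(1) w n in auto)
    qed
  qed
  define \<gamma> where "\<gamma> = 2 * s * (\<beta> + 1) / (\<beta> + 2 - p)"
  \<comment> \<open>Here the upper bound on \<open>p\<close> enters: since
    \<open>2 * s / (1 + 2 * s) \<le> 1\<close>, it gives \<open>p < 2 + \<beta>\<close>.\<close>
  have bp2: "\<beta> + 2 - p > 0"
  proof -
    have "2 * s * (1 + \<beta>) / (1 + 2 * s) \<le> 1 + \<beta>" using s bp by (simp add: field_simps)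
    then show ?thesis using assms(5) by simp
  qed
  have \<gamma>: "\<gamma> > 0" using s bp bp2 by (simp add: \<gamma>_def)
  \<comment> \<open>Growth of \<open>\<phi>\<close> at a point passes to the infimum over the
    exterior because \<open>norm x powr \<gamma>\<close> is smallest at
    \<open>norm x = n\<close>.\<close>
  have growth: "\<forall>\<^sub>F n in sequentially. K * real n powr \<gamma> \<le> c n" if K: "0 \<le> K" for K
  proof -
    obtain b where b: "AE x in lebesgue. b \<le> norm x \<longrightarrow> K \<le> \<phi> x / norm x powr \<gamma>"
      using growth_AE[OF assms(8), folded \<gamma>_def] by blast
    obtain n0 :: nat where n0: "b < real n0" using reals_Archimedean2 by blast
    have "K * real n powr \<gamma> \<le> c n" if n: "n \<ge> max 1 n0" for n
    proof (rule c_ge)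
      show "AE x in lebesgue. real n \<le> norm x \<longrightarrow> K * real n powr \<gamma> \<le> \<phi> x"
        using b
      proof eventually_elim
        case (elim x)
        show ?case
        proof
          assume nx: "real n \<le> norm x"
          have x0: "0 < norm x powr \<gamma>" using nx n by auto
          have "K * real n powr \<gamma> \<le> K * norm x powr \<gamma>" using nx K \<gamma> by (intro mult_left_mono powr_mono2) auto
          also have "\<dots> \<le> \<phi> x" using elim nx n0 n x0 by (simp add: pos_le_divide_eq)
          finally show "K * real n powr \<gamma> \<le> \<phi> x" .
        qed
      qed
    qed
    then show ?thesis unfolding eventually_sequentially by blast
  qed
  have c_top: "filterlim c at_top sequentially"
  proof (rule filterlim_at_top_mono)
    show "filterlim (\<lambda>n. real n powr \<gamma>) at_top sequentially"
      by (rule filterlim_compose[OF real_powr_at_top[OF \<gamma>] filterlim_real_sequentially])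
    show "\<forall>\<^sub>F n in sequentially. real n powr \<gamma> \<le> c n" using growth[of 1] by simp
  qed
  define \<tau> where "\<tau> n = c n powr (- ((p - 1) / (1 + \<beta>)))" for n
  have \<tau>0: "\<tau> \<longlonglongrightarrow> 0" unfolding \<tau>_def by (rule tendsto_neg_powr[OF _ c_top]) (use bp in auto)
  obtain \<kappa> Ci where \<kappa>: "0 < \<kappa>" "0 \<le> Ci" "\<And>x::'a. fl s inner_cut x \<le> - \<kappa> + Ci * inner_cut x"
    by (rule inner_cut_fl[OF s]) blast
  define A where "A = (p - 1) / (1 + \<beta>)"
  have A0: "0 < A" using bp by (simp add: A_def)
  define \<kappa>0 where "\<kappa>0 = (1 + A) powr (- (1 / (p - 1)))"
  have \<kappa>0: "0 < \<kappa>0" using A0 by (simp add: \<kappa>0_def)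
  have lower: "\<forall>\<^sub>F n in sequentially. AE w in lborel. 0 < fst w \<and> fst w < T \<longrightarrow>
      min 1 (fst w / \<tau> n) * decay \<beta> p M (fst w) \<le> u n (fst w) (snd w)" if T: "0 < T" and M: "0 < M" for T M
  proof -
    \<comment> \<open>The exponent in \<open>\<tau> n * c n = c n powr \<delta>\<close>, the time
      integral of the outer level over the ramp. The product \<open>\<gamma> * \<delta>\<close>
      equals \<open>2 * s\<close>, so growth faster than \<open>n powr \<gamma>\<close> makes
      \<open>n powr (- (2 * s)) * \<tau> n * c n\<close> unbounded.\<close>
    define \<delta> where "\<delta> = (\<beta> + 2 - p) / (1 + \<beta>)"
    have \<delta>: "0 < \<delta>" using bp bp2 by (simp add: \<delta>_def)
    \<comment> \<open>Chosen so that \<open>(K * n powr \<gamma>) powr \<delta>\<close> is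
      \<open>4 * M / (\<kappa> * \<kappa>0)\<close> times \<open>n powr (2 * s)\<close>, the amount
      of inflow that the ramp to level \<open>M\<close> consumes.\<close>
    define K where "K = (4 * M / (\<kappa> * \<kappa>0)) powr (1 / \<delta>)"
    define mm where "mm n = Ci * real n powr (- (2 * s))" for n
    have mm0: "mm \<longlonglongrightarrow> 0"
    proof -
      have "mm \<longlonglongrightarrow> Ci * 0" unfolding mm_def[abs_def]
        by (intro tendsto_intros tendsto_neg_powr filterlim_real_sequentially) (use s in auto)
      then show ?thesis by simp
    qed
    have ev1: "\<forall>\<^sub>F n in sequentially. 4 * M / \<kappa>0 + 1 \<le> c n"
      using c_top unfolding filterlim_at_top by blast
    have ev2: "\<forall>\<^sub>F n in sequentially. 1 / 2 < exp (- (mm n * T))"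
    proof -
      have "(\<lambda>n. exp (- (mm n * T))) \<longlonglongrightarrow> exp (- (0 * T))" by (intro tendsto_intros mm0)
      then show ?thesis by (rule order_tendstoD) simp
    qed
    \<comment> \<open>In the limit the damping disappears and \<open>c n powr (1 - p)\<close> tends
      to 0, while \<open>M powr (1 - p)\<close> stays positive; hence the inequality is strict for
      large \<open>n\<close>.\<close>
    have ev3: "\<forall>\<^sub>F n in sequentially. exp (mm n * T * (p - 1)) * (c n powr (1 - p) + A * T powr (1 + \<beta>)) < M powr (1 - p) + A * T powr (1 + \<beta>)"
    proof -
      have "(\<lambda>n. exp (mm n * T * (p - 1)) * (c n powr (1 - p) + A * T powr (1 + \<beta>))) \<longlonglongrightarrow> exp (0 * T * (p - 1)) * (0 + A * T powr (1 + \<beta>))"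
        by (intro tendsto_intros mm0 tendsto_neg_powr c_top) (use bp in auto)
      then show ?thesis by (rule order_tendstoD) (use M in simp)
    qed
    have ev4: "\<forall>\<^sub>F n in sequentially. K * real n powr \<gamma> \<le> c n" by (rule growth) (simp add: K_def)
    show ?thesis
      using ev1 ev2 ev3 ev4 eventually_ge_at_top[of 1]
    proof eventually_elim
      case (elim n)
      have n1: "1 \<le> n" by fact
      have "0 < 4 * M / \<kappa>0" using M \<kappa>0 by simp
      then have cn: "0 < c n" "4 * M / \<kappa>0 \<le> c n" using elim(1) by auto
      have cM: "M \<le> \<kappa>0 * c n / 4" using cn(2) \<kappa>0 by (simp add: field_simps)
      have \<tau>n: "0 < \<tau> n" using cn by (simp add: \<tau>_def)
      define a where "a t = exp (- (mm n * t)) * decay \<beta> p (c n) t" for t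
      define b where "b t = min 1 (t / \<tau> n) * decay \<beta> p M t" for t
      have mmn: "0 \<le> mm n" using \<kappa> by (simp add: mm_def)
      have bM: "b t \<le> decay \<beta> p M t" if "0 \<le> t" for t
      proof -
        have "min 1 (t / \<tau> n) * decay \<beta> p M t \<le> 1 * decay \<beta> p M t"
          using decay_pos[OF bp M, of t] by (intro mult_right_mono) auto
        then show ?thesis by (simp add: b_def)
      qed
      have ba: "b t \<le> a t" if "0 \<le> t" "t \<le> T" for t
      proof -
        have "decay \<beta> p M t \<le> a t" unfolding a_def
          by (rule decay_exp_compare[OF bp cn(1) M mmn that]) (use elim(3) in \<open>simp add: A_def\<close>)
        then show ?thesis using bM[OF that(1)] by linarith
      qed
      have gain: "M / \<tau> n \<le> \<kappa> * real n powr (- (2 * s)) * (a t - b t)" if t: "0 < t" "t < T" "t < \<tau> n" for t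
      proof -
        have "c n * \<kappa>0 \<le> decay \<beta> p (c n) t"
          unfolding \<kappa>0_def A_def by (rule decay_early[OF bp cn(1)]) (use t in \<open>auto simp: \<tau>_def\<close>)
        moreover have "1 / 2 \<le> exp (- (mm n * t))"
        proof -
          have "exp (- (mm n * T)) \<le> exp (- (mm n * t))" using t mmn by (simp add: mult_left_mono)
          then show ?thesis using elim(2) by linarith
        qed
        ultimately have "1 / 2 * (c n * \<kappa>0) \<le> a t"
          unfolding a_def using cn \<kappa>0 by (intro mult_mono) auto
        moreover have "b t \<le> M" using bM[of t] decay_le[OF bp M, of t] t by linarith
        \<comment> \<open>During the ramp \<open>a\<close> keeps at least half of
          \<open>\<kappa>0 * c n\<close>, the half being the damping, and \<open>b \<le> M\<close>
          takes at most a quarter.\<close>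
        ultimately have ab: "\<kappa>0 * c n / 4 \<le> a t - b t" using cM by (simp add: mult.commute)
        have "4 * M / (\<kappa> * \<kappa>0) \<le> real n powr (- (2 * s)) * (\<tau> n * c n)"
        proof -
          have "2 * s * e / d * (d / e) = 2 * s" if "d > 0" "e > 0" for d e :: real using that by simp
          from this[OF bp2, of "1 + \<beta>"] have \<gamma>\<delta>: "\<gamma> * \<delta> = 2 * s"
            using bp by (simp only: \<gamma>_def \<delta>_def add.commute[of \<beta> 1])
          have "(K * real n powr \<gamma>) powr \<delta> \<le> c n powr \<delta>"
            using elim(4) \<delta> by (intro powr_mono2) (auto simp: K_def)
          moreover have "(K * real n powr \<gamma>) powr \<delta> = 4 * M / (\<kappa> * \<kappa>0) * real n powr (2 * s)"
            using M \<kappa>(1) \<kappa>0 \<delta> by (simp add: powr_mult K_def powr_powr \<gamma>\<delta>)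
          moreover have "c n powr \<delta> = \<tau> n * c n"
          proof -
            have "\<delta> = - ((p - 1) / (1 + \<beta>)) + 1" using bp by (simp add: \<delta>_def field_simps)
            then have "c n powr \<delta> = c n powr (- ((p - 1) / (1 + \<beta>))) * c n powr 1" by (simp only: powr_add)
            then show ?thesis using cn by (simp add: \<tau>_def)
          qed
          ultimately have "real n powr (- (2 * s)) * (4 * M / (\<kappa> * \<kappa>0) * real n powr (2 * s)) \<le> real n powr (- (2 * s)) * (\<tau> n * c n)"
            by (intro mult_left_mono) auto
          moreover have "real n powr (- (2 * s)) * real n powr (2 * s) = 1" using n1 by (simp flip: powr_add)
          ultimately show ?thesis by (simp add: mult.left_commute mult.commute[of _ "real n powr (- (2 * s))"])
        qed
        then have "M \<le> \<kappa> * real n powr (- (2 * s)) * (\<kappa>0 * c n / 4) * \<tau> n"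
          using \<kappa>(1) \<kappa>0 by (simp add: field_simps)
        then have "M / \<tau> n \<le> \<kappa> * real n powr (- (2 * s)) * (\<kappa>0 * c n / 4)"
          using \<tau>n by (simp add: pos_divide_le_eq)
        also have "\<dots> \<le> \<kappa> * real n powr (- (2 * s)) * (a t - b t)"
          using ab \<kappa> by (intro mult_left_mono) auto
        finally show ?thesis .
      qed
      have "AE w in lborel. \<forall>k. 0 < fst w \<and> fst w < T \<longrightarrow>
          b (fst w) - c n * outer (real (Suc k)) (snd w) - c n * (real (Suc k) powr (- (2 * s)) * (55 * levy_mass TYPE('a) s)) * fst w \<le> V n (Suc k) (fst w) (snd w)"
        unfolding AE_all_countable
      proof
        fix k
        show "AE w in lborel. 0 < fst w \<and> fst w < T \<longrightarrow>
          b (fst w) - c n * outer (real (Suc k)) (snd w) - c n * (real (Suc k) powr (- (2 * s)) * (55 * levy_mass TYPE('a) s)) * fst w \<le> V n (Suc k) (fst w) (snd w)"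
        \<comment> \<open>The cut-off radius of the barrier is the truncation radius of the datum,
          so \<open>N n (Suc k)\<close> is at least \<open>c n\<close> throughout the shell where
          the barrier asks for it; \<open>Suc k\<close> keeps the radius positive.\<close>
        proof (rule weak_lower[OF s bp V(1)[OF n1] Ni _ _ cn(1) _ _ T \<tau>n M \<kappa>(3) \<kappa>(2) less_imp_le[OF \<kappa>(1)] _ b_def ba gain])
          have p0: "AE x in lborel. 0 \<le> \<phi> x" using \<phi>0 by (simp add: AE_completion_iff)
          show "AE x in lborel. 0 \<le> N n (Suc k) x"
            using p0 by eventually_elim (use c_nonneg[of n] in \<open>simp add: N_def nu\<close>)
          have "AE x in lborel. real n \<le> norm x \<longrightarrow> c n \<le> \<phi> x" using c_AE[of n] by (simp add: AE_completion_iff)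
          then show "AE x in lborel. real n \<le> norm x \<and> norm x < real (Suc k) \<longrightarrow> c n \<le> N n (Suc k) x"
            by eventually_elim (auto simp: N_def nu)
          show "a t = exp (- (Ci * real n powr (- (2 * s)) * t)) * decay \<beta> p (c n) t" for t
            by (simp add: a_def mm_def)
        qed (use n1 in auto)
      qed
      moreover have "AE w in lborel. 0 < fst w \<longrightarrow> (\<lambda>k. V n k (fst w) (snd w)) \<longlonglongrightarrow> u n (fst w) (snd w)" by (rule V(2)[OF n1])
      ultimately show ?case
      proof eventually_elim
        case (elim w)
        show ?case
        proof
          assume w: "0 < fst w \<and> fst w < T"
          have "(\<lambda>k. b (fst w) - c n * outer (real k) (snd w) - c n * (real k powr (- (2 * s)) * (55 * levy_mass TYPE('a) s)) * fst w)
             \<longlonglongrightarrow> b (fst w) - c n * 0 - c n * (0 * (55 * levy_mass TYPE('a) s)) * fst w"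
            by (intro tendsto_intros outer_tendsto tendsto_neg_powr filterlim_real_sequentially) (use s in auto)
          from LIMSEQ_Suc[OF this] have l1: "(\<lambda>k. b (fst w) - c n * outer (real (Suc k)) (snd w) - c n * (real (Suc k) powr (- (2 * s)) * (55 * levy_mass TYPE('a) s)) * fst w) \<longlonglongrightarrow> b (fst w)"
            by simp
          have l2: "(\<lambda>k. V n (Suc k) (fst w) (snd w)) \<longlonglongrightarrow> u n (fst w) (snd w)" using elim(2) w by (intro LIMSEQ_Suc) blast
          have "b (fst w) \<le> u n (fst w) (snd w)"
            by (rule LIMSEQ_le[OF l1 l2]) (use elim(1) w in auto)
          then show "min 1 (fst w / \<tau> n) * decay \<beta> p M (fst w) \<le> u n (fst w) (snd w)" by (simp add: b_def)
        qed
      qed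
    qed
  qed
  \<comment> \<open>The threshold for \<open>n\<close> depends on \<open>T\<close> and
    \<open>M\<close>. Integer values of both suffice and leave countably many null sets to
    unite.\<close>
  define L where "L i j n \<longleftrightarrow> (AE w in lborel. 0 < fst w \<and> fst w < real (Suc i) \<longrightarrow>
      min 1 (fst w / \<tau> n) * decay \<beta> p (real (Suc j)) (fst w) \<le> u n (fst w) (snd w))" for i j n
  have "\<exists>m. \<forall>n\<ge>m. L i j n" for i j
    using lower[of "real (Suc i)" "real (Suc j)"] unfolding eventually_sequentially L_def by simp
  then obtain n0 where n0: "\<And>i j n. n0 i j \<le> n \<Longrightarrow> L i j n" by metis
  have low: "AE w in lborel. \<forall>i j n. n0 i j \<le> n \<longrightarrow> 0 < fst w \<and> fst w < real (Suc i) \<longrightarrow>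
      min 1 (fst w / \<tau> n) * decay \<beta> p (real (Suc j)) (fst w) \<le> u n (fst w) (snd w)"
    unfolding AE_all_countable
  proof (intro allI)
    fix i j n
    show "AE w in lborel. n0 i j \<le> n \<longrightarrow> 0 < fst w \<and> fst w < real (Suc i) \<longrightarrow>
      min 1 (fst w / \<tau> n) * decay \<beta> p (real (Suc j)) (fst w) \<le> u n (fst w) (snd w)"
    proof (cases "n0 i j \<le> n")
      case True
      from n0[OF this] show ?thesis unfolding L_def by eventually_elim simp
    qed simp
  qed
  have A2: "AE (t, x) in lebesgue_on Q_inf. (\<lambda>n. u n t x) \<longlonglongrightarrow> flat_solution \<beta> p t"
    unfolding case_prod_beta' AE_Q using low upper
  proof eventually_elim
    case (elim w)
    show ?case
    proof
      \<comment> \<open>At a fixed positive time the ramp is over once \<open>\<tau> n\<close> is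
        smaller, so the lower bounds reach \<open>decay\<close> from every integer level, and these
        tend to the flat solution as the level grows.\<close>
      assume w: "0 < fst w"
      obtain i :: nat where "fst w < real i" using reals_Archimedean2 by blast
      then have i: "fst w < real (Suc i)" by simp
      show "(\<lambda>n. u n (fst w) (snd w)) \<longlonglongrightarrow> flat_solution \<beta> p (fst w)"
      proof (rule order_tendstoI)
        fix y assume "y < flat_solution \<beta> p (fst w)"
        then have "\<forall>\<^sub>F j in sequentially. y < decay \<beta> p (real j) (fst w)"
          by (rule order_tendstoD(1)[OF decay_tendsto_flat[OF bp w]])
        then obtain j0 where "\<forall>j\<ge>j0. y < decay \<beta> p (real j) (fst w)" unfolding eventually_sequentially by blast
        then have j: "y < decay \<beta> p (real (Suc j0)) (fst w)" using le_SucI[OF le_refl] by blast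
        have "\<forall>\<^sub>F n in sequentially. \<tau> n < fst w" by (rule order_tendstoD(2)[OF \<tau>0 w])
        moreover have "\<forall>\<^sub>F n in sequentially. 0 < c n" using c_top unfolding filterlim_at_top_dense by blast
        ultimately show "\<forall>\<^sub>F n in sequentially. y < u n (fst w) (snd w)"
          using eventually_ge_at_top[of "n0 i j0"]
        proof eventually_elim
          case (elim n)
          have "0 < \<tau> n" using elim(2) by (simp add: \<tau>_def)
          then have "min 1 (fst w / \<tau> n) = 1" using elim(1) by (simp add: min_absorb1)
          moreover have "min 1 (fst w / \<tau> n) * decay \<beta> p (real (Suc j0)) (fst w) \<le> u n (fst w) (snd w)"
            using \<open>\<forall>i j n. n0 i j \<le> n \<longrightarrow> 0 < fst w \<and> fst w < real (Suc i) \<longrightarrow> min 1 (fst w / \<tau> n) * decay \<beta> p (real (Suc j)) (fst w) \<le> u n (fst w) (snd w)\<close> elim(3) w i by blast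
          ultimately show ?case using j by simp
        qed
      next
        fix y assume y: "flat_solution \<beta> p (fst w) < y"
        show "\<forall>\<^sub>F n in sequentially. u n (fst w) (snd w) < y"
          using eventually_ge_at_top[of 1]
        proof eventually_elim
          case (elim n)
          have "u n (fst w) (snd w) \<le> flat_solution \<beta> p (fst w)"
            using \<open>0 < fst w \<longrightarrow> (\<forall>n\<ge>1. u n (fst w) (snd w) \<le> flat_solution \<beta> p (fst w))\<close> w elim by blast
          then show ?case using y by linarith
        qed
      qed
    qed
  qed
  show ?thesis using A1 A2 by blast
qed

end
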